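(* Let $d\ge 1$, let $\Omega\subset\mathbb{R}^d$ be a bounded Lipschitz domain, and let $s\in(0,1)$. Let $A\in L^\infty(\mathbb{R}^d\times\mathbb{R}^d)$ be symmetric, i.e. $A(x,y)=A(y,x)$ for almost every $(x,y)\in\mathbb{R}^{2d}$, and strictly positive, with $$\lambda=\operatorname*{essinf}_{(x,y)\in\mathbb{R}^{2d}}A(x,y)>0,\qquad \Lambda=\|A\|_{L^\infty(\mathbb{R}^{2d})}.$$ Then there are $\mathcal{P}>2$ and $\epsilon_0>0$ (with $[s-\epsilon_0,s+\epsilon_0]\subset(0,1)$), depending on $d$, $\Omega$, and $\Lambda/\lambda$ (for the fixed $s$), such that for every $p\in[\mathcal{P}',\mathcal{P}]$ there is a corresponding $\sigma\in[s-\epsilon_0,s+\epsilon_0]$ such that, with $\rho=2s-\sigma$, the following holds: for every $F\in W^{-\rho,p}(\Omega)$ the problem $$\begin{cases}\mathrm{v.p.}\displaystyle\int_{\mathbb{R}^d}A(x,y)\frac{u(x)-u(y)}{|x-y|^{d+2s}}\,dy=F(x), & x\in\Omega,\\ u=0, & \text{in }\mathbb{R}^d\setminus\Omega,\end{cases}$$ has a unique solution $u\in\widetilde{W}^{\sigma,p}(\Omega)$, and there is a constant $C>0$ independent of $F$ with $\|u\|_{\widetilde{W}^{\sigma,p}(\Omega)}\le C\|F\|_{W^{-\rho,p}(\Omega)}$. Moreover, if $p\in(2,\mathcal{P}]$, then $\sigma>s$.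
   Context: For $p\in(1,\infty)$, $p'$ denotes the Hölder conjugate of $p$. For $\alpha\in(0,1)$ and $p\in(1,\infty)$, $W^{\alpha,p}(\mathbb{R}^d)$ is the fractional Sobolev space of functions in $L^p(\mathbb{R}^d)$ with finite Gagliardo seminorm $\left(\iint_{\mathbb{R}^{2d}}\frac{|u(x)-u(y)|^p}{|x-y|^{d+\alpha p}}\,dx\,dy\right)^{1/p}$, and $$\widetilde{W}^{\alpha,p}(\Omega)=\{u\in W^{\alpha,p}(\mathbb{R}^d):\operatorname{supp}(u)\subset\overline{\Omega}\}.$$ For $\alpha\in(0,1)$, $W^{-\alpha,p}(\Omega)$ denotes the dual of $\widetilde{W}^{\alpha,p'}(\Omega)$. The boundary value problem is understood weakly: for $\theta,\nu\in(0,1)$ with $\theta+\nu=2s$ and $p\in(1,\infty)$, define the bounded linear operator $\mathcal{L}_A:\widetilde{W}^{\theta,p}(\Omega)\to W^{-\nu,p}(\Omega)$ by $$\langle\mathcal{L}_Aw,\varphi\rangle=\int_{\mathbb{R}^d}\int_{\mathbb{R}^d}A(x,y)\frac{(w(x)-w(y))(\varphi(x)-\varphi(y))}{|x-y|^{d+2s}}\,dx\,dy,\qquad \varphi\in\widetilde{W}^{\nu,p'}(\Omega).$$ A solution $u\in\widetilde{W}^{\sigma,p}(\Omega)$ with datum $F\in W^{-\rho,p}(\Omega)$, $\rho=2s-\sigma$, is a $u$ with $\mathcal{L}_Au=F$ in $W^{-\rho,p}(\Omega)$ (the constant factor $1/2$ arising from formal symmetrization of the principal value integral is ignored, i.e.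 absorbed in the normalization). *)

theory Defs
  imports "HOL-Analysis.Analysis" "HOL-Probability.Essential_Supremum"
begin

text \<open>
  The Euclidean space is an arbitrary type of class \<open>euclidean_space\<close>, of dimension \<open>DIM('a)\<close>,
  which is always at least 1. Elements of function spaces are represented by Lebesgue measurable
  functions, two of which stand for the same element if they agree almost everywhere.
\<close>

text \<open>
  Near each boundary point the domain is the part of a ball lying above a Lipschitz graph over
  a hyperplane through the origin with unit normal \<open>e\<close>; the vector \<open>x - (x \<bullet> e) *\<^sub>R e\<close> is the
  projection of \<open>x\<close> to that hyperplane.
\<close>

definition lipschitz_boundary :: "'a::euclidean_space set \<Rightarrow> bool" where
  "lipschitz_boundary \<Omega> \<longleftrightarrow>
     (\<forall>z\<in>frontier \<Omega>. \<exists>r>0. \<exists>e L. \<exists>\<gamma> :: 'a \<Rightarrow> real.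
        norm e = 1 \<and> L-lipschitz_on {y. y \<bullet> e = 0} \<gamma> \<and>
        \<Omega> \<inter> ball z r = {x \<in> ball z r. \<gamma> (x - (x \<bullet> e) *\<^sub>R e) < x \<bullet> e})"

definition bounded_lipschitz_domain :: "'a::euclidean_space set \<Rightarrow> bool" where
  "bounded_lipschitz_domain \<Omega> \<longleftrightarrow>
     \<Omega> \<noteq> {} \<and> open \<Omega> \<and> connected \<Omega> \<and> bounded \<Omega> \<and> lipschitz_boundary \<Omega>"

definition conj_exp :: "real \<Rightarrow> real" where
  "conj_exp p = p / (p - 1)"

definition Lp_space :: "real \<Rightarrow> ('a::euclidean_space \<Rightarrow> real) set" where
  "Lp_space p = {u \<in> borel_measurable lebesgue. integrable lebesgue (\<lambda>x. \<bar>u x\<bar> powr p)}"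

definition Linf_space :: "('a::euclidean_space \<Rightarrow> real) set" where
  "Linf_space = {f \<in> borel_measurable lebesgue. esssup lebesgue (\<lambda>z. ereal \<bar>f z\<bar>) < \<infinity>}"

definition Linf_norm :: "('a::euclidean_space \<Rightarrow> real) \<Rightarrow> real" where
  "Linf_norm f = real_of_ereal (esssup lebesgue (\<lambda>z. ereal \<bar>f z\<bar>))"

definition ess_inf :: "('a::euclidean_space \<Rightarrow> real) \<Rightarrow> ereal" where
  "ess_inf f = - esssup lebesgue (\<lambda>z. - ereal (f z))"

definition gagliardo_integrand ::
  "real \<Rightarrow> real \<Rightarrow> ('a::euclidean_space \<Rightarrow> real) \<Rightarrow> 'a \<times> 'a \<Rightarrow> real" where
  "gagliardo_integrand \<alpha> p u =
     (\<lambda>(x, y). \<bar>u x - u y\<bar> powr p / norm (x - y) powr (real DIM('a) + \<alpha> * p))"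

definition frac_sobolev :: "real \<Rightarrow> real \<Rightarrow> ('a::euclidean_space \<Rightarrow> real) set" where
  "frac_sobolev \<alpha> p = {u \<in> Lp_space p. integrable lebesgue (gagliardo_integrand \<alpha> p u)}"

definition frac_sobolev_norm :: "real \<Rightarrow> real \<Rightarrow> ('a::euclidean_space \<Rightarrow> real) \<Rightarrow> real" where
  "frac_sobolev_norm \<alpha> p u =
     ((LINT x|lebesgue. \<bar>u x\<bar> powr p) + (LINT z|lebesgue. gagliardo_integrand \<alpha> p u z))
       powr (1 / p)"

text \<open>The support of an almost everywhere equivalence class of functions, i.e. the complement of
  the largest open set on which the function vanishes almost everywhere.\<close>

definition ess_support :: "('a::euclidean_space \<Rightarrow> real) \<Rightarrow> 'a set" where
  "ess_support u = - \<Union>{U. open U \<and> (AE x in lebesgue. x \<in> U \<longrightarrow> u x = 0)}"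

definition sobolev_tilde ::
  "real \<Rightarrow> real \<Rightarrow> 'a::euclidean_space set \<Rightarrow> ('a \<Rightarrow> real) set" where
  "sobolev_tilde \<alpha> p \<Omega> = {u \<in> frac_sobolev \<alpha> p. ess_support u \<subseteq> closure \<Omega>}"

text \<open>
  \<open>sobolev_neg \<alpha> p \<Omega>\<close> is the dual of \<open>sobolev_tilde \<alpha> (conj_exp p) \<Omega>\<close>; note that \<open>\<alpha>\<close> stands for
  the space of order \<open>-\<alpha>\<close>. Only the values of a functional on that space matter; boundedness makes
  them independent of the representatives.
\<close>

definition sobolev_neg ::
  "real \<Rightarrow> real \<Rightarrow> 'a::euclidean_space set \<Rightarrow> (('a \<Rightarrow> real) \<Rightarrow> real) set" where
  "sobolev_neg \<alpha> p \<Omega> = {F.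
     (\<forall>\<phi>\<in>sobolev_tilde \<alpha> (conj_exp p) \<Omega>. \<forall>\<psi>\<in>sobolev_tilde \<alpha> (conj_exp p) \<Omega>.
        F (\<lambda>x. \<phi> x + \<psi> x) = F \<phi> + F \<psi>) \<and>
     (\<forall>c. \<forall>\<phi>\<in>sobolev_tilde \<alpha> (conj_exp p) \<Omega>. F (\<lambda>x. c * \<phi> x) = c * F \<phi>) \<and>
     (\<exists>B. \<forall>\<phi>\<in>sobolev_tilde \<alpha> (conj_exp p) \<Omega>.
        \<bar>F \<phi>\<bar> \<le> B * frac_sobolev_norm \<alpha> (conj_exp p) \<phi>)}"

definition sobolev_neg_norm ::
  "real \<Rightarrow> real \<Rightarrow> 'a::euclidean_space set \<Rightarrow> (('a \<Rightarrow> real) \<Rightarrow> real) \<Rightarrow> real" where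
  "sobolev_neg_norm \<alpha> p \<Omega> F =
     (SUP \<phi> \<in> {\<phi> \<in> sobolev_tilde \<alpha> (conj_exp p) \<Omega>.
                frac_sobolev_norm \<alpha> (conj_exp p) \<phi> \<le> 1}. \<bar>F \<phi>\<bar>)"

definition nonlocal_op ::
  "real \<Rightarrow> ('a::euclidean_space \<times> 'a \<Rightarrow> real) \<Rightarrow> ('a \<Rightarrow> real) \<Rightarrow> ('a \<Rightarrow> real) \<Rightarrow> real" where
  "nonlocal_op s A w \<phi> =
     (LINT (x, y)|lebesgue.
        A (x, y) * ((w x - w y) * (\<phi> x - \<phi> y) / norm (x - y) powr (real DIM('a) + 2 * s)))"

text \<open>The function \<open>u\<close> solves the Dirichlet problem weakly: \<open>nonlocal_op s A u\<close> and \<open>F\<close> are the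
  same functional on \<open>sobolev_tilde (2 * s - \<sigma>) (conj_exp p) \<Omega>\<close>.\<close>

definition weak_solution ::
  "real \<Rightarrow> ('a::euclidean_space \<times> 'a \<Rightarrow> real) \<Rightarrow> 'a set \<Rightarrow> real \<Rightarrow> real \<Rightarrow>
   (('a \<Rightarrow> real) \<Rightarrow> real) \<Rightarrow> ('a \<Rightarrow> real) \<Rightarrow> bool" where
  "weak_solution s A \<Omega> \<sigma> p F u \<longleftrightarrow>
     u \<in> sobolev_tilde \<sigma> p \<Omega> \<and>
     (\<forall>\<phi>\<in>sobolev_tilde (2 * s - \<sigma>) (conj_exp p) \<Omega>. nonlocal_op s A u \<phi> = F \<phi>)"

end

theory Submission
  imports Defs
begin

text \<open>
  Put \<open>D u (x, y) = (u x - u y) / |x - y|^(s + \<tau>)\<close> and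
  \<open>dM = |x - y|^(2 \<tau> - d) dx dy\<close> on the bounded set of pairs that meet the closure of the domain and have
  moderate distance. Up to equivalence, the norm of \<open>u\<close> of order \<open>s + \<tau> (1 - 2/p)\<close> is the norm of \<open>D u\<close> in
  \<open>L^p(M)\<close>, so a single measure carries the whole scale of spaces; conjugate exponents have orders
  with sum \<open>2 s\<close>, and the bilinear form is \<open>\<integral> A (D w) (D \<phi>) dM\<close>. Thus \<open>\<sigma> > s\<close> exactly when \<open>p > 2\<close>.

  Comparing local averages of \<open>u\<close> at consecutive dyadic scales, and replacing the coarse average by
  one over the exterior near the boundary, reconstructs \<open>u\<close> from \<open>D u\<close> by a positive kernel.
  Taking \<open>D\<close> of it yields an integral operator \<open>R\<close> that satisfies Schur bounds, hence acts on every
  \<open>L^p(M)\<close>, and projects onto the gradients. The exterior measure density of a Lipschitz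
  domain is what makes this work up to the boundary.

  For a gradient \<open>U = R U\<close> and a nonnegative weight \<open>w\<close>, the function \<open>R (w |U| U) - w |U| U\<close> is
  \<open>\<integral> k(\<xi>, \<eta>) U(\<eta>) (w |U \<eta>| - w |U \<xi>|) dM(\<eta>)\<close>. For \<open>w t = t^(p - 2)\<close>, truncated or not,
  \<open>a b |w a - w b| \<le> 2 |p - 2| (w a a^2 + w b b^2)\<close>. So the gradient \<open>R (|U|^(p - 2) U)\<close> is an admissible
  test function, which for \<open>p\<close> near 2 gives the a priori bound in \<open>L^p(M)\<close>, as \<open>|U|^(p - 2) U\<close> itself
  would. Existence follows from \<open>p = 2\<close>: with truncated test functions for \<open>p > 2\<close>, and by
  approximation of the datum for \<open>p < 2\<close>.
\<close>

text \<open>What is needed of \<open>R\<close> is an explicit positive construction behind its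
  kernel, not orthogonality: the orthogonal projection of L^2(M) onto gradients would come without
  pointwise kernel bounds, hence without control on other L^p. Nothing below uses the adjoint of
  \<open>R\<close>.

  The range of p comes from one absorption. The commutator costs at most 4 Lam C |p - 2| times the
  weighted energy, with C the Schur constant, and ellipticity can give away lam / 2; this is the
  condition 8 Lam C |p - 2| \<le> lam. C depends on the domain, s and \<tau>, but not on the
  coefficient, so only the ratio Lam / lam enters.

  The three conditions on \<tau> have separate purposes. \<tau> > 0 makes M finite near the diagonal
  and moves the order away from s as p leaves 2. \<tau> < s makes averages converge and gives the
  decay in the column bound. s + \<tau> < 1 makes the Lipschitz bounds for the kernels summable over
  the dyadic scales in the row bound.

  Functionals are represented by minimising a convex energy. For exponent 2 this gives the solution
  itself; for larger exponents it represents a functional on gradients by an L^p function that can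
  be truncated.\<close>

definition Lp :: "'b measure \<Rightarrow> real \<Rightarrow> ('b \<Rightarrow> real) set" where
  "Lp M p = {f \<in> borel_measurable M. integrable M (\<lambda>x. \<bar>f x\<bar> powr p)}"

text \<open>The p-th power of the L^p norm. The root is taken only where homogeneity matters;
  elsewhere the crude inequality \<open>powr_add_bound\<close> does the work of Minkowski's.\<close>

definition pint :: "'b measure \<Rightarrow> real \<Rightarrow> ('b \<Rightarrow> real) \<Rightarrow> real" where
  "pint M p f = (\<integral>x. \<bar>f x\<bar> powr p \<partial>M)"

lemma LpD: "f \<in> Lp M p \<Longrightarrow> f \<in> borel_measurable M" "f \<in> Lp M p \<Longrightarrow> integrable M (\<lambda>x. \<bar>f x\<bar> powr p)"
  by (auto simp: Lp_def)

lemma LpI: "f \<in> borel_measurable M \<Longrightarrow> integrable M (\<lambda>x. \<bar>f x\<bar> powr p) \<Longrightarrow> f \<in> Lp M p"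
  by (auto simp: Lp_def)

lemma pint_nonneg [simp]: "0 \<le> pint M p f"
  by (simp add: pint_def)

lemma powr_add_bound:
  fixes a b p :: real
  assumes "0 \<le> p"
  shows "\<bar>a + b\<bar> powr p \<le> 2 powr p * (\<bar>a\<bar> powr p + \<bar>b\<bar> powr p)"
proof -
  have "\<bar>a + b\<bar> powr p \<le> (2 * max \<bar>a\<bar> \<bar>b\<bar>) powr p"
    by (rule powr_mono2) (use assms in auto)
  also have "\<dots> = 2 powr p * max \<bar>a\<bar> \<bar>b\<bar> powr p"
    by (simp add: powr_mult)
  also have "max \<bar>a\<bar> \<bar>b\<bar> powr p \<le> \<bar>a\<bar> powr p + \<bar>b\<bar> powr p"
    by (simp add: max_def)
  finally show ?thesis by simp
qed

lemma Lp_add: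
  assumes "f \<in> Lp M p" "g \<in> Lp M p" "0 \<le> p"
  shows "(\<lambda>x. f x + g x) \<in> Lp M p"
    and "pint M p (\<lambda>x. f x + g x) \<le> 2 powr p * (pint M p f + pint M p g)"
proof -
  note [measurable] = LpD(1)[OF assms(1)] LpD(1)[OF assms(2)]
  note [intro] = LpD(2)[OF assms(1)] LpD(2)[OF assms(2)]
  have i: "integrable M (\<lambda>x. 2 powr p * (\<bar>f x\<bar> powr p + \<bar>g x\<bar> powr p))"
    by (intro integrable_mult_right Bochner_Integration.integrable_add) auto
  have j: "integrable M (\<lambda>x. \<bar>f x + g x\<bar> powr p)"
    by (rule Bochner_Integration.integrable_bound[OF i])
       (use powr_add_bound[OF assms(3)] in \<open>auto intro!: AE_I2 order_trans[OF powr_add_bound[OF assms(3)]]\<close>)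
  then show "(\<lambda>x. f x + g x) \<in> Lp M p" by (auto intro!: LpI)
  have "pint M p (\<lambda>x. f x + g x) \<le> (\<integral>x. 2 powr p * (\<bar>f x\<bar> powr p + \<bar>g x\<bar> powr p) \<partial>M)"
    unfolding pint_def by (rule integral_mono[OF j i]) (rule powr_add_bound[OF assms(3)])
  also have "\<dots> = 2 powr p * (pint M p f + pint M p g)"
    unfolding pint_def by (simp, subst Bochner_Integration.integral_add) auto
  finally show "pint M p (\<lambda>x. f x + g x) \<le> 2 powr p * (pint M p f + pint M p g)" .
qed

lemma Lp_cmult:
  assumes "f \<in> Lp M p"
  shows "(\<lambda>x. c * f x) \<in> Lp M p" and "pint M p (\<lambda>x. c * f x) = \<bar>c\<bar> powr p * pint M p f"
  using LpD[OF assms] by (auto intro!: LpI simp: abs_mult powr_mult pint_def)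

lemma Lp_diff:
  assumes "f \<in> Lp M p" "g \<in> Lp M p" "0 \<le> p"
  shows "(\<lambda>x. f x - g x) \<in> Lp M p"
    and "pint M p (\<lambda>x. f x - g x) \<le> 2 powr p * (pint M p f + pint M p g)"
proof -
  have m: "(\<lambda>x. - g x) \<in> Lp M p" using assms(2) by (auto simp: Lp_def)
  have m2: "pint M p (\<lambda>x. - g x) = pint M p g" by (simp add: pint_def)
  show "(\<lambda>x. f x - g x) \<in> Lp M p"
    "pint M p (\<lambda>x. f x - g x) \<le> 2 powr p * (pint M p f + pint M p g)"
    using Lp_add[OF assms(1) m assms(3)] m2 by auto
qed

lemma Lp_bound:
  assumes "f \<in> borel_measurable M" "g \<in> Lp M p" "0 \<le> p" "AE x in M. \<bar>f x\<bar> \<le> c * \<bar>g x\<bar>" "0 \<le> c"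
  shows "f \<in> Lp M p" and "pint M p f \<le> c powr p * pint M p g"
proof -
  note [measurable] = assms(1)
  have i: "integrable M (\<lambda>x. c powr p * \<bar>g x\<bar> powr p)" using LpD[OF assms(2)] by simp
  have ae: "AE x in M. \<bar>f x\<bar> powr p \<le> c powr p * \<bar>g x\<bar> powr p"
    using assms(4)
  proof eventually_elim
    case (elim x)
    then have "\<bar>f x\<bar> powr p \<le> (c * \<bar>g x\<bar>) powr p" using assms by (intro powr_mono2) auto
    then show ?case using assms by (simp add: powr_mult)
  qed
  have j: "integrable M (\<lambda>x. \<bar>f x\<bar> powr p)"
    by (rule Bochner_Integration.integrable_bound[OF i]) (use ae in auto)
  then show "f \<in> Lp M p" by (auto intro: LpI assms)
  have "pint M p f \<le> (\<integral>x. c powr p * \<bar>g x\<bar> powr p \<partial>M)"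
    unfolding pint_def by (rule integral_mono_AE[OF j i ae])
  then show "pint M p f \<le> c powr p * pint M p g" by (simp add: pint_def)
qed

lemma Lp_cong_AE:
  assumes "f \<in> Lp M p" "g \<in> borel_measurable M" "AE x in M. f x = g x"
  shows "g \<in> Lp M p" and "pint M p g = pint M p f"
proof -
  note [measurable] = LpD(1)[OF assms(1)] assms(2)
  have "integrable M (\<lambda>x. \<bar>f x\<bar> powr p) = integrable M (\<lambda>x. \<bar>g x\<bar> powr p)"
    by (rule integrable_cong_AE) (use assms(3) in auto)
  then show "g \<in> Lp M p" using LpD(2)[OF assms(1)] by (auto intro: LpI)
  show "pint M p g = pint M p f" unfolding pint_def
    by (rule integral_cong_AE) (use assms(3) in auto)
qed

lemma pint_eq_0_iff:
  assumes "f \<in> Lp M p" shows "pint M p f = 0 \<longleftrightarrow> (AE x in M. f x = 0)"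
  unfolding pint_def using integral_nonneg_eq_0_iff_AE[OF LpD(2)[OF assms]] by simp

text \<open>Young's inequality for f and g, each divided by its norm. That division is why the case
  of a vanishing norm is separate.\<close>

lemma Holder:
  assumes f: "f \<in> Lp M p" and g: "g \<in> Lp M q" and pq: "p > 1" "q > 1" "1/p + 1/q = 1"
  shows "integrable M (\<lambda>x. f x * g x)"
    and "(\<integral>x. \<bar>f x * g x\<bar> \<partial>M) \<le> pint M p f powr (1/p) * pint M q g powr (1/q)"
    and "\<bar>\<integral>x. f x * g x \<partial>M\<bar> \<le> pint M p f powr (1/p) * pint M q g powr (1/q)"
proof -
  note [measurable] = LpD(1)[OF f] LpD(1)[OF g]
  note [intro] = LpD(2)[OF f] LpD(2)[OF g]
  \<comment> \<open>Young's inequality without normalisation already bounds the product by an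
    integrable function.\<close>
  have "integrable M (\<lambda>x. \<bar>f x\<bar> powr p / p + \<bar>g x\<bar> powr q / q)"
    by (intro Bochner_Integration.integrable_add) auto
  then show I: "integrable M (\<lambda>x. f x * g x)"
  proof (rule Bochner_Integration.integrable_bound)
    show "AE x in M. norm (f x * g x) \<le> norm (\<bar>f x\<bar> powr p / p + \<bar>g x\<bar> powr q / q)"
      using Youngs_inequality[OF pq] pq by (auto simp: abs_mult)
  qed auto
  show J: "(\<integral>x. \<bar>f x * g x\<bar> \<partial>M) \<le> pint M p f powr (1/p) * pint M q g powr (1/q)"
  proof (cases "pint M p f = 0 \<or> pint M q g = 0")
    case True
    then have "AE x in M. f x * g x = 0"
      using pint_eq_0_iff[OF f] pint_eq_0_iff[OF g] by auto
    then have "AE x in M. \<bar>f x * g x\<bar> = 0" by auto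
    then have "(\<integral>x. \<bar>f x * g x\<bar> \<partial>M) = 0"
      by (rule integral_eq_zero_AE)
    then show ?thesis by simp
  next
    case False
    define a where "a = pint M p f powr (1/p)"
    define b where "b = pint M q g powr (1/q)"
    have ab: "a > 0" "b > 0" "a powr p = pint M p f" "b powr q = pint M q g"
      using False pq by (auto simp: a_def b_def powr_powr less_le)
    have le: "\<bar>f x * g x\<bar> / (a * b) \<le> \<bar>f x\<bar> powr p / (p * pint M p f) + \<bar>g x\<bar> powr q / (q * pint M q g)" for x
    proof -
      have "(\<bar>f x\<bar> / a) * (\<bar>g x\<bar> / b) \<le> (\<bar>f x\<bar> / a) powr p / p + (\<bar>g x\<bar> / b) powr q / q"
        by (rule Youngs_inequality[OF pq]) (use ab in auto)
      then show ?thesis using ab by (simp add: powr_divide abs_mult mult.commute)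
    qed
    have "(\<integral>x. \<bar>f x * g x\<bar> / (a * b) \<partial>M) \<le> (\<integral>x. \<bar>f x\<bar> powr p / (p * pint M p f) + \<bar>g x\<bar> powr q / (q * pint M q g) \<partial>M)"
      by (rule integral_mono) (use I le in \<open>auto intro!: Bochner_Integration.integrable_add\<close>)
    also have "\<dots> = pint M p f / (p * pint M p f) + pint M q g / (q * pint M q g)"
      by (subst Bochner_Integration.integral_add) (auto simp: pint_def)
    also have "\<dots> = 1" using False pq by simp
    finally have "(\<integral>x. \<bar>f x * g x\<bar> \<partial>M) / (a * b) \<le> 1" by simp
    then show ?thesis using ab by (simp add: a_def b_def divide_le_eq split: if_splits)
  qed
  show "\<bar>\<integral>x. f x * g x \<partial>M\<bar> \<le> pint M p f powr (1/p) * pint M q g powr (1/q)"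
    using J integral_abs_bound[of M "\<lambda>x. f x * g x"] by linarith
qed

section \<open>Inclusions and completeness of L^p over a finite measure\<close>

context finite_measure
begin

lemma Lp_mono:
  assumes "f \<in> Lp M b" "0 < a" "a \<le> b" shows "f \<in> Lp M a"
proof (rule LpI)
  show [measurable]: "f \<in> borel_measurable M" using LpD(1)[OF assms(1)] .
  have "integrable M (\<lambda>x. 1 + \<bar>f x\<bar> powr b)" using LpD(2)[OF assms(1)] by auto
  then show "integrable M (\<lambda>x. \<bar>f x\<bar> powr a)"
  proof (rule Bochner_Integration.integrable_bound)
    have "\<bar>f x\<bar> powr a \<le> 1 + \<bar>f x\<bar> powr b" for x
    proof (cases "\<bar>f x\<bar> \<le> 1")
      case True
      then have "\<bar>f x\<bar> powr a \<le> 1 powr a" using assms by (intro powr_mono2) auto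
      then show ?thesis using powr_ge_zero[of "\<bar>f x\<bar>" b] by (simp del: powr_ge_zero)
    next
      case False
      then have "\<bar>f x\<bar> powr a \<le> \<bar>f x\<bar> powr b" using assms by (intro powr_mono) auto
      then show ?thesis by simp
    qed
    then show "AE x in M. norm (\<bar>f x\<bar> powr a) \<le> norm (1 + \<bar>f x\<bar> powr b)" by auto
  qed auto
qed

lemma Lp_integrable: "f \<in> Lp M p \<Longrightarrow> 1 \<le> p \<Longrightarrow> integrable M f"
  using Lp_mono[of f p 1] by (auto simp: Lp_def intro: integrable_abs_cancel)

lemma bounded_in_Lp:
  assumes "f \<in> borel_measurable M" "\<And>x. x \<in> space M \<Longrightarrow> \<bar>f x\<bar> \<le> c" "0 \<le> p" shows "f \<in> Lp M p"
proof (rule LpI)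
  note [measurable] = assms(1)
  show "integrable M (\<lambda>x. \<bar>f x\<bar> powr p)"
    by (rule integrable_const_bound[where B="\<bar>c\<bar> powr p"])
       (use assms in \<open>auto intro!: powr_mono2 AE_I2 order_trans[OF assms(2) abs_ge_self]\<close>)
qed (fact assms)

text \<open>Hoelder's inequality with exponent b / a for |f|^a against the constant 1.\<close>

lemma pint_mono_exponent:
  assumes "0 < a" "a \<le> b"
  shows "\<exists>c>0. \<forall>f\<in>Lp M b. pint M a f powr (1/a) \<le> c * pint M b f powr (1/b)"
proof (cases "a = b")
  case True
  then show ?thesis by (intro exI[of _ 1]) auto
next
  case False
  with assms have ab: "a < b" by simp
  define r where "r = b/a"
  define r' where "r' = r/(r-1)"
  have r: "r > 1" using assms ab by (simp add: r_def)
  have r': "r' > 1" "1/r + 1/r' = 1" using r by (auto simp: r'_def field_simps)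
  \<comment> \<open>The summand 1 keeps c positive when the whole space has measure 0.\<close>
  define c where "c = measure M (space M) powr (1/r' * (1/a)) + 1"
  show ?thesis
  proof (intro exI[of _ c] conjI ballI)
    show "c > 0" by (simp add: c_def add_nonneg_pos)
    fix f assume f: "f \<in> Lp M b"
    note [measurable] = LpD(1)[OF f]
    have A: "(\<lambda>x. \<bar>f x\<bar> powr a) \<in> Lp M r" and A': "pint M r (\<lambda>x. \<bar>f x\<bar> powr a) = pint M b f"
      using LpD(2)[OF f] assms by (auto intro!: LpI simp: powr_powr r_def pint_def)
    have B: "(\<lambda>x. 1) \<in> Lp M r'" and B': "pint M r' (\<lambda>x. 1) = measure M (space M)"
      by (auto intro!: LpI simp: pint_def)
    have "pint M a f \<le> pint M b f powr (1/r) * measure M (space M) powr (1/r')"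
      using Holder(2)[OF A B r r'] by (simp add: A' B' pint_def[of M a])
    then have "pint M a f powr (1/a) \<le> (pint M b f powr (1/r) * measure M (space M) powr (1/r')) powr (1/a)"
      using assms by (intro powr_mono2) auto
    also have "\<dots> = pint M b f powr (1/b) * measure M (space M) powr (1/r' * (1/a))"
      using assms by (simp add: powr_mult powr_powr r_def)
    also have "\<dots> \<le> c * pint M b f powr (1/b)"
      by (subst mult.commute) (auto intro!: mult_right_mono simp: c_def)
    finally show "pint M a f powr (1/a) \<le> c * pint M b f powr (1/b)" .
  qed
qed

text \<open>Riesz-Fischer. As the measure is finite, L^p distances control L^1 distances, so a fast
  subsequence has summable L^1 increments and converges almost everywhere; Fatou's lemma returns to
  the p-th powers.\<close>

lemma Lp_complete:
  assumes f: "\<And>n. f n \<in> Lp M p" and p: "p \<ge> 1"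
    and C: "\<And>e. e > 0 \<Longrightarrow> \<exists>N. \<forall>m\<ge>N. \<forall>n\<ge>N. pint M p (\<lambda>x. f m x - f n x) \<le> e"
  shows "\<exists>g\<in>Lp M p. (\<lambda>n. pint M p (\<lambda>x. f n x - g x)) \<longlonglongrightarrow> 0"
proof -
  note [measurable] = LpD(1)[OF f]
  obtain c where c: "c > 0" "\<And>f. f \<in> Lp M p \<Longrightarrow> pint M 1 f powr 1 \<le> c * pint M p f powr (1/p)"
    using pint_mono_exponent[of 1 p] p by force
  have "\<exists>N. \<forall>m\<ge>N. \<forall>n\<ge>N. (\<integral>x. \<bar>f m x - f n x\<bar> \<partial>M) \<le> (1/2)^k" for k :: nat
  proof -
    have "((1/2)^k / c) powr p > 0" using c by simp
    from C[OF this] obtain N where N: "\<And>m n. m \<ge> N \<Longrightarrow> n \<ge> N \<Longrightarrow> pint M p (\<lambda>x. f m x - f n x) \<le> ((1/2)^k / c) powr p"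
      by blast
    have "(\<integral>x. \<bar>f m x - f n x\<bar> \<partial>M) \<le> (1/2)^k" if "m \<ge> N" "n \<ge> N" for m n
    proof -
      have "(\<integral>x. \<bar>f m x - f n x\<bar> \<partial>M) \<le> c * pint M p (\<lambda>x. f m x - f n x) powr (1/p)"
        using c(2)[OF Lp_diff(1)[OF f[of m] f[of n]]] p by (simp add: pint_def[of M 1])
      also have "\<dots> \<le> c * (((1/2)^k / c) powr p) powr (1/p)"
        using N[OF that] c p by (intro mult_left_mono powr_mono2) auto
      also have "\<dots> = (1/2)^k" using c p by (simp add: powr_powr)
      finally show ?thesis .
    qed
    then show ?thesis by blast
  qed
  then obtain N where N: "\<And>k m n. m \<ge> N k \<Longrightarrow> n \<ge> N k \<Longrightarrow> (\<integral>x. \<bar>f m x - f n x\<bar> \<partial>M) \<le> (1/2)^k"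
    by metis
  \<comment> \<open>The maximum makes both \<open>r k\<close> and \<open>r (Suc k)\<close> at least
    \<open>N k\<close>; the summand k makes the subsequence tend to infinity.\<close>
  define r where "r k = k + Max (N ` {..k})" for k
  have rN: "r k \<ge> N k" "r k \<ge> k" for k
    unfolding r_def by (auto intro!: Max_ge trans_le_add2)
  have rN2: "r (Suc k) \<ge> N k" for k
  proof -
    have "N k \<le> Max (N ` {..Suc k})" by (intro Max_ge) auto
    then show ?thesis unfolding r_def by linarith
  qed
  define d where "d k x = \<bar>f (r (Suc k)) x - f (r k) x\<bar>" for k x
  have di: "integrable M (\<lambda>x. f m x - f n x)" for m n
    using Lp_integrable[OF f p] by auto
  have dn: "(\<integral>\<^sup>+x. ennreal (d k x) \<partial>M) \<le> ennreal ((1/2)^k)" for k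
    unfolding d_def using di[of "r (Suc k)" "r k"] N[of k "r (Suc k)" "r k"] rN[of k] rN2[of k]
    by (subst nn_integral_eq_integral) (auto intro!: ennreal_leI)
  have [measurable]: "d k \<in> borel_measurable M" for k unfolding d_def by measurable
  have "(\<integral>\<^sup>+x. (\<Sum>k. ennreal (d k x)) \<partial>M) = (\<Sum>k. \<integral>\<^sup>+x. ennreal (d k x) \<partial>M)"
    by (rule nn_integral_suminf) measurable
  also have "\<dots> \<le> (\<Sum>k. ennreal ((1/2)^k))"
    by (intro suminf_le dn) auto
  also have "\<dots> < \<infinity>"
    by (subst suminf_ennreal2) (auto intro!: summable_geometric)
  finally have "AE x in M. (\<Sum>k. ennreal (d k x)) \<noteq> \<infinity>"
    by (intro nn_integral_PInf_AE) auto
  then have ae: "AE x in M. convergent (\<lambda>k. f (r k) x)"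
  proof eventually_elim
    case (elim x)
    then have "summable (\<lambda>k. d k x)"
      by (intro summable_suminf_not_top) (auto simp: d_def)
    then have "summable (\<lambda>k. f (r (Suc k)) x - f (r k) x)"
      unfolding d_def by (rule summable_rabs_cancel)
    then have "convergent (\<lambda>n. \<Sum>k<n. f (r (Suc k)) x - f (r k) x)"
      by (simp add: summable_iff_convergent)
    then have "convergent (\<lambda>n. (f (r n) x - f (r 0) x))"
      using sum_lessThan_telescope[of "\<lambda>k. f (r k) x"] by simp
    from convergent_add[OF this convergent_const[of "f (r 0) x"]] show ?case by simp
  qed
  define g where "g x = lim (\<lambda>k. f (r k) x)" for x
  have [measurable]: "g \<in> borel_measurable M" unfolding g_def by measurable
  have aeg: "AE x in M. (\<lambda>k. f (r k) x) \<longlonglongrightarrow> g x"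
    using ae by eventually_elim (simp add: g_def convergent_LIMSEQ_iff)
  have key: "\<exists>N0. \<forall>n\<ge>N0. (\<integral>\<^sup>+x. ennreal (\<bar>f n x - g x\<bar> powr p) \<partial>M) \<le> ennreal e" if e: "e > 0" for e
  proof -
    obtain N0 where N0: "\<And>m n. m \<ge> N0 \<Longrightarrow> n \<ge> N0 \<Longrightarrow> pint M p (\<lambda>x. f m x - f n x) \<le> e"
      using C[OF e] by blast
    have "(\<integral>\<^sup>+x. ennreal (\<bar>f n x - g x\<bar> powr p) \<partial>M) \<le> ennreal e" if n: "n \<ge> N0" for n
    proof -
      have "(\<integral>\<^sup>+x. ennreal (\<bar>f n x - g x\<bar> powr p) \<partial>M) = (\<integral>\<^sup>+x. liminf (\<lambda>k. ennreal (\<bar>f n x - f (r k) x\<bar> powr p)) \<partial>M)"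
      proof (rule nn_integral_cong_AE, use aeg in eventually_elim)
        case (elim x)
        have "(\<lambda>k. \<bar>f n x - f (r k) x\<bar> powr p) \<longlonglongrightarrow> \<bar>f n x - g x\<bar> powr p"
          using p by (intro tendsto_powr2 tendsto_intros elim) auto
        then have "(\<lambda>k. ennreal (\<bar>f n x - f (r k) x\<bar> powr p)) \<longlonglongrightarrow> ennreal (\<bar>f n x - g x\<bar> powr p)"
          by (rule tendsto_ennrealI)
        from lim_imp_Liminf[OF _ this] show ?case by simp
      qed
      \<comment> \<open>Fatou's lemma carries the Cauchy estimate from \<open>f (r k)\<close> over
        to the limit g.\<close>
      also have "\<dots> \<le> liminf (\<lambda>k. \<integral>\<^sup>+x. ennreal (\<bar>f n x - f (r k) x\<bar> powr p) \<partial>M)"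
        by (rule nn_integral_liminf) measurable
      also have "\<dots> \<le> liminf (\<lambda>k. ennreal e)"
      proof (rule Liminf_mono, use eventually_ge_at_top[of N0] in eventually_elim)
        case (elim k)
        have "f n \<in> Lp M p" "f (r k) \<in> Lp M p" using f by auto
        from LpD(2)[OF Lp_diff(1)[OF this]] show ?case
          using N0[OF n order_trans[OF elim rN(2)]] p
          by (subst nn_integral_eq_integral) (auto simp: pint_def intro!: ennreal_leI)
      qed
      finally show ?thesis by (simp add: Liminf_const)
    qed
    then show ?thesis by blast
  qed
  have keyr: "(\<lambda>x. f n x - g x) \<in> Lp M p \<and> pint M p (\<lambda>x. f n x - g x) \<le> e"
    if "(\<integral>\<^sup>+x. ennreal (\<bar>f n x - g x\<bar> powr p) \<partial>M) \<le> ennreal e" "e > 0" for n e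
  proof -
    have "integrable M (\<lambda>x. \<bar>f n x - g x\<bar> powr p)"
      using that(1) by (intro integrableI_bounded) (auto simp: less_top[symmetric] top_unique)
    then have "(\<lambda>x. f n x - g x) \<in> Lp M p" by (intro LpI) auto
    moreover have "ennreal (pint M p (\<lambda>x. f n x - g x)) \<le> ennreal e"
      using that(1) LpD(2)[OF calculation] by (subst (asm) nn_integral_eq_integral) (auto simp: pint_def)
    ultimately show ?thesis using that(2) by simp
  qed
  show ?thesis
  proof (intro bexI[of _ g])
    obtain N0 where "\<forall>n\<ge>N0. (\<integral>\<^sup>+x. ennreal (\<bar>f n x - g x\<bar> powr p) \<partial>M) \<le> ennreal 1"
      using key[of 1] by auto
    then have "(\<lambda>x. f N0 x - g x) \<in> Lp M p" using keyr[of N0 1] by simp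
    from Lp_diff(1)[OF f[of N0] this] p show "g \<in> Lp M p" by simp
    show "(\<lambda>n. pint M p (\<lambda>x. f n x - g x)) \<longlonglongrightarrow> 0"
    proof (rule LIMSEQ_I)
      fix e :: real assume "e > 0"
      then obtain N0 where "\<forall>n\<ge>N0. (\<integral>\<^sup>+x. ennreal (\<bar>f n x - g x\<bar> powr p) \<partial>M) \<le> ennreal (e/2)"
        using key[of "e/2"] by auto
      then have "\<forall>n\<ge>N0. pint M p (\<lambda>x. f n x - g x) \<le> e/2" using keyr[of _ "e/2"] \<open>e > 0\<close> by simp
      then show "\<exists>no. \<forall>n\<ge>no. norm (pint M p (\<lambda>x. f n x - g x) - 0) < e"
        using \<open>e > 0\<close> by (intro exI[of _ N0]) force
    qed
  qed
qed

end

section \<open>Integral operators with Schur bounds\<close>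

text \<open>The setting of the Schur test with constant weights: bounds on rows and columns by the
  same C give the operator norm bound C on every L^p with 1 < p.\<close>

locale schur_operator = finite_measure M for M :: "'b measure" +
  fixes k :: "'b \<Rightarrow> 'b \<Rightarrow> real" and C :: real
  assumes k_measurable [measurable]: "(\<lambda>(x, y). k x y) \<in> borel_measurable (M \<Otimes>\<^sub>M M)"
    and C_pos: "0 < C"
    and schur_row: "\<And>x. x \<in> space M \<Longrightarrow> (\<integral>\<^sup>+y. ennreal \<bar>k x y\<bar> \<partial>M) \<le> ennreal C"
    and schur_col: "\<And>y. y \<in> space M \<Longrightarrow> (\<integral>\<^sup>+x. ennreal \<bar>k x y\<bar> \<partial>M) \<le> ennreal C"
begin

sublocale P: pair_sigma_finite M M ..

text \<open>Where the integrand is not integrable this value is 0. Additivity of \<open>R\<close> is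
  therefore available only almost everywhere, whereas homogeneity and invariance under null sets
  hold at every point.\<close>

definition R :: "('b \<Rightarrow> real) \<Rightarrow> 'b \<Rightarrow> real" where
  "R f x = (\<integral>y. k x y * f y \<partial>M)"

lemma R_measurable [measurable]:
  assumes [measurable]: "f \<in> borel_measurable M" shows "R f \<in> borel_measurable M"
  unfolding R_def by measurable

lemma nn_integral_kernel_le:
  assumes [measurable]: "f \<in> borel_measurable M"
  shows "(\<integral>\<^sup>+x. \<integral>\<^sup>+y. ennreal \<bar>k x y\<bar> * f y \<partial>M \<partial>M) \<le> ennreal C * (\<integral>\<^sup>+y. f y \<partial>M)"
proof -
  have "(\<integral>\<^sup>+x. \<integral>\<^sup>+y. ennreal \<bar>k x y\<bar> * f y \<partial>M \<partial>M) = (\<integral>\<^sup>+y. \<integral>\<^sup>+x. ennreal \<bar>k x y\<bar> * f y \<partial>M \<partial>M)"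
    by (subst P.Fubini') auto
  also have "\<dots> = (\<integral>\<^sup>+y. (\<integral>\<^sup>+x. ennreal \<bar>k x y\<bar> \<partial>M) * f y \<partial>M)"
    by (intro nn_integral_cong nn_integral_multc) measurable
  also have "\<dots> \<le> (\<integral>\<^sup>+y. ennreal C * f y \<partial>M)"
    by (intro nn_integral_mono mult_right_mono schur_col) auto
  finally show ?thesis by (simp add: nn_integral_cmult)
qed

lemma kernel_integrable_pair:
  assumes "integrable M f"
  shows "integrable (M \<Otimes>\<^sub>M M) (\<lambda>(x, y). k x y * f y)"
proof (rule integrableI_bounded)
  have [measurable]: "f \<in> borel_measurable M" using assms by auto
  show "(\<lambda>(x, y). k x y * f y) \<in> borel_measurable (M \<Otimes>\<^sub>M M)" by measurable
  have "(\<integral>\<^sup>+z. ennreal (norm (case z of (x, y) \<Rightarrow> k x y * f y)) \<partial>(M \<Otimes>\<^sub>M M))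
      = (\<integral>\<^sup>+x. \<integral>\<^sup>+y. ennreal \<bar>k x y\<bar> * ennreal \<bar>f y\<bar> \<partial>M \<partial>M)"
    using nn_integral_fst[of "\<lambda>(x, y). ennreal (norm (k x y * f y))" M]
    by (simp add: abs_mult ennreal_mult case_prod_unfold)
  also have "\<dots> \<le> ennreal C * (\<integral>\<^sup>+y. ennreal \<bar>f y\<bar> \<partial>M)"
    by (rule nn_integral_kernel_le) measurable
  also have "\<dots> < \<infinity>"
    using assms by (auto simp: integrable_iff_bounded ennreal_mult_less_top)
  finally show "(\<integral>\<^sup>+z. ennreal (norm (case z of (x, y) \<Rightarrow> k x y * f y)) \<partial>(M \<Otimes>\<^sub>M M)) < \<infinity>" .
qed

lemma kernel_integrable_AE:
  "integrable M f \<Longrightarrow> AE x in M. integrable M (\<lambda>y. k x y * f y)"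
  using P.AE_integrable_fst'[OF kernel_integrable_pair[of f]] by simp

lemma R_integrable: "integrable M f \<Longrightarrow> integrable M (R f)"
  using P.integrable_fst'[OF kernel_integrable_pair[of f]] by (simp add: R_def[abs_def])

lemma R_cmult: "R (\<lambda>x. c * f x) x = c * R f x"
  unfolding R_def by (simp add: mult.left_commute)

lemma R_add:
  assumes "integrable M f" "integrable M g"
  shows "AE x in M. R (\<lambda>x. f x + g x) x = R f x + R g x"
  using kernel_integrable_AE[OF assms(1)] kernel_integrable_AE[OF assms(2)]
  by eventually_elim (simp add: R_def distrib_left)

lemma R_diff:
  assumes "integrable M f" "integrable M g"
  shows "AE x in M. R (\<lambda>x. f x - g x) x = R f x - R g x"
  using kernel_integrable_AE[OF assms(1)] kernel_integrable_AE[OF assms(2)]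
  by eventually_elim (simp add: R_def right_diff_distrib)

lemma kernel_row_integrable:
  assumes "x \<in> space M"
  shows "integrable M (k x)" "(\<integral>y. \<bar>k x y\<bar> \<partial>M) \<le> C"
proof -
  have [measurable]: "k x \<in> borel_measurable M" using assms by measurable
  show i: "integrable M (k x)"
    using schur_row[OF assms] by (intro integrableI_bounded) (auto simp: less_top[symmetric] top_unique)
  have "ennreal (\<integral>y. \<bar>k x y\<bar> \<partial>M) \<le> ennreal C"
    using schur_row[OF assms] i by (subst (asm) nn_integral_eq_integral) auto
  then show "(\<integral>y. \<bar>k x y\<bar> \<partial>M) \<le> C" using C_pos by simp
qed

lemma R_cong_AE:
  assumes "f \<in> borel_measurable M" "g \<in> borel_measurable M" "AE x in M. f x = g x" "x \<in> space M"
  shows "R f x = R g x"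
proof -
  note [measurable] = assms(1,2)
  have [measurable]: "k x \<in> borel_measurable M" using assms(4) by measurable
  show ?thesis unfolding R_def
    by (rule integral_cong_AE) (use assms(3) in auto)
qed

text \<open>Split |k| = |k|^(1/p) |k|^(1/q). Hoelder's inequality and the row bound give |R f|^p
  \<le> C^(p-1) times the integral of |k| |f|^p; integrating in x, the column bound contributes the
  last factor C.\<close>

lemma R_Lp:
  assumes f: "f \<in> Lp M p" and p: "1 < p"
  shows "R f \<in> Lp M p" and "pint M p (R f) \<le> C powr p * pint M p f"
proof -
  note [measurable] = LpD(1)[OF f]
  define q where "q = p / (p - 1)"
  have q: "q > 1" "1/p + 1/q = 1" using p by (auto simp: q_def field_simps)
  have fi: "integrable M (\<lambda>x. \<bar>f x\<bar> powr p)" by (rule LpD(2)[OF f])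
  define S where "S x = (\<integral>y. \<bar>k x y\<bar> * \<bar>f y\<bar> powr p \<partial>M)" for x
  have Kp: "integrable (M \<Otimes>\<^sub>M M) (\<lambda>(x, y). \<bar>k x y\<bar> * \<bar>f y\<bar> powr p)"
    using integrable_abs[OF kernel_integrable_pair[OF fi]]
    by (simp add: abs_mult case_prod_unfold)
  have Si: "integrable M S" unfolding S_def using P.integrable_fst'[OF Kp] by simp
  have Sint: "(\<integral>x. S x \<partial>M) \<le> C * pint M p f"
  proof -
    have "ennreal (\<integral>x. S x \<partial>M) = (\<integral>\<^sup>+x. ennreal (S x) \<partial>M)"
      by (rule nn_integral_eq_integral[symmetric, OF Si]) (simp add: S_def)
    also have "\<dots> \<le> (\<integral>\<^sup>+x. \<integral>\<^sup>+y. ennreal \<bar>k x y\<bar> * ennreal (\<bar>f y\<bar> powr p) \<partial>M \<partial>M)"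
    proof (rule nn_integral_mono)
      fix x assume "x \<in> space M"
      have "ennreal (S x) \<le> ennreal (norm (\<integral>y. \<bar>k x y\<bar> * \<bar>f y\<bar> powr p \<partial>M))"
        unfolding S_def by (intro ennreal_leI) simp
      \<comment> \<open>If the integrand is not integrable, the integral on the left is 0 by
        convention and the bound is trivial.\<close>
      also have "\<dots> \<le> (\<integral>\<^sup>+y. norm (\<bar>k x y\<bar> * \<bar>f y\<bar> powr p) \<partial>M)"
        using integral_norm_bound_ennreal[of M "\<lambda>y. \<bar>k x y\<bar> * \<bar>f y\<bar> powr p"]
        by (cases "integrable M (\<lambda>y. \<bar>k x y\<bar> * \<bar>f y\<bar> powr p)")
           (simp_all add: not_integrable_integral_eq)
      finally show "ennreal (S x) \<le> (\<integral>\<^sup>+y. ennreal \<bar>k x y\<bar> * ennreal (\<bar>f y\<bar> powr p) \<partial>M)"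
        by (simp add: abs_mult ennreal_mult)
    qed
    also have "\<dots> \<le> ennreal C * (\<integral>\<^sup>+y. ennreal (\<bar>f y\<bar> powr p) \<partial>M)"
      by (rule nn_integral_kernel_le) measurable
    also have "\<dots> = ennreal (C * pint M p f)"
      unfolding pint_def using C_pos
      by (subst nn_integral_eq_integral[OF fi]) (auto simp: ennreal_mult)
    finally show ?thesis using C_pos by simp
  qed
  have pw: "AE x in M. \<bar>R f x\<bar> powr p \<le> C powr (p - 1) * S x"
    using P.AE_integrable_fst'[OF Kp, simplified] AE_space
  proof eventually_elim
    case (elim x)
    then have [measurable]: "k x \<in> borel_measurable M" by measurable
    have a1: "(\<lambda>y. \<bar>k x y\<bar> powr (1/p) * \<bar>f y\<bar>) \<in> Lp M p"
      and a2: "pint M p (\<lambda>y. \<bar>k x y\<bar> powr (1/p) * \<bar>f y\<bar>) = S x"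
      using elim(1) p by (auto intro!: LpI simp: pint_def S_def powr_mult powr_powr abs_mult)
    have b1: "(\<lambda>y. \<bar>k x y\<bar> powr (1/q)) \<in> Lp M q"
      and b2: "pint M q (\<lambda>y. \<bar>k x y\<bar> powr (1/q)) \<le> C"
      using kernel_row_integrable[OF elim(2)] q by (auto intro!: LpI simp: pint_def powr_powr)
    have "\<bar>R f x\<bar> \<le> (\<integral>y. \<bar>k x y * f y\<bar> \<partial>M)"
      unfolding R_def by (rule integral_abs_bound)
    also have "\<dots> = (\<integral>y. \<bar>\<bar>k x y\<bar> powr (1/p) * \<bar>f y\<bar> * \<bar>k x y\<bar> powr (1/q)\<bar> \<partial>M)"
    proof (rule Bochner_Integration.integral_cong[OF refl])
      fix y
      have "\<bar>k x y\<bar> = \<bar>k x y\<bar> powr (1/p) * \<bar>k x y\<bar> powr (1/q)"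
        using q(2) by (simp add: powr_add[symmetric])
      then show "\<bar>k x y * f y\<bar> = \<bar>\<bar>k x y\<bar> powr (1/p) * \<bar>f y\<bar> * \<bar>k x y\<bar> powr (1/q)\<bar>"
        by (simp add: abs_mult mult_ac)
    qed
    also have "\<dots> \<le> S x powr (1/p) * pint M q (\<lambda>y. \<bar>k x y\<bar> powr (1/q)) powr (1/q)"
      using Holder(2)[OF a1 b1 p q] by (simp add: a2)
    also have "\<dots> \<le> S x powr (1/p) * C powr (1/q)"
      using b2 q by (intro mult_left_mono powr_mono2) auto
    finally have "\<bar>R f x\<bar> powr p \<le> (S x powr (1/p) * C powr (1/q)) powr p"
      using p by (intro powr_mono2) auto
    also have "\<dots> = C powr (p - 1) * S x"
    proof -
      have "S x \<ge> 0" by (simp add: S_def)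
      moreover have "p / q = p - 1" using p by (simp add: q_def)
      ultimately show ?thesis using p by (simp add: powr_mult powr_powr)
    qed
    finally show ?case .
  qed
  have i: "integrable M (\<lambda>x. \<bar>R f x\<bar> powr p)"
    by (rule Bochner_Integration.integrable_bound[OF integrable_mult_right[OF Si, of "C powr (p - 1)"]])
       (use pw in auto)
  then show "R f \<in> Lp M p" by (auto intro!: LpI)
  have "pint M p (R f) \<le> (\<integral>x. C powr (p - 1) * S x \<partial>M)"
    unfolding pint_def by (rule integral_mono_AE[OF i _ pw]) (use Si in simp)
  also have "\<dots> \<le> C powr (p - 1) * (C * pint M p f)"
    using Sint by (simp add: mult_left_mono)
  also have "\<dots> = C powr p * pint M p f"
    using C_pos by (simp add: powr_diff)
  finally show "pint M p (R f) \<le> C powr p * pint M p f" .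
qed

text \<open>
  As \<open>U = R U\<close>, the bracket in \<open>D\<close> at \<open>x\<close> is the integral of \<open>k x y * U y * (w |U y| - w |U x|)\<close>.
\<close>

lemma commutator_bound:
  assumes U: "integrable M U" "AE x in M. R U x = U x"
    and A [measurable]: "A \<in> borel_measurable M" and AL: "\<And>x. x \<in> space M \<Longrightarrow> \<bar>A x\<bar> \<le> L"
    and w [measurable]: "w \<in> borel_measurable borel" and w0: "\<And>a. 0 \<le> w a"
    and W: "integrable M (\<lambda>x. w \<bar>U x\<bar> * U x)" and WU: "integrable M (\<lambda>x. w \<bar>U x\<bar> * (U x)\<^sup>2)"
    and \<theta>: "0 \<le> \<theta>" "\<And>a b. 0 \<le> a \<Longrightarrow> 0 \<le> b \<Longrightarrow> a * b * \<bar>w a - w b\<bar> \<le> \<theta> * (w a * a\<^sup>2 + w b * b\<^sup>2)"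
  defines "D \<equiv> \<lambda>x. A x * U x * (R (\<lambda>x. w \<bar>U x\<bar> * U x) x - w \<bar>U x\<bar> * U x)"
  shows "integrable M D" and "\<bar>\<integral>x. D x \<partial>M\<bar> \<le> 2 * L * C * \<theta> * (\<integral>x. w \<bar>U x\<bar> * (U x)\<^sup>2 \<partial>M)"
proof -
  have [measurable]: "U \<in> borel_measurable M" using U by auto
  have [measurable]: "D \<in> borel_measurable M" unfolding D_def by measurable
  define E where "E x = w \<bar>U x\<bar> * (U x)\<^sup>2" for x
  have [measurable]: "E \<in> borel_measurable M" unfolding E_def by measurable
  have E0: "E x \<ge> 0" for x by (simp add: E_def w0)
  have L0: "L \<ge> 0" if "x \<in> space M" for x using AL[OF that] by simp
  have pw: "AE x in M. ennreal \<bar>D x\<bar> \<le> (\<integral>\<^sup>+y. ennreal \<bar>k x y\<bar> * ennreal (L * \<theta> * (E x + E y)) \<partial>M)"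
    using U(2) kernel_integrable_AE[OF U(1)] kernel_integrable_AE[OF W] AE_space
  proof eventually_elim
    case (elim x)
    have "D x = A x * U x * ((\<integral>y. k x y * (w \<bar>U y\<bar> * U y) \<partial>M) - (\<integral>y. w \<bar>U x\<bar> * (k x y * U y) \<partial>M))"
      using elim(1) unfolding D_def by (simp add: R_def)
    also have "\<dots> = (\<integral>y. A x * U x * (k x y * (w \<bar>U y\<bar> * U y) - w \<bar>U x\<bar> * (k x y * U y)) \<partial>M)"
      using elim(2,3) by simp
    finally have Dx: "D x = \<dots>" .
    have "ennreal \<bar>D x\<bar> \<le> (\<integral>\<^sup>+y. norm (A x * U x * (k x y * (w \<bar>U y\<bar> * U y) - w \<bar>U x\<bar> * (k x y * U y))) \<partial>M)"
      unfolding real_norm_def[symmetric] Dx by (rule integral_norm_bound_ennreal) (use elim(2,3) in simp)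
    also have "\<dots> \<le> (\<integral>\<^sup>+y. ennreal \<bar>k x y\<bar> * ennreal (L * \<theta> * (E x + E y)) \<partial>M)"
    proof (rule nn_integral_mono)
      fix y
      have "norm (A x * U x * (k x y * (w \<bar>U y\<bar> * U y) - w \<bar>U x\<bar> * (k x y * U y)))
         = norm (A x * k x y * (U x * U y * (w \<bar>U x\<bar> - w \<bar>U y\<bar>)))"
        unfolding norm_minus_commute[of "A x * k x y * (U x * U y * (w \<bar>U x\<bar> - w \<bar>U y\<bar>))" 0, simplified]
        by (subst abs_minus_cancel[symmetric]) (simp add: algebra_simps)
      also have "\<dots> = \<bar>A x\<bar> * \<bar>k x y\<bar> * (\<bar>U x\<bar> * \<bar>U y\<bar> * \<bar>w \<bar>U x\<bar> - w \<bar>U y\<bar>\<bar>)"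
        by (simp add: abs_mult)
      also have "\<dots> \<le> L * \<bar>k x y\<bar> * (\<theta> * (E x + E y))"
      proof (rule mult_mono[OF mult_right_mono[OF AL[OF elim(4)] abs_ge_zero]])
        show "\<bar>U x\<bar> * \<bar>U y\<bar> * \<bar>w \<bar>U x\<bar> - w \<bar>U y\<bar>\<bar> \<le> \<theta> * (E x + E y)"
          using \<theta>(2)[of "\<bar>U x\<bar>" "\<bar>U y\<bar>"] by (simp add: E_def)
      qed (use L0[OF elim(4)] in auto)
      finally show "ennreal (norm (A x * U x * (k x y * (w \<bar>U y\<bar> * U y) - w \<bar>U x\<bar> * (k x y * U y))))
         \<le> ennreal \<bar>k x y\<bar> * ennreal (L * \<theta> * (E x + E y))"
        using E0 \<theta>(1) L0[OF elim(4)] by (simp add: ennreal_mult[symmetric] mult_ac ennreal_leI)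
    qed
    finally show ?case .
  qed
  have Ei: "integrable M E" using WU by (simp add: E_def[abs_def])
  have total: "(\<integral>\<^sup>+x. ennreal \<bar>D x\<bar> \<partial>M) \<le> ennreal (2 * L * C * \<theta> * (\<integral>x. E x \<partial>M))"
  proof (cases "space M = {}")
    case True
    then show ?thesis by (simp add: nn_integral_empty)
  next
    case False
    then have L: "L \<ge> 0" using L0 by auto
    have "(\<integral>\<^sup>+x. ennreal \<bar>D x\<bar> \<partial>M) \<le> (\<integral>\<^sup>+x. \<integral>\<^sup>+y. ennreal \<bar>k x y\<bar> * ennreal (L * \<theta> * (E x + E y)) \<partial>M \<partial>M)"
      by (rule nn_integral_mono_AE[OF pw])
    also have "\<dots> = (\<integral>\<^sup>+x. (\<integral>\<^sup>+y. ennreal \<bar>k x y\<bar> \<partial>M) * ennreal (L * \<theta> * E x)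
                    + (\<integral>\<^sup>+y. ennreal \<bar>k x y\<bar> * ennreal (L * \<theta> * E y) \<partial>M) \<partial>M)"
    proof (rule nn_integral_cong)
      fix x assume "x \<in> space M"
      then have [measurable]: "k x \<in> borel_measurable M" by measurable
      have "(\<integral>\<^sup>+y. ennreal \<bar>k x y\<bar> * ennreal (L * \<theta> * (E x + E y)) \<partial>M)
         = (\<integral>\<^sup>+y. ennreal \<bar>k x y\<bar> * ennreal (L * \<theta> * E x) + ennreal \<bar>k x y\<bar> * ennreal (L * \<theta> * E y) \<partial>M)"
        using E0 L \<theta>(1) by (intro nn_integral_cong) (simp add: distrib_left ennreal_plus)
      also have "\<dots> = (\<integral>\<^sup>+y. ennreal \<bar>k x y\<bar> * ennreal (L * \<theta> * E x) \<partial>M) + (\<integral>\<^sup>+y. ennreal \<bar>k x y\<bar> * ennreal (L * \<theta> * E y) \<partial>M)"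
        by (rule nn_integral_add) measurable
      finally show "(\<integral>\<^sup>+y. ennreal \<bar>k x y\<bar> * ennreal (L * \<theta> * (E x + E y)) \<partial>M)
        = (\<integral>\<^sup>+y. ennreal \<bar>k x y\<bar> \<partial>M) * ennreal (L * \<theta> * E x) + (\<integral>\<^sup>+y. ennreal \<bar>k x y\<bar> * ennreal (L * \<theta> * E y) \<partial>M)"
        by (simp add: nn_integral_multc)
    qed
    also have "\<dots> = (\<integral>\<^sup>+x. (\<integral>\<^sup>+y. ennreal \<bar>k x y\<bar> \<partial>M) * ennreal (L * \<theta> * E x) \<partial>M)
                    + (\<integral>\<^sup>+x. \<integral>\<^sup>+y. ennreal \<bar>k x y\<bar> * ennreal (L * \<theta> * E y) \<partial>M \<partial>M)"
      by (rule nn_integral_add) measurable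
    \<comment> \<open>The row bound handles the term with \<open>E x\<close>, the column bound the
      one with \<open>E y\<close>; together they produce the factor 2.\<close>
    also have "\<dots> \<le> (\<integral>\<^sup>+x. ennreal C * ennreal (L * \<theta> * E x) \<partial>M) + ennreal C * (\<integral>\<^sup>+x. ennreal (L * \<theta> * E x) \<partial>M)"
      by (intro add_mono nn_integral_mono mult_right_mono schur_row nn_integral_kernel_le) auto
    also have "\<dots> = 2 * (ennreal C * (\<integral>\<^sup>+x. ennreal (L * \<theta> * E x) \<partial>M))"
      by (simp add: nn_integral_cmult mult_2)
    also have "(\<integral>\<^sup>+x. ennreal (L * \<theta> * E x) \<partial>M) = ennreal (L * \<theta> * (\<integral>x. E x \<partial>M))"
      using E0 L \<theta>(1) Ei by (subst nn_integral_eq_integral) auto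
    finally show ?thesis
      using C_pos L \<theta>(1) E0 by (simp add: ennreal_mult[symmetric] mult_ac numeral_mult_ennreal)
  qed
  show Di: "integrable M D"
    using total by (intro integrableI_bounded) (auto simp: less_top[symmetric] top_unique)
  have E00: "2 * L * C * \<theta> * (\<integral>x. E x \<partial>M) \<ge> 0"
  proof (cases "space M = {}")
    case True
    have "(\<integral>x. E x \<partial>M) = 0" by (simp add: True Bochner_Integration.integral_empty)
    then show ?thesis by simp
  next
    case False
    then show ?thesis using L0 C_pos \<theta>(1) E0 by (auto intro!: mult_nonneg_nonneg)
  qed
  have "ennreal \<bar>\<integral>x. D x \<partial>M\<bar> \<le> (\<integral>\<^sup>+x. ennreal \<bar>D x\<bar> \<partial>M)"
    using integral_norm_bound_ennreal[OF Di] by simp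
  also note total
  finally show "\<bar>\<integral>x. D x \<partial>M\<bar> \<le> 2 * L * C * \<theta> * (\<integral>x. w \<bar>U x\<bar> * (U x)\<^sup>2 \<partial>M)"
    using E00 by (simp add: E_def)
qed

end

section \<open>Power weights\<close>

text \<open>1 - x^e is at most e ln (1/x), hence at most e / x: the factor x pays for the
  logarithmic singularity at 0, and the bound is linear in e.\<close>

lemma mult_one_minus_powr_le:
  fixes x e :: real
  assumes "0 < x" "x \<le> 1" "0 \<le> e"
  shows "x * (1 - x powr e) \<le> e"
proof -
  have "1 - x powr e \<le> e * ln (1/x)"
  proof -
    have "1 + e * ln x \<le> exp (e * ln x)" by (rule exp_ge_add_one_self)
    then have "1 + e * ln x \<le> x powr e" using assms by (simp add: powr_def)
    then show ?thesis using assms by (simp add: ln_div)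
  qed
  also have "\<dots> \<le> e * (1/x)"
    using ln_le_minus_one[of "1/x"] assms by (intro mult_left_mono) auto
  finally have "x * (1 - x powr e) \<le> x * (e * (1/x))"
    using assms by (intro mult_left_mono) auto
  then show ?thesis using assms by simp
qed

text \<open>The left side is x^(1-e) (1 - x^e), and x^(1-e) is at most sqrt x as e \<le> 1/2. The
  preceding lemma for sqrt x and the exponent 2 e gives the constant 2.\<close>

lemma mult_powr_minus_one_le:
  fixes x e :: real
  assumes "0 < x" "x \<le> 1" "0 \<le> e" "e \<le> 1/2"
  shows "x * (x powr (-e) - 1) \<le> 2 * e"
proof -
  have "x * (x powr (-e) - 1) = x powr (1 - e) * (1 - x powr e)"
    using assms by (simp add: algebra_simps powr_diff powr_minus field_simps)
  also have "\<dots> \<le> x powr (1/2) * (1 - x powr e)"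
    using assms by (intro mult_right_mono powr_mono') (auto intro: powr_le1)
  also have "\<dots> = x powr (1/2) * (1 - (x powr (1/2)) powr (2 * e))"
    by (simp add: powr_powr)
  also have "\<dots> \<le> 2 * e"
    using assms by (intro mult_one_minus_powr_le) (auto intro: powr_le1)
  finally show ?thesis .
qed

text \<open>By homogeneity only the ratio x = b / a \<le> 1 of the smaller to the larger argument
  matters, and the term of the larger argument alone suffices on the right. Negative e is the case p
  < 2.\<close>

lemma powr_weight_diff:
  fixes a b e :: real
  assumes "0 \<le> a" "0 \<le> b" "\<bar>e\<bar> \<le> 1/2"
  shows "a * b * \<bar>a powr e - b powr e\<bar> \<le> 2 * \<bar>e\<bar> * (a powr e * a\<^sup>2 + b powr e * b\<^sup>2)"
proof -
  have *: "a * b * \<bar>a powr e - b powr e\<bar> \<le> 2 * \<bar>e\<bar> * (a powr e * a\<^sup>2)"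
    if ab: "0 < b" "b \<le> a" for a b
  proof -
    define x where "x = b / a"
    have x: "0 < x" "x \<le> 1" "b = a * x" using ab by (auto simp: x_def)
    have bp: "b powr e = a powr e * x powr e" using x ab by (simp add: powr_mult)
    have "x * \<bar>1 - x powr e\<bar> \<le> 2 * \<bar>e\<bar>"
    proof (cases "e \<ge> 0")
      case True
      then show ?thesis using mult_one_minus_powr_le[OF x(1,2) True] powr_le1[OF True, of x] x by auto
    next
      case False
      have "x powr e \<ge> 1" using powr_mono'[of e 0 x] x False by simp
      then show ?thesis using mult_powr_minus_one_le[OF x(1,2), of "-e"] False assms by auto
    qed
    then have "a\<^sup>2 * a powr e * (x * \<bar>1 - x powr e\<bar>) \<le> a\<^sup>2 * a powr e * (2 * \<bar>e\<bar>)"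
      by (intro mult_left_mono) auto
    moreover have "a powr e - b powr e = a powr e * (1 - x powr e)" by (simp add: bp algebra_simps)
    ultimately show ?thesis
      by (simp add: abs_mult x(3) power2_eq_square mult_ac)
  qed
  consider "a = 0 \<or> b = 0" | "0 < b" "b \<le> a" | "0 < a" "a \<le> b" using assms by linarith
  then show ?thesis
  proof cases
    case 1
    then show ?thesis by auto
  next
    case 2
    have "0 \<le> 2 * \<bar>e\<bar> * (b powr e * b\<^sup>2)" by simp
    with *[OF 2] show ?thesis unfolding distrib_left by linarith
  next
    case 3
    have "0 \<le> 2 * \<bar>e\<bar> * (a powr e * a\<^sup>2)" by simp
    with *[OF 3] show ?thesis unfolding distrib_left abs_minus_commute[of "a powr e"] mult.commute[of a b] by linarith
  qed
qed

text \<open>Truncation destroys homogeneity, but one direction survives: x (min a N) \<le> min b N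
  for x = b / a. With e \<ge> 0 this gives the same bound as without truncation, with a constant
  independent of N.\<close>

lemma min_powr_weight_diff:
  fixes a b e N :: real
  assumes "0 \<le> a" "0 \<le> b" "0 \<le> e" "0 < N"
  shows "a * b * \<bar>min a N powr e - min b N powr e\<bar>
    \<le> 2 * \<bar>e\<bar> * (min a N powr e * a\<^sup>2 + min b N powr e * b\<^sup>2)"
proof -
  have *: "a * b * \<bar>min a N powr e - min b N powr e\<bar> \<le> 2 * \<bar>e\<bar> * (min a N powr e * a\<^sup>2)"
    if ab: "0 < b" "b \<le> a" for a b
  proof -
    define x where "x = b / a"
    have x: "0 < x" "x \<le> 1" "b = a * x" using ab by (auto simp: x_def)
    have m: "min a N * x \<le> min b N"
    proof (cases "a \<le> N")
      case True then show ?thesis using ab x by simp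
    next
      case False
      have "N * x \<le> a * x" "N * x \<le> N" using False x assms(4) by (auto intro: mult_left_le)
      then show ?thesis using False x by simp
    qed
    have "(min a N * x) powr e \<le> min b N powr e"
      using m x ab assms by (intro powr_mono2) auto
    then have bp: "min a N powr e * x powr e \<le> min b N powr e" using x ab assms by (simp add: powr_mult)
    have "min b N powr e \<le> min a N powr e" using ab assms by (intro powr_mono2) auto
    then have "\<bar>min a N powr e - min b N powr e\<bar> \<le> min a N powr e * (1 - x powr e)"
      using bp by (simp add: algebra_simps)
    then have "a * b * \<bar>min a N powr e - min b N powr e\<bar> \<le> a * b * (min a N powr e * (1 - x powr e))"
      using ab by (intro mult_left_mono) auto
    also have "\<dots> = min a N powr e * a\<^sup>2 * (x * (1 - x powr e))" by (simp add: x(3) power2_eq_square mult_ac)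
    also have "\<dots> \<le> min a N powr e * a\<^sup>2 * (2 * \<bar>e\<bar>)"
      using mult_one_minus_powr_le[OF x(1,2) assms(3)] assms by (intro mult_left_mono) auto
    finally show ?thesis by (simp add: mult_ac)
  qed
  consider "a = 0 \<or> b = 0" | "0 < b" "b \<le> a" | "0 < a" "a \<le> b" using assms by linarith
  then show ?thesis
  proof cases
    case 1
    then show ?thesis by auto
  next
    case 2
    have "0 \<le> 2 * \<bar>e\<bar> * (min b N powr e * b\<^sup>2)" by simp
    with *[OF 2] show ?thesis unfolding distrib_left by linarith
  next
    case 3
    have "0 \<le> 2 * \<bar>e\<bar> * (min a N powr e * a\<^sup>2)" by simp
    with *[OF 3] show ?thesis
      unfolding distrib_left abs_minus_commute[of "min a N powr e"] mult.commute[of a b] by linarith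
  qed
qed

text \<open>With r = p - 2 this is the derivative of |a|^p / p, i.e. the duality map from L^p to the
  space with the conjugate exponent.\<close>

definition powr_sgn :: "real \<Rightarrow> real \<Rightarrow> real" where
  "powr_sgn r a = \<bar>a\<bar> powr r * a"

lemma powr_sgn_2 [simp]: "powr_sgn 0 a = a"
  by (simp add: powr_sgn_def)

lemma abs_powr_sgn: "\<bar>powr_sgn r a\<bar> = \<bar>a\<bar> powr (r + 1)"
  by (cases "a = 0") (auto simp: powr_sgn_def abs_mult powr_add)

lemma powr_sgn_measurable [measurable]: "powr_sgn r \<in> borel_measurable borel"
  unfolding powr_sgn_def[abs_def] by measurable

lemma powr_sgn_mult_self: "powr_sgn r a * a = \<bar>a\<bar> powr (r + 2)"
  by (cases "a = 0") (auto simp: powr_sgn_def powr_add power2_eq_square)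

text \<open>For -1 < r < 0 the factor |a|^r is singular at 0; in this form both powers have the
  positive exponent r + 1, so continuity is visible.\<close>

lemma powr_sgn_alt: "powr_sgn r a = max a 0 powr (r + 1) - max (- a) 0 powr (r + 1)"
  by (cases "a = 0"; cases "a > 0") (auto simp: powr_sgn_def powr_add)

lemma tendsto_powr_sgn:
  assumes "0 < r + 1" "(f \<longlongrightarrow> a) F"
  shows "((\<lambda>x. powr_sgn r (f x)) \<longlongrightarrow> powr_sgn r a) F"
  unfolding powr_sgn_alt using assms
  by (intro tendsto_diff tendsto_powr2 tendsto_max tendsto_minus tendsto_const) auto

text \<open>The tangent of a convex function lies below it. After multiplying out, this is exactly
  Young's inequality for |y| and |x|^(q-1), so no derivative is taken.\<close>

lemma convex_tangent_powr:
  fixes x y q :: real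
  assumes "1 < q"
  shows "\<bar>x\<bar> powr q / q + powr_sgn (q - 2) x * (y - x) \<le> \<bar>y\<bar> powr q / q"
proof -
  define r where "r = q / (q - 1)"
  have r: "1 < r" "1/q + 1/r = 1" using assms by (auto simp: r_def field_simps)
  have "powr_sgn (q - 2) x * y \<le> \<bar>y\<bar> * \<bar>x\<bar> powr (q - 1)"
    using abs_ge_self[of "powr_sgn (q - 2) x * y"] by (simp add: abs_mult abs_powr_sgn mult.commute)
  also have "\<dots> \<le> \<bar>y\<bar> powr q / q + (\<bar>x\<bar> powr (q - 1)) powr r / r"
    using assms r by (intro Youngs_inequality) auto
  also have "(\<bar>x\<bar> powr (q - 1)) powr r = \<bar>x\<bar> powr q" using assms by (simp add: powr_powr r_def)
  also have "\<bar>x\<bar> powr q / r = \<bar>x\<bar> powr q * (1 - 1/q)"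
  proof -
    have "1/r = 1 - 1/q" using r(2) by linarith
    moreover have "\<bar>x\<bar> powr q / r = \<bar>x\<bar> powr q * (1/r)" by simp
    ultimately show ?thesis by metis
  qed
  finally have "powr_sgn (q - 2) x * y \<le> \<bar>y\<bar> powr q / q + \<bar>x\<bar> powr q * (1 - 1/q)" .
  moreover have "powr_sgn (q - 2) x * x = \<bar>x\<bar> powr q" using powr_sgn_mult_self[of "q - 2" x] by simp
  ultimately show ?thesis by (simp add: right_diff_distrib)
qed

text \<open>After division by x + y both arguments lie in the unit interval, where z^r \<le>
  z.\<close>

lemma powr_add_le_powr_sum:
  fixes x y r :: real
  assumes "0 \<le> x" "0 \<le> y" "1 \<le> r"
  shows "x powr r + y powr r \<le> (x + y) powr r"
proof (cases "x + y = 0")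
  case True
  then have "x = 0" "y = 0" using assms by auto
  then show ?thesis by simp
next
  case False
  define s where "s = x + y"
  have s: "s > 0" using False assms by (simp add: s_def)
  have *: "z powr r \<le> s powr r * (z / s)" if "0 \<le> z" "z \<le> s" for z
  proof -
    have "z powr r = s powr r * (z / s) powr r" using s that by (simp add: powr_divide)
    also have "(z / s) powr r \<le> (z / s) powr 1" using s that assms by (intro powr_mono') auto
    finally show ?thesis using s that by (simp add: mult_left_mono)
  qed
  have "x powr r + y powr r \<le> s powr r * (x / s) + s powr r * (y / s)"
    using assms by (intro add_mono *) (auto simp: s_def)
  also have "\<dots> = s powr r * ((x + y) / s)" by (simp add: add_divide_distrib distrib_left)
  finally show ?thesis using s by (simp add: s_def)
qed

text \<open>Add the tangent inequalities at the midpoint for both end points; the linear terms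
  cancel.\<close>

lemma mean_powr_le:
  fixes x y r :: real
  assumes "0 \<le> x" "0 \<le> y" "1 \<le> r"
  shows "((x + y) / 2) powr r \<le> (x powr r + y powr r) / 2"
proof (cases "r = 1")
  case True
  then show ?thesis using assms by simp
next
  case False
  with assms have r: "1 < r" by simp
  define c where "c = (x + y) / 2"
  have c: "0 \<le> c" using assms by (simp add: c_def)
  have "\<bar>c\<bar> powr r / r + powr_sgn (r - 2) c * (x - c) \<le> \<bar>x\<bar> powr r / r"
       "\<bar>c\<bar> powr r / r + powr_sgn (r - 2) c * (y - c) \<le> \<bar>y\<bar> powr r / r"
    using convex_tangent_powr[OF r] by auto
  moreover have "powr_sgn (r - 2) c * (x - c) + powr_sgn (r - 2) c * (y - c) = 0"
    by (simp add: c_def flip: distrib_left)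
  ultimately have "2 * (c powr r / r) \<le> x powr r / r + y powr r / r" using c assms by simp
  then show ?thesis using r by (simp add: c_def field_simps)
qed

text \<open>Superadditivity of t^(q/2), then the parallelogram identity, then convexity of t^(q/2).
  This uniform convexity makes minimising sequences Cauchy.\<close>

lemma Clarkson:
  fixes a b q :: real
  assumes "2 \<le> q"
  shows "\<bar>(a + b) / 2\<bar> powr q + \<bar>(a - b) / 2\<bar> powr q \<le> (\<bar>a\<bar> powr q + \<bar>b\<bar> powr q) / 2"
proof -
  have sq: "\<bar>z\<bar> powr q = (z\<^sup>2) powr (q / 2)" for z :: real
  proof (cases "z = 0")
    case False
    have "z\<^sup>2 = \<bar>z\<bar> powr 2" using False by simp
    then show ?thesis by (simp only: powr_powr) simp
  qed simp
  have "\<bar>(a + b) / 2\<bar> powr q + \<bar>(a - b) / 2\<bar> powr q \<le> (((a + b) / 2)\<^sup>2 + ((a - b) / 2)\<^sup>2) powr (q / 2)"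
    unfolding sq using assms by (intro powr_add_le_powr_sum) auto
  also have "((a + b) / 2)\<^sup>2 + ((a - b) / 2)\<^sup>2 = (a\<^sup>2 + b\<^sup>2) / 2"
    by (simp add: power2_eq_square field_simps)
  also have "\<dots> powr (q / 2) \<le> ((a\<^sup>2) powr (q / 2) + (b\<^sup>2) powr (q / 2)) / 2"
    using assms by (intro mean_powr_le) auto
  finally show ?thesis unfolding sq .
qed

lemma truncation_tendsto:
  assumes V: "V \<in> Lp M q"
  defines "T \<equiv> \<lambda>(n::nat) x. if \<bar>V x\<bar> \<le> real n then V x else 0"
  shows "(\<lambda>n. pint M q (\<lambda>x. T n x - V x)) \<longlonglongrightarrow> 0"
proof -
  note [measurable] = LpD(1)[OF V]
  have "(\<lambda>n. \<integral>x. \<bar>T n x - V x\<bar> powr q \<partial>M) \<longlonglongrightarrow> (\<integral>x. 0 \<partial>M)"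
  proof (rule integral_dominated_convergence[where w="\<lambda>x. \<bar>V x\<bar> powr q"])
    show "AE x in M. (\<lambda>n. \<bar>T n x - V x\<bar> powr q) \<longlonglongrightarrow> 0"
    proof (rule AE_I2)
      fix x
      obtain n0 where n0: "\<bar>V x\<bar> \<le> real n0" using real_arch_simple by blast
      have "eventually (\<lambda>n. \<bar>T n x - V x\<bar> powr q = 0) sequentially"
        using eventually_ge_at_top[of n0]
        by eventually_elim (use n0 in \<open>auto simp: T_def\<close>)
      then show "(\<lambda>n. \<bar>T n x - V x\<bar> powr q) \<longlonglongrightarrow> 0"
        by (rule tendsto_eventually)
    qed
  qed (use LpD[OF V] in \<open>auto simp: T_def\<close>)
  then show ?thesis by (simp add: pint_def)
qed

section \<open>Elliptic forms on the range of a projection\<close>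

text \<open>Idempotence is the only algebraic requirement; the kernel need not be symmetric.\<close>

locale schur_projection = schur_operator +
  assumes R_R: "\<And>f. integrable M f \<Longrightarrow> AE x in M. R (R f) x = R f x"
begin

text \<open>The range of the projection in L^p. In the application these are the difference
  quotients of the functions in one Sobolev space of the scale.\<close>

definition G :: "real \<Rightarrow> ('a \<Rightarrow> real) set" where
  "G p = {U \<in> Lp M p. AE x in M. R U x = U x}"

lemma G_D: "U \<in> G p \<Longrightarrow> U \<in> Lp M p" "U \<in> G p \<Longrightarrow> AE x in M. R U x = U x"
  by (auto simp: G_def)

lemma G_add:
  assumes "U \<in> G p" "V \<in> G p" "1 \<le> p" shows "(\<lambda>x. U x + V x) \<in> G p"
proof -
  have "AE x in M. R (\<lambda>x. U x + V x) x = U x + V x"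
    using R_add[OF Lp_integrable[OF G_D(1)[OF assms(1)] assms(3)] Lp_integrable[OF G_D(1)[OF assms(2)] assms(3)]]
      G_D(2)[OF assms(1)] G_D(2)[OF assms(2)]
    by eventually_elim simp
  then show ?thesis using Lp_add(1)[OF G_D(1)[OF assms(1)] G_D(1)[OF assms(2)]] assms(3) by (auto simp: G_def)
qed

lemma G_cmult:
  assumes "U \<in> G p" shows "(\<lambda>x. c * U x) \<in> G p"
  using Lp_cmult(1)[OF G_D(1)[OF assms]] G_D(2)[OF assms] by (auto simp: G_def R_cmult)

lemma G_diff:
  assumes "U \<in> G p" "V \<in> G p" "1 \<le> p" shows "(\<lambda>x. U x - V x) \<in> G p"
  using G_add[OF assms(1) G_cmult[OF assms(2), of "-1"] assms(3)] by simp

lemma G_zero: "(\<lambda>x. 0) \<in> G p"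
  by (auto simp: G_def R_def Lp_def)

lemma G_mono: "U \<in> G b \<Longrightarrow> 0 < a \<Longrightarrow> a \<le> b \<Longrightarrow> U \<in> G a"
  using Lp_mono by (auto simp: G_def)

lemma R_in_G: "f \<in> Lp M p \<Longrightarrow> 1 < p \<Longrightarrow> R f \<in> G p"
  using R_Lp(1) R_R[OF Lp_integrable] by (auto simp: G_def)

text \<open>R g - g equals (f n - g) - R (f n - g) almost everywhere, and the L^p bound for
  \<open>R\<close> makes the right side small.\<close>

lemma G_closed:
  assumes f: "\<And>n. f n \<in> G p" and g: "g \<in> Lp M p" and p: "1 < p"
    and lim: "(\<lambda>n. pint M p (\<lambda>x. f n x - g x)) \<longlonglongrightarrow> 0"
  shows "g \<in> G p"
proof -
  note fL = G_D(1)[OF f]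
  have fi: "integrable M (f n)" for n using Lp_integrable[OF fL] p by simp
  have gi: "integrable M g" using Lp_integrable[OF g] p by simp
  have Rg: "R g \<in> Lp M p" using R_Lp(1)[OF g p] .
  note [measurable] = LpD(1)[OF fL] LpD(1)[OF g]
  have d: "(\<lambda>x. f n x - g x) \<in> Lp M p" for n using Lp_diff(1)[OF fL g] p by simp
  have le: "pint M p (\<lambda>x. R g x - g x) \<le> 2 powr p * (C powr p * pint M p (\<lambda>x. f n x - g x) + pint M p (\<lambda>x. f n x - g x))" for n
  proof -
    have "AE x in M. R g x - g x = (f n x - g x) - R (\<lambda>x. f n x - g x) x"
      using R_diff[OF fi[of n] gi] G_D(2)[OF f[of n]] by eventually_elim simp
    then have "pint M p (\<lambda>x. R g x - g x) = pint M p (\<lambda>x. (f n x - g x) - R (\<lambda>x. f n x - g x) x)"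
      by (intro Lp_cong_AE(2)[OF Lp_diff(1)[OF d R_Lp(1)[OF d p]]]) (use p in auto)
    also have "\<dots> \<le> 2 powr p * (pint M p (\<lambda>x. f n x - g x) + pint M p (R (\<lambda>x. f n x - g x)))"
      using Lp_diff(2)[OF d R_Lp(1)[OF d p]] p by simp
    also have "\<dots> \<le> 2 powr p * (C powr p * pint M p (\<lambda>x. f n x - g x) + pint M p (\<lambda>x. f n x - g x))"
      using R_Lp(2)[OF d p] by simp
    finally show ?thesis .
  qed
  have l: "(\<lambda>n. 2 powr p * (C powr p * pint M p (\<lambda>x. f n x - g x) + pint M p (\<lambda>x. f n x - g x))) \<longlonglongrightarrow> 2 powr p * (C powr p * 0 + 0)"
    by (intro tendsto_intros lim)
  have "pint M p (\<lambda>x. R g x - g x) \<le> 2 powr p * (C powr p * 0 + 0)"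
    by (rule LIMSEQ_le_const[OF l]) (use le in blast)
  then have "pint M p (\<lambda>x. R g x - g x) \<le> 0" by simp
  then have "pint M p (\<lambda>x. R g x - g x) = 0" using pint_nonneg[of M p "\<lambda>x. R g x - g x"] by linarith
  then have "AE x in M. R g x - g x = 0"
    using pint_eq_0_iff[OF Lp_diff(1)[OF Rg g]] p by simp
  then show ?thesis using g by (auto simp: G_def)
qed

end

context schur_projection
begin

text \<open>The bound B is kept explicit because the final estimate has to be linear in the norm of
  the datum. Applied to differences, it also gives independence of representatives.\<close>

definition functional_on :: "real \<Rightarrow> (('a \<Rightarrow> real) \<Rightarrow> real) \<Rightarrow> real \<Rightarrow> bool" where
  "functional_on q F B \<longleftrightarrow> 0 \<le> B \<and>
     (\<forall>U\<in>G q. \<forall>V\<in>G q. F (\<lambda>x. U x + V x) = F U + F V) \<and>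
     (\<forall>c. \<forall>U\<in>G q. F (\<lambda>x. c * U x) = c * F U) \<and>
     (\<forall>U\<in>G q. \<bar>F U\<bar> \<le> B * pint M q U powr (1/q))"

lemma functional_onD:
  assumes "functional_on q F B"
  shows "0 \<le> B" "U \<in> G q \<Longrightarrow> V \<in> G q \<Longrightarrow> F (\<lambda>x. U x + V x) = F U + F V"
    "U \<in> G q \<Longrightarrow> F (\<lambda>x. c * U x) = c * F U" "U \<in> G q \<Longrightarrow> \<bar>F U\<bar> \<le> B * pint M q U powr (1/q)"
  using assms by (auto simp: functional_on_def)

lemma functional_on_diff:
  assumes F: "functional_on q F B" and U: "U \<in> G q" and V: "V \<in> G q"
  shows "F (\<lambda>x. U x - V x) = F U - F V"
  using functional_onD(2)[OF F U G_cmult[OF V, of "-1"]] functional_onD(3)[OF F V, of "-1"] by simp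

lemma powr_sgn_Lp:
  assumes f: "f \<in> Lp M p" and p: "1 < p"
  shows "(\<lambda>x. powr_sgn (p - 2) (f x)) \<in> Lp M (p / (p - 1))"
    and "pint M (p / (p - 1)) (\<lambda>x. powr_sgn (p - 2) (f x)) = pint M p f"
  using LpD[OF f] p by (auto intro!: LpI simp: abs_powr_sgn powr_powr pint_def)

end

text \<open>The bounds on the coefficient hold at every point; an essentially bounded coefficient is
  first replaced by a clamped Borel representative.\<close>

locale schur_elliptic = schur_projection +
  fixes A :: "'a \<Rightarrow> real" and lam Lam :: real
  assumes A_measurable [measurable]: "A \<in> borel_measurable M"
    and lam_pos: "0 < lam"
    and A_bounds: "\<And>x. x \<in> space M \<Longrightarrow> lam \<le> A x" "\<And>x. x \<in> space M \<Longrightarrow> A x \<le> Lam"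
    and Lam_ge: "lam \<le> Lam"
begin

lemma A_abs: "x \<in> space M \<Longrightarrow> \<bar>A x\<bar> \<le> Lam"
  using A_bounds[of x] lam_pos by auto

lemma A_mult_Lp:
  assumes f: "f \<in> Lp M p" and p: "0 \<le> p"
  shows "(\<lambda>x. A x * f x) \<in> Lp M p"
proof -
  have [measurable]: "f \<in> borel_measurable M" using LpD[OF f] by simp
  show ?thesis
    by (rule Lp_bound(1)[OF _ f p, of _ Lam])
       (use A_abs lam_pos Lam_ge in \<open>auto simp: abs_mult intro!: mult_right_mono\<close>)
qed

lemma A_mult_integrable:
  assumes "integrable M f" shows "integrable M (\<lambda>x. A x * f x)"
proof -
  have [measurable]: "f \<in> borel_measurable M" using assms by simp
  show ?thesis
    by (rule Bochner_Integration.integrable_bound[OF integrable_mult_right[OF assms, of Lam]])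
       (use A_abs lam_pos Lam_ge in \<open>auto simp: abs_mult intro!: mult_right_mono\<close>)
qed

lemma A_form_integrable:
  assumes "U \<in> Lp M p" "V \<in> Lp M q" "p > 1" "q > 1" "1/p + 1/q = 1"
  shows "integrable M (\<lambda>x. A x * U x * V x)"
  using Holder(1)[OF A_mult_Lp[OF assms(1)] assms(2-5)] assms(3) by simp

text \<open>Replacing R (w |U| U) by w |U| U on the right would give at least lam times the weighted
  energy. The error is the integral of the commutator, at most 2 Lam C \<theta> times that energy,
  and takes away at most half.\<close>

lemma weighted_test:
  assumes U: "integrable M U" "AE x in M. R U x = U x"
    and w [measurable]: "w \<in> borel_measurable borel" and w0: "\<And>a. 0 \<le> w a"
    and W: "integrable M (\<lambda>x. w \<bar>U x\<bar> * U x)" and WU: "integrable M (\<lambda>x. w \<bar>U x\<bar> * (U x)\<^sup>2)"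
    and \<theta>: "0 \<le> \<theta>" "\<And>a b. 0 \<le> a \<Longrightarrow> 0 \<le> b \<Longrightarrow> a * b * \<bar>w a - w b\<bar> \<le> \<theta> * (w a * a\<^sup>2 + w b * b\<^sup>2)"
    and small: "2 * Lam * C * \<theta> \<le> lam / 2"
  shows "lam / 2 * (\<integral>x. w \<bar>U x\<bar> * (U x)\<^sup>2 \<partial>M) \<le> (\<integral>x. A x * U x * R (\<lambda>x. w \<bar>U x\<bar> * U x) x \<partial>M)"
proof -
  have [measurable]: "U \<in> borel_measurable M" using U by auto
  define I where "I = (\<integral>x. w \<bar>U x\<bar> * (U x)\<^sup>2 \<partial>M)"
  have I0: "I \<ge> 0" by (auto simp: I_def w0)
  define D where "D x = A x * U x * (R (\<lambda>x. w \<bar>U x\<bar> * U x) x - w \<bar>U x\<bar> * U x)" for x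
  have Di: "integrable M D" and Db: "\<bar>\<integral>x. D x \<partial>M\<bar> \<le> 2 * Lam * C * \<theta> * I"
    using commutator_bound[OF U A_measurable A_abs w w0 W WU \<theta>] by (auto simp: D_def[abs_def] I_def)
  have AWi: "integrable M (\<lambda>x. A x * (w \<bar>U x\<bar> * (U x)\<^sup>2))"
    by (rule A_mult_integrable[OF WU])
  have "lam * I \<le> (\<integral>x. A x * (w \<bar>U x\<bar> * (U x)\<^sup>2) \<partial>M)"
    unfolding I_def integral_mult_right_zero[symmetric]
    by (rule integral_mono) (use WU AWi w0 A_bounds in \<open>auto intro!: mult_right_mono\<close>)
  moreover have "(\<integral>x. A x * U x * R (\<lambda>x. w \<bar>U x\<bar> * U x) x \<partial>M) = (\<integral>x. D x + A x * (w \<bar>U x\<bar> * (U x)\<^sup>2) \<partial>M)"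
    by (rule Bochner_Integration.integral_cong) (auto simp: D_def power2_eq_square algebra_simps)
  moreover have "\<dots> = (\<integral>x. D x \<partial>M) + (\<integral>x. A x * (w \<bar>U x\<bar> * (U x)\<^sup>2) \<partial>M)"
    by (rule Bochner_Integration.integral_add[OF Di AWi])
  moreover have "2 * Lam * C * \<theta> * I \<le> lam / 2 * I" using small I0 by (rule mult_right_mono)
  ultimately show ?thesis using Db unfolding I_def[symmetric] by (simp add: abs_le_iff)
qed

text \<open>Test with R W for the dual power W of U. The p-th power integral of U equals the q-th
  power integral of W, so the right side has only the power 1/q of it, and dividing leaves the norm
  of U.\<close>

lemma a_priori_bound:
  assumes U: "U \<in> G p" and p: "1 < p" "\<bar>p - 2\<bar> \<le> 1/2" and small: "8 * Lam * C * \<bar>p - 2\<bar> \<le> lam"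
    and q: "q = p / (p - 1)" and B: "0 \<le> B"
    and bd: "\<And>\<Phi>. \<Phi> \<in> G q \<Longrightarrow> \<bar>\<integral>x. A x * U x * \<Phi> x \<partial>M\<bar> \<le> B * pint M q \<Phi> powr (1/q)"
  shows "pint M p U powr (1/p) \<le> 2 * C / lam * B"
proof -
  note UL = G_D(1)[OF U]
  note [measurable] = LpD(1)[OF UL]
  have q1: "1 < q" "1/p + 1/q = 1" using p by (auto simp: q field_simps)
  define W where "W x = powr_sgn (p - 2) (U x)" for x
  have W: "W \<in> Lp M q" and Wp: "pint M q W = pint M p U"
    using powr_sgn_Lp[OF UL p(1)] by (auto simp: W_def[abs_def] q)
  have WU: "\<bar>U x\<bar> powr (p - 2) * (U x)\<^sup>2 = \<bar>U x\<bar> powr p" for x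
    using powr_sgn_mult_self[of "p - 2" "U x"] by (simp add: powr_sgn_def power2_eq_square mult.assoc)
  have "lam / 2 * (\<integral>x. \<bar>U x\<bar> powr (p - 2) * (U x)\<^sup>2 \<partial>M)
      \<le> (\<integral>x. A x * U x * R (\<lambda>x. \<bar>U x\<bar> powr (p - 2) * U x) x \<partial>M)"
  \<comment> \<open>With \<theta> = 2 |p - 2| the smallness condition reads 4 Lam C |p - 2| \<le>
    lam / 2, which is the origin of the number 8.\<close>
  proof (rule weighted_test[where w="\<lambda>a. a powr (p - 2)" and \<theta>="2 * \<bar>p - 2\<bar>"])
    show "integrable M U" using Lp_integrable[OF UL] p by simp
    show "AE x in M. R U x = U x" by (rule G_D(2)[OF U])
    show "integrable M (\<lambda>x. \<bar>U x\<bar> powr (p - 2) * U x)"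
      using Lp_integrable[OF W] q1 by (simp add: W_def[abs_def] powr_sgn_def)
    show "integrable M (\<lambda>x. \<bar>U x\<bar> powr (p - 2) * (U x)\<^sup>2)"
      unfolding WU by (rule LpD(2)[OF UL])
  qed (use powr_weight_diff p small in \<open>auto\<close>)
  then have "lam / 2 * pint M p U \<le> (\<integral>x. A x * U x * R W x \<partial>M)"
    unfolding WU by (simp add: pint_def W_def[abs_def] powr_sgn_def)
  also have "\<dots> \<le> B * pint M q (R W) powr (1/q)"
    using bd[OF R_in_G[OF W q1(1)]] by simp
  also have "\<dots> \<le> B * (C powr q * pint M p U) powr (1/q)"
    using R_Lp(2)[OF W q1(1)] q1 B by (intro mult_left_mono powr_mono2) (auto simp: Wp)
  also have "\<dots> = B * C * pint M p U powr (1/q)"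
    using C_pos q1 by (simp add: powr_mult powr_powr)
  finally have main: "lam / 2 * pint M p U \<le> B * C * pint M p U powr (1/q)" .
  show ?thesis
  proof (cases "pint M p U = 0")
    case True
    then show ?thesis using B C_pos lam_pos by simp
  next
    case False
    then have I: "pint M p U > 0" using pint_nonneg[of M p U] by linarith
    have "pint M p U = pint M p U powr (1/p) * pint M p U powr (1/q)"
      using I q1(2) by (simp flip: powr_add)
    then have "lam / 2 * pint M p U powr (1/p) * pint M p U powr (1/q) \<le> B * C * pint M p U powr (1/q)"
      using main by (simp add: mult.assoc)
    then have "lam / 2 * pint M p U powr (1/p) \<le> B * C" using I by simp
    then show ?thesis using lam_pos by (simp add: field_simps)
  qed
qed

text \<open>Minimise the integral of A |W|^q / q minus F W over gradients; the claim is the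
  Euler-Lagrange equation. For q = 2 it is the weak problem itself. For q > 2 it represents F by A
  |W|^(q-2) W, a function with the conjugate exponent, and so replaces a Hahn-Banach extension
  followed by Riesz representation.\<close>

lemma variational_solution:
  assumes q: "2 \<le> q" and F: "functional_on q F B"
  shows "\<exists>W\<in>G q. \<forall>\<Phi>\<in>G q. (\<integral>x. A x * powr_sgn (q - 2) (W x) * \<Phi> x \<partial>M) = F \<Phi>"
proof -
  define E where "E W = (\<integral>x. A x * (\<bar>W x\<bar> powr q / q) \<partial>M)" for W
  define J where "J W = E W - F W" for W
  define r where "r = q / (q - 1)"
  have r: "1 < r" "1/q + 1/r = 1" using q by (auto simp: r_def field_simps)
  have q1: "1 < q" using q by simp
  have Ei: "integrable M (\<lambda>x. A x * (\<bar>W x\<bar> powr q / q))" if "W \<in> Lp M q" for W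
    by (intro A_mult_integrable integrable_divide LpD(2)[OF that])
  have E_lower: "lam / q * pint M q W \<le> E W" if "W \<in> Lp M q" for W
  proof -
    have "lam / q * pint M q W = (\<integral>x. lam * (\<bar>W x\<bar> powr q / q) \<partial>M)" by (simp add: pint_def)
    also have "\<dots> \<le> E W" unfolding E_def
      by (rule integral_mono) (use Ei[OF that] LpD[OF that] A_bounds q in \<open>auto intro!: mult_right_mono divide_right_mono\<close>)
    finally show ?thesis .
  qed
  \<comment> \<open>Young's inequality is applied to (lam I)^(1/q) and B lam^(-1/q), so that the
    first term is exactly the lower bound lam I / q for the energy.\<close>
  define c0 where "c0 = (B * lam powr (- 1/q)) powr r / r"
  have J_lower: "- c0 \<le> J W" if W: "W \<in> G q" for W
  proof -
    define I where "I = pint M q W"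
    have I0: "0 \<le> I" by (simp add: I_def)
    have "F W \<le> B * I powr (1/q)" using functional_onD(4)[OF F W] by (simp add: I_def)
    also have "\<dots> = (lam * I) powr (1/q) * (B * lam powr (- 1/q))"
      using lam_pos I0 by (simp add: powr_mult mult_ac flip: powr_add)
    also have "\<dots> \<le> ((lam * I) powr (1/q)) powr q / q + c0"
      unfolding c0_def using q1 r functional_onD(1)[OF F] by (intro Youngs_inequality) auto
    also have "((lam * I) powr (1/q)) powr q / q = lam / q * I" using q1 I0 lam_pos by (simp add: powr_powr)
    also have "\<dots> \<le> E W" using E_lower[OF G_D(1)[OF W]] by (simp add: I_def)
    finally show ?thesis by (simp add: J_def)
  qed
  define j where "j = (INF W\<in>G q. J W)"
  have bdd: "bdd_below (J ` G q)" using J_lower by (intro bdd_belowI[of _ "- c0"]) auto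
  have j_le: "j \<le> J W" if "W \<in> G q" for W
    unfolding j_def by (rule cINF_lower[OF bdd that])
  have "\<exists>W\<in>G q. J W < j + 1 / real (Suc n)" for n
  proof -
    have "j < j + 1 / real (Suc n)" by simp
    then show ?thesis using cINF_less_iff[OF _ bdd, of "j + 1 / real (Suc n)"] G_zero unfolding j_def by blast
  qed
  then obtain W where W: "\<And>n. W n \<in> G q" and WJ: "\<And>n. J (W n) < j + 1 / real (Suc n)"
    by metis
  note WL = G_D(1)[OF W]
  \<comment> \<open>The midpoint S cannot beat the infimum j, and F is linear, so by Clarkson's
    inequality the energy of the half difference T is at most the mean excess of the two values over
    j.\<close>
  have cauchy_bound: "lam / q * (1/2) powr q * pint M q (\<lambda>x. W m x - W n x) \<le> (1 / real (Suc m) + 1 / real (Suc n)) / 2" for m n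
  proof -
    define S where "S x = (1/2) * (W m x + W n x)" for x
    define T where "T x = (1/2) * (W m x - W n x)" for x
    have S: "S \<in> G q"
      unfolding S_def[abs_def] by (rule G_cmult[OF G_add[OF W W]]) (use q in simp)
    have T: "T \<in> G q"
      unfolding T_def[abs_def] by (rule G_cmult[OF G_diff[OF W W]]) (use q in simp)
    have "E S + E T = (\<integral>x. A x * (\<bar>S x\<bar> powr q / q) + A x * (\<bar>T x\<bar> powr q / q) \<partial>M)"
      unfolding E_def using Ei[OF G_D(1)[OF S]] Ei[OF G_D(1)[OF T]] by simp
    also have "\<dots> \<le> (\<integral>x. (A x * (\<bar>W m x\<bar> powr q / q) + A x * (\<bar>W n x\<bar> powr q / q)) / 2 \<partial>M)"
    proof (rule integral_mono)
      fix x assume x: "x \<in> space M"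
      have "\<bar>S x\<bar> powr q + \<bar>T x\<bar> powr q \<le> (\<bar>W m x\<bar> powr q + \<bar>W n x\<bar> powr q) / 2"
        using Clarkson[OF q, of "W m x" "W n x"] by (simp add: S_def T_def)
      then have "A x / q * (\<bar>S x\<bar> powr q + \<bar>T x\<bar> powr q) \<le> A x / q * ((\<bar>W m x\<bar> powr q + \<bar>W n x\<bar> powr q) / 2)"
        using A_bounds[OF x] lam_pos q by (intro mult_left_mono) auto
      then show "A x * (\<bar>S x\<bar> powr q / q) + A x * (\<bar>T x\<bar> powr q / q)
          \<le> (A x * (\<bar>W m x\<bar> powr q / q) + A x * (\<bar>W n x\<bar> powr q / q)) / 2"
        by (simp add: distrib_left add_divide_distrib)
    qed (use Ei[OF G_D(1)[OF S]] Ei[OF G_D(1)[OF T]] Ei[OF WL] in auto)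
    also have "\<dots> = (E (W m) + E (W n)) / 2"
      unfolding E_def using Ei[OF WL] by simp
    finally have 1: "E S + E T \<le> (E (W m) + E (W n)) / 2" .
    have FS: "F S = (F (W m) + F (W n)) / 2"
    proof -
      have "(\<lambda>x. W m x + W n x) \<in> G q" by (rule G_add[OF W W]) (use q in simp)
      from functional_onD(3)[OF F this, of "1/2"] functional_onD(2)[OF F W[of m] W[of n]]
      show ?thesis unfolding S_def[abs_def] by simp
    qed
    have "E T \<le> (J (W m) + J (W n)) / 2 - J S" using 1 FS unfolding J_def by argo
    also have "\<dots> \<le> (1 / real (Suc m) + 1 / real (Suc n)) / 2"
      using WJ[of m] WJ[of n] j_le[OF S] by argo
    finally have "lam / q * pint M q T \<le> (1 / real (Suc m) + 1 / real (Suc n)) / 2"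
      using E_lower[OF G_D(1)[OF T]] by linarith
    moreover have "pint M q T = (1/2) powr q * pint M q (\<lambda>x. W m x - W n x)"
    proof -
      have "(\<lambda>x. W m x - W n x) \<in> Lp M q" by (rule Lp_diff(1)[OF WL WL]) (use q in simp)
      from Lp_cmult(2)[OF this, of "1/2"] show ?thesis unfolding T_def[abs_def] by simp
    qed
    ultimately show ?thesis by (simp add: mult_ac)
  qed
  have "\<exists>g\<in>Lp M q. (\<lambda>n. pint M q (\<lambda>x. W n x - g x)) \<longlonglongrightarrow> 0"
  proof (rule Lp_complete[OF WL])
    fix e :: real assume e: "0 < e"
    define c where "c = lam / q * (1/2) powr q"
    have c: "c > 0" using lam_pos q by (simp add: c_def)
    obtain N :: nat where N: "1 / (c * e) < real N" using reals_Archimedean2 by blast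
    have "pint M q (\<lambda>x. W m x - W n x) \<le> e" if "N \<le> m" "N \<le> n" for m n
    proof -
      have i: "1 / real (Suc k) \<le> c * e" if "N \<le> k" for k
      proof -
        have "1 / (c * e) \<le> real (Suc k)" using N that by linarith
        then show ?thesis using c e by (simp add: field_simps)
      qed
      have "c * pint M q (\<lambda>x. W m x - W n x) \<le> c * e"
        using cauchy_bound[of m n] i[OF that(1)] i[OF that(2)] unfolding c_def[symmetric] by argo
      then show ?thesis using c by simp
    qed
    then show "\<exists>N. \<forall>m\<ge>N. \<forall>n\<ge>N. pint M q (\<lambda>x. W m x - W n x) \<le> e" by blast
  qed (use q in simp)
  then obtain g where gL: "g \<in> Lp M q" and glim: "(\<lambda>n. pint M q (\<lambda>x. W n x - g x)) \<longlonglongrightarrow> 0" by blast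
  have g: "g \<in> G q" by (rule G_closed[OF W gL q1 glim])
  have pL: "(\<lambda>x. A x * powr_sgn (q - 2) (V x)) \<in> Lp M r" if "V \<in> Lp M q" for V
    using A_mult_Lp[OF powr_sgn_Lp(1)[OF that q1]] r by (simp add: r_def)
  have pI: "integrable M (\<lambda>x. A x * powr_sgn (q - 2) (V x) * Z x)" if "V \<in> Lp M q" "Z \<in> Lp M q" for V Z
    using Holder(1)[OF pL[OF that(1)] that(2) r(1) q1] r(2) by simp
  have tangent: "E X + (\<integral>x. A x * powr_sgn (q - 2) (X x) * (Y x - X x) \<partial>M) \<le> E Y"
    if X: "X \<in> Lp M q" and Y: "Y \<in> Lp M q" for X Y
  proof -
    have d: "(\<lambda>x. Y x - X x) \<in> Lp M q" using Lp_diff(1)[OF Y X] q by simp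
    have "E X + (\<integral>x. A x * powr_sgn (q - 2) (X x) * (Y x - X x) \<partial>M)
      = (\<integral>x. A x * (\<bar>X x\<bar> powr q / q) + A x * powr_sgn (q - 2) (X x) * (Y x - X x) \<partial>M)"
      unfolding E_def using Ei[OF X] pI[OF X d] by simp
    also have "\<dots> \<le> E Y" unfolding E_def
    proof (rule integral_mono)
      fix x assume x: "x \<in> space M"
      have "A x * (\<bar>X x\<bar> powr q / q + powr_sgn (q - 2) (X x) * (Y x - X x)) \<le> A x * (\<bar>Y x\<bar> powr q / q)"
        using A_bounds[OF x] lam_pos by (intro mult_left_mono convex_tangent_powr[OF q1]) auto
      then show "A x * (\<bar>X x\<bar> powr q / q) + A x * powr_sgn (q - 2) (X x) * (Y x - X x) \<le> A x * (\<bar>Y x\<bar> powr q / q)"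
        by (simp add: distrib_left)
    qed (use Ei[OF X] Ei[OF Y] pI[OF X d] in auto)
    finally show ?thesis .
  qed
  \<comment> \<open>The tangent inequality at the limit g bounds E g by E (W n) up to a term linear
    in W n - g, which Hoelder's inequality makes small. This is semicontinuity without continuity of
    E.\<close>
  have Jg: "J g \<le> j"
  proof -
    define K where "K = pint M r (\<lambda>x. A x * powr_sgn (q - 2) (g x)) powr (1/r) + B"
    have K0: "0 \<le> K" using functional_onD(1)[OF F] by (simp add: K_def)
    have le: "J g \<le> j + 1 / real (Suc n) + K * pint M q (\<lambda>x. W n x - g x) powr (1/q)" for n
    proof -
      have d: "(\<lambda>x. W n x - g x) \<in> G q" using G_diff[OF W g] q by simp
      have "E g + (\<integral>x. A x * powr_sgn (q - 2) (g x) * (W n x - g x) \<partial>M) \<le> E (W n)"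
        by (rule tangent[OF gL WL])
      moreover have "\<bar>\<integral>x. A x * powr_sgn (q - 2) (g x) * (W n x - g x) \<partial>M\<bar>
          \<le> pint M r (\<lambda>x. A x * powr_sgn (q - 2) (g x)) powr (1/r) * pint M q (\<lambda>x. W n x - g x) powr (1/q)"
        using Holder(3)[OF pL[OF gL] G_D(1)[OF d] r(1) q1] r(2) by simp
      moreover have "\<bar>F (W n) - F g\<bar> \<le> B * pint M q (\<lambda>x. W n x - g x) powr (1/q)"
        using functional_onD(4)[OF F d] functional_on_diff[OF F W g] by simp
      ultimately show ?thesis using WJ[of n] unfolding J_def K_def distrib_right abs_le_iff by argo
    qed
    have "(\<lambda>n. j + 1 / real (Suc n) + K * pint M q (\<lambda>x. W n x - g x) powr (1/q)) \<longlonglongrightarrow> j + 0 + K * 0 powr (1/q)"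
      using q1 by (intro tendsto_intros LIMSEQ_Suc[OF lim_1_over_n] tendsto_powr2[OF glim]) auto
    then have "J g \<le> j + 0 + K * 0 powr (1/q)"
      by (rule LIMSEQ_le_const) (use le in blast)
    then show ?thesis by simp
  qed
  \<comment> \<open>Minimality compares g with g + t \<Phi>; the tangent at the perturbed point
    bounds the increase of energy by t times an integral. Dividing by t and letting t tend to 0
    avoids differentiating under the integral. The opposite inequality follows with -\<Phi>.\<close>
  have half: "F \<Phi> \<le> (\<integral>x. A x * powr_sgn (q - 2) (g x) * \<Phi> x \<partial>M)" if P: "\<Phi> \<in> G q" for \<Phi>
  proof -
    define t where "t n = 1 / real (Suc n)" for n
    define H where "H n x = g x + t n * \<Phi> x" for n x
    have t: "0 < t n" "t n \<le> 1" for n by (auto simp: t_def)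
    note PL = G_D(1)[OF P]
    note [measurable] = LpD(1)[OF PL] LpD(1)[OF gL]
    have HG: "H n \<in> G q" for n unfolding H_def[abs_def] using G_add[OF g G_cmult[OF P]] q by simp
    note HL = G_D(1)[OF HG]
    have le: "F \<Phi> \<le> (\<integral>x. A x * powr_sgn (q - 2) (H n x) * \<Phi> x \<partial>M)" for n
    proof -
      have "E (H n) + (\<integral>x. A x * powr_sgn (q - 2) (H n x) * (g x - H n x) \<partial>M) \<le> E g"
        by (rule tangent[OF HL gL])
      moreover have "(\<integral>x. A x * powr_sgn (q - 2) (H n x) * (g x - H n x) \<partial>M)
          = - t n * (\<integral>x. A x * powr_sgn (q - 2) (H n x) * \<Phi> x \<partial>M)"
        unfolding integral_mult_right_zero[symmetric]
        by (rule Bochner_Integration.integral_cong) (auto simp: H_def)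
      moreover have "J g \<le> J (H n)" using Jg j_le[OF HG] by (rule order_trans)
      moreover have "F (H n) = F g + t n * F \<Phi>"
        unfolding H_def[abs_def] using functional_onD(2)[OF F g G_cmult[OF P]] functional_onD(3)[OF F P] by simp
      ultimately have "t n * F \<Phi> \<le> t n * (\<integral>x. A x * powr_sgn (q - 2) (H n x) * \<Phi> x \<partial>M)"
        unfolding J_def by linarith
      then show ?thesis using t by simp
    qed
    have "(\<lambda>n. \<integral>x. A x * powr_sgn (q - 2) (H n x) * \<Phi> x \<partial>M) \<longlonglongrightarrow> (\<integral>x. A x * powr_sgn (q - 2) (g x) * \<Phi> x \<partial>M)"
    proof (rule integral_dominated_convergence[where w="\<lambda>x. Lam * \<bar>\<bar>g x\<bar> + \<bar>\<Phi> x\<bar>\<bar> powr q"])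
      show "AE x in M. (\<lambda>n. A x * powr_sgn (q - 2) (H n x) * \<Phi> x) \<longlonglongrightarrow> A x * powr_sgn (q - 2) (g x) * \<Phi> x"
      proof (rule AE_I2)
        fix x
        have "(\<lambda>n. H n x) \<longlonglongrightarrow> g x + 0 * \<Phi> x"
          unfolding H_def t_def by (intro tendsto_intros LIMSEQ_Suc[OF lim_1_over_n])
        then show "(\<lambda>n. A x * powr_sgn (q - 2) (H n x) * \<Phi> x) \<longlonglongrightarrow> A x * powr_sgn (q - 2) (g x) * \<Phi> x"
          using q by (intro tendsto_intros tendsto_powr_sgn) auto
      qed
      have "(\<lambda>x. \<bar>g x\<bar> + \<bar>\<Phi> x\<bar>) \<in> Lp M q"
        using Lp_add(1)[of "\<lambda>x. \<bar>g x\<bar>" M q "\<lambda>x. \<bar>\<Phi> x\<bar>"] gL PL q by (auto simp: Lp_def)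
      from LpD(2)[OF this] show "integrable M (\<lambda>x. Lam * \<bar>\<bar>g x\<bar> + \<bar>\<Phi> x\<bar>\<bar> powr q)" by simp
      show "AE x in M. norm (A x * powr_sgn (q - 2) (H n x) * \<Phi> x) \<le> Lam * \<bar>\<bar>g x\<bar> + \<bar>\<Phi> x\<bar>\<bar> powr q" for n
      proof (rule AE_I2)
        fix x assume x: "x \<in> space M"
        define s where "s = \<bar>g x\<bar> + \<bar>\<Phi> x\<bar>"
        have "\<bar>t n * \<Phi> x\<bar> \<le> \<bar>\<Phi> x\<bar>" using t[of n] by (simp add: abs_mult mult_left_le_one_le)
        then have "\<bar>H n x\<bar> \<le> s" unfolding H_def s_def by linarith
        then have "\<bar>H n x\<bar> powr (q - 1) * \<bar>\<Phi> x\<bar> \<le> s powr (q - 1) * s"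
          using q by (intro mult_mono powr_mono2) (auto simp: s_def)
        also have "\<dots> = s powr q"
          by (cases "s = 0") (auto simp: s_def powr_diff)
        finally have 1: "\<bar>H n x\<bar> powr (q - 1) * \<bar>\<Phi> x\<bar> \<le> s powr q" .
        have "norm (A x * powr_sgn (q - 2) (H n x) * \<Phi> x) = \<bar>A x\<bar> * (\<bar>H n x\<bar> powr (q - 1) * \<bar>\<Phi> x\<bar>)"
          by (simp add: abs_mult abs_powr_sgn)
        also have "\<dots> \<le> Lam * s powr q"
          using 1 A_abs[OF x] lam_pos Lam_ge by (intro mult_mono) auto
        finally show "norm (A x * powr_sgn (q - 2) (H n x) * \<Phi> x) \<le> Lam * \<bar>\<bar>g x\<bar> + \<bar>\<Phi> x\<bar>\<bar> powr q"
          by (simp add: s_def)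
      qed
    qed (auto simp: H_def)
    then show ?thesis by (rule LIMSEQ_le_const) (use le in blast)
  qed
  have "(\<integral>x. A x * powr_sgn (q - 2) (g x) * \<Phi> x \<partial>M) = F \<Phi>" if P: "\<Phi> \<in> G q" for \<Phi>
  proof (rule antisym[OF _ half[OF P]])
    have "F (\<lambda>x. (-1) * \<Phi> x) \<le> (\<integral>x. A x * powr_sgn (q - 2) (g x) * ((-1) * \<Phi> x) \<partial>M)"
      by (rule half[OF G_cmult[OF P]])
    then show "(\<integral>x. A x * powr_sgn (q - 2) (g x) * \<Phi> x \<partial>M) \<le> F \<Phi>"
      using functional_onD(3)[OF F P, of "-1"] by simp
  qed
  then show ?thesis using g by blast
qed


text \<open>As q \<le> 2, the datum is bounded on G 2, which yields a solution U in L^2. The weight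
  |U|^(p-2) cannot be used directly since integrability of |U|^p is the goal; truncated weights give
  bounds independent of the truncation level, and Fatou's lemma removes it.\<close>

lemma existence_ge_2:
  assumes p: "2 \<le> p" and small: "8 * Lam * C * (p - 2) \<le> lam"
    and q: "q = p / (p - 1)" and F: "functional_on q F B"
  shows "\<exists>U\<in>G p. \<forall>\<Phi>\<in>G q. (\<integral>x. A x * U x * \<Phi> x \<partial>M) = F \<Phi>"
proof -
  have q1: "1 < q" "1/p + 1/q = 1" "q \<le> 2" using p by (auto simp: q field_simps)
  have p1: "1 < p" using p by simp
  obtain c where c: "c > 0" "\<And>f. f \<in> Lp M 2 \<Longrightarrow> pint M q f powr (1/q) \<le> c * pint M 2 f powr (1/2)"
    using pint_mono_exponent[of q 2] q1 by auto
  have F2: "functional_on 2 F (B * c)"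
    unfolding functional_on_def
  proof (intro conjI ballI allI)
    have G2: "U \<in> G q" if "U \<in> G 2" for U using G_mono[OF that] q1 by simp
    show "0 \<le> B * c" using functional_onD(1)[OF F] c by simp
    fix U assume U: "U \<in> G 2"
    show "F (\<lambda>x. U x + V x) = F U + F V" if "V \<in> G 2" for V
      using functional_onD(2)[OF F G2[OF U] G2[OF that]] .
    show "F (\<lambda>x. c * U x) = c * F U" for c using functional_onD(3)[OF F G2[OF U]] .
    have "\<bar>F U\<bar> \<le> B * pint M q U powr (1/q)" using functional_onD(4)[OF F G2[OF U]] .
    also have "\<dots> \<le> B * (c * pint M 2 U powr (1/2))"
      using c(2)[OF G_D(1)[OF U]] functional_onD(1)[OF F] by (rule mult_left_mono)
    finally show "\<bar>F U\<bar> \<le> B * c * pint M 2 U powr (1/2)" by simp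
  qed
  from variational_solution[OF order_refl F2] obtain U where U: "U \<in> G 2"
    and sol: "\<And>\<Phi>. \<Phi> \<in> G 2 \<Longrightarrow> (\<integral>x. A x * U x * \<Phi> x \<partial>M) = F \<Phi>" by auto
  note UL = G_D(1)[OF U]
  note [measurable] = LpD(1)[OF UL]
  have Ui: "integrable M U" using Lp_integrable[OF UL] by simp
  have U2: "integrable M (\<lambda>x. (U x)\<^sup>2)" using LpD(2)[OF UL] by simp
  \<comment> \<open>Solves lam / 2 * I = B C I^(1/q) for I.\<close>
  define K where "K = (2 / lam * (B * C)) powr p"
  define w where "w N a = min a N powr (p - 2)" for N a :: real
  have trunc: "(\<integral>\<^sup>+x. ennreal (w N \<bar>U x\<bar> * (U x)\<^sup>2) \<partial>M) \<le> ennreal K" if N: "1 \<le> N" for N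
  proof -
    have [measurable]: "w N \<in> borel_measurable borel" unfolding w_def[abs_def] by measurable
    have w0: "0 \<le> w N a" for a by (simp add: w_def)
    have wN: "w N \<bar>a\<bar> \<le> N powr (p - 2)" for a
      unfolding w_def using N p by (intro powr_mono2) auto
    have WL: "(\<lambda>x. w N \<bar>U x\<bar> * U x) \<in> Lp M 2"
      by (rule Lp_bound(1)[OF _ UL, of _ "N powr (p - 2)"])
         (use wN w0 in \<open>auto simp: abs_mult intro!: mult_right_mono\<close>)
    have WUi: "integrable M (\<lambda>x. w N \<bar>U x\<bar> * (U x)\<^sup>2)"
      by (rule Bochner_Integration.integrable_bound[OF integrable_mult_right[OF U2, of "N powr (p - 2)"]])
         (use wN w0 in \<open>auto simp: abs_mult intro!: mult_right_mono\<close>)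
    define W where "W x = w N \<bar>U x\<bar> * U x" for x
    have WLq: "W \<in> Lp M q" using Lp_mono[OF WL] q1 by (simp add: W_def[abs_def])
    define I where "I = (\<integral>x. w N \<bar>U x\<bar> * (U x)\<^sup>2 \<partial>M)"
    have I0: "0 \<le> I" by (simp add: I_def w0)
    \<comment> \<open>The datum is only bounded by the L^q norm, so the q-th power of the test
      function must be controlled by the weighted energy I. As m \<le> a and (p - 2) (q - 1) = 2 -
      q, the surplus power of the truncated value m is at most a^(2-q).\<close>
    have Wq: "pint M q W \<le> I"
      unfolding pint_def I_def
    proof (rule integral_mono[OF LpD(2)[OF WLq] WUi])
      fix x
      show "\<bar>W x\<bar> powr q \<le> w N \<bar>U x\<bar> * (U x)\<^sup>2"
      proof (cases "U x = 0")
        case False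
        define a where "a = \<bar>U x\<bar>"
        define m where "m = min a N"
        have am: "0 < m" "m \<le> a" using False N by (auto simp: a_def m_def)
        have e: "(p - 2) * (q - 1) = 2 - q" using p by (simp add: q field_simps)
        have "\<bar>W x\<bar> powr q = m powr ((p - 2) * q) * a powr q"
          by (simp add: W_def w_def abs_mult powr_mult powr_powr m_def a_def)
        also have "\<dots> = m powr (p - 2) * (m powr ((p - 2) * (q - 1)) * a powr q)"
          using am by (simp add: powr_add[symmetric] algebra_simps flip: mult.assoc)
        also have "\<dots> \<le> m powr (p - 2) * (a powr (2 - q) * a powr q)"
          using am q1 unfolding e by (intro mult_left_mono mult_right_mono powr_mono2) auto
        also have "a powr (2 - q) * a powr q = (U x)\<^sup>2"
          using am by (simp add: a_def flip: powr_add)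
        finally show ?thesis by (simp add: w_def m_def a_def)
      qed (simp add: W_def)
    qed
    have "lam / 2 * I \<le> (\<integral>x. A x * U x * R (\<lambda>x. w N \<bar>U x\<bar> * U x) x \<partial>M)"
      unfolding I_def
    proof (rule weighted_test[where \<theta>="2 * \<bar>p - 2\<bar>"])
      show "integrable M (\<lambda>x. w N \<bar>U x\<bar> * U x)" using Lp_integrable[OF WL] by simp
      show "a * b * \<bar>w N a - w N b\<bar> \<le> 2 * \<bar>p - 2\<bar> * (w N a * a\<^sup>2 + w N b * b\<^sup>2)" if "0 \<le> a" "0 \<le> b" for a b
        unfolding w_def using that p N by (intro min_powr_weight_diff) auto
      show "2 * Lam * C * (2 * \<bar>p - 2\<bar>) \<le> lam / 2"
      proof -
        have "2 * Lam * C * (2 * \<bar>p - 2\<bar>) = (8 * Lam * C * (p - 2)) / 2" using p by (simp add: algebra_simps)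
        then show ?thesis using small by linarith
      qed
    qed (use Ui G_D(2)[OF U] w0 WUi in auto)
    also have "\<dots> = F (R W)"
      using sol[OF R_in_G[OF WL]] by (simp add: W_def[abs_def])
    also have "\<dots> \<le> B * pint M q (R W) powr (1/q)"
      using functional_onD(4)[OF F R_in_G[OF WLq q1(1)]] by simp
    also have "\<dots> \<le> B * (C powr q * I) powr (1/q)"
      using R_Lp(2)[OF WLq q1(1)] mult_left_mono[OF Wq, of "C powr q"] functional_onD(1)[OF F] q1
      by (intro mult_left_mono powr_mono2) auto
    also have "\<dots> = B * C * I powr (1/q)"
      using C_pos q1 by (simp add: powr_mult powr_powr)
    finally have main: "lam / 2 * I \<le> B * C * I powr (1/q)" .
    have "I \<le> K"
    proof (cases "I = 0")
      case True
      then show ?thesis by (simp add: K_def)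
    next
      case False
      then have I: "I > 0" using I0 by simp
      have "I = I powr (1/p) * I powr (1/q)" using I q1(2) by (simp flip: powr_add)
      then have "lam / 2 * I powr (1/p) * I powr (1/q) \<le> B * C * I powr (1/q)"
        using main by (simp add: mult.assoc)
      then have "lam / 2 * I powr (1/p) \<le> B * C" using I by simp
      then have "I powr (1/p) \<le> 2 / lam * (B * C)" using lam_pos by (simp add: field_simps)
      then have "(I powr (1/p)) powr p \<le> K" unfolding K_def using p by (intro powr_mono2) auto
      then show ?thesis using I p by (simp add: powr_powr)
    qed
    then show ?thesis
      using WUi w0 by (subst nn_integral_eq_integral) (auto simp: I_def intro!: ennreal_leI)
  qed
  have "(\<integral>\<^sup>+x. ennreal (\<bar>U x\<bar> powr p) \<partial>M)
      = (\<integral>\<^sup>+x. liminf (\<lambda>n. ennreal (w (real (Suc n)) \<bar>U x\<bar> * (U x)\<^sup>2)) \<partial>M)"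
  proof (rule nn_integral_cong)
    fix x
    obtain n0 where n0: "\<bar>U x\<bar> \<le> real n0" using real_arch_simple by blast
    have "eventually (\<lambda>n. ennreal (w (real (Suc n)) \<bar>U x\<bar> * (U x)\<^sup>2) = ennreal (\<bar>U x\<bar> powr p)) sequentially"
      using eventually_ge_at_top[of n0]
    proof eventually_elim
      case (elim n)
      then have "min \<bar>U x\<bar> (real (Suc n)) = \<bar>U x\<bar>" using n0 by simp
      then have "w (real (Suc n)) \<bar>U x\<bar> * (U x)\<^sup>2 = powr_sgn (p - 2) (U x) * U x"
        unfolding w_def by (simp add: powr_sgn_def power2_eq_square)
      then show ?case unfolding powr_sgn_mult_self by simp
    qed
    then have "(\<lambda>n. ennreal (w (real (Suc n)) \<bar>U x\<bar> * (U x)\<^sup>2)) \<longlonglongrightarrow> ennreal (\<bar>U x\<bar> powr p)"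
      by (rule tendsto_eventually)
    from lim_imp_Liminf[OF _ this]
    show "ennreal (\<bar>U x\<bar> powr p) = liminf (\<lambda>n. ennreal (w (real (Suc n)) \<bar>U x\<bar> * (U x)\<^sup>2))" by simp
  qed
  also have "\<dots> \<le> liminf (\<lambda>n. \<integral>\<^sup>+x. ennreal (w (real (Suc n)) \<bar>U x\<bar> * (U x)\<^sup>2) \<partial>M)"
    by (rule nn_integral_liminf) (unfold w_def, measurable)
  also have "\<dots> \<le> liminf (\<lambda>n. ennreal K)"
    by (rule Liminf_mono) (use trunc in simp)
  finally have "(\<integral>\<^sup>+x. ennreal (\<bar>U x\<bar> powr p) \<partial>M) \<le> ennreal K" by (simp add: Liminf_const)
  then have "integrable M (\<lambda>x. \<bar>U x\<bar> powr p)"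
    by (intro integrableI_bounded) (auto simp: less_top[symmetric] top_unique)
  then have UG: "U \<in> G p" using G_D(2)[OF U] by (auto simp: G_def intro: LpI)
  have "(\<integral>x. A x * U x * \<Phi> x \<partial>M) = F \<Phi>" if P: "\<Phi> \<in> G q" for \<Phi>
  proof -
    note PL = G_D(1)[OF P]
    note [measurable] = LpD(1)[OF PL]
    \<comment> \<open>Truncation makes \<Phi> bounded but leaves G q; applying R leads back into it,
      and into G 2, where the equation is known. Since R \<Phi> = \<Phi>, these functions converge
      to \<Phi> in L^q.\<close>
    define T where "T n x = (if \<bar>\<Phi> x\<bar> \<le> real n then \<Phi> x else 0)" for n :: nat and x
    have [measurable]: "T n \<in> borel_measurable M" for n unfolding T_def[abs_def] by measurable
    have TL: "T n \<in> Lp M b" if "0 \<le> b" for n b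
      by (rule bounded_in_Lp[of _ "real n"]) (use that in \<open>auto simp: T_def\<close>)
    have Tlim: "(\<lambda>n. pint M q (\<lambda>x. T n x - \<Phi> x)) \<longlonglongrightarrow> 0"
      unfolding T_def by (rule truncation_tendsto[OF PL])
    have TLq: "T n \<in> Lp M q" for n using TL[of q] q1 by simp
    have RT: "R (T n) \<in> G q" for n using R_in_G[OF TLq q1(1)] .
    have d: "(\<lambda>x. T n x - \<Phi> x) \<in> Lp M q" for n using Lp_diff(1)[OF TLq PL] q1 by simp
    have ae: "AE x in M. R (T n) x - \<Phi> x = R (\<lambda>x. T n x - \<Phi> x) x" for n
    proof -
      have "AE x in M. R (\<lambda>x. T n x - \<Phi> x) x = R (T n) x - R \<Phi> x"
        using R_diff[OF Lp_integrable[OF TLq] Lp_integrable[OF PL]] q1 by simp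
      then show ?thesis using G_D(2)[OF P] by eventually_elim simp
    qed
    have RTle: "pint M q (\<lambda>x. R (T n) x - \<Phi> x) \<le> C powr q * pint M q (\<lambda>x. T n x - \<Phi> x)" for n
      using Lp_cong_AE(2)[OF R_Lp(1)[OF d q1(1)], of "\<lambda>x. R (T n) x - \<Phi> x" n] ae[of n] R_Lp(2)[OF d q1(1), of n]
      by (auto simp: eq_commute)
    have "\<bar>(\<integral>x. A x * U x * \<Phi> x \<partial>M) - F \<Phi>\<bar>
        \<le> (pint M p (\<lambda>x. A x * U x) powr (1/p) + B) * (C powr q * pint M q (\<lambda>x. T n x - \<Phi> x)) powr (1/q)" for n
    proof -
      have dG: "(\<lambda>x. R (T n) x - \<Phi> x) \<in> G q" using G_diff[OF RT P] q1 by simp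
      have AU: "(\<lambda>x. A x * U x) \<in> Lp M p" using A_mult_Lp[OF G_D(1)[OF UG]] p by simp
      have "(\<integral>x. A x * U x * R (T n) x \<partial>M) = F (R (T n))"
        by (rule sol) (rule R_in_G[OF TL], auto)
      moreover have "(\<integral>x. A x * U x * (R (T n) x - \<Phi> x) \<partial>M) = (\<integral>x. A x * U x * R (T n) x \<partial>M) - (\<integral>x. A x * U x * \<Phi> x \<partial>M)"
        using A_form_integrable[OF G_D(1)[OF UG] G_D(1)[OF RT] p1 q1(1,2)] A_form_integrable[OF G_D(1)[OF UG] PL p1 q1(1,2)]
        by (simp add: right_diff_distrib)
      moreover have "F (\<lambda>x. R (T n) x - \<Phi> x) = F (R (T n)) - F \<Phi>"
        by (rule functional_on_diff[OF F RT P])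
      ultimately have "\<bar>(\<integral>x. A x * U x * \<Phi> x \<partial>M) - F \<Phi>\<bar>
         \<le> \<bar>\<integral>x. A x * U x * (R (T n) x - \<Phi> x) \<partial>M\<bar> + \<bar>F (\<lambda>x. R (T n) x - \<Phi> x)\<bar>" by linarith
      also have "\<dots> \<le> pint M p (\<lambda>x. A x * U x) powr (1/p) * pint M q (\<lambda>x. R (T n) x - \<Phi> x) powr (1/q)
          + B * pint M q (\<lambda>x. R (T n) x - \<Phi> x) powr (1/q)"
        by (intro add_mono Holder(3)[OF AU G_D(1)[OF dG] p1 q1(1,2)] functional_onD(4)[OF F dG])
      also have "\<dots> = (pint M p (\<lambda>x. A x * U x) powr (1/p) + B) * pint M q (\<lambda>x. R (T n) x - \<Phi> x) powr (1/q)"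
        by (simp add: distrib_right)
      also have "\<dots> \<le> (pint M p (\<lambda>x. A x * U x) powr (1/p) + B) * (C powr q * pint M q (\<lambda>x. T n x - \<Phi> x)) powr (1/q)"
        using RTle[of n] functional_onD(1)[OF F] q1 by (intro mult_left_mono powr_mono2) auto
      finally show ?thesis .
    qed
    moreover have "(\<lambda>n. (pint M p (\<lambda>x. A x * U x) powr (1/p) + B) * (C powr q * pint M q (\<lambda>x. T n x - \<Phi> x)) powr (1/q))
        \<longlonglongrightarrow> (pint M p (\<lambda>x. A x * U x) powr (1/p) + B) * (C powr q * 0) powr (1/q)"
      using q1 C_pos by (intro tendsto_intros tendsto_powr2 Tlim always_eventually) auto
    ultimately have "\<bar>(\<integral>x. A x * U x * \<Phi> x \<partial>M) - F \<Phi>\<bar> \<le> (pint M p (\<lambda>x. A x * U x) powr (1/p) + B) * (C powr q * 0) powr (1/q)"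
      by (intro LIMSEQ_le_const) blast+
    then show ?thesis by simp
  qed
  then show ?thesis using UG by blast
qed

text \<open>Here q > 2 and the datum is defined only on G q, which is smaller than G 2. It is first
  represented by a function V in L^p; bounded truncations of V give data on G 2 with L^2 solutions.
  The a priori bound for their differences makes these Cauchy in L^p.\<close>

lemma existence_lt_2:
  assumes p: "1 < p" "p < 2" "\<bar>p - 2\<bar> \<le> 1/2" and small: "8 * Lam * C * \<bar>p - 2\<bar> \<le> lam"
    and q: "q = p / (p - 1)" and F: "functional_on q F B"
  shows "\<exists>U\<in>G p. \<forall>\<Phi>\<in>G q. (\<integral>x. A x * U x * \<Phi> x \<partial>M) = F \<Phi>"
proof -
  have q1: "1 < q" "1/p + 1/q = 1" "2 \<le> q" and pq: "p = q / (q - 1)" using p by (auto simp: q field_simps)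
  from variational_solution[OF q1(3) F] obtain W where W: "W \<in> G q"
    and rep: "\<And>\<Phi>. \<Phi> \<in> G q \<Longrightarrow> (\<integral>x. A x * powr_sgn (q - 2) (W x) * \<Phi> x \<partial>M) = F \<Phi>" by blast
  define V where "V x = A x * powr_sgn (q - 2) (W x)" for x
  have VL: "V \<in> Lp M p"
    unfolding V_def[abs_def] using A_mult_Lp[OF powr_sgn_Lp(1)[OF G_D(1)[OF W] q1(1)]] p by (simp add: pq[symmetric])
  note [measurable] = LpD(1)[OF VL]
  define T where "T n x = (if \<bar>V x\<bar> \<le> real n then V x else 0)" for n :: nat and x
  have [measurable]: "T n \<in> borel_measurable M" for n unfolding T_def[abs_def] by measurable
  have TL: "T n \<in> Lp M b" if "0 \<le> b" for n b
    by (rule bounded_in_Lp[of _ "real n"]) (use that in \<open>auto simp: T_def\<close>)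
  have Tlim: "(\<lambda>n. pint M p (\<lambda>x. T n x - V x)) \<longlonglongrightarrow> 0"
    unfolding T_def by (rule truncation_tendsto[OF VL])
  have "\<exists>U\<in>G 2. \<forall>\<Phi>\<in>G 2. (\<integral>x. A x * U x * \<Phi> x \<partial>M) = (\<integral>x. T n x * \<Phi> x \<partial>M)" for n
  proof -
    have int: "integrable M (\<lambda>x. T n x * \<Phi> x)" if "\<Phi> \<in> G 2" for \<Phi>
      using Holder(1)[OF TL[of 2] G_D(1)[OF that]] by simp
    have "functional_on 2 (\<lambda>\<Phi>. \<integral>x. T n x * \<Phi> x \<partial>M) (pint M 2 (T n) powr (1/2))"
      unfolding functional_on_def
      using int Holder(3)[OF TL[of 2] G_D(1), of _ 2] by (auto simp: distrib_left mult.left_commute)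
    from variational_solution[OF order_refl this] show ?thesis by simp
  qed
  then obtain U where U: "\<And>n. U n \<in> G 2"
    and sol: "\<And>n \<Phi>. \<Phi> \<in> G 2 \<Longrightarrow> (\<integral>x. A x * U n x * \<Phi> x \<partial>M) = (\<integral>x. T n x * \<Phi> x \<partial>M)" by metis
  have Up: "U n \<in> G p" for n using G_mono[OF U] p by simp
  have TLp: "T n \<in> Lp M p" for n using TL p by simp
  have diff: "pint M p (\<lambda>x. U m x - U n x) powr (1/p) \<le> 2 * C / lam * pint M p (\<lambda>x. T m x - T n x) powr (1/p)" for m n
  proof (rule a_priori_bound[OF G_diff[OF Up Up] p(1,3) small q])
    fix \<Phi> assume P: "\<Phi> \<in> G q"
    have P2: "\<Phi> \<in> G 2" using G_mono[OF P] q1 by simp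
    have d: "(\<lambda>x. T m x - T n x) \<in> Lp M p" using Lp_diff(1)[OF TLp TLp] p by simp
    have "(\<integral>x. A x * (U m x - U n x) * \<Phi> x \<partial>M) = (\<integral>x. A x * U m x * \<Phi> x \<partial>M) - (\<integral>x. A x * U n x * \<Phi> x \<partial>M)"
      using A_form_integrable[OF G_D(1)[OF Up] G_D(1)[OF P] p(1) q1(1,2)] by (simp add: left_diff_distrib right_diff_distrib)
    also have "\<dots> = (\<integral>x. T m x * \<Phi> x \<partial>M) - (\<integral>x. T n x * \<Phi> x \<partial>M)" by (simp add: sol[OF P2])
    also have "\<dots> = (\<integral>x. (T m x - T n x) * \<Phi> x \<partial>M)"
      using Holder(1)[OF TLp G_D(1)[OF P] p(1) q1(1,2)] by (simp add: left_diff_distrib)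
    finally show "\<bar>\<integral>x. A x * (U m x - U n x) * \<Phi> x \<partial>M\<bar> \<le> pint M p (\<lambda>x. T m x - T n x) powr (1/p) * pint M q \<Phi> powr (1/q)"
      using Holder(3)[OF d G_D(1)[OF P] p(1) q1(1,2)] by simp
  qed (use p in auto)
  have "\<exists>g\<in>Lp M p. (\<lambda>n. pint M p (\<lambda>x. U n x - g x)) \<longlonglongrightarrow> 0"
  proof (rule Lp_complete[OF G_D(1)[OF Up]])
    fix e :: real assume e: "0 < e"
    \<comment> \<open>Collects the constant of the a priori bound, raised to the power p, and the
      constants 2^p and 2 from comparing two truncations with V.\<close>
    define e' where "e' = e / ((2 * C / lam) powr p * 2 powr p * 2)"
    have e': "e' > 0" using e C_pos lam_pos by (simp add: e'_def)
    from LIMSEQ_D[OF Tlim this] obtain N where N: "\<And>n. n \<ge> N \<Longrightarrow> pint M p (\<lambda>x. T n x - V x) < e'" by auto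
    have "pint M p (\<lambda>x. U m x - U n x) \<le> e" if "N \<le> m" "N \<le> n" for m n
    proof -
      have dL: "(\<lambda>x. T k x - V x) \<in> Lp M p" for k using Lp_diff(1)[OF TLp VL] p by simp
      have "pint M p (\<lambda>x. T m x - T n x) = pint M p (\<lambda>x. (T m x - V x) - (T n x - V x))" by simp
      also have "\<dots> \<le> 2 powr p * (pint M p (\<lambda>x. T m x - V x) + pint M p (\<lambda>x. T n x - V x))"
        using Lp_diff(2)[OF dL dL] p by simp
      also have "\<dots> \<le> 2 powr p * (2 * e')" using N[OF that(1)] N[OF that(2)] by (intro mult_left_mono) auto
      finally have 1: "pint M p (\<lambda>x. T m x - T n x) \<le> 2 powr p * (2 * e')" .
      have "pint M p (\<lambda>x. U m x - U n x) = (pint M p (\<lambda>x. U m x - U n x) powr (1/p)) powr p"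
        using p by (simp add: powr_powr)
      also have "\<dots> \<le> (2 * C / lam * pint M p (\<lambda>x. T m x - T n x) powr (1/p)) powr p"
        using diff p by (intro powr_mono2) auto
      also have "\<dots> = (2 * C / lam) powr p * pint M p (\<lambda>x. T m x - T n x)"
        using p C_pos lam_pos by (simp add: powr_mult powr_powr powr_divide)
      also have "\<dots> \<le> (2 * C / lam) powr p * (2 powr p * (2 * e'))" using 1 by (intro mult_left_mono) auto
      also have "\<dots> = e" using C_pos lam_pos by (simp add: e'_def)
      finally show ?thesis .
    qed
    then show "\<exists>N. \<forall>m\<ge>N. \<forall>n\<ge>N. pint M p (\<lambda>x. U m x - U n x) \<le> e" by blast
  qed (use p in simp)
  then obtain g where gL: "g \<in> Lp M p" and glim: "(\<lambda>n. pint M p (\<lambda>x. U n x - g x)) \<longlonglongrightarrow> 0" by blast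
  have g: "g \<in> G p" by (rule G_closed[OF Up gL p(1) glim])
  have "(\<integral>x. A x * g x * \<Phi> x \<partial>M) = F \<Phi>" if P: "\<Phi> \<in> G q" for \<Phi>
  proof -
    have P2: "\<Phi> \<in> G 2" using G_mono[OF P] q1 by simp
    note PL = G_D(1)[OF P]
    have APL: "(\<lambda>x. A x * \<Phi> x) \<in> Lp M q" using A_mult_Lp[OF PL] q1 by simp
    have d1: "(\<lambda>x. U n x - g x) \<in> Lp M p" for n using Lp_diff(1)[OF G_D(1)[OF Up] gL] p by simp
    have d2: "(\<lambda>x. T n x - V x) \<in> Lp M p" for n using Lp_diff(1)[OF TLp VL] p by simp
    define b where "b n = pint M p (\<lambda>x. U n x - g x) powr (1/p) * pint M q (\<lambda>x. A x * \<Phi> x) powr (1/q)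
         + pint M p (\<lambda>x. T n x - V x) powr (1/p) * pint M q \<Phi> powr (1/q)" for n
    have "\<bar>(\<integral>x. A x * g x * \<Phi> x \<partial>M) - F \<Phi>\<bar> \<le> b n" for n
    proof -
      have "(\<integral>x. (U n x - g x) * (A x * \<Phi> x) \<partial>M) = (\<integral>x. U n x * (A x * \<Phi> x) \<partial>M) - (\<integral>x. g x * (A x * \<Phi> x) \<partial>M)"
        using Holder(1)[OF G_D(1)[OF Up] APL p(1) q1(1,2)] Holder(1)[OF gL APL p(1) q1(1,2)] by (simp add: left_diff_distrib)
      moreover have "(\<integral>x. U n x * (A x * \<Phi> x) \<partial>M) = (\<integral>x. A x * U n x * \<Phi> x \<partial>M)"
        "(\<integral>x. g x * (A x * \<Phi> x) \<partial>M) = (\<integral>x. A x * g x * \<Phi> x \<partial>M)" by (simp_all add: mult_ac)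
      moreover have "(\<integral>x. (T n x - V x) * \<Phi> x \<partial>M) = (\<integral>x. T n x * \<Phi> x \<partial>M) - (\<integral>x. V x * \<Phi> x \<partial>M)"
        using Holder(1)[OF TLp PL p(1) q1(1,2)] Holder(1)[OF VL PL p(1) q1(1,2)] by (simp add: left_diff_distrib)
      moreover have "(\<integral>x. V x * \<Phi> x \<partial>M) = F \<Phi>" using rep[OF P] by (simp add: V_def)
      moreover note sol[OF P2, of n] Holder(3)[OF d1 APL p(1) q1(1,2), of n] Holder(3)[OF d2 PL p(1) q1(1,2), of n]
      ultimately show ?thesis unfolding b_def by linarith
    qed
    moreover have "b \<longlonglongrightarrow> 0 powr (1/p) * pint M q (\<lambda>x. A x * \<Phi> x) powr (1/q) + 0 powr (1/p) * pint M q \<Phi> powr (1/q)"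
      unfolding b_def[abs_def] using p
      by (intro tendsto_add tendsto_mult tendsto_const tendsto_powr2 glim Tlim always_eventually) auto
    ultimately have "\<bar>(\<integral>x. A x * g x * \<Phi> x \<partial>M) - F \<Phi>\<bar> \<le> 0 powr (1/p) * pint M q (\<lambda>x. A x * \<Phi> x) powr (1/q) + 0 powr (1/p) * pint M q \<Phi> powr (1/q)"
      by (intro LIMSEQ_le_const) blast+
    then show ?thesis by simp
  qed
  then show ?thesis using g by blast
qed

end

section \<open>Dyadic sums\<close>

lemma dyadic_bracket:
  fixes x :: real assumes "1 \<le> x"
  shows "\<exists>j. 2 ^ j \<le> x \<and> x < 2 ^ Suc j"
proof -
  define n where "n = (LEAST n. x < 2 ^ n)"
  have ex: "\<exists>n. x < 2 ^ n" by (rule real_arch_pow) simp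
  have n: "x < 2 ^ n" unfolding n_def using LeastI_ex[OF ex] .
  with assms have "n \<noteq> 0" by (cases n) auto
  then obtain j where j: "n = Suc j" by (cases n) auto
  have "\<not> x < 2 ^ j" using not_less_Least[of j "\<lambda>n. x < 2 ^ n"] j unfolding n_def by simp
  then show ?thesis using n j by (intro exI[of _ j]) auto
qed

text \<open>Geometric sums cut off at a threshold are bounded below by finding a telescoping
  majorant, so it is never necessary to determine which indices contribute.\<close>

lemma suminf_telescope_le:
  fixes a \<phi> :: "nat \<Rightarrow> real"
  assumes "\<And>k. a k \<le> \<phi> k - \<phi> (Suc k)" "\<And>k. 0 \<le> \<phi> k" "\<And>k. 0 \<le> a k"
  shows "(\<Sum>k. ennreal (a k)) \<le> ennreal (\<phi> 0)"
proof (rule suminf_le_const[OF summableI])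
  fix n
  have "(\<Sum>k<n. a k) \<le> (\<Sum>k<n. \<phi> k - \<phi> (Suc k))" by (intro sum_mono assms)
  also have "\<dots> = \<phi> 0 - \<phi> n" by (rule sum_lessThan_telescope')
  also have "\<dots> \<le> \<phi> 0" using assms by simp
  finally show "(\<Sum>k<n. ennreal (a k)) \<le> ennreal (\<phi> 0)"
    using assms by (simp add: ennreal_leI)
qed

lemma suminf_telescope_up_le:
  fixes a \<phi> :: "nat \<Rightarrow> real"
  assumes "\<And>k. a k \<le> \<phi> (Suc k) - \<phi> k" "\<And>k. 0 \<le> \<phi> k" "\<And>k. \<phi> k \<le> B" "\<And>k. 0 \<le> a k"
  shows "(\<Sum>k. ennreal (a k)) \<le> ennreal B"
proof (rule suminf_le_const[OF summableI])
  fix n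
  have "(\<Sum>k<n. a k) \<le> (\<Sum>k<n. \<phi> (Suc k) - \<phi> k)" by (intro sum_mono assms)
  also have "\<dots> = \<phi> n - \<phi> 0" by (rule sum_lessThan_telescope)
  also have "\<dots> \<le> B" using assms(2)[of 0] assms(3)[of n] by simp
  finally show "(\<Sum>k<n. ennreal (a k)) \<le> ennreal B"
    using assms by (simp add: ennreal_leI)
qed

text \<open>A geometric series dominated by its smallest admissible scale, which is at least
  \<rho>.\<close>

lemma dyadic_sum_large_scales:
  fixes T b \<rho> :: real
  assumes "0 < T" "0 < b" "0 < \<rho>"
  shows "(\<Sum>k. ennreal (if \<rho> \<le> T / 2 ^ k then (T / 2 ^ k) powr (- b) else 0))
    \<le> ennreal (\<rho> powr (- b) / (1 - 2 powr (- b)))"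
proof -
  define c where "c = 1 / (1 - 2 powr (- b))"
  have c: "c > 0" using assms powr_less_mono[of "-b" 0 2] by (simp add: c_def)
  \<comment> \<open>The factor 2 shifts the index: for t = T / 2^k the values at
    \<open>Suc k\<close> and k involve t and 2 t, so for \<rho> \<le> t the increment is exactly
    t^(-b). Clipping at \<rho> stops the growth afterwards.\<close>
  define \<phi> where "\<phi> k = c * max \<rho> (2 * (T / 2 ^ k)) powr (- b)" for k
  have "(\<Sum>k. ennreal (if \<rho> \<le> T / 2 ^ k then (T / 2 ^ k) powr (- b) else 0)) \<le> ennreal (c * \<rho> powr (- b))"
  proof (rule suminf_telescope_up_le[of _ \<phi>])
    fix k
    define t where "t = T / 2 ^ k"
    have t: "t > 0" using assms by (simp add: t_def)
    have s: "2 * (T / 2 ^ Suc k) = t" by (simp add: t_def)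
    show "0 \<le> \<phi> k" using c by (simp add: \<phi>_def)
    show "\<phi> k \<le> c * \<rho> powr (- b)" unfolding \<phi>_def
      using c assms by (intro mult_left_mono powr_mono2') auto
    show "0 \<le> (if \<rho> \<le> T / 2 ^ k then (T / 2 ^ k) powr (- b) else 0)" by simp
    show "(if \<rho> \<le> T / 2 ^ k then (T / 2 ^ k) powr (- b) else 0) \<le> \<phi> (Suc k) - \<phi> k"
    proof (cases "\<rho> \<le> t")
      case True
      then have "max \<rho> t = t" "max \<rho> (2 * t) = 2 * t" using t by auto
      then have "\<phi> (Suc k) - \<phi> k = c * (t powr (- b) - (2 * t) powr (- b))"
        unfolding \<phi>_def s by (simp add: t_def right_diff_distrib)
      also have "\<dots> = c * (1 - 2 powr (- b)) * t powr (- b)"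
        using t by (simp add: powr_mult algebra_simps)
      also have "c * (1 - 2 powr (- b)) = 1" using c by (auto simp: c_def)
      finally show ?thesis using True by (simp add: t_def)
    next
      case False
      have "max \<rho> (2 * t) powr (- b) \<le> max \<rho> t powr (- b)"
        using assms t by (intro powr_mono2') auto
      then show ?thesis using False c unfolding \<phi>_def s by (simp add: t_def)
    qed
  qed
  then show ?thesis by (simp add: c_def)
qed

lemma dyadic_sum_small_scales:
  fixes T b r :: real
  assumes "0 < T" "0 < b" "0 \<le> r"
  shows "(\<Sum>k. ennreal (if T / 2 ^ k \<le> r then (T / 2 ^ k) powr b else 0))
    \<le> ennreal (min r T powr b / (1 - 2 powr (- b)))"
proof -
  define c where "c = 1 / (1 - 2 powr (- b))"
  have c: "c > 0" using assms powr_less_mono[of "-b" 0 2] by (simp add: c_def)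
  define \<phi> where "\<phi> k = c * min r (T / 2 ^ k) powr b" for k
  have "(\<Sum>k. ennreal (if T / 2 ^ k \<le> r then (T / 2 ^ k) powr b else 0)) \<le> ennreal (\<phi> 0)"
  proof (rule suminf_telescope_le)
    fix k
    define t where "t = T / 2 ^ k"
    have t: "t > 0" using assms by (simp add: t_def)
    have s: "T / 2 ^ Suc k = t / 2" by (simp add: t_def)
    show "0 \<le> \<phi> k" using c by (simp add: \<phi>_def)
    show "0 \<le> (if T / 2 ^ k \<le> r then (T / 2 ^ k) powr b else 0)" by simp
    show "(if T / 2 ^ k \<le> r then (T / 2 ^ k) powr b else 0) \<le> \<phi> k - \<phi> (Suc k)"
    proof (cases "t \<le> r")
      case True
      then have "min r t = t" "min r (t / 2) = t / 2" using t by auto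
      then have "\<phi> k - \<phi> (Suc k) = c * (t powr b - (t / 2) powr b)"
        unfolding \<phi>_def s by (simp add: t_def right_diff_distrib)
      also have "\<dots> = c * (1 - 2 powr (- b)) * t powr b"
        using t by (simp add: powr_divide powr_minus field_simps)
      also have "c * (1 - 2 powr (- b)) = 1" using c by (auto simp: c_def)
      finally show ?thesis using True by (simp add: t_def)
    next
      case False
      have "min r (t / 2) powr b \<le> min r t powr b"
        using assms t by (intro powr_mono2) auto
      then show ?thesis using False c unfolding \<phi>_def s by (simp add: t_def)
    qed
  qed
  then show ?thesis by (simp add: c_def \<phi>_def)
qed

text \<open>Split at t = r. Small scales contribute t^a and are dominated by the largest; large
  scales contribute r t^(a-1) and are dominated by the smallest, which requires a < 1. Both parts
  have size r^a. Below, a = s + \<tau>.\<close>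

lemma dyadic_sum_Lipschitz:
  fixes T a r :: real
  assumes T: "0 < T" and a: "0 < a" "a < 1" and r: "0 \<le> r"
  shows "(\<Sum>k. ennreal (min 1 (r / (T / 2 ^ k)) * (T / 2 ^ k) powr a))
    \<le> ennreal ((1 / (1 - 2 powr (- a)) + 1 / (1 - 2 powr (a - 1))) * min r T powr a)"
proof (cases "r = 0")
  case True
  then show ?thesis by simp
next
  case False
  then have r: "0 < r" using r by simp
  define t where "t k = T / 2 ^ k" for k :: nat
  have t: "0 < t k" "t k \<le> T" for k using T by (auto simp: t_def divide_le_eq mult_le_cancel_left1)
  have "(\<Sum>k. ennreal (min 1 (r / t k) * t k powr a))
    \<le> (\<Sum>k. ennreal (if t k \<le> r then t k powr a else 0) + ennreal r * ennreal (if r \<le> t k then t k powr (- (1 - a)) else 0))"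
  proof (rule suminf_le)
    fix k
    show "ennreal (min 1 (r / t k) * t k powr a) \<le> ennreal (if t k \<le> r then t k powr a else 0)
        + ennreal r * ennreal (if r \<le> t k then t k powr (- (1 - a)) else 0)"
    proof (cases "t k \<le> r")
      case True
      then have "min 1 (r / t k) = 1" using t[of k] by (auto simp: min_def field_simps)
      then show ?thesis using True by simp
    next
      case False
      then have "min 1 (r / t k) * t k powr a = r * t k powr (- (1 - a))"
        using t[of k] r by (auto simp: min_def field_simps powr_diff)
      then show ?thesis using False r by (simp add: ennreal_mult)
    qed
  qed auto
  also have "\<dots> = (\<Sum>k. ennreal (if t k \<le> r then t k powr a else 0)) + ennreal r * (\<Sum>k. ennreal (if r \<le> t k then t k powr (- (1 - a)) else 0))"
    by (subst suminf_add[OF summableI summableI, symmetric]) (simp only: ennreal_suminf_cmult)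
  also have "\<dots> \<le> ennreal (min r T powr a / (1 - 2 powr (- a))) + ennreal (min r T powr a / (1 - 2 powr (a - 1)))"
  proof (rule add_mono)
    show "(\<Sum>k. ennreal (if t k \<le> r then t k powr a else 0)) \<le> ennreal (min r T powr a / (1 - 2 powr (- a)))"
      unfolding t_def by (rule dyadic_sum_small_scales[OF T a(1)]) (use r in simp)
    show "ennreal r * (\<Sum>k. ennreal (if r \<le> t k then t k powr (- (1 - a)) else 0)) \<le> ennreal (min r T powr a / (1 - 2 powr (a - 1)))"
    proof (cases "r \<le> T")
      case True
      have "ennreal r * (\<Sum>k. ennreal (if r \<le> t k then t k powr (- (1 - a)) else 0)) \<le> ennreal r * ennreal (r powr (- (1 - a)) / (1 - 2 powr (- (1 - a))))"
        unfolding t_def by (intro mult_left_mono dyadic_sum_large_scales T r) (use a in auto)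
      also have "\<dots> = ennreal (r * r powr (- (1 - a)) / (1 - 2 powr (a - 1)))"
        using r powr_less_mono[of "a - 1" 0 2] a by (subst ennreal_mult[symmetric]) auto
      also have "r * r powr (- (1 - a)) = min r T powr a" using True r by (simp add: powr_diff)
      finally show ?thesis .
    next
      case False
      then have "\<not> r \<le> t k" for k using t[of k] by simp
      then show ?thesis by simp
    qed
  qed
  also have "\<dots> = ennreal ((1 / (1 - 2 powr (- a)) + 1 / (1 - 2 powr (a - 1))) * min r T powr a)"
    using powr_less_mono[of "a - 1" 0 2] powr_less_mono[of "- a" 0 2] a
    by (subst ennreal_plus[symmetric]) (auto simp: distrib_right)
  finally show ?thesis by (simp add: t_def)
qed

lemma two_power_powr: "(2 ^ j :: real) powr a = (2 powr a) ^ j"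
  by (induction j) (auto simp: powr_mult)

text \<open>Dyadic balls take the place of polar coordinates: each annulus has volume at most a
  constant times u^d, its contribution is of size u^a, and these form a geometric series.\<close>

lemma nn_integral_norm_powr_inside:
  fixes a :: real
  assumes "0 < a"
  shows "\<exists>C\<ge>0. \<forall>t>0. (\<integral>\<^sup>+w. ennreal (if norm w \<le> t then norm w powr (a - real DIM('a)) else 0) \<partial>(lborel :: 'a::euclidean_space measure))
     \<le> ennreal (C * t powr a)"
proof -
  define d where "d = real DIM('a)"
  \<comment> \<open>Bounds the variation of the power over one annulus u/2 < |w| \<le> u, whichever
    sign a - d has.\<close>
  define c where "c = 2 powr \<bar>a - d\<bar>"
  define V where "V = unit_ball_vol d"
  have V: "V \<ge> 0" by (simp add: V_def d_def)
  define q where "q = (1/2::real) powr a"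
  have q: "0 < q" "q < 1" using assms powr_less_mono'[of "1/2::real" 0 a] by (auto simp: q_def)
  show ?thesis
  proof (intro exI[of _ "c * V / (1 - q)"] conjI allI impI)
    show "0 \<le> c * V / (1 - q)" using q V by (simp add: c_def)
    fix t :: real assume t: "0 < t"
    define f where "f j w = ennreal (c * (t / 2 ^ j) powr (a - d)) * indicator (cball 0 (t / 2 ^ j)) w" for j :: nat and w :: 'a
    have fm: "f j \<in> borel_measurable lborel" for j
      unfolding f_def by (intro borel_measurable_times_ennreal borel_measurable_const borel_measurable_indicator) simp
    have pw: "ennreal (if norm w \<le> t then norm w powr (a - d) else 0) \<le> (\<Sum>j. f j w)" for w :: 'a
    proof (cases "w = 0 \<or> t < norm w")
      case True
      then show ?thesis by auto
    next
      case False
      then have w: "0 < norm w" "norm w \<le> t" by auto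
      then obtain j where j: "2 ^ j \<le> t / norm w" "t / norm w < 2 ^ Suc j"
        using dyadic_bracket[of "t / norm w"] by (auto simp: field_simps)
      define u where "u = t / 2 ^ j"
      have u: "u > 0" "norm w \<le> u" "u < 2 * norm w" using j w t by (auto simp: u_def field_simps)
      have "norm w powr (a - d) \<le> c * u powr (a - d)"
      proof (cases "a - d \<ge> 0")
        case True
        have "norm w powr (a - d) \<le> u powr (a - d)" using True u w by (intro powr_mono2) auto
        also have "\<dots> \<le> c * u powr (a - d)" using ge_one_powr_ge_zero[of 2 "\<bar>a - d\<bar>"] by (simp add: c_def mult_le_cancel_right1)
        finally show ?thesis .
      next
        case False
        have "norm w powr (a - d) \<le> (u / 2) powr (a - d)" using False u w by (intro powr_mono2') auto
        also have "\<dots> = c * u powr (a - d)" using False by (simp add: c_def powr_divide powr_diff powr_minus field_simps)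
        finally show ?thesis .
      qed
      then have "ennreal (if norm w \<le> t then norm w powr (a - d) else 0) \<le> f j w"
        using w u by (simp add: f_def u_def ennreal_leI)
      also have "f j w = (\<Sum>i\<in>{j}. f i w)" by simp
      also have "\<dots> \<le> (\<Sum>j. f j w)" by (rule sum_le_suminf) auto
      finally show ?thesis .
    qed
    have "(\<integral>\<^sup>+w. ennreal (if norm w \<le> t then norm w powr (a - d) else 0) \<partial>(lborel :: 'a measure)) \<le> (\<integral>\<^sup>+w. (\<Sum>j. f j w) \<partial>lborel)"
      by (rule nn_integral_mono) (rule pw)
    also have "\<dots> = (\<Sum>j. \<integral>\<^sup>+w. f j w \<partial>lborel)"
      by (rule nn_integral_suminf[OF fm])
    also have "\<dots> = (\<Sum>j. ennreal (c * V * t powr a * q ^ j))"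
    proof (rule suminf_cong)
      fix j
      define u where "u = t / 2 ^ j"
      have u: "u > 0" using t by (simp add: u_def)
      have "(\<integral>\<^sup>+w. f j w \<partial>lborel) = ennreal (c * u powr (a - d)) * ennreal (V * u ^ DIM('a))"
        using u unfolding f_def u_def[symmetric] by (subst nn_integral_cmult_indicator) (auto simp: emeasure_cball V_def d_def)
      also have "\<dots> = ennreal (c * V * (u powr (a - d) * u ^ DIM('a)))"
        using V u by (subst ennreal_mult[symmetric]) (auto simp: c_def mult_ac)
      also have "u powr (a - d) * u ^ DIM('a) = u powr a"
        using u by (simp add: d_def powr_diff powr_realpow)
      also have "u powr a = t powr a * q ^ j"
        using t by (simp add: u_def q_def powr_divide two_power_powr power_divide)
      finally show "(\<integral>\<^sup>+w. f j w \<partial>lborel) = ennreal (c * V * t powr a * q ^ j)" by (simp add: mult.assoc)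
    qed
    also have "\<dots> = ennreal (\<Sum>j. c * V * t powr a * q ^ j)"
      using q V by (intro suminf_ennreal2) (auto intro!: summable_mult summable_geometric simp: c_def)
    also have "(\<Sum>j. c * V * t powr a * q ^ j) = c * V / (1 - q) * t powr a"
      using q by (simp add: suminf_mult summable_geometric suminf_geometric)
    finally show "(\<integral>\<^sup>+w. ennreal (if norm w \<le> t then norm w powr (a - real DIM('a)) else 0) \<partial>(lborel :: 'a measure)) \<le> ennreal (c * V / (1 - q) * t powr a)"
      unfolding d_def .
  qed
qed

lemma nn_integral_norm_powr_outside:
  fixes a :: real
  assumes "0 < a"
  shows "\<exists>C\<ge>0. \<forall>t>0. (\<integral>\<^sup>+w. ennreal (if t \<le> norm w then norm w powr (- a - real DIM('a)) else 0) \<partial>(lborel :: 'a::euclidean_space measure))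
     \<le> ennreal (C * t powr (- a))"
proof -
  define d where "d = real DIM('a)"
  define V where "V = unit_ball_vol d * 2 ^ DIM('a)"
  have V: "V \<ge> 0" by (simp add: V_def d_def)
  define q where "q = (1/2::real) powr a"
  have q: "0 < q" "q < 1" using assms powr_less_mono'[of "1/2::real" 0 a] by (auto simp: q_def)
  show ?thesis
  proof (intro exI[of _ "V / (1 - q)"] conjI allI impI)
    show "0 \<le> V / (1 - q)" using q V by simp
    fix t :: real assume t: "0 < t"
    define f where "f j w = ennreal ((t * 2 ^ j) powr (- a - d)) * indicator (cball 0 (2 * (t * 2 ^ j))) w" for j :: nat and w :: 'a
    have fm: "f j \<in> borel_measurable lborel" for j
      unfolding f_def by (intro borel_measurable_times_ennreal borel_measurable_const borel_measurable_indicator) simp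
    have pw: "ennreal (if t \<le> norm w then norm w powr (- a - d) else 0) \<le> (\<Sum>j. f j w)" for w :: 'a
    proof (cases "t \<le> norm w")
      case False
      then show ?thesis by auto
    next
      case True
      then have w: "0 < norm w" "t \<le> norm w" using t by auto
      then obtain j where j: "2 ^ j \<le> norm w / t" "norm w / t < 2 ^ Suc j"
        using dyadic_bracket[of "norm w / t"] t by (auto simp: field_simps)
      define u where "u = t * 2 ^ j"
      have u: "u > 0" "u \<le> norm w" "norm w < 2 * u" using j w t by (auto simp: u_def field_simps)
      have "norm w powr (- a - d) \<le> u powr (- a - d)" using u w assms by (intro powr_mono2') (auto simp: d_def)
      then have "ennreal (if t \<le> norm w then norm w powr (- a - d) else 0) \<le> f j w"
        using w u by (simp add: f_def u_def ennreal_leI)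
      also have "f j w = (\<Sum>i\<in>{j}. f i w)" by simp
      also have "\<dots> \<le> (\<Sum>j. f j w)" by (rule sum_le_suminf) auto
      finally show ?thesis .
    qed
    have "(\<integral>\<^sup>+w. ennreal (if t \<le> norm w then norm w powr (- a - d) else 0) \<partial>(lborel :: 'a measure)) \<le> (\<integral>\<^sup>+w. (\<Sum>j. f j w) \<partial>lborel)"
      by (rule nn_integral_mono) (rule pw)
    also have "\<dots> = (\<Sum>j. \<integral>\<^sup>+w. f j w \<partial>lborel)"
      by (rule nn_integral_suminf[OF fm])
    also have "\<dots> = (\<Sum>j. ennreal (V * t powr (- a) * q ^ j))"
    proof (rule suminf_cong)
      fix j
      define u where "u = t * 2 ^ j"
      have u: "u > 0" using t by (simp add: u_def)
      have "(\<integral>\<^sup>+w. f j w \<partial>lborel) = ennreal (u powr (- a - d)) * ennreal (V * u ^ DIM('a))"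
        using u unfolding f_def u_def[symmetric]
        by (subst nn_integral_cmult_indicator) (auto simp: emeasure_cball V_def d_def power_mult_distrib mult.assoc)
      also have "\<dots> = ennreal (V * (u powr (- a - d) * u ^ DIM('a)))"
        using V u by (subst ennreal_mult[symmetric]) (auto simp: mult_ac)
      also have "u powr (- a - d) * u ^ DIM('a) = u powr (- a)"
        using u by (simp add: d_def powr_diff powr_realpow)
      also have "u powr (- a) = t powr (- a) * q ^ j"
        using t by (simp add: u_def q_def powr_mult powr_divide two_power_powr powr_minus power_divide power_inverse field_simps)
      finally show "(\<integral>\<^sup>+w. f j w \<partial>lborel) = ennreal (V * t powr (- a) * q ^ j)" by (simp add: mult.assoc)
    qed
    also have "\<dots> = ennreal (\<Sum>j. V * t powr (- a) * q ^ j)"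
      using q V by (intro suminf_ennreal2) (auto intro!: summable_mult summable_geometric)
    also have "(\<Sum>j. V * t powr (- a) * q ^ j) = V / (1 - q) * t powr (- a)"
      using q by (simp add: suminf_mult summable_geometric suminf_geometric)
    finally show "(\<integral>\<^sup>+w. ennreal (if t \<le> norm w then norm w powr (- a - real DIM('a)) else 0) \<partial>(lborel :: 'a measure)) \<le> ennreal (V / (1 - q) * t powr (- a))"
      unfolding d_def .
  qed
qed

lemma nn_integral_reflect:
  fixes f :: "'a::euclidean_space \<Rightarrow> ennreal"
  assumes [measurable]: "f \<in> borel_measurable borel"
  shows "(\<integral>\<^sup>+y. f (x - y) \<partial>lborel) = (\<integral>\<^sup>+w. f w \<partial>lborel)"
proof -
  have "(lborel :: 'a measure) = density (distr lborel borel (\<lambda>y. x + (-1) *\<^sub>R y)) (\<lambda>_. 1)"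
    using lborel_affine[of "-1" x] by simp
  then have "(\<integral>\<^sup>+w. f w \<partial>lborel) = (\<integral>\<^sup>+w. f w \<partial>density (distr lborel borel (\<lambda>y. x + (-1) *\<^sub>R y)) (\<lambda>_. 1))"
    by metis
  also have "\<dots> = (\<integral>\<^sup>+y. f (x - y) \<partial>lborel)"
    by (subst nn_integral_density) (auto simp: nn_integral_distr)
  finally show ?thesis by simp
qed

lemma nn_integral_shift:
  fixes f :: "'a::euclidean_space \<Rightarrow> ennreal"
  assumes [measurable]: "f \<in> borel_measurable borel"
  shows "(\<integral>\<^sup>+y. f (y - x) \<partial>lborel) = (\<integral>\<^sup>+w. f w \<partial>lborel)"
  using nn_integral_reflect[of "\<lambda>w. f (- w)" x] nn_integral_reflect[of f 0] by simp

section \<open>Local averages at dyadic scales\<close>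

text \<open>\<open>K\<close> will be the closure of the domain. \<open>depth\<close> makes the
  coarsest cutoff vanish identically, so the telescoping sum of averages starts at 0.
  \<open>exterior\<close> is the measure density of the complement at all scales up to T, which
  makes averages over the exterior comparable to averages over balls.\<close>

locale whitney_domain =
  fixes K :: "'a::euclidean_space set" and s \<tau> T c :: real
  assumes K_compact: "compact K"
    and \<tau>_pos: "0 < \<tau>" and \<tau>_less: "\<tau> < s" and order_less_1: "s + \<tau> < 1"
    and T_pos: "0 < T" and c_pos: "0 < c"
    and depth: "\<And>x. infdist x (- K) \<le> T"
    and exterior: "\<And>y t. y \<in> K \<Longrightarrow> 0 < t \<Longrightarrow> t \<le> T \<Longrightarrow> infdist y (- K) < 3 * t \<Longrightarrow>
       c * t ^ DIM('a) \<le> measure lborel (ball y (4 * t) - K)"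
    and boundary_null: "AE x in lborel. x \<in> K \<longrightarrow> 0 < infdist x (- K)"
begin

text \<open>
  For \<open>|w| \<le> 6 T\<close> we have \<open>dens w = |w|^(2 \<tau> - d)\<close>, which is integrable at 0; the cap in \<open>gap\<close> makes \<open>dens\<close>
  integrable at infinity. In all cases \<open>dens w / (gap w)^2\<close> is the kernel of order \<open>s\<close>.
\<close>

definition gap :: "'a \<Rightarrow> real" where
  "gap w = min (norm w) (6 * T) powr (s + \<tau>)"

definition dens :: "'a \<Rightarrow> real" where
  "dens w = (gap w)\<^sup>2 * norm w powr (- (real DIM('a) + 2 * s))"

definition scale :: "nat \<Rightarrow> real" where
  "scale k = T / 2 ^ k"

text \<open>A hat function and not an indicator, because the kernels have to be Lipschitz in x with
  constant of order 1 / t relative to their size.\<close>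

definition tent :: "real \<Rightarrow> 'a \<Rightarrow> real" where
  "tent t w = max 0 (1 - norm w / t)"

definition mass :: "real \<Rightarrow> real" where
  "mass t = (\<integral>w. tent t w \<partial>lborel)"

text \<open>Vanishes at distance at most \<open>scale k\<close> from the complement and equals 1
  from distance \<open>2 * scale k\<close> on, so an average at this scale around a point where it
  does not vanish does not reach the exterior.\<close>

definition cut :: "nat \<Rightarrow> 'a \<Rightarrow> real" where
  "cut k x = min 1 (max 0 (infdist x (- K) / scale k - 1))"

definition extmass :: "nat \<Rightarrow> 'a \<Rightarrow> real" where
  "extmass k y = (\<integral>z. (if z \<notin> K \<and> norm (y - z) < 4 * scale k then 1 else 0) \<partial>lborel)"

text \<open>The uniform probability density on the part of the complement near y. The radius 4 is 3
  + 1: the boundary is met within distance \<open>3 * scale k\<close> of y, and the exterior ball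
  found there lies within one more \<open>scale k\<close>.\<close>

definition ext :: "nat \<Rightarrow> 'a \<Rightarrow> 'a \<Rightarrow> real" where
  "ext k y z = (if y \<in> K \<and> infdist y (- K) < 3 * scale k \<and> z \<notin> K \<and> norm (y - z) < 4 * scale k
     then 1 / extmass k y else 0)"

text \<open>
  The integral of \<open>piece k x y z * (u y - u z)\<close> is the difference of \<open>cut k x\<close> times the average
  of \<open>u\<close> at scale \<open>k\<close> for consecutive \<open>k\<close>. Where the cutoff grows there is no coarse average to subtract:
  there \<open>z\<close> runs through the exterior, where \<open>u z = 0\<close>.
\<close>

definition piece :: "nat \<Rightarrow> 'a \<Rightarrow> 'a \<Rightarrow> 'a \<Rightarrow> real" where
  "piece k x y z = tent (scale (Suc k)) (x - y) / mass (scale (Suc k)) *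
     (cut k x * (tent (scale k) (x - z) / mass (scale k)) + (cut (Suc k) x - cut k x) * ext k y z)"

text \<open>A coarse support condition with room to spare: a piece has |x - y| below half a scale
  and |x - z| below that plus 4 scales.\<close>

definition near :: "nat \<Rightarrow> 'a \<Rightarrow> 'a \<Rightarrow> 'a \<Rightarrow> bool" where
  "near k x y z \<longleftrightarrow> norm (x - y) < scale k \<and> norm (x - z) < 5 * scale k"

lemma order_bounds: "0 < s" "s < 1"
  using \<tau>_pos \<tau>_less order_less_1 by auto

lemma K_borel [measurable]: "K \<in> sets borel"
  using K_compact by (simp add: compact_imp_closed)

lemma infdist_measurable [measurable]: "(\<lambda>x. infdist x (- K)) \<in> borel_measurable borel"
  by (intro borel_measurable_continuous_onI continuous_on_infdist continuous_on_id)

lemma infdist_outside: "x \<notin> K \<Longrightarrow> infdist x (- K) = 0"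
  by (simp add: infdist_zero)

lemma in_K_near: "norm (x - y) < infdist x (- K) \<Longrightarrow> y \<in> K"
  using infdist_le[of y "- K" x] by (force simp: dist_norm)

lemma infdist_lip: "\<bar>infdist x (- K) - infdist y (- K)\<bar> \<le> norm (x - y)"
  using infdist_triangle_abs[of x "- K" y] by (simp add: dist_norm)

lemma gap_measurable [measurable]: "gap \<in> borel_measurable borel"
  unfolding gap_def[abs_def] by measurable

lemma dens_measurable [measurable]: "dens \<in> borel_measurable borel"
  unfolding dens_def[abs_def] by measurable

lemma gap_nonneg [simp]: "0 \<le> gap w" by (simp add: gap_def)

text \<open>Division by \<open>gap\<close> thus returns 0 on the diagonal, and most pointwise
  identities for difference quotients remain true there.\<close>

lemma gap_zero [simp]: "gap 0 = 0" using T_pos by (simp add: gap_def min_def)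

lemma gap_pos: "w \<noteq> 0 \<Longrightarrow> 0 < gap w" using T_pos by (auto simp: gap_def min_def)

lemma dens_nonneg [simp]: "0 \<le> dens w" by (simp add: dens_def)

lemma dens_pos: "w \<noteq> 0 \<Longrightarrow> 0 < dens w" using gap_pos[of w] by (simp add: dens_def)

lemma gap_small: "norm w \<le> 6 * T \<Longrightarrow> gap w = norm w powr (s + \<tau>)" by (simp add: gap_def min_def)

lemma gap_le: "gap w \<le> norm w powr (s + \<tau>)"
  unfolding gap_def using T_pos order_bounds \<tau>_pos by (intro powr_mono2) auto

lemma scale_pos [simp]: "0 < scale k" using T_pos by (simp add: scale_def)

lemma scale_neq_0 [simp]: "scale k \<noteq> 0" using scale_pos[of k] by linarith

lemma scale_Suc: "scale (Suc k) = scale k / 2" by (simp add: scale_def)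

lemma scale_le: "scale k \<le> T"
  using T_pos by (auto simp: scale_def divide_le_eq mult_le_cancel_left1)

lemma scale_tendsto: "scale \<longlonglongrightarrow> 0"
proof -
  have "(\<lambda>k. T * (1/2) ^ k) \<longlonglongrightarrow> T * 0" by (intro tendsto_intros) auto
  then show ?thesis by (simp add: scale_def[abs_def] power_divide)
qed

lemma tent_measurable [measurable]: "tent t \<in> borel_measurable borel"
  unfolding tent_def[abs_def] by measurable

lemma tent_bounds: "0 \<le> tent t w" "0 < t \<Longrightarrow> tent t w \<le> 1"
  by (auto simp: tent_def)

lemma tent_support: "0 < t \<Longrightarrow> tent t w \<noteq> 0 \<Longrightarrow> norm w < t"
  by (auto simp: tent_def max_def field_simps split: if_splits)

lemma tent_lip:
  assumes "0 < t" shows "\<bar>tent t v - tent t w\<bar> \<le> norm (v - w) / t"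
proof -
  have "\<bar>tent t v - tent t w\<bar> \<le> \<bar>norm v / t - norm w / t\<bar>"
    unfolding tent_def max_def by auto
  also have "\<dots> = \<bar>norm v - norm w\<bar> / t" using assms by (simp add: diff_divide_distrib[symmetric])
  also have "\<dots> \<le> norm (v - w) / t" using assms norm_triangle_ineq3[of v w] by (simp add: divide_right_mono)
  finally show ?thesis .
qed

lemma tent_integrable:
  assumes t: "0 < t" shows "integrable lborel (tent t)"
proof (rule Bochner_Integration.integrable_bound)
  show "integrable lborel (indicator (cball 0 t) :: 'a \<Rightarrow> real)"
    by (rule integrable_real_indicator) (auto simp: emeasure_lborel_cball_finite[simplified])
  have "\<bar>tent t w\<bar> \<le> indicator (cball 0 t) w" for w
    using tent_bounds[of t w] tent_support[OF t, of w] t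
    by (cases "tent t w = 0") (auto simp: indicator_def)
  then show "AE w in lborel. norm (tent t w) \<le> norm (indicator (cball 0 t) w :: real)" by auto
qed simp

text \<open>The hat function is at least 1/2 on the ball of half the radius.\<close>

lemma mass_ge: "0 < t \<Longrightarrow> unit_ball_vol (real DIM('a)) / 2 / 2 ^ DIM('a) * t ^ DIM('a) \<le> mass t"
proof -
  assume t: "0 < t"
  have "(\<integral>w. 1/2 * indicator (cball 0 (t/2)) w \<partial>(lborel :: 'a measure)) \<le> mass t"
    unfolding mass_def
  proof (rule integral_mono)
    show "integrable lborel (\<lambda>w :: 'a. 1/2 * indicator (cball 0 (t/2)) w :: real)"
      by (intro integrable_mult_right integrable_real_indicator) (auto simp: emeasure_lborel_cball_finite[simplified])
    show "1/2 * indicator (cball 0 (t/2)) w \<le> tent t w" for w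
      using t by (auto simp: indicator_def tent_def field_simps)
  qed (use tent_integrable t in auto)
  then show "unit_ball_vol (real DIM('a)) / 2 / 2 ^ DIM('a) * t ^ DIM('a) \<le> mass t"
    using t by (simp add: content_cball power_divide)
qed

lemma mass_pos: "0 < t \<Longrightarrow> 0 < mass t"
proof -
  assume t: "0 < t"
  have "0 < unit_ball_vol (real DIM('a)) / 2 / 2 ^ DIM('a) * t ^ DIM('a)" using t by simp
  with mass_ge[OF t] show "0 < mass t" by linarith
qed

lemma cut_measurable [measurable]: "cut k \<in> borel_measurable borel"
  unfolding cut_def[abs_def] by measurable

lemma cut_bounds: "0 \<le> cut k x" "cut k x \<le> 1"
  by (auto simp: cut_def)

lemma cut_mono: "cut k x \<le> cut (Suc k) x"
proof -
  have "infdist x (- K) / scale k \<le> infdist x (- K) / scale (Suc k)"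
    unfolding scale_Suc using scale_pos[of k] infdist_nonneg[of x "- K"] by (auto simp: field_simps)
  then show ?thesis unfolding cut_def by auto
qed

lemma clamp_lip:
  fixes a b :: real
  shows "\<bar>min 1 (max 0 (a - 1)) - min 1 (max 0 (b - 1))\<bar> \<le> \<bar>a - b\<bar>"
  unfolding min_def max_def by auto

lemma cut_lip: "\<bar>cut k x - cut k y\<bar> \<le> norm (x - y) / scale k"
proof -
  have "\<bar>cut k x - cut k y\<bar> \<le> \<bar>infdist x (- K) / scale k - infdist y (- K) / scale k\<bar>"
    unfolding cut_def by (rule clamp_lip)
  also have "\<dots> = \<bar>infdist x (- K) - infdist y (- K)\<bar> / scale k"
    by (simp add: diff_divide_distrib[symmetric] abs_of_pos[OF scale_pos])
  also have "\<dots> \<le> norm (x - y) / scale k"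
    by (rule divide_right_mono[OF infdist_lip less_imp_le[OF scale_pos]])
  finally show ?thesis .
qed

lemma cut_0: "cut 0 x = 0"
  using depth[of x] T_pos by (simp add: cut_def scale_def)

lemma clamp_cases:
  fixes a :: real
  shows "min 1 (max 0 (a - 1)) \<noteq> 0 \<Longrightarrow> 1 < a" "min 1 (max 0 (a - 1)) \<noteq> 1 \<Longrightarrow> a < 2"
  unfolding min_def max_def by (auto split: if_splits)

lemma cut_nonzero: "cut k x \<noteq> 0 \<Longrightarrow> scale k < infdist x (- K)"
  using clamp_cases(1)[of "infdist x (- K) / scale k"] scale_pos[of k] by (simp add: cut_def field_simps)

lemma cut_not_1: "cut k x \<noteq> 1 \<Longrightarrow> infdist x (- K) < 2 * scale k"
  using clamp_cases(2)[of "infdist x (- K) / scale k"] scale_pos[of k] by (simp add: cut_def divide_less_eq)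

lemma cut_tendsto: "0 < infdist x (- K) \<Longrightarrow> eventually (\<lambda>k. cut k x = 1) sequentially"
proof -
  assume "0 < infdist x (- K)"
  then have "eventually (\<lambda>k. scale k < infdist x (- K) / 2) sequentially"
    by (intro order_tendstoD(2)[OF scale_tendsto]) simp
  then show ?thesis by eventually_elim (use cut_not_1 in force)
qed

lemma extmass_measurable [measurable]: "extmass k \<in> borel_measurable borel"
  unfolding extmass_def[abs_def] by measurable

lemma extmass_integrable:
  "integrable lborel (\<lambda>z. if z \<notin> K \<and> norm (y - z) < 4 * scale k then 1 else 0 :: real)"
proof -
  have "integrable lborel (indicator (ball y (4 * scale k) - K) :: 'a \<Rightarrow> real)"
  proof (rule integrable_real_indicator)
    have "emeasure lborel (ball y (4 * scale k) - K) \<le> emeasure lborel (ball y (4 * scale k))"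
      by (rule emeasure_mono) auto
    also have "\<dots> < \<infinity>" by (rule emeasure_lborel_ball_finite)
    finally show "emeasure lborel (ball y (4 * scale k) - K) < \<infinity>" .
  qed measurable
  then show ?thesis
    by (rule Bochner_Integration.integrable_cong[THEN iffD1, rotated -1])
       (auto simp: indicator_def dist_norm)
qed

lemma extmass_ge:
  assumes "y \<in> K" "infdist y (- K) < 3 * scale k"
  shows "c * scale k ^ DIM('a) \<le> extmass k y"
proof -
  have "extmass k y = (\<integral>z. indicator (ball y (4 * scale k) - K) z \<partial>lborel)"
    unfolding extmass_def by (rule Bochner_Integration.integral_cong) (auto simp: indicator_def dist_norm)
  also have "\<dots> = measure lborel (ball y (4 * scale k) - K)" by simp
  finally show ?thesis using exterior[OF assms(1) scale_pos scale_le assms(2)] by simp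
qed

lemma ext_measurable [measurable (raw)]:
  assumes [measurable]: "f \<in> borel_measurable N" "g \<in> borel_measurable N"
  shows "(\<lambda>w. ext k (f w) (g w)) \<in> borel_measurable N"
  unfolding ext_def by measurable

lemma ext_bounds: "0 \<le> ext k y z" "ext k y z \<le> 1 / c * scale k powr (- real DIM('a))"
proof -
  have c0: "0 < c * scale k ^ DIM('a)" using c_pos by simp
  show "0 \<le> ext k y z" using extmass_ge[of y k] c0 unfolding ext_def by auto
  have "1 / extmass k y \<le> 1 / (c * scale k ^ DIM('a))" if "y \<in> K" "infdist y (- K) < 3 * scale k"
    using extmass_ge[OF that] c0 by (intro divide_left_mono) auto
  moreover have "1 / (c * scale k ^ DIM('a)) = 1 / c * scale k powr (- real DIM('a))"
    by (simp add: powr_minus powr_realpow field_simps)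
  ultimately show "ext k y z \<le> 1 / c * scale k powr (- real DIM('a))"
    using c_pos unfolding ext_def by auto
qed

lemma ext_integral:
  assumes "y \<in> K" "infdist y (- K) < 3 * scale k"
  shows "integrable lborel (ext k y)" "(\<integral>z. ext k y z \<partial>lborel) = 1"
proof -
  have e: "ext k y = (\<lambda>z. (if z \<notin> K \<and> norm (y - z) < 4 * scale k then 1 else 0) / extmass k y)"
    using assms by (auto simp: ext_def fun_eq_iff)
  show "integrable lborel (ext k y)" unfolding e using extmass_integrable by (rule integrable_divide)
  have "0 < c * scale k ^ DIM('a)" using c_pos by simp
  then have "extmass k y > 0" using extmass_ge[OF assms] by linarith
  then show "(\<integral>z. ext k y z \<partial>lborel) = 1" unfolding e by (simp add: extmass_def)
qed

lemma piece_measurable [measurable (raw)]: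
  assumes [measurable]: "f \<in> borel_measurable N" "g \<in> borel_measurable N" "h \<in> borel_measurable N"
  shows "(\<lambda>w. piece k (f w) (g w) (h w)) \<in> borel_measurable N"
  unfolding piece_def by measurable

lemma near_measurable [measurable (raw)]:
  assumes [measurable]: "f \<in> borel_measurable N" "g \<in> borel_measurable N" "h \<in> borel_measurable N"
  shows "Measurable.pred N (\<lambda>w. near k (f w) (g w) (h w))"
  unfolding near_def by measurable

lemma piece_nonneg: "0 \<le> piece k x y z"
  unfolding piece_def using tent_bounds(1) mass_pos[OF scale_pos] cut_bounds cut_mono ext_bounds(1)
  by (intro mult_nonneg_nonneg add_nonneg_nonneg divide_nonneg_nonneg) (auto intro: less_imp_le)

text \<open>The finer hat function has radius \<open>scale (Suc k)\<close>, and a nonzero piece puts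
  x at more than that distance from the complement, so y cannot leave \<open>K\<close>.\<close>

lemma piece_support:
  assumes "piece k x y z \<noteq> 0"
  shows "near k x y z" "x \<in> K" "y \<in> K" "norm (y - z) < 6 * scale k"
proof -
  have t: "tent (scale (Suc k)) (x - y) \<noteq> 0" using assms by (auto simp: piece_def)
  then have xy: "norm (x - y) < scale (Suc k)" by (intro tent_support) auto
  have alt: "cut k x \<noteq> 0 \<and> tent (scale k) (x - z) \<noteq> 0 \<or> cut (Suc k) x \<noteq> cut k x \<and> ext k y z \<noteq> 0"
    using assms by (auto simp: piece_def)
  have "cut (Suc k) x \<noteq> 0"
    using alt cut_mono[of k x] cut_bounds(1)[of k x] by auto
  then have d: "scale (Suc k) < infdist x (- K)" by (rule cut_nonzero)
  then show "x \<in> K" using infdist_outside[of x] scale_pos[of "Suc k"] by (cases "x \<in> K") auto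
  show "y \<in> K" using xy d in_K_near[of x y] by linarith
  have yz: "norm (x - z) < scale k \<or> norm (y - z) < 4 * scale k"
    using alt by (auto simp: ext_def split: if_splits intro: tent_support[OF scale_pos])
  have tri: "norm (x - z) \<le> norm (x - y) + norm (y - z)" "norm (y - z) \<le> norm (x - y) + norm (x - z)"
    using norm_triangle_ineq[of "x - y" "y - z"] norm_triangle_ineq[of "y - x" "x - z"]
    by (auto simp: norm_minus_commute)
  show "norm (y - z) < 6 * scale k" using yz tri xy scale_pos[of k] unfolding scale_Suc by linarith
  show "near k x y z" unfolding near_def using yz tri xy scale_pos[of k] unfolding scale_Suc by linarith
qed

text \<open>A piece is a product of two densities of size scale^(-d) with factors that are Lipschitz
  with constant of order 1 / scale. The minimum with 1 merges the Lipschitz bound with the trivial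
  one.\<close>

lemma piece_bounds:
  "\<exists>C>0. \<forall>k x x' y z. piece k x y z \<le> C * scale k powr (- 2 * real DIM('a)) * of_bool (near k x y z) \<and>
     \<bar>piece k x y z - piece k x' y z\<bar> \<le> C * min 1 (norm (x - x') / scale k) * scale k powr (- 2 * real DIM('a))
        * (of_bool (near k x y z) + of_bool (near k x' y z))"
proof -
  define m where "m = unit_ball_vol (real DIM('a)) / 2 / 2 ^ DIM('a)"
  have m: "m > 0" by (simp add: m_def)
  define B0 where "B0 = 2 ^ DIM('a) / m + 1 / c"
  have B0: "B0 > 0" using m c_pos by (simp add: B0_def add_pos_pos)
  show ?thesis
  \<comment> \<open>9 = 4 + 5. The finer hat function has Lipschitz constant 2 / t and multiplies X
    \<le> 2 B, giving 4; X itself has Lipschitz constant 5 B / t, made of 2 for the averaged part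
    and 3 for the exterior part.\<close>
  proof (intro exI[of _ "9 * B0\<^sup>2"] conjI allI)
    show "0 < 9 * B0\<^sup>2" using B0 by simp
    fix k and x x' y z :: 'a
    define t where "t = scale k"
    define B where "B = B0 * t powr (- real DIM('a))"
    have t: "t > 0" "t \<noteq> 0" by (auto simp: t_def)
    have B: "B > 0" using B0 t by (simp add: B_def)
    have BB: "9 * B\<^sup>2 = 9 * B0\<^sup>2 * scale k powr (- 2 * real DIM('a))"
      using t by (simp add: B_def power_mult_distrib t_def power2_eq_square flip: powr_add)
    define \<alpha> where "\<alpha> = 1 / mass (scale (Suc k))"
    define \<beta> where "\<beta> = 1 / mass (scale k)"
    have tp: "t powr (- real DIM('a)) = 1 / t ^ DIM('a)" using t by (simp add: powr_minus powr_realpow field_simps)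
    have \<alpha>: "0 \<le> \<alpha>" "\<alpha> \<le> B"
    proof -
      have p: "0 < m * (t / 2) ^ DIM('a)" using m t by simp
      have "m * (t / 2) ^ DIM('a) \<le> mass (scale (Suc k))"
        using mass_ge[of "scale (Suc k)"] by (simp add: scale_Suc t_def m_def)
      then have "\<alpha> \<le> 1 / (m * (t / 2) ^ DIM('a))"
        unfolding \<alpha>_def using p by (intro divide_left_mono) auto
      also have "\<dots> = 2 ^ DIM('a) / m * (1 / t ^ DIM('a))" using t by (simp add: power_divide)
      also have "\<dots> \<le> B" unfolding B_def tp B0_def using t c_pos by (intro mult_right_mono) auto
      finally show "\<alpha> \<le> B" .
      show "0 \<le> \<alpha>" using mass_pos[of "scale (Suc k)"] by (simp add: \<alpha>_def)
    qed
    have \<beta>: "0 \<le> \<beta>" "\<beta> \<le> B"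
    proof -
      have p: "0 < m * t ^ DIM('a)" using m t by simp
      have "m * t ^ DIM('a) \<le> mass (scale k)"
        using mass_ge[of "scale k"] by (simp add: t_def m_def)
      then have "\<beta> \<le> 1 / (m * t ^ DIM('a))"
        unfolding \<beta>_def using p by (intro divide_left_mono) auto
      also have "\<dots> = 1 / m * (1 / t ^ DIM('a))" by simp
      also have "\<dots> \<le> B" unfolding B_def tp B0_def using t c_pos m
        by (intro mult_right_mono) (auto intro!: add_increasing2 divide_right_mono)
      finally show "\<beta> \<le> B" .
      show "0 \<le> \<beta>" using mass_pos[of "scale k"] by (simp add: \<beta>_def)
    qed
    define e where "e = ext k y z"
    have e: "0 \<le> e" "e \<le> B"
    proof -
      show "0 \<le> e" using ext_bounds by (simp add: e_def)
      have "e \<le> 1 / c * t powr (- real DIM('a))" using ext_bounds by (simp add: e_def t_def)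
      also have "\<dots> \<le> B" unfolding B_def B0_def using m by (intro mult_right_mono) auto
      finally show "e \<le> B" .
    qed
    define X where "X v = cut k v * (\<beta> * tent t (v - z)) + (cut (Suc k) v - cut k v) * e" for v
    define p where "p v = tent (scale (Suc k)) (v - y)" for v
    have pc: "piece k v y z = \<alpha> * p v * X v" for v
      by (simp add: piece_def X_def p_def \<alpha>_def \<beta>_def e_def t_def)
    have p: "0 \<le> p v" "p v \<le> 1" for v using tent_bounds[of "scale (Suc k)"] by (auto simp: p_def)
    have X: "0 \<le> X v" "X v \<le> 2 * B" for v
    proof -
      have q: "0 \<le> tent t (v - z)" "tent t (v - z) \<le> 1" using tent_bounds[of t] t by auto
      show "0 \<le> X v" unfolding X_def using cut_bounds[of k v] cut_mono[of k v] \<beta> e q by (intro add_nonneg_nonneg mult_nonneg_nonneg) auto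
      have "cut k v * (\<beta> * tent t (v - z)) \<le> 1 * (B * 1)"
        using cut_bounds[of k v] \<beta> B q by (intro mult_mono) auto
      moreover have "(cut (Suc k) v - cut k v) * e \<le> 1 * B"
        using cut_bounds[of k v] cut_bounds[of "Suc k" v] cut_mono[of k v] e B by (intro mult_mono) auto
      ultimately show "X v \<le> 2 * B" by (simp add: X_def)
    qed
    have sup: "piece k v y z \<le> 2 * B\<^sup>2" for v
    proof -
      have "\<alpha> * p v * X v \<le> B * 1 * (2 * B)"
        using \<alpha> p[of v] X[of v] B by (intro mult_mono) auto
      then show ?thesis by (simp add: pc power2_eq_square)
    qed
    have zero: "piece k v y z = 0" if "\<not> near k v y z" for v
      using piece_support(1)[of k v y z] that by blast
    have B2: "2 * B\<^sup>2 \<le> 9 * B\<^sup>2" by simp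
    show "piece k x y z \<le> 9 * B0\<^sup>2 * scale k powr (- 2 * real DIM('a)) * of_bool (near k x y z)"
      unfolding BB[symmetric] using order_trans[OF sup[of x] B2] zero[of x] by (cases "near k x y z") auto
    define r where "r = norm (x - x')"
    have r: "r \<ge> 0" by (simp add: r_def)
    have lip: "\<bar>piece k x y z - piece k x' y z\<bar> \<le> 9 * B\<^sup>2 * (r / t)"
    proof -
      have dp: "\<bar>p x - p x'\<bar> \<le> 2 * (r / t)"
        using tent_lip[of "scale (Suc k)" "x - y" "x' - y"] by (simp add: p_def r_def scale_Suc t_def mult.commute)
      have dq: "\<bar>tent t (x - z) - tent t (x' - z)\<bar> \<le> r / t"
        using tent_lip[of t "x - z" "x' - z"] t by (simp add: r_def)
      have dc: "\<bar>cut k x - cut k x'\<bar> \<le> r / t" using cut_lip[of k x x'] by (simp add: r_def t_def)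
      have dc': "\<bar>cut (Suc k) x - cut (Suc k) x'\<bar> \<le> 2 * (r / t)"
        using cut_lip[of "Suc k" x x'] by (simp add: r_def t_def scale_Suc mult.commute)
      have "X x - X x' = \<beta> * ((cut k x - cut k x') * tent t (x - z) + cut k x' * (tent t (x - z) - tent t (x' - z)))
         + e * ((cut (Suc k) x - cut (Suc k) x') - (cut k x - cut k x'))"
        by (simp add: X_def algebra_simps)
      also have "\<bar>\<dots>\<bar> \<le> \<beta> * (\<bar>cut k x - cut k x'\<bar> * \<bar>tent t (x - z)\<bar> + \<bar>cut k x'\<bar> * \<bar>tent t (x - z) - tent t (x' - z)\<bar>)
         + e * (\<bar>cut (Suc k) x - cut (Suc k) x'\<bar> + \<bar>cut k x - cut k x'\<bar>)"
      proof (rule order_trans[OF abs_triangle_ineq add_mono])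
        show "\<bar>\<beta> * ((cut k x - cut k x') * tent t (x - z) + cut k x' * (tent t (x - z) - tent t (x' - z)))\<bar>
          \<le> \<beta> * (\<bar>cut k x - cut k x'\<bar> * \<bar>tent t (x - z)\<bar> + \<bar>cut k x'\<bar> * \<bar>tent t (x - z) - tent t (x' - z)\<bar>)"
          unfolding abs_mult using \<beta> abs_triangle_ineq[of "(cut k x - cut k x') * tent t (x - z)" "cut k x' * (tent t (x - z) - tent t (x' - z))"]
          by (simp add: abs_mult mult_left_mono)
        show "\<bar>e * ((cut (Suc k) x - cut (Suc k) x') - (cut k x - cut k x'))\<bar>
          \<le> e * (\<bar>cut (Suc k) x - cut (Suc k) x'\<bar> + \<bar>cut k x - cut k x'\<bar>)"
          unfolding abs_mult using e by (simp add: mult_left_mono)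
      qed
      also have "\<dots> \<le> B * ((r / t) * 1 + 1 * (r / t)) + B * (2 * (r / t) + r / t)"
        using \<beta> e B dq dc dc' tent_bounds[of t "x - z"] t cut_bounds[of k x'] r
        by (intro add_mono mult_mono) auto
      also have "\<dots> = 5 * B * (r / t)" by (simp add: algebra_simps)
      finally have dX: "\<bar>X x - X x'\<bar> \<le> 5 * B * (r / t)" .
      have "piece k x y z - piece k x' y z = \<alpha> * ((p x - p x') * X x + p x' * (X x - X x'))"
        by (simp add: pc algebra_simps)
      also have "\<bar>\<dots>\<bar> \<le> \<alpha> * (\<bar>p x - p x'\<bar> * \<bar>X x\<bar> + \<bar>p x'\<bar> * \<bar>X x - X x'\<bar>)"
        unfolding abs_mult using \<alpha> abs_triangle_ineq[of "(p x - p x') * X x" "p x' * (X x - X x')"]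
        by (simp add: abs_mult mult_left_mono)
      also have "\<dots> \<le> B * ((2 * (r / t)) * (2 * B) + 1 * (5 * B * (r / t)))"
        using \<alpha> dp dX X[of x] p[of x'] B r t by (intro mult_mono add_mono) auto
      also have "\<dots> = 9 * B\<^sup>2 * (r / t)" by (simp add: algebra_simps power2_eq_square)
      finally show ?thesis .
    qed
    have both: "\<bar>piece k x y z - piece k x' y z\<bar> \<le> 9 * B\<^sup>2 * min 1 (r / t)"
    proof (cases "r / t \<le> 1")
      case True
      then show ?thesis using lip by (simp only: min_absorb2)
    next
      case False
      have "\<bar>piece k x y z - piece k x' y z\<bar> \<le> 2 * B\<^sup>2"
        using sup[of x] sup[of x'] piece_nonneg[of k x y z] piece_nonneg[of k x' y z] by linarith
      from order_trans[OF this B2] show ?thesis using False by (simp add: min_def)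
    qed
    have nn: "0 \<le> 9 * B\<^sup>2 * min 1 (r / t)" using r t by simp
    have "\<bar>piece k x y z - piece k x' y z\<bar> \<le> 9 * B\<^sup>2 * min 1 (r / t) * (of_bool (near k x y z) + of_bool (near k x' y z))"
      using both nn zero[of x] zero[of x'] by (cases "near k x y z"; cases "near k x' y z") auto
    then show "\<bar>piece k x y z - piece k x' y z\<bar> \<le> 9 * B0\<^sup>2 * min 1 (norm (x - x') / scale k) * scale k powr (- 2 * real DIM('a))
        * (of_bool (near k x y z) + of_bool (near k x' y z))"
      unfolding BB r_def t_def by (simp add: mult_ac)
  qed
qed

end

lemma nn_integral_lborel_pair:
  fixes f :: "'a::euclidean_space \<times> 'b::euclidean_space \<Rightarrow> ennreal"
  assumes "f \<in> borel_measurable borel"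
  shows "(\<integral>\<^sup>+z. f z \<partial>lborel) = (\<integral>\<^sup>+x. \<integral>\<^sup>+y. f (x, y) \<partial>lborel \<partial>lborel)"
proof -
  have "f \<in> borel_measurable (lborel \<Otimes>\<^sub>M lborel)"
    unfolding lborel_prod using assms by simp
  from lborel.nn_integral_fst[OF this] show ?thesis by (simp add: lborel_prod)
qed

section \<open>The averaging kernel and its integral bounds\<close>

context whitney_domain
begin

text \<open>For y \<noteq> z only finitely many terms are nonzero. Convergence for y = z is not
  claimed; integrals over (y, z) contain the factor \<open>gap (y - z)\<close>, which is 0 there, or
  a difference of values at y and z.\<close>

definition avg_kernel :: "'a \<Rightarrow> 'a \<Rightarrow> 'a \<Rightarrow> real" where
  "avg_kernel x y z = (\<Sum>k. piece k x y z)"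

lemma avg_kernel_measurable [measurable (raw)]:
  assumes [measurable]: "f \<in> borel_measurable N" "g \<in> borel_measurable N" "h \<in> borel_measurable N"
  shows "(\<lambda>w. avg_kernel (f w) (g w) (h w)) \<in> borel_measurable N"
  unfolding avg_kernel_def by measurable

lemma piece_eventually_zero:
  assumes "y \<noteq> z" shows "\<exists>n. \<forall>k\<ge>n. \<forall>x. piece k x y z = 0"
proof -
  have "eventually (\<lambda>k. scale k < norm (y - z) / 6) sequentially"
    by (rule order_tendstoD(2)[OF scale_tendsto]) (use assms in simp)
  then obtain n where n: "\<And>k. n \<le> k \<Longrightarrow> scale k < norm (y - z) / 6"
    by (auto simp: eventually_sequentially)
  have "piece k x y z = 0" if "n \<le> k" for k x
    using n[OF that] piece_support(4)[of k x y z] by (cases "piece k x y z = 0") auto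
  then show ?thesis by blast
qed

lemma piece_summable: "y \<noteq> z \<Longrightarrow> summable (\<lambda>k. piece k x y z)"
proof -
  assume "y \<noteq> z"
  from piece_eventually_zero[OF this] obtain n where n: "\<forall>k\<ge>n. \<forall>x. piece k x y z = 0" by blast
  show ?thesis by (rule summable_finite[of "{..<n}"]) (use n in auto)
qed

lemma piece_diff_summable: "y \<noteq> z \<Longrightarrow> summable (\<lambda>k. \<bar>piece k x y z - piece k x' y z\<bar>)"
proof -
  assume "y \<noteq> z"
  from piece_eventually_zero[OF this] obtain n where n: "\<forall>k\<ge>n. \<forall>x. piece k x y z = 0" by blast
  show ?thesis by (rule summable_finite[of "{..<n}"]) (use n in auto)
qed

lemma avg_kernel_diff_le:
  assumes "y \<noteq> z"
  shows "ennreal \<bar>avg_kernel x y z - avg_kernel x' y z\<bar> \<le> (\<Sum>k. ennreal \<bar>piece k x y z - piece k x' y z\<bar>)"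
proof -
  have "avg_kernel x y z - avg_kernel x' y z = (\<Sum>k. piece k x y z - piece k x' y z)"
    unfolding avg_kernel_def by (rule suminf_diff[OF piece_summable[OF assms] piece_summable[OF assms]])
  also have "\<bar>\<dots>\<bar> \<le> (\<Sum>k. \<bar>piece k x y z - piece k x' y z\<bar>)"
    by (rule summable_rabs[OF piece_diff_summable[OF assms]])
  finally have "ennreal \<bar>avg_kernel x y z - avg_kernel x' y z\<bar> \<le> ennreal (\<Sum>k. \<bar>piece k x y z - piece k x' y z\<bar>)"
    by (rule ennreal_leI)
  also have "\<dots> = (\<Sum>k. ennreal \<bar>piece k x y z - piece k x' y z\<bar>)"
    by (rule suminf_ennreal2[symmetric]) (use piece_diff_summable[OF assms] in auto)
  finally show ?thesis .
qed

lemma avg_kernel_eq: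
  assumes "y \<noteq> z" shows "ennreal (avg_kernel x y z) = (\<Sum>k. ennreal (piece k x y z))"
  unfolding avg_kernel_def by (rule suminf_ennreal2[symmetric]) (use piece_nonneg piece_summable[OF assms] in auto)

lemma avg_kernel_nonneg: "y \<noteq> z \<Longrightarrow> 0 \<le> avg_kernel x y z"
  unfolding avg_kernel_def by (intro suminf_nonneg piece_summable piece_nonneg)

lemma avg_kernel_support:
  assumes "avg_kernel x y z \<noteq> 0" shows "x \<in> K" "y \<in> K" "norm (y - z) < 6 * T"
proof -
  have "\<exists>k. piece k x y z \<noteq> 0"
  proof (rule ccontr)
    assume "\<not> (\<exists>k. piece k x y z \<noteq> 0)"
    then have "avg_kernel x y z = 0" by (simp add: avg_kernel_def)
    with assms show False by simp
  qed
  then obtain k where "piece k x y z \<noteq> 0" by blast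
  from piece_support[OF this] scale_le[of k] show "x \<in> K" "y \<in> K" "norm (y - z) < 6 * T" by auto
qed

definition pair_density :: "'a \<times> 'a \<Rightarrow> real" where
  "pair_density z = (if fst z \<in> K \<or> snd z \<in> K then dens (fst z - snd z) else 0)"

definition pair_measure :: "('a \<times> 'a) measure" where
  "pair_measure = density lborel (\<lambda>z. ennreal (pair_density z))"

lemma space_pair_measure [simp]: "space pair_measure = UNIV" by (simp add: pair_measure_def)
lemma sets_pair_measure [simp, measurable_cong]: "sets pair_measure = sets borel" by (simp add: pair_measure_def)

lemma pair_measurable_borel [measurable]:
  "fst \<in> borel_measurable (borel :: ('a \<times> 'a) measure)" "snd \<in> borel_measurable (borel :: ('a \<times> 'a) measure)"
  by (simp_all add: borel_prod[symmetric])

lemma pair_density_measurable [measurable]: "pair_density \<in> borel_measurable borel"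
  unfolding pair_density_def[abs_def] by measurable

lemma pair_density_nonneg [simp]: "0 \<le> pair_density z" by (simp add: pair_density_def)

lemma pair_density_le: "pair_density z \<le> dens (fst z - snd z)" by (simp add: pair_density_def)

lemma nn_integral_pair_measure:
  assumes [measurable]: "f \<in> borel_measurable borel"
  shows "(\<integral>\<^sup>+z. f z \<partial>pair_measure) = (\<integral>\<^sup>+z. ennreal (pair_density z) * f z \<partial>lborel)"
  unfolding pair_measure_def by (rule nn_integral_density) measurable

lemma dens_small: "norm w \<le> 6 * T \<Longrightarrow> dens w = norm w powr (2 * \<tau> - real DIM('a))"
  by (cases "w = 0") (auto simp: dens_def gap_small power2_eq_square simp flip: powr_add)

lemma dens_large: "6 * T \<le> norm w \<Longrightarrow> dens w = (6 * T) powr (2 * (s + \<tau>)) * norm w powr (- (2 * s) - real DIM('a))"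
proof -
  assume w: "6 * T \<le> norm w"
  have e: "- (real DIM('a) + 2 * s) = - (2 * s) - real DIM('a)" by simp
  have "gap w = (6 * T) powr (s + \<tau>)" using w by (simp add: gap_def min_def)
  then have "(gap w)\<^sup>2 = (6 * T) powr (2 * (s + \<tau>))" by (simp add: power2_eq_square flip: powr_add)
  then show ?thesis unfolding dens_def e by simp
qed

lemma dens_integral: "\<exists>D\<ge>0. (\<integral>\<^sup>+w. ennreal (dens w) \<partial>lborel) \<le> ennreal D"
proof -
  obtain C1 where C1: "C1 \<ge> 0" "\<And>t. t > 0 \<Longrightarrow> (\<integral>\<^sup>+w. ennreal (if norm w \<le> t then norm w powr (2 * \<tau> - real DIM('a)) else 0) \<partial>(lborel :: 'a measure)) \<le> ennreal (C1 * t powr (2 * \<tau>))"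
    using nn_integral_norm_powr_inside[where 'a='a, of "2 * \<tau>"] \<tau>_pos by auto
  obtain C2 where C2: "C2 \<ge> 0" "\<And>t. t > 0 \<Longrightarrow> (\<integral>\<^sup>+w. ennreal (if t \<le> norm w then norm w powr (- (2 * s) - real DIM('a)) else 0) \<partial>(lborel :: 'a measure)) \<le> ennreal (C2 * t powr (- (2 * s)))"
    using nn_integral_norm_powr_outside[where 'a='a, of "2 * s"] order_bounds by auto
  define t where "t = 6 * T"
  have t: "t > 0" using T_pos by (simp add: t_def)
  define c1 where "c1 = t powr (2 * (s + \<tau>))"
  have "(\<integral>\<^sup>+w. ennreal (dens w) \<partial>lborel) \<le> (\<integral>\<^sup>+w. ennreal (if norm w \<le> t then norm w powr (2 * \<tau> - real DIM('a)) else 0)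
     + ennreal c1 * ennreal (if t \<le> norm w then norm w powr (- (2 * s) - real DIM('a)) else 0) \<partial>(lborel :: 'a measure))"
  proof (rule nn_integral_mono)
    fix w :: 'a
    show "ennreal (dens w) \<le> ennreal (if norm w \<le> t then norm w powr (2 * \<tau> - real DIM('a)) else 0)
     + ennreal c1 * ennreal (if t \<le> norm w then norm w powr (- (2 * s) - real DIM('a)) else 0)"
    proof (cases "norm w \<le> t")
      case True
      then have "dens w = norm w powr (2 * \<tau> - real DIM('a))" using dens_small[of w] by (simp add: t_def)
      then show ?thesis using True by (simp add: add_increasing2)
    next
      case False
      then have "dens w = c1 * norm w powr (- (2 * s) - real DIM('a))" using dens_large[of w] by (simp add: t_def c1_def)
      then show ?thesis using False by (simp add: ennreal_mult c1_def)
    qed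
  qed
  also have "\<dots> = (\<integral>\<^sup>+w. ennreal (if norm w \<le> t then norm w powr (2 * \<tau> - real DIM('a)) else 0) \<partial>(lborel :: 'a measure))
     + ennreal c1 * (\<integral>\<^sup>+w. ennreal (if t \<le> norm w then norm w powr (- (2 * s) - real DIM('a)) else 0) \<partial>(lborel :: 'a measure))"
    by (subst nn_integral_add) (auto simp: nn_integral_cmult)
  also have "\<dots> \<le> ennreal (C1 * t powr (2 * \<tau>)) + ennreal c1 * ennreal (C2 * t powr (- (2 * s)))"
    by (intro add_mono mult_left_mono C1 C2 t) auto
  also have "\<dots> = ennreal (C1 * t powr (2 * \<tau>) + c1 * (C2 * t powr (- (2 * s))))"
    using C1(1) C2(1) by (simp add: ennreal_mult[symmetric] ennreal_plus[symmetric] c1_def del: ennreal_plus)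
  finally show ?thesis using C1(1) C2(1) by (intro exI[of _ "C1 * t powr (2 * \<tau>) + c1 * (C2 * t powr (- (2 * s)))"]) (auto simp: c1_def)
qed

text \<open>Every pair has a component in the bounded set \<open>K\<close>, and \<open>dens\<close>
  is integrable in the other component.\<close>

lemma finite_measure_pair_measure: "finite_measure pair_measure"
proof
  obtain D where D: "D \<ge> 0" "(\<integral>\<^sup>+w. ennreal (dens w) \<partial>lborel) \<le> ennreal D" using dens_integral by blast
  have Kf: "emeasure lborel K < \<infinity>" by (rule emeasure_compact_finite[OF K_compact])
  have "emeasure pair_measure (space pair_measure) = (\<integral>\<^sup>+z. ennreal (pair_density z) \<partial>lborel)"
    by (simp add: pair_measure_def emeasure_density)
  also have "\<dots> \<le> (\<integral>\<^sup>+z. indicator K (fst z) * ennreal (dens (fst z - snd z)) + indicator K (snd z) * ennreal (dens (fst z - snd z)) \<partial>lborel)"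
    by (rule nn_integral_mono) (auto simp: pair_density_def indicator_def)
  also have "\<dots> = (\<integral>\<^sup>+x. \<integral>\<^sup>+y. indicator K x * ennreal (dens (x - y)) + indicator K y * ennreal (dens (x - y)) \<partial>lborel \<partial>lborel)"
    by (subst nn_integral_lborel_pair) (simp_all, measurable)
  also have "\<dots> = (\<integral>\<^sup>+x. \<integral>\<^sup>+y. indicator K x * ennreal (dens (x - y)) \<partial>lborel \<partial>lborel) + (\<integral>\<^sup>+x. \<integral>\<^sup>+y. indicator K y * ennreal (dens (x - y)) \<partial>lborel \<partial>lborel)"
  proof -
    have "(\<integral>\<^sup>+x. \<integral>\<^sup>+y. indicator K x * ennreal (dens (x - y)) + indicator K y * ennreal (dens (x - y)) \<partial>lborel \<partial>lborel)
      = (\<integral>\<^sup>+x. (\<integral>\<^sup>+y. indicator K x * ennreal (dens (x - y)) \<partial>lborel) + (\<integral>\<^sup>+y. indicator K y * ennreal (dens (x - y)) \<partial>lborel) \<partial>lborel)"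
      by (intro nn_integral_cong nn_integral_add) measurable
    also have "\<dots> = (\<integral>\<^sup>+x. \<integral>\<^sup>+y. indicator K x * ennreal (dens (x - y)) \<partial>lborel \<partial>lborel) + (\<integral>\<^sup>+x. \<integral>\<^sup>+y. indicator K y * ennreal (dens (x - y)) \<partial>lborel \<partial>lborel)"
      by (rule nn_integral_add) measurable
    finally show ?thesis .
  qed
  also have "(\<integral>\<^sup>+x. \<integral>\<^sup>+y. indicator K y * ennreal (dens (x - y)) \<partial>lborel \<partial>lborel) = (\<integral>\<^sup>+y. \<integral>\<^sup>+x. indicator K y * ennreal (dens (x - y)) \<partial>lborel \<partial>lborel)"
    by (subst lborel_pair.Fubini') auto
  also have "\<dots> = (\<integral>\<^sup>+y. indicator K y * (\<integral>\<^sup>+w. ennreal (dens w) \<partial>lborel) \<partial>lborel)"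
    by (intro nn_integral_cong) (simp add: nn_integral_cmult nn_integral_shift[of "\<lambda>w. ennreal (dens w)"])
  also have "(\<integral>\<^sup>+x. \<integral>\<^sup>+y. indicator K x * ennreal (dens (x - y)) \<partial>lborel \<partial>lborel) = (\<integral>\<^sup>+x. indicator K x * (\<integral>\<^sup>+w. ennreal (dens w) \<partial>lborel) \<partial>lborel)"
    by (intro nn_integral_cong) (simp add: nn_integral_cmult nn_integral_reflect[of "\<lambda>w. ennreal (dens w)"])
  also have "(\<integral>\<^sup>+x. indicator K x * (\<integral>\<^sup>+w. ennreal (dens w) \<partial>lborel) \<partial>lborel) = emeasure lborel K * (\<integral>\<^sup>+w. ennreal (dens w) \<partial>lborel)"
    by (subst nn_integral_multc) auto
  also have "\<dots> + \<dots> < \<infinity>"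
  proof -
    have "(\<integral>\<^sup>+w. ennreal (dens w) \<partial>lborel) < \<infinity>" using D(2) by (auto intro: le_less_trans)
    then show ?thesis using Kf by (simp add: ennreal_mult_less_top)
  qed
  finally show "emeasure pair_measure (space pair_measure) \<noteq> \<infinity>" by simp
qed

lemma near_triangle: "near k x y z \<Longrightarrow> norm (y - z) < 6 * scale k"
  using norm_triangle_ineq[of "y - x" "x - z"] by (simp add: near_def norm_minus_commute)

lemma nn_integral_near_pair:
  "(\<integral>\<^sup>+w. of_bool (near k x (fst w) (snd w)) \<partial>lborel)
     = ennreal ((unit_ball_vol (real DIM('a)))\<^sup>2 * 5 ^ DIM('a) * scale k powr (2 * real DIM('a)))"
proof -
  have "(\<integral>\<^sup>+w. of_bool (near k x (fst w) (snd w)) \<partial>lborel)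
    = (\<integral>\<^sup>+w. indicator (ball x (scale k) \<times> ball x (5 * scale k)) w \<partial>(lborel :: ('a \<times> 'a) measure))"
    by (rule nn_integral_cong) (auto simp: near_def indicator_def dist_norm)
  also have "\<dots> = emeasure (lborel :: ('a \<times> 'a) measure) (ball x (scale k) \<times> ball x (5 * scale k))"
    by (rule nn_integral_indicator) (simp add: borel_prod[symmetric])
  also have "\<dots> = emeasure lborel (ball x (scale k)) * emeasure lborel (ball x (5 * scale k))"
    unfolding lborel_prod[symmetric] by (rule lborel.emeasure_pair_measure_Times) auto
  also have "\<dots> = ennreal ((unit_ball_vol (real DIM('a)))\<^sup>2 * 5 ^ DIM('a) * scale k powr (2 * real DIM('a)))"
  proof -
    have "scale k powr (2 * real DIM('a)) = scale k ^ DIM('a) * scale k ^ DIM('a)"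
      by (simp only: mult_2 powr_add powr_realpow[OF scale_pos])
    then show ?thesis
      using less_imp_le[OF scale_pos[of k]]
      by (simp add: emeasure_ball ennreal_mult[symmetric] power2_eq_square power_mult_distrib mult_ac)
  qed
  finally show ?thesis .
qed

text \<open>The indicator on the right records that y and z less than 6 scales apart are necessary
  for any x to exist; it restricts later sums to scales not below |y - z| / 6.\<close>

lemma nn_integral_near:
  "(\<integral>\<^sup>+x. of_bool (near k x y z) \<partial>lborel)
     \<le> ennreal (unit_ball_vol (real DIM('a)) * scale k powr real DIM('a)) * of_bool (norm (y - z) / 6 \<le> scale k)"
proof (cases "norm (y - z) / 6 \<le> scale k")
  case True
  have "(\<integral>\<^sup>+x. of_bool (near k x y z) \<partial>lborel) \<le> (\<integral>\<^sup>+x. indicator (ball y (scale k)) x \<partial>lborel)"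
    by (rule nn_integral_mono) (auto simp: near_def indicator_def dist_norm norm_minus_commute)
  also have "\<dots> = emeasure lborel (ball y (scale k))" by simp
  finally show ?thesis using True less_imp_le[OF scale_pos[of k]] by (simp add: emeasure_ball powr_realpow)
next
  case False
  then have "\<not> near k x y z" for x using near_triangle[of k x y z] by auto
  then show ?thesis by simp
qed

text \<open>At scale t the weight \<open>gap\<close> contributes t^(s+\<tau>), the difference of
  pieces min 1 (r/t) t^(-2d) with r = |x - x'|, and the pairs (y, z) a volume t^(2d). Summing over t
  gives r^(s+\<tau>) because s + \<tau> < 1.\<close>

lemma avg_kernel_row_bound:
  "\<exists>C>0. \<forall>x x'. (\<integral>\<^sup>+w. ennreal (gap (fst w - snd w)) * ennreal \<bar>avg_kernel x (fst w) (snd w) - avg_kernel x' (fst w) (snd w)\<bar> \<partial>lborel)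
     \<le> ennreal (C * min (norm (x - x')) T powr (s + \<tau>))"
proof -
  obtain Cb where Cb: "Cb > 0"
    "\<And>k x x' y z. \<bar>piece k x y z - piece k x' y z\<bar> \<le> Cb * min 1 (norm (x - x') / scale k) * scale k powr (- 2 * real DIM('a))
        * (of_bool (near k x y z) + of_bool (near k x' y z))"
    using piece_bounds by blast
  define \<gamma> where "\<gamma> = s + \<tau>"
  have \<gamma>: "0 < \<gamma>" "\<gamma> < 1" using order_bounds \<tau>_pos order_less_1 by (auto simp: \<gamma>_def)
  define V where "V = (unit_ball_vol (real DIM('a)))\<^sup>2 * 5 ^ DIM('a)"
  have V: "V > 0" unfolding V_def by (intro mult_pos_pos zero_less_power unit_ball_vol_pos) auto
  define C1 where "C1 = Cb * 6 powr \<gamma> * (2 * V)"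
  have C1: "C1 > 0" using Cb V by (simp add: C1_def)
  define S where "S = 1 / (1 - 2 powr (- \<gamma>)) + 1 / (1 - 2 powr (\<gamma> - 1))"
  have S: "S > 0" using powr_less_mono[of "- \<gamma>" 0 2] powr_less_mono[of "\<gamma> - 1" 0 2] \<gamma> by (simp add: S_def add_pos_pos)
  show ?thesis
  proof (intro exI[of _ "C1 * S"] conjI allI)
    show "0 < C1 * S" using C1 S by simp
    fix x x' :: 'a
    define r where "r = norm (x - x')"
    have r: "0 \<le> r" by (simp add: r_def)
    define a where "a k = Cb * min 1 (r / scale k) * scale k powr (- 2 * real DIM('a)) * (6 * scale k) powr \<gamma>" for k
    have a: "0 \<le> a k" for k unfolding a_def using Cb(1) divide_nonneg_pos[OF r scale_pos[of k]] by (intro mult_nonneg_nonneg) auto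
    define f where "f k w = ennreal (a k) * (of_bool (near k x (fst w) (snd w)) + of_bool (near k x' (fst w) (snd w)))" for k and w :: "'a \<times> 'a"
    have fm [measurable]: "f k \<in> borel_measurable borel" for k unfolding f_def by measurable
    have pw: "ennreal (gap (y - z)) * ennreal \<bar>piece k x y z - piece k x' y z\<bar> \<le> f k (y, z)" for k y z
    proof (cases "near k x y z \<or> near k x' y z")
      case False
      then show ?thesis using Cb(2)[of k x y z x'] by simp
    next
      case True
      then have "norm (y - z) \<le> 6 * scale k" using near_triangle[of k x y z] near_triangle[of k x' y z] by auto
      then have "gap (y - z) \<le> (6 * scale k) powr \<gamma>"
        using gap_le[of "y - z"] \<gamma> unfolding \<gamma>_def by (intro order_trans[OF gap_le] powr_mono2) auto
      then have "gap (y - z) * \<bar>piece k x y z - piece k x' y z\<bar>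
         \<le> (6 * scale k) powr \<gamma> * (Cb * min 1 (norm (x - x') / scale k) * scale k powr (- 2 * real DIM('a)) * (of_bool (near k x y z) + of_bool (near k x' y z)))"
        by (intro mult_mono Cb(2)) auto
      also have "\<dots> = a k * (of_bool (near k x y z) + of_bool (near k x' y z))" by (simp add: a_def r_def)
      finally have "ennreal (gap (y - z) * \<bar>piece k x y z - piece k x' y z\<bar>) \<le> ennreal (a k * (of_bool (near k x y z) + of_bool (near k x' y z)))"
        by (rule ennreal_leI)
      then show ?thesis using a[of k]
        by (cases "near k x y z"; cases "near k x' y z") (auto simp: f_def ennreal_mult)
    qed
    have "(\<integral>\<^sup>+w. ennreal (gap (fst w - snd w)) * ennreal \<bar>avg_kernel x (fst w) (snd w) - avg_kernel x' (fst w) (snd w)\<bar> \<partial>lborel)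
       \<le> (\<integral>\<^sup>+w. (\<Sum>k. f k w) \<partial>lborel)"
    proof (rule nn_integral_mono)
      fix w :: "'a \<times> 'a"
      obtain y z where w: "w = (y, z)" by (cases w)
      show "ennreal (gap (fst w - snd w)) * ennreal \<bar>avg_kernel x (fst w) (snd w) - avg_kernel x' (fst w) (snd w)\<bar> \<le> (\<Sum>k. f k w)"
      proof (cases "y = z")
        case True
        then show ?thesis by (simp add: w)
      next
        case False
        have "ennreal (gap (y - z)) * ennreal \<bar>avg_kernel x y z - avg_kernel x' y z\<bar> \<le> ennreal (gap (y - z)) * (\<Sum>k. ennreal \<bar>piece k x y z - piece k x' y z\<bar>)"
          by (intro mult_left_mono avg_kernel_diff_le False) auto
        also have "\<dots> = (\<Sum>k. ennreal (gap (y - z)) * ennreal \<bar>piece k x y z - piece k x' y z\<bar>)"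
          by (rule ennreal_suminf_cmult[symmetric])
        also have "\<dots> \<le> (\<Sum>k. f k (y, z))" by (intro suminf_le pw) auto
        finally show ?thesis by (simp add: w)
      qed
    qed
    also have "\<dots> = (\<Sum>k. \<integral>\<^sup>+w. f k w \<partial>lborel)"
      by (rule nn_integral_suminf) simp
    also have "\<dots> = (\<Sum>k. ennreal C1 * ennreal (min 1 (r / (T / 2 ^ k)) * (T / 2 ^ k) powr \<gamma>))"
    proof (rule suminf_cong)
      fix k
      have "(\<integral>\<^sup>+w. f k w \<partial>lborel) = ennreal (a k) * ((\<integral>\<^sup>+w. of_bool (near k x (fst w) (snd w)) \<partial>lborel) + (\<integral>\<^sup>+w. of_bool (near k x' (fst w) (snd w)) \<partial>lborel))"
        unfolding f_def by (subst nn_integral_cmult, measurable, subst nn_integral_add, measurable)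
      also have "\<dots> = ennreal (a k) * (ennreal (V * scale k powr (2 * real DIM('a))) + ennreal (V * scale k powr (2 * real DIM('a))))"
        unfolding nn_integral_near_pair V_def ..
      also have "\<dots> = ennreal (a k * (2 * V * scale k powr (2 * real DIM('a))))"
        using V a[of k] by (simp add: ennreal_mult[symmetric] ennreal_plus[symmetric] del: ennreal_plus)
      also have "a k * (2 * V * scale k powr (2 * real DIM('a))) = C1 * (min 1 (r / scale k) * scale k powr \<gamma>)"
      proof -
        have "scale k powr (- 2 * real DIM('a)) * scale k powr (2 * real DIM('a)) = 1" by (simp flip: powr_add)
        moreover have "(6 * scale k) powr \<gamma> = 6 powr \<gamma> * scale k powr \<gamma>" by (simp add: powr_mult)
        ultimately show ?thesis by (simp add: a_def C1_def algebra_simps)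
      qed
      finally show "(\<integral>\<^sup>+w. f k w \<partial>lborel) = ennreal C1 * ennreal (min 1 (r / (T / 2 ^ k)) * (T / 2 ^ k) powr \<gamma>)"
        using C1 divide_nonneg_pos[OF r scale_pos[of k]]
        unfolding scale_def by (subst ennreal_mult[symmetric]) (auto intro!: mult_nonneg_nonneg)
    qed
    also have "\<dots> = ennreal C1 * (\<Sum>k. ennreal (min 1 (r / (T / 2 ^ k)) * (T / 2 ^ k) powr \<gamma>))"
      by (rule ennreal_suminf_cmult)
    also have "\<dots> \<le> ennreal C1 * ennreal (S * min r T powr \<gamma>)"
      unfolding S_def by (intro mult_left_mono dyadic_sum_Lipschitz T_pos \<gamma> r) auto
    also have "\<dots> = ennreal (C1 * S * min (norm (x - x')) T powr (s + \<tau>))"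
      using C1 S by (simp add: ennreal_mult[symmetric] r_def \<gamma>_def mult.assoc)
    finally show "(\<integral>\<^sup>+w. ennreal (gap (fst w - snd w)) * ennreal \<bar>avg_kernel x (fst w) (snd w) - avg_kernel x' (fst w) (snd w)\<bar> \<partial>lborel)
       \<le> ennreal (C1 * S * min (norm (x - x')) T powr (s + \<tau>))" .
  qed
qed

lemma piece_decay_sum:
  fixes b :: real
  assumes "0 < b" "y \<noteq> z"
  shows "(\<Sum>k. ennreal (scale k powr (- b)) * of_bool (norm (y - z) / 6 \<le> scale k))
     \<le> ennreal (6 powr b / (1 - 2 powr (- b)) * norm (y - z) powr (- b))"
proof -
  have "(\<Sum>k. ennreal (scale k powr (- b)) * of_bool (norm (y - z) / 6 \<le> scale k))
    = (\<Sum>k. ennreal (if norm (y - z) / 6 \<le> T / 2 ^ k then (T / 2 ^ k) powr (- b) else 0))"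
    by (intro suminf_cong) (simp add: scale_def)
  also have "\<dots> \<le> ennreal ((norm (y - z) / 6) powr (- b) / (1 - 2 powr (- b)))"
    by (rule dyadic_sum_large_scales[OF T_pos assms(1)]) (use assms(2) in simp)
  also have "(norm (y - z) / 6) powr (- b) / (1 - 2 powr (- b)) = 6 powr b / (1 - 2 powr (- b)) * norm (y - z) powr (- b)"
  proof -
    have "(norm (y - z) / 6) powr (- b) = 6 powr b * norm (y - z) powr (- b)"
      by (simp add: powr_divide powr_minus_divide)
    then show ?thesis by simp
  qed
  finally show ?thesis .
qed

text \<open>At scale t the integral of min 1 (|w|/t) |w|^(\<tau>-s-d) is of order t^(\<tau>-s): it
  converges at 0 by the Lipschitz factor, as s - \<tau> < 1, and at infinity as \<tau> < s. With the
  size t^(-2d) of the piece and the volume t^d of admissible points this is t^(\<tau>-s-d), and only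
  t \<ge> |y - z| / 6 occur.\<close>

lemma avg_kernel_column_bound:
  "\<exists>C>0. \<forall>y z. y \<noteq> z \<longrightarrow> (\<integral>\<^sup>+w. ennreal (norm (fst w - snd w) powr (\<tau> - s - real DIM('a))) * ennreal \<bar>avg_kernel (fst w) y z - avg_kernel (snd w) y z\<bar> \<partial>lborel)
     \<le> ennreal (C * norm (y - z) powr (\<tau> - s - real DIM('a)))"
proof -
  obtain Cb where Cb: "Cb > 0"
    "\<And>k x x' y z. \<bar>piece k x y z - piece k x' y z\<bar> \<le> Cb * min 1 (norm (x - x') / scale k) * scale k powr (- 2 * real DIM('a))
        * (of_bool (near k x y z) + of_bool (near k x' y z))"
    using piece_bounds by blast
  define d where "d = real DIM('a)"
  obtain C1 where C1: "C1 \<ge> 0" "\<And>t. t > 0 \<Longrightarrow> (\<integral>\<^sup>+w. ennreal (if norm w \<le> t then norm w powr (1 + \<tau> - s - d) else 0) \<partial>(lborel :: 'a measure)) \<le> ennreal (C1 * t powr (1 + \<tau> - s))"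
    using nn_integral_norm_powr_inside[where 'a='a, of "1 + \<tau> - s"] order_bounds \<tau>_pos unfolding d_def by auto
  obtain C2 where C2: "C2 \<ge> 0" "\<And>t. t > 0 \<Longrightarrow> (\<integral>\<^sup>+w. ennreal (if t \<le> norm w then norm w powr (\<tau> - s - d) else 0) \<partial>(lborel :: 'a measure)) \<le> ennreal (C2 * t powr (\<tau> - s))"
    using nn_integral_norm_powr_outside[where 'a='a, of "s - \<tau>"] \<tau>_less unfolding d_def minus_diff_eq by auto
  define V where "V = unit_ball_vol (real DIM('a))"
  have V: "V > 0" unfolding V_def by (intro unit_ball_vol_pos) auto
  define h where "h k w = min 1 (norm w / scale k) * norm w powr (\<tau> - s - d)" for k and w :: 'a
  have h0: "0 \<le> h k w" for k w
    unfolding h_def using divide_nonneg_pos[OF norm_ge_zero scale_pos, of w k] by (intro mult_nonneg_nonneg) auto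
  have hm [measurable]: "h k \<in> borel_measurable borel" for k unfolding h_def[abs_def] by measurable
  have h_int: "(\<integral>\<^sup>+w. ennreal (h k w) \<partial>lborel) \<le> ennreal ((C1 + C2) * scale k powr (\<tau> - s))" for k
  proof -
    define t where "t = scale k"
    have t: "0 < t" by (simp add: t_def)
    have "(\<integral>\<^sup>+w. ennreal (h k w) \<partial>lborel) \<le> (\<integral>\<^sup>+w. ennreal (1 / t) * ennreal (if norm w \<le> t then norm w powr (1 + \<tau> - s - d) else 0)
        + ennreal (if t \<le> norm w then norm w powr (\<tau> - s - d) else 0) \<partial>(lborel :: 'a measure))"
    proof (rule nn_integral_mono)
      fix w :: 'a
      show "ennreal (h k w) \<le> ennreal (1 / t) * ennreal (if norm w \<le> t then norm w powr (1 + \<tau> - s - d) else 0)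
        + ennreal (if t \<le> norm w then norm w powr (\<tau> - s - d) else 0)"
      proof (cases "norm w \<le> t")
        case True
        have "h k w \<le> norm w / t * norm w powr (\<tau> - s - d)"
          unfolding h_def t_def by (intro mult_right_mono) auto
        also have "\<dots> = 1 / t * norm w powr (1 + \<tau> - s - d)"
        proof (cases "w = 0")
          case False
          have e: "1 + \<tau> - s - d = 1 + (\<tau> - s - d)" by simp
          show ?thesis using False unfolding e powr_add by simp
        qed simp
        finally have "ennreal (h k w) \<le> ennreal (1 / t * norm w powr (1 + \<tau> - s - d))" by (rule ennreal_leI)
        also have "\<dots> = ennreal (1 / t) * ennreal (norm w powr (1 + \<tau> - s - d))" using t by (intro ennreal_mult) auto
        finally show ?thesis using True by (simp add: add_increasing2)
      next
        case False
        have "h k w \<le> 1 * norm w powr (\<tau> - s - d)" unfolding h_def by (intro mult_right_mono) auto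
        then show ?thesis using False by (simp add: ennreal_leI)
      qed
    qed
    also have "\<dots> = ennreal (1 / t) * (\<integral>\<^sup>+w. ennreal (if norm w \<le> t then norm w powr (1 + \<tau> - s - d) else 0) \<partial>(lborel :: 'a measure))
       + (\<integral>\<^sup>+w. ennreal (if t \<le> norm w then norm w powr (\<tau> - s - d) else 0) \<partial>(lborel :: 'a measure))"
      by (subst nn_integral_add) (auto simp: nn_integral_cmult)
    also have "\<dots> \<le> ennreal (1 / t) * ennreal (C1 * t powr (1 + \<tau> - s)) + ennreal (C2 * t powr (\<tau> - s))"
      by (intro add_mono mult_left_mono C1 C2 t) auto
    also have "\<dots> = ennreal (1 / t * (C1 * t powr (1 + \<tau> - s)) + C2 * t powr (\<tau> - s))"
      using C1(1) C2(1) t by (simp add: ennreal_mult[symmetric] ennreal_plus[symmetric] del: ennreal_plus)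
    also have "1 / t * (C1 * t powr (1 + \<tau> - s)) = C1 * t powr (\<tau> - s)"
    proof -
      have e: "1 + \<tau> - s = 1 + (\<tau> - s)" by simp
      show ?thesis using t unfolding e powr_add by simp
    qed
    finally show ?thesis by (simp add: t_def distrib_right)
  qed
  define b where "b = d + s - \<tau>"
  have b: "0 < b" using \<tau>_less by (simp add: b_def d_def add_nonneg_pos)
  have C12: "C1 + C2 \<ge> 0" using C1 C2 by simp
  define C' where "C' = Cb * (2 * (C1 + C2) * V)"
  have C': "C' \<ge> 0" using Cb C12 V by (simp add: C'_def)
  define S where "S = 6 powr b / (1 - 2 powr (- b))"
  have S: "S > 0" using powr_less_mono[of "- b" 0 2] b by (simp add: S_def)
  show ?thesis
  \<comment> \<open>C1 and C2 are only known to be nonnegative; the summand 1 makes the constant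
    positive.\<close>
  proof (intro exI[of _ "C' * S + 1"] conjI allI impI)
    show "0 < C' * S + 1" using C' S by (simp add: add_nonneg_pos)
    fix y z :: 'a assume yz: "y \<noteq> z"
    define a where "a k = Cb * scale k powr (- 2 * d)" for k
    have a: "0 \<le> a k" for k using Cb by (simp add: a_def)
    define f where "f k w = ennreal (a k) * (ennreal (h k (fst w - snd w)) * of_bool (near k (fst w) y z) + ennreal (h k (fst w - snd w)) * of_bool (near k (snd w) y z))" for k and w :: "'a \<times> 'a"
    have fm [measurable]: "f k \<in> borel_measurable borel" for k unfolding f_def by measurable
    have pw: "ennreal (norm (x - x') powr (\<tau> - s - d)) * ennreal \<bar>piece k x y z - piece k x' y z\<bar> \<le> f k (x, x')" for k x x'
    proof -
      have "norm (x - x') powr (\<tau> - s - d) * \<bar>piece k x y z - piece k x' y z\<bar>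
        \<le> norm (x - x') powr (\<tau> - s - d) * (Cb * min 1 (norm (x - x') / scale k) * scale k powr (- 2 * real DIM('a)) * (of_bool (near k x y z) + of_bool (near k x' y z)))"
        by (intro mult_left_mono Cb(2)) auto
      also have "\<dots> = a k * (h k (x - x') * of_bool (near k x y z) + h k (x - x') * of_bool (near k x' y z))"
        by (simp add: a_def h_def d_def algebra_simps)
      finally have "ennreal (norm (x - x') powr (\<tau> - s - d) * \<bar>piece k x y z - piece k x' y z\<bar>)
        \<le> ennreal (a k * (h k (x - x') * of_bool (near k x y z) + h k (x - x') * of_bool (near k x' y z)))"
        by (rule ennreal_leI)
      also have "\<dots> = f k (x, x')"
      proof -
        have e: "ennreal (v * of_bool P) = ennreal v * of_bool P" for v P by (cases P) auto
        have n: "0 \<le> h k (x - x') * of_bool P" for P using h0 by simp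
        show ?thesis
          unfolding f_def fst_conv snd_conv ennreal_mult[OF a add_nonneg_nonneg[OF n n]] ennreal_plus[OF n n] e ..
      qed
      finally show ?thesis by (simp add: ennreal_mult)
    qed
    have "(\<integral>\<^sup>+w. ennreal (norm (fst w - snd w) powr (\<tau> - s - d)) * ennreal \<bar>avg_kernel (fst w) y z - avg_kernel (snd w) y z\<bar> \<partial>lborel)
       \<le> (\<integral>\<^sup>+w. (\<Sum>k. f k w) \<partial>lborel)"
    proof (rule nn_integral_mono)
      fix w :: "'a \<times> 'a"
      have "ennreal (norm (fst w - snd w) powr (\<tau> - s - d)) * ennreal \<bar>avg_kernel (fst w) y z - avg_kernel (snd w) y z\<bar>
        \<le> ennreal (norm (fst w - snd w) powr (\<tau> - s - d)) * (\<Sum>k. ennreal \<bar>piece k (fst w) y z - piece k (snd w) y z\<bar>)"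
        by (intro mult_left_mono avg_kernel_diff_le yz) auto
      also have "\<dots> = (\<Sum>k. ennreal (norm (fst w - snd w) powr (\<tau> - s - d)) * ennreal \<bar>piece k (fst w) y z - piece k (snd w) y z\<bar>)"
        by (rule ennreal_suminf_cmult[symmetric])
      also have "\<dots> \<le> (\<Sum>k. f k (fst w, snd w))" by (intro suminf_le pw) auto
      finally show "ennreal (norm (fst w - snd w) powr (\<tau> - s - d)) * ennreal \<bar>avg_kernel (fst w) y z - avg_kernel (snd w) y z\<bar> \<le> (\<Sum>k. f k w)" by simp
    qed
    also have "\<dots> = (\<Sum>k. \<integral>\<^sup>+w. f k w \<partial>lborel)"
      by (rule nn_integral_suminf) simp
    also have "\<dots> \<le> (\<Sum>k. ennreal C' * (ennreal (scale k powr (- b)) * of_bool (norm (y - z) / 6 \<le> scale k)))"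
    proof (rule suminf_le)
      fix k
      define H where "H = (\<integral>\<^sup>+w. ennreal (h k w) \<partial>lborel)"
      define I where "I = (\<integral>\<^sup>+x. of_bool (near k x y z) \<partial>lborel)"
      have A1: "(\<integral>\<^sup>+w. ennreal (h k (fst w - snd w)) * of_bool (near k (fst w) y z) \<partial>lborel) = H * I"
      proof -
        have "(\<integral>\<^sup>+w. ennreal (h k (fst w - snd w)) * of_bool (near k (fst w) y z) \<partial>lborel)
          = (\<integral>\<^sup>+x. \<integral>\<^sup>+x'. ennreal (h k (x - x')) * of_bool (near k x y z) \<partial>lborel \<partial>lborel)"
          by (subst nn_integral_lborel_pair) (simp_all, measurable)
        also have "\<dots> = (\<integral>\<^sup>+x. H * of_bool (near k x y z) \<partial>lborel)"
          unfolding H_def by (intro nn_integral_cong) (simp add: nn_integral_multc nn_integral_reflect[of "\<lambda>w. ennreal (h k w)"])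
        also have "\<dots> = H * I" unfolding I_def by (rule nn_integral_cmult) measurable
        finally show ?thesis .
      qed
      have A2: "(\<integral>\<^sup>+w. ennreal (h k (fst w - snd w)) * of_bool (near k (snd w) y z) \<partial>lborel) = H * I"
      proof -
        have "(\<integral>\<^sup>+w. ennreal (h k (fst w - snd w)) * of_bool (near k (snd w) y z) \<partial>lborel)
          = (\<integral>\<^sup>+x. \<integral>\<^sup>+x'. ennreal (h k (x - x')) * of_bool (near k x' y z) \<partial>lborel \<partial>lborel)"
          by (subst nn_integral_lborel_pair) (simp_all, measurable)
        also have "\<dots> = (\<integral>\<^sup>+x'. \<integral>\<^sup>+x. ennreal (h k (x - x')) * of_bool (near k x' y z) \<partial>lborel \<partial>lborel)"
          by (subst lborel_pair.Fubini') auto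
        also have "\<dots> = (\<integral>\<^sup>+x'. H * of_bool (near k x' y z) \<partial>lborel)"
          unfolding H_def by (intro nn_integral_cong) (simp add: nn_integral_multc nn_integral_shift[of "\<lambda>w. ennreal (h k w)"])
        also have "\<dots> = H * I" unfolding I_def by (rule nn_integral_cmult) measurable
        finally show ?thesis .
      qed
      have "(\<integral>\<^sup>+w. f k w \<partial>lborel) = ennreal (a k) * (H * I + H * I)"
        unfolding A1[symmetric] unfolding A1 A2[symmetric] unfolding f_def
        by (subst nn_integral_cmult, measurable, subst nn_integral_add, measurable, simp add: A1 A2)
      also have "\<dots> = ennreal (2 * a k) * (H * I)"
        using a[of k] by (simp add: mult_2[symmetric] ennreal_mult mult_ac)
      also have "\<dots> \<le> ennreal (2 * a k) * (ennreal ((C1 + C2) * scale k powr (\<tau> - s)) * (ennreal (V * scale k powr d) * of_bool (norm (y - z) / 6 \<le> scale k)))"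
        unfolding H_def I_def V_def d_def
        by (intro mult_left_mono mult_mono h_int[unfolded d_def] nn_integral_near) auto
      also have "\<dots> = ennreal (2 * a k * ((C1 + C2) * scale k powr (\<tau> - s)) * (V * scale k powr d)) * of_bool (norm (y - z) / 6 \<le> scale k)"
        using a[of k] C12 V by (simp add: ennreal_mult mult.assoc)
      also have "2 * a k * ((C1 + C2) * scale k powr (\<tau> - s)) * (V * scale k powr d) = C' * scale k powr (- b)"
      proof -
        have "scale k powr (- b) = scale k powr (- 2 * d) * scale k powr (\<tau> - s) * scale k powr d"
        proof -
          have e: "- b = - 2 * d + (\<tau> - s) + d" by (simp add: b_def)
          show ?thesis unfolding e powr_add ..
        qed
        then show ?thesis by (simp add: a_def C'_def mult_ac)
      qed
      finally show "(\<integral>\<^sup>+w. f k w \<partial>lborel) \<le> ennreal C' * (ennreal (scale k powr (- b)) * of_bool (norm (y - z) / 6 \<le> scale k))"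
        using C' by (simp add: ennreal_mult mult.assoc)
    qed auto
    also have "\<dots> = ennreal C' * (\<Sum>k. ennreal (scale k powr (- b)) * of_bool (norm (y - z) / 6 \<le> scale k))"
      by (rule ennreal_suminf_cmult)
    also have "\<dots> \<le> ennreal C' * ennreal (S * norm (y - z) powr (- b))"
      unfolding S_def by (intro mult_left_mono piece_decay_sum b yz) auto
    also have "\<dots> = ennreal (C' * S * norm (y - z) powr (- b))"
      using C' S by (simp add: ennreal_mult[symmetric] mult.assoc)
    also have "\<dots> \<le> ennreal ((C' * S + 1) * norm (y - z) powr (- b))"
      by (intro ennreal_leI mult_right_mono) auto
    finally show "(\<integral>\<^sup>+w. ennreal (norm (fst w - snd w) powr (\<tau> - s - real DIM('a))) * ennreal \<bar>avg_kernel (fst w) y z - avg_kernel (snd w) y z\<bar> \<partial>lborel)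
       \<le> ennreal ((C' * S + 1) * norm (y - z) powr (\<tau> - s - real DIM('a)))"
      by (simp add: b_def d_def algebra_simps)
  qed
qed

text \<open>Without a difference in x each scale contributes t^(-2d) t^d. This bound is what makes
  the reconstruction integral exist at almost every x.\<close>

lemma avg_kernel_column_mass:
  "\<exists>C>0. \<forall>y z. y \<noteq> z \<longrightarrow> (\<integral>\<^sup>+x. ennreal (avg_kernel x y z) \<partial>lborel) \<le> ennreal (C * norm (y - z) powr (- real DIM('a)))"
proof -
  obtain Cb where Cb: "Cb > 0"
    "\<And>k x y z. piece k x y z \<le> Cb * scale k powr (- 2 * real DIM('a)) * of_bool (near k x y z)"
    using piece_bounds by blast
  define d where "d = real DIM('a)"
  have d: "0 < d" by (simp add: d_def)
  define V where "V = unit_ball_vol (real DIM('a))"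
  have V: "V > 0" unfolding V_def by (intro unit_ball_vol_pos) auto
  define S where "S = 6 powr d / (1 - 2 powr (- d))"
  have S: "S > 0" using powr_less_mono[of "- d" 0 2] d by (simp add: S_def)
  show ?thesis
  proof (intro exI[of _ "Cb * V * S"] conjI allI impI)
    show "0 < Cb * V * S" using Cb V S by simp
    fix y z :: 'a assume yz: "y \<noteq> z"
    have "(\<integral>\<^sup>+x. ennreal (avg_kernel x y z) \<partial>lborel) = (\<integral>\<^sup>+x. (\<Sum>k. ennreal (piece k x y z)) \<partial>lborel)"
      by (simp add: avg_kernel_eq[OF yz])
    also have "\<dots> = (\<Sum>k. \<integral>\<^sup>+x. ennreal (piece k x y z) \<partial>lborel)"
      by (rule nn_integral_suminf) measurable
    also have "\<dots> \<le> (\<Sum>k. ennreal (Cb * V) * (ennreal (scale k powr (- d)) * of_bool (norm (y - z) / 6 \<le> scale k)))"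
    proof (rule suminf_le)
      fix k
      have "(\<integral>\<^sup>+x. ennreal (piece k x y z) \<partial>lborel) \<le> (\<integral>\<^sup>+x. ennreal (Cb * scale k powr (- 2 * d)) * of_bool (near k x y z) \<partial>lborel)"
      proof (rule nn_integral_mono)
        fix x
        show "ennreal (piece k x y z) \<le> ennreal (Cb * scale k powr (- 2 * d)) * of_bool (near k x y z)"
          using Cb(2)[of k x y z] Cb(1) by (cases "near k x y z") (auto simp: d_def ennreal_neg intro: ennreal_leI)
      qed
      also have "\<dots> = ennreal (Cb * scale k powr (- 2 * d)) * (\<integral>\<^sup>+x. of_bool (near k x y z) \<partial>lborel)"
        by (rule nn_integral_cmult) measurable
      also have "\<dots> \<le> ennreal (Cb * scale k powr (- 2 * d)) * (ennreal (V * scale k powr d) * of_bool (norm (y - z) / 6 \<le> scale k))"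
        unfolding V_def d_def by (intro mult_left_mono nn_integral_near) auto
      also have "\<dots> = ennreal (Cb * scale k powr (- 2 * d) * (V * scale k powr d)) * of_bool (norm (y - z) / 6 \<le> scale k)"
        using Cb V by (simp add: ennreal_mult mult.assoc)
      also have "Cb * scale k powr (- 2 * d) * (V * scale k powr d) = Cb * V * scale k powr (- d)"
      proof -
        have "scale k powr (- d) = scale k powr (- 2 * d) * scale k powr d" by (simp flip: powr_add)
        then show ?thesis by (simp add: mult_ac)
      qed
      finally show "(\<integral>\<^sup>+x. ennreal (piece k x y z) \<partial>lborel) \<le> ennreal (Cb * V) * (ennreal (scale k powr (- d)) * of_bool (norm (y - z) / 6 \<le> scale k))"
        using Cb V by (simp add: ennreal_mult mult.assoc)
    qed auto
    also have "\<dots> = ennreal (Cb * V) * (\<Sum>k. ennreal (scale k powr (- d)) * of_bool (norm (y - z) / 6 \<le> scale k))"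
      by (rule ennreal_suminf_cmult)
    also have "\<dots> \<le> ennreal (Cb * V) * ennreal (S * norm (y - z) powr (- d))"
      unfolding S_def by (intro mult_left_mono piece_decay_sum d yz) auto
    also have "\<dots> = ennreal (Cb * V * S * norm (y - z) powr (- real DIM('a)))"
      using Cb V S by (simp add: ennreal_mult[symmetric] mult.assoc d_def)
    finally show "(\<integral>\<^sup>+x. ennreal (avg_kernel x y z) \<partial>lborel) \<le> ennreal (Cb * V * S * norm (y - z) powr (- real DIM('a)))" .
  qed
qed

end

lemma AE_lborel_pair:
  assumes "AE x in (lborel :: 'a::euclidean_space measure). P x"
  shows "AE w in (lborel :: ('a \<times> 'a) measure). P (fst w) \<and> P (snd w)"
proof -
  obtain N where N: "N \<in> null_sets lborel" "{x. \<not> P x} \<subseteq> N"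
    using assms by (auto simp: eventually_ae_filter)
  have Ns: "N \<in> sets lborel" using N(1) by (auto simp: null_sets_def)
  have 1: "N \<times> UNIV \<in> null_sets (lborel \<Otimes>\<^sub>M (lborel :: 'a measure))"
    using lborel.times_in_null_sets1[OF N(1), of UNIV] by simp
  have 2: "UNIV \<times> N \<in> null_sets ((lborel :: 'a measure) \<Otimes>\<^sub>M lborel)"
    by (intro lborel.times_in_null_sets2 N) simp
  have "N \<times> UNIV \<union> UNIV \<times> N \<in> null_sets (lborel :: ('a \<times> 'a) measure)"
    using null_sets.Un[OF 1 2] unfolding lborel_prod .
  then show ?thesis by (rule AE_I') (use N(2) in auto)
qed

section \<open>The Schur operator of difference quotients\<close>

context whitney_domain
begin

text \<open>
  The factor \<open>gap / dens\<close> turns integration against \<open>pair_measure\<close> into Lebesgue integration of differences.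
\<close>

definition grad_kernel :: "'a \<times> 'a \<Rightarrow> 'a \<times> 'a \<Rightarrow> real" where
  "grad_kernel w v = (avg_kernel (fst w) (fst v) (snd v) - avg_kernel (snd w) (fst v) (snd v)) / gap (fst w - snd w)
     * (gap (fst v - snd v) / dens (fst v - snd v))"

lemma grad_kernel_measurable: "(\<lambda>(w, v). grad_kernel w v) \<in> borel_measurable (pair_measure \<Otimes>\<^sub>M pair_measure)"
proof -
  have [measurable]: "fst \<in> pair_measure \<Otimes>\<^sub>M pair_measure \<rightarrow>\<^sub>M borel" "snd \<in> pair_measure \<Otimes>\<^sub>M pair_measure \<rightarrow>\<^sub>M borel"
    by (auto intro: measurable_fst'' measurable_snd'' simp: measurable_cong_sets[OF refl sets_pair_measure, symmetric])
  show ?thesis unfolding grad_kernel_def case_prod_unfold by measurable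
qed

text \<open>The measure contributes at most \<open>dens\<close>, which cancels the denominator in
  the second variable and leaves the weight \<open>gap\<close> of the row bound for averages. The
  resulting power of |x - x'|, capped at T, is at most \<open>gap\<close>, the remaining
  denominator.\<close>

lemma grad_kernel_row:
  assumes C: "0 < C" "\<And>x x'. (\<integral>\<^sup>+w. ennreal (gap (fst w - snd w)) * ennreal \<bar>avg_kernel x (fst w) (snd w) - avg_kernel x' (fst w) (snd w)\<bar> \<partial>lborel)
     \<le> ennreal (C * min (norm (x - x')) T powr (s + \<tau>))"
  shows "(\<integral>\<^sup>+v. ennreal \<bar>grad_kernel w v\<bar> \<partial>pair_measure) \<le> ennreal C"
proof (cases "fst w = snd w")
  case True
  then have "grad_kernel w v = 0" for v by (simp add: grad_kernel_def)
  then show ?thesis by simp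
next
  case False
  then have g: "gap (fst w - snd w) > 0" using gap_pos[of "fst w - snd w"] by simp
  have "(\<integral>\<^sup>+v. ennreal \<bar>grad_kernel w v\<bar> \<partial>pair_measure) = (\<integral>\<^sup>+v. ennreal (pair_density v) * ennreal \<bar>grad_kernel w v\<bar> \<partial>lborel)"
    by (rule nn_integral_pair_measure) (unfold grad_kernel_def, measurable)
  also have "\<dots> \<le> (\<integral>\<^sup>+v. ennreal (1 / gap (fst w - snd w)) * (ennreal (gap (fst v - snd v)) * ennreal \<bar>avg_kernel (fst w) (fst v) (snd v) - avg_kernel (snd w) (fst v) (snd v)\<bar>) \<partial>lborel)"
  proof (rule nn_integral_mono)
    fix v :: "'a \<times> 'a"
    define e where "e = \<bar>avg_kernel (fst w) (fst v) (snd v) - avg_kernel (snd w) (fst v) (snd v)\<bar>"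
    have "pair_density v * \<bar>grad_kernel w v\<bar> \<le> 1 / gap (fst w - snd w) * (gap (fst v - snd v) * e)"
    proof (cases "fst v = snd v")
      case True
      then show ?thesis by (simp add: grad_kernel_def)
    next
      case False
      then have dp: "dens (fst v - snd v) > 0" using dens_pos[of "fst v - snd v"] by simp
      have k: "\<bar>grad_kernel w v\<bar> = e / gap (fst w - snd w) * (gap (fst v - snd v) / dens (fst v - snd v))"
        by (simp add: grad_kernel_def e_def abs_mult)
      have "pair_density v * \<bar>grad_kernel w v\<bar> \<le> dens (fst v - snd v) * \<bar>grad_kernel w v\<bar>"
        using pair_density_le by (rule mult_right_mono) simp
      also have "dens (fst v - snd v) * \<bar>grad_kernel w v\<bar> = 1 / gap (fst w - snd w) * (gap (fst v - snd v) * e)"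
        using dp g unfolding k by (simp add: field_simps)
      finally show ?thesis .
    qed
    then have "ennreal (pair_density v * \<bar>grad_kernel w v\<bar>) \<le> ennreal (1 / gap (fst w - snd w) * (gap (fst v - snd v) * e))"
      by (rule ennreal_leI)
    then show "ennreal (pair_density v) * ennreal \<bar>grad_kernel w v\<bar> \<le> ennreal (1 / gap (fst w - snd w)) * (ennreal (gap (fst v - snd v)) * ennreal \<bar>avg_kernel (fst w) (fst v) (snd v) - avg_kernel (snd w) (fst v) (snd v)\<bar>)"
      unfolding e_def[symmetric] using g by (simp add: ennreal_mult[symmetric] e_def)
  qed
  also have "\<dots> = ennreal (1 / gap (fst w - snd w)) * (\<integral>\<^sup>+v. ennreal (gap (fst v - snd v)) * ennreal \<bar>avg_kernel (fst w) (fst v) (snd v) - avg_kernel (snd w) (fst v) (snd v)\<bar> \<partial>lborel)"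
    by (rule nn_integral_cmult) measurable
  also have "\<dots> \<le> ennreal (1 / gap (fst w - snd w)) * ennreal (C * min (norm (fst w - snd w)) T powr (s + \<tau>))"
    by (intro mult_left_mono C) auto
  also have "\<dots> = ennreal (1 / gap (fst w - snd w) * (C * min (norm (fst w - snd w)) T powr (s + \<tau>)))"
    using g C(1) by (intro ennreal_mult[symmetric]) auto
  also have "\<dots> \<le> ennreal C"
  proof (rule ennreal_leI)
    have "min (norm (fst w - snd w)) T powr (s + \<tau>) \<le> gap (fst w - snd w)"
      unfolding gap_def using T_pos order_bounds \<tau>_pos by (intro powr_mono2) auto
    then have "C * min (norm (fst w - snd w)) T powr (s + \<tau>) \<le> C * gap (fst w - snd w)"
      using C(1) by simp
    then show "1 / gap (fst w - snd w) * (C * min (norm (fst w - snd w)) T powr (s + \<tau>)) \<le> C"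
      using g by (simp add: field_simps)
  qed
  finally show ?thesis .
qed

lemma dens_div_gap: "dens w / gap w \<le> norm w powr (\<tau> - s - real DIM('a))"
proof (cases "w = 0")
  case False
  have e: "\<tau> - s - real DIM('a) = (s + \<tau>) + - (real DIM('a) + 2 * s)" by simp
  have "dens w / gap w = gap w * norm w powr (- (real DIM('a) + 2 * s))"
    using gap_pos[OF False] by (simp add: dens_def power2_eq_square)
  also have "\<dots> \<le> norm w powr (s + \<tau>) * norm w powr (- (real DIM('a) + 2 * s))"
    by (intro mult_right_mono gap_le) auto
  finally show ?thesis unfolding e powr_add .
qed simp

lemma gap_div_dens: "w \<noteq> 0 \<Longrightarrow> norm w < 6 * T \<Longrightarrow> gap w / dens w * norm w powr (\<tau> - s - real DIM('a)) = 1"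
proof -
  assume w: "w \<noteq> 0" "norm w < 6 * T"
  have g: "gap w = norm w powr (s + \<tau>)" using w by (intro gap_small) simp
  have d: "dens w = norm w powr (2 * \<tau> - real DIM('a))" using w by (intro dens_small) simp
  show ?thesis unfolding g d using w by (simp add: powr_diff[symmetric] flip: powr_add)
qed

text \<open>In the first variable \<open>dens / gap\<close> is at most the weight of the column
  bound for averages. The factor \<open>gap / dens\<close> in the second variable is the exact
  reciprocal of the right side there as long as |y - z| < 6 T; beyond that the kernel
  vanishes.\<close>

lemma grad_kernel_col:
  assumes C: "0 < C" "\<And>y z. y \<noteq> z \<Longrightarrow> (\<integral>\<^sup>+w. ennreal (norm (fst w - snd w) powr (\<tau> - s - real DIM('a))) * ennreal \<bar>avg_kernel (fst w) y z - avg_kernel (snd w) y z\<bar> \<partial>lborel)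
     \<le> ennreal (C * norm (y - z) powr (\<tau> - s - real DIM('a)))"
  shows "(\<integral>\<^sup>+w. ennreal \<bar>grad_kernel w v\<bar> \<partial>pair_measure) \<le> ennreal C"
proof (cases "fst v \<noteq> snd v \<and> norm (fst v - snd v) < 6 * T")
  case False
  have "grad_kernel w v = 0" for w
  proof (cases "fst v = snd v")
    case True
    then show ?thesis by (simp add: grad_kernel_def)
  next
    case F: False
    then have "avg_kernel x (fst v) (snd v) = 0" for x using False avg_kernel_support(3)[of x "fst v" "snd v"] by auto
    then show ?thesis by (simp add: grad_kernel_def)
  qed
  then show ?thesis by simp
next
  case True
  define y z where "y = fst v" and "z = snd v"
  have yz: "y \<noteq> z" "norm (y - z) < 6 * T" using True by (auto simp: y_def z_def)
  define \<omega> where "\<omega> = gap (y - z) / dens (y - z)"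
  have \<omega>: "\<omega> \<ge> 0" by (simp add: \<omega>_def)
  have "(\<integral>\<^sup>+w. ennreal \<bar>grad_kernel w v\<bar> \<partial>pair_measure) = (\<integral>\<^sup>+w. ennreal (pair_density w) * ennreal \<bar>grad_kernel w v\<bar> \<partial>lborel)"
    by (rule nn_integral_pair_measure) (unfold grad_kernel_def, measurable)
  also have "\<dots> \<le> (\<integral>\<^sup>+w. ennreal \<omega> * (ennreal (norm (fst w - snd w) powr (\<tau> - s - real DIM('a))) * ennreal \<bar>avg_kernel (fst w) y z - avg_kernel (snd w) y z\<bar>) \<partial>lborel)"
  proof (rule nn_integral_mono)
    fix w :: "'a \<times> 'a"
    define e where "e = \<bar>avg_kernel (fst w) y z - avg_kernel (snd w) y z\<bar>"
    have e: "e \<ge> 0" by (simp add: e_def)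
    have k: "\<bar>grad_kernel w v\<bar> = e / gap (fst w - snd w) * \<omega>"
      by (simp add: grad_kernel_def e_def y_def z_def \<omega>_def abs_mult)
    have "pair_density w * \<bar>grad_kernel w v\<bar> \<le> dens (fst w - snd w) * \<bar>grad_kernel w v\<bar>"
      using pair_density_le by (rule mult_right_mono) simp
    also have "dens (fst w - snd w) * \<bar>grad_kernel w v\<bar> = \<omega> * (dens (fst w - snd w) / gap (fst w - snd w) * e)"
      unfolding k by simp
    also have "\<dots> \<le> \<omega> * (norm (fst w - snd w) powr (\<tau> - s - real DIM('a)) * e)"
      by (intro mult_left_mono mult_right_mono dens_div_gap e \<omega>)
    finally have "ennreal (pair_density w * \<bar>grad_kernel w v\<bar>) \<le> ennreal (\<omega> * (norm (fst w - snd w) powr (\<tau> - s - real DIM('a)) * e))"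
      by (rule ennreal_leI)
    then show "ennreal (pair_density w) * ennreal \<bar>grad_kernel w v\<bar> \<le> ennreal \<omega> * (ennreal (norm (fst w - snd w) powr (\<tau> - s - real DIM('a))) * ennreal \<bar>avg_kernel (fst w) y z - avg_kernel (snd w) y z\<bar>)"
      unfolding e_def[symmetric] using \<omega> e by (simp add: ennreal_mult[symmetric])
  qed
  also have "\<dots> = ennreal \<omega> * (\<integral>\<^sup>+w. ennreal (norm (fst w - snd w) powr (\<tau> - s - real DIM('a))) * ennreal \<bar>avg_kernel (fst w) y z - avg_kernel (snd w) y z\<bar> \<partial>lborel)"
    by (rule nn_integral_cmult) measurable
  also have "\<dots> \<le> ennreal \<omega> * ennreal (C * norm (y - z) powr (\<tau> - s - real DIM('a)))"
    by (intro mult_left_mono C yz) auto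
  also have "\<dots> = ennreal (C * (\<omega> * norm (y - z) powr (\<tau> - s - real DIM('a))))"
    using \<omega> C(1) by (simp add: ennreal_mult[symmetric] mult_ac)
  also have "\<omega> * norm (y - z) powr (\<tau> - s - real DIM('a)) = 1"
    unfolding \<omega>_def by (rule gap_div_dens) (use yz in auto)
  finally show ?thesis by simp
qed

text \<open>A fixed choice, so that the constant is a parameter of the operator determined by the
  geometry and the orders alone. The final range of p is computed from it before any coefficient is
  given.\<close>

definition schur_const :: real where
  "schur_const = (SOME C. 0 < C \<and> (\<forall>w. (\<integral>\<^sup>+v. ennreal \<bar>grad_kernel w v\<bar> \<partial>pair_measure) \<le> ennreal C) \<and> (\<forall>v. (\<integral>\<^sup>+w. ennreal \<bar>grad_kernel w v\<bar> \<partial>pair_measure) \<le> ennreal C))"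

lemma schur_const:
  "0 < schur_const \<and> (\<forall>w. (\<integral>\<^sup>+v. ennreal \<bar>grad_kernel w v\<bar> \<partial>pair_measure) \<le> ennreal schur_const) \<and> (\<forall>v. (\<integral>\<^sup>+w. ennreal \<bar>grad_kernel w v\<bar> \<partial>pair_measure) \<le> ennreal schur_const)"
  unfolding schur_const_def
proof (rule someI_ex)
  obtain C1 where C1: "C1 > 0" "\<And>w. (\<integral>\<^sup>+v. ennreal \<bar>grad_kernel w v\<bar> \<partial>pair_measure) \<le> ennreal C1"
    using avg_kernel_row_bound grad_kernel_row by blast
  obtain C2 where C2: "C2 > 0" "\<And>v. (\<integral>\<^sup>+w. ennreal \<bar>grad_kernel w v\<bar> \<partial>pair_measure) \<le> ennreal C2"
    using avg_kernel_column_bound grad_kernel_col by blast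
  have "ennreal C1 \<le> ennreal (max C1 C2)" "ennreal C2 \<le> ennreal (max C1 C2)"
    by (auto intro: ennreal_leI)
  then show "\<exists>C. 0 < C \<and> (\<forall>w. (\<integral>\<^sup>+v. ennreal \<bar>grad_kernel w v\<bar> \<partial>pair_measure) \<le> ennreal C) \<and> (\<forall>v. (\<integral>\<^sup>+w. ennreal \<bar>grad_kernel w v\<bar> \<partial>pair_measure) \<le> ennreal C)"
    using C1(1) order_trans[OF C1(2)] order_trans[OF C2(2)] by (intro exI[of _ "max C1 C2"]) simp
qed

sublocale schur_operator pair_measure grad_kernel schur_const
proof -
  interpret finite_measure pair_measure by (rule finite_measure_pair_measure)
  show "schur_operator pair_measure grad_kernel schur_const"
    by unfold_locales (use schur_const grad_kernel_measurable in auto)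
qed

definition quot :: "('a \<Rightarrow> real) \<Rightarrow> 'a \<times> 'a \<Rightarrow> real" where
  "quot u w = (u (fst w) - u (snd w)) / gap (fst w - snd w)"

text \<open>A left inverse of \<open>quot\<close>, almost everywhere, for functions that vanish off
  \<open>K\<close> and have integrable quotient. For an arbitrary integrable f it yields a function
  whose difference quotient is \<open>R f\<close> almost everywhere.\<close>

definition reconstruct :: "('a \<times> 'a \<Rightarrow> real) \<Rightarrow> 'a \<Rightarrow> real" where
  "reconstruct f x = (\<integral>v. avg_kernel x (fst v) (snd v) * (f v * gap (fst v - snd v)) \<partial>lborel)"

lemma quot_measurable [measurable]:
  assumes [measurable]: "u \<in> borel_measurable borel" shows "quot u \<in> borel_measurable borel"
  unfolding quot_def[abs_def] by measurable

lemma reconstruct_measurable [measurable]: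
  assumes [measurable]: "f \<in> borel_measurable borel" shows "reconstruct f \<in> borel_measurable borel"
  unfolding reconstruct_def[abs_def] by measurable

lemma reconstruct_outside: "x \<notin> K \<Longrightarrow> reconstruct f x = 0"
proof -
  assume "x \<notin> K"
  then have "avg_kernel x y z = 0" for y z using avg_kernel_support(1)[of x y z] by blast
  then show ?thesis by (simp add: reconstruct_def)
qed

text \<open>After exchanging the integrals, the column mass turns \<open>gap\<close> into |y -
  z|^(s+\<tau>-d). That is |y - z|^(s-\<tau>) times the density of the measure, and the extra factor
  is bounded on the support because \<tau> < s.\<close>

lemma reconstruct_integrable_AE:
  assumes f: "integrable pair_measure f"
  shows "AE x in lborel. integrable lborel (\<lambda>v. avg_kernel x (fst v) (snd v) * (f v * gap (fst v - snd v)))"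
proof -
  have [measurable]: "f \<in> borel_measurable borel"
    using borel_measurable_integrable[OF f] by (simp add: measurable_cong_sets[OF sets_pair_measure refl])
  obtain C where C: "C > 0" "\<And>y z. y \<noteq> z \<Longrightarrow> (\<integral>\<^sup>+x. ennreal (avg_kernel x y z) \<partial>lborel) \<le> ennreal (C * norm (y - z) powr (- real DIM('a)))"
    using avg_kernel_column_mass by blast
  define B where "B = C * (6 * T) powr (s - \<tau>)"
  have B: "B > 0" using C T_pos by (simp add: B_def)
  have pw: "ennreal (\<bar>f v\<bar> * gap (fst v - snd v)) * (\<integral>\<^sup>+x. ennreal \<bar>avg_kernel x (fst v) (snd v)\<bar> \<partial>lborel)
     \<le> ennreal B * (ennreal (pair_density v) * ennreal \<bar>f v\<bar>)" for v
  proof -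
    define y z where "y = fst v" and "z = snd v"
    show ?thesis
    proof (cases "y \<noteq> z \<and> y \<in> K \<and> norm (y - z) < 6 * T")
      case False
      show ?thesis
      proof (cases "y = z")
        case True then show ?thesis by (simp add: y_def z_def)
      next
        case F: False
        then have "avg_kernel x y z = 0" for x using False avg_kernel_support(2,3)[of x y z] by auto
        then show ?thesis by (simp add: y_def z_def)
      qed
    next
      case True
      then have yz: "y \<noteq> z" "y \<in> K" "norm (y - z) < 6 * T" by auto
      have "ennreal (\<bar>f v\<bar> * gap (y - z)) * (\<integral>\<^sup>+x. ennreal \<bar>avg_kernel x y z\<bar> \<partial>lborel)
        \<le> ennreal (\<bar>f v\<bar> * gap (y - z)) * ennreal (C * norm (y - z) powr (- real DIM('a)))"
        using C(2)[OF yz(1)] avg_kernel_nonneg[OF yz(1)] by (intro mult_left_mono) auto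
      also have "\<dots> = ennreal (C * \<bar>f v\<bar> * (gap (y - z) * norm (y - z) powr (- real DIM('a))))"
        using C(1) by (subst ennreal_mult[symmetric]) (auto simp: mult_ac)
      also have "\<dots> \<le> ennreal (C * \<bar>f v\<bar> * ((6 * T) powr (s - \<tau>) * pair_density v))"
      proof (intro ennreal_leI mult_left_mono)
        have q: "pair_density v = norm (y - z) powr (2 * \<tau> - real DIM('a))"
          using yz dens_small[of "y - z"] by (simp add: pair_density_def y_def z_def)
        have e: "s + \<tau> - real DIM('a) = (s - \<tau>) + (2 * \<tau> - real DIM('a))" by simp
        have "gap (y - z) * norm (y - z) powr (- real DIM('a)) = norm (y - z) powr (s + \<tau> - real DIM('a))"
          using yz by (simp add: gap_small flip: powr_add)
        also have "\<dots> = norm (y - z) powr (s - \<tau>) * norm (y - z) powr (2 * \<tau> - real DIM('a))"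
          unfolding e powr_add ..
        also have "\<dots> \<le> (6 * T) powr (s - \<tau>) * norm (y - z) powr (2 * \<tau> - real DIM('a))"
          using yz \<tau>_less by (intro mult_right_mono powr_mono2) auto
        finally show "gap (y - z) * norm (y - z) powr (- real DIM('a)) \<le> (6 * T) powr (s - \<tau>) * pair_density v"
          unfolding q .
      qed (use C in auto)
      also have "\<dots> = ennreal B * (ennreal (pair_density v) * ennreal \<bar>f v\<bar>)"
        using C(1) by (simp add: B_def ennreal_mult[symmetric] mult_ac)
      finally show ?thesis by (simp add: y_def z_def)
    qed
  qed
  have "(\<integral>\<^sup>+x. \<integral>\<^sup>+v. ennreal (norm (avg_kernel x (fst v) (snd v) * (f v * gap (fst v - snd v)))) \<partial>lborel \<partial>lborel)
     = (\<integral>\<^sup>+v. \<integral>\<^sup>+x. ennreal (norm (avg_kernel x (fst v) (snd v) * (f v * gap (fst v - snd v)))) \<partial>lborel \<partial>lborel)"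
    by (subst lborel_pair.Fubini') auto
  also have "\<dots> = (\<integral>\<^sup>+v. ennreal (\<bar>f v\<bar> * gap (fst v - snd v)) * (\<integral>\<^sup>+x. ennreal \<bar>avg_kernel x (fst v) (snd v)\<bar> \<partial>lborel) \<partial>lborel)"
  proof (rule nn_integral_cong)
    fix v
    have "(\<integral>\<^sup>+x. ennreal (norm (avg_kernel x (fst v) (snd v) * (f v * gap (fst v - snd v)))) \<partial>lborel)
      = (\<integral>\<^sup>+x. ennreal (\<bar>f v\<bar> * gap (fst v - snd v)) * ennreal \<bar>avg_kernel x (fst v) (snd v)\<bar> \<partial>lborel)"
      by (rule nn_integral_cong) (simp add: abs_mult ennreal_mult[symmetric] mult_ac)
    also have "\<dots> = ennreal (\<bar>f v\<bar> * gap (fst v - snd v)) * (\<integral>\<^sup>+x. ennreal \<bar>avg_kernel x (fst v) (snd v)\<bar> \<partial>lborel)"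
      by (rule nn_integral_cmult) measurable
    finally show "(\<integral>\<^sup>+x. ennreal (norm (avg_kernel x (fst v) (snd v) * (f v * gap (fst v - snd v)))) \<partial>lborel)
      = ennreal (\<bar>f v\<bar> * gap (fst v - snd v)) * (\<integral>\<^sup>+x. ennreal \<bar>avg_kernel x (fst v) (snd v)\<bar> \<partial>lborel)" .
  qed
  also have "\<dots> \<le> (\<integral>\<^sup>+v. ennreal B * (ennreal (pair_density v) * ennreal \<bar>f v\<bar>) \<partial>lborel)"
    by (rule nn_integral_mono) (rule pw)
  also have "\<dots> = ennreal B * (\<integral>\<^sup>+v. ennreal \<bar>f v\<bar> \<partial>pair_measure)"
    by (subst nn_integral_cmult, measurable, subst nn_integral_pair_measure, measurable)
  also have "\<dots> < \<infinity>"
    using f by (auto simp: integrable_iff_bounded ennreal_mult_less_top)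
  finally have "AE x in lborel. (\<integral>\<^sup>+v. ennreal (norm (avg_kernel x (fst v) (snd v) * (f v * gap (fst v - snd v)))) \<partial>lborel) \<noteq> \<infinity>"
    by (intro nn_integral_PInf_AE) auto
  then show ?thesis
    by eventually_elim (rule integrableI_bounded, measurable, simp add: less_top)
qed

lemma R_eq_quot_reconstruct:
  assumes f: "integrable pair_measure f"
  shows "AE w in pair_measure. R f w = quot (reconstruct f) w"
proof -
  have [measurable]: "f \<in> borel_measurable borel"
    using borel_measurable_integrable[OF f] by (simp add: measurable_cong_sets[OF sets_pair_measure refl])
  have "AE w in (lborel :: ('a \<times> 'a) measure). R f w = quot (reconstruct f) w"
    using AE_lborel_pair[OF reconstruct_integrable_AE[OF f]]
  proof eventually_elim
    case (elim w)
    have [measurable]: "grad_kernel w \<in> borel_measurable borel" unfolding grad_kernel_def[abs_def] by measurable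
    have "R f w = (\<integral>v. grad_kernel w v * f v \<partial>pair_measure)" by (rule R_def)
    also have "\<dots> = (\<integral>v. pair_density v *\<^sub>R (grad_kernel w v * f v) \<partial>lborel)"
      unfolding pair_measure_def by (rule integral_density) auto
    also have "\<dots> = (\<integral>v. (avg_kernel (fst w) (fst v) (snd v) * (f v * gap (fst v - snd v)) - avg_kernel (snd w) (fst v) (snd v) * (f v * gap (fst v - snd v))) / gap (fst w - snd w) \<partial>lborel)"
    proof (rule Bochner_Integration.integral_cong[OF refl])
      fix v :: "'a \<times> 'a"
      show "pair_density v *\<^sub>R (grad_kernel w v * f v) = (avg_kernel (fst w) (fst v) (snd v) * (f v * gap (fst v - snd v)) - avg_kernel (snd w) (fst v) (snd v) * (f v * gap (fst v - snd v))) / gap (fst w - snd w)"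
      proof (cases "fst v = snd v")
        case True
        then show ?thesis by (simp add: grad_kernel_def)
      next
        case False
        show ?thesis
        proof (cases "fst v \<in> K")
          case True
          then have "pair_density v = dens (fst v - snd v)" by (simp add: pair_density_def)
          then show ?thesis using dens_pos[of "fst v - snd v"] False
            unfolding grad_kernel_def left_diff_distrib[symmetric] by simp
        next
          case False
          then have "avg_kernel x (fst v) (snd v) = 0" for x using avg_kernel_support(2)[of x "fst v" "snd v"] by blast
          then show ?thesis by (simp add: grad_kernel_def)
        qed
      qed
    qed
    also have "\<dots> = quot (reconstruct f) w"
      using elim by (simp add: quot_def reconstruct_def)
    finally show ?case .
  qed
  then show ?thesis unfolding pair_measure_def by (subst AE_density) (auto elim: eventually_mono)
qed

text \<open>Pair each x in \<open>K\<close> with the points y of a fixed unit ball outside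
  \<open>K\<close>. There u y = 0, and |x - y| lies between fixed positive bounds, so the quotient
  is comparable to u x.\<close>

lemma Poincare:
  assumes p: "0 < p"
  shows "\<exists>C>0. \<forall>u\<in>borel_measurable borel. (\<forall>x. x \<notin> K \<longrightarrow> u x = 0) \<longrightarrow>
    (\<integral>\<^sup>+x. ennreal (\<bar>u x\<bar> powr p) \<partial>lborel) \<le> ennreal C * (\<integral>\<^sup>+w. ennreal (\<bar>quot u w\<bar> powr p) \<partial>pair_measure)"
proof -
  obtain \<rho> where \<rho>: "\<rho> > 0" "\<And>x. x \<in> K \<Longrightarrow> norm x \<le> \<rho>"
    using compact_imp_bounded[OF K_compact] unfolding bounded_pos by blast
  obtain b :: 'a where b: "b \<in> Basis" by (meson nonempty_Basis ex_in_conv)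
  define y0 where "y0 = (\<rho> + 2) *\<^sub>R b"
  have y0: "norm y0 = \<rho> + 2" using b \<rho> by (simp add: y0_def)
  define Rr where "Rr = 2 * \<rho> + 3"
  have dist: "1 \<le> norm (x - y)" "norm (x - y) \<le> Rr" "y \<notin> K" if "x \<in> K" "y \<in> ball y0 1" for x y
  proof -
    have a: "norm (y0 - y) < 1" using that(2) by (simp add: dist_norm)
    have n: "norm x \<le> \<rho>" using \<rho> that by simp
    have 1: "norm y0 \<le> norm (y0 - y) + norm y" using norm_triangle_ineq[of "y0 - y" y] by simp
    have 2: "norm y \<le> norm (y0 - y) + norm y0" using norm_triangle_ineq[of "y - y0" y0] by (simp add: norm_minus_commute)
    have 3: "norm y \<le> norm (x - y) + norm x" using norm_triangle_ineq[of "y - x" x] by (simp add: norm_minus_commute)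
    have 4: "norm (x - y) \<le> norm x + norm y" by (rule norm_triangle_ineq4)
    show "1 \<le> norm (x - y)" "norm (x - y) \<le> Rr" using 1 2 3 4 a n y0 by (auto simp: Rr_def)
    show "y \<notin> K" using \<rho>(2)[of y] 1 a y0 by auto
  qed
  define g1 where "g1 = min 1 (6 * T) powr (s + \<tau>)"
  define g2 where "g2 = (6 * T) powr (s + \<tau>)"
  have g: "g1 > 0" "g2 > 0" using T_pos by (auto simp: g1_def g2_def)
  have gb: "g1 \<le> gap w" "gap w \<le> g2" if "1 \<le> norm w" for w
    unfolding gap_def g1_def g2_def using that T_pos order_bounds \<tau>_pos by (auto intro!: powr_mono2)
  \<comment> \<open>The smallest possible value of gap^(-p) times \<open>dens\<close> over the pairs
    considered, estimated factor by factor.\<close>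
  define m0 where "m0 = g2 powr (- p) * (g1\<^sup>2 * Rr powr (- (real DIM('a) + 2 * s)))"
  have Rr: "Rr > 0" using \<rho> by (simp add: Rr_def)
  have m0: "m0 > 0" using g Rr by (simp add: m0_def)
  define V where "V = unit_ball_vol (real DIM('a))"
  have V: "V > 0" unfolding V_def by (intro unit_ball_vol_pos) auto
  show ?thesis
  proof (intro exI[of _ "1 / (m0 * V)"] conjI ballI impI)
    show "0 < 1 / (m0 * V)" using m0 V by simp
    fix u :: "'a \<Rightarrow> real" assume [measurable]: "u \<in> borel_measurable borel" and u0: "\<forall>x. x \<notin> K \<longrightarrow> u x = 0"
    have pw: "ennreal m0 * ennreal (\<bar>u x\<bar> powr p) * indicator (ball y0 1) y \<le> ennreal (pair_density (x, y)) * ennreal (\<bar>quot u (x, y)\<bar> powr p)" for x y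
    proof (cases "x \<in> K \<and> y \<in> ball y0 1")
      case False
      then show ?thesis using u0 by (auto simp: indicator_def)
    next
      case True
      then have xy: "x \<in> K" "y \<in> ball y0 1" by auto
      note d = dist[OF xy]
      have uy: "u y = 0" using u0 d(3) by simp
      have gp: "gap (x - y) > 0" using gb(1)[OF d(1)] g by linarith
      have "m0 \<le> gap (x - y) powr (- p) * ((gap (x - y))\<^sup>2 * norm (x - y) powr (- (real DIM('a) + 2 * s)))"
        unfolding m0_def using gb[OF d(1)] g d gp p order_bounds
        by (intro mult_mono power_mono powr_mono2') auto
      then have "m0 * \<bar>u x\<bar> powr p \<le> gap (x - y) powr (- p) * dens (x - y) * \<bar>u x\<bar> powr p"
        unfolding dens_def by (rule mult_right_mono) simp
      also have "\<dots> = pair_density (x, y) * \<bar>quot u (x, y)\<bar> powr p"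
        using xy gp uy by (simp add: pair_density_def quot_def powr_divide powr_minus_divide)
      finally have "ennreal (m0 * \<bar>u x\<bar> powr p) \<le> ennreal (pair_density (x, y) * \<bar>quot u (x, y)\<bar> powr p)" by (rule ennreal_leI)
      then show ?thesis using xy m0 by (simp add: ennreal_mult)
    qed
    have inner: "(\<integral>\<^sup>+y. ennreal m0 * ennreal (\<bar>u x\<bar> powr p) * indicator (ball y0 1) y \<partial>lborel)
      = ennreal (m0 * V) * ennreal (\<bar>u x\<bar> powr p)" for x
      using m0 V by (subst nn_integral_cmult_indicator) (auto simp: emeasure_ball V_def ennreal_mult mult_ac)
    have "ennreal (m0 * V) * (\<integral>\<^sup>+x. ennreal (\<bar>u x\<bar> powr p) \<partial>lborel)
      = (\<integral>\<^sup>+x. \<integral>\<^sup>+y. ennreal m0 * ennreal (\<bar>u x\<bar> powr p) * indicator (ball y0 1) y \<partial>lborel \<partial>lborel)"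
      unfolding inner by (rule nn_integral_cmult[symmetric]) measurable
    also have "\<dots> \<le> (\<integral>\<^sup>+x. \<integral>\<^sup>+y. ennreal (pair_density (x, y)) * ennreal (\<bar>quot u (x, y)\<bar> powr p) \<partial>lborel \<partial>lborel)"
      by (intro nn_integral_mono pw)
    also have "\<dots> = (\<integral>\<^sup>+w. ennreal (pair_density w) * ennreal (\<bar>quot u w\<bar> powr p) \<partial>lborel)"
      by (subst nn_integral_lborel_pair) auto
    also have "\<dots> = (\<integral>\<^sup>+w. ennreal (\<bar>quot u w\<bar> powr p) \<partial>pair_measure)"
      by (rule nn_integral_pair_measure[symmetric]) measurable
    finally have le: "ennreal (m0 * V) * (\<integral>\<^sup>+x. ennreal (\<bar>u x\<bar> powr p) \<partial>lborel) \<le> (\<integral>\<^sup>+w. ennreal (\<bar>quot u w\<bar> powr p) \<partial>pair_measure)" .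
    have "(\<integral>\<^sup>+x. ennreal (\<bar>u x\<bar> powr p) \<partial>lborel) = ennreal (1 / (m0 * V)) * (ennreal (m0 * V) * (\<integral>\<^sup>+x. ennreal (\<bar>u x\<bar> powr p) \<partial>lborel))"
      unfolding mult.assoc[symmetric] using m0 V by (simp add: ennreal_mult[symmetric])
    also have "\<dots> \<le> ennreal (1 / (m0 * V)) * (\<integral>\<^sup>+w. ennreal (\<bar>quot u w\<bar> powr p) \<partial>pair_measure)"
      by (rule mult_left_mono[OF le]) simp
    finally show "(\<integral>\<^sup>+x. ennreal (\<bar>u x\<bar> powr p) \<partial>lborel) \<le> ennreal (1 / (m0 * V)) * (\<integral>\<^sup>+w. ennreal (\<bar>quot u w\<bar> powr p) \<partial>pair_measure)" .
  qed
qed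

end

section \<open>Reconstruction of a function from its difference quotients\<close>

lemma lborel_eq_reflect: "(lborel :: 'a::euclidean_space measure) = distr lborel borel (\<lambda>y. x - y)"
  using lborel_affine[of "-1" x] by (simp add: density_1)

lemma integral_reflect:
  fixes f :: "'a::euclidean_space \<Rightarrow> real"
  assumes [measurable]: "f \<in> borel_measurable borel"
  shows "(\<integral>y. f (x - y) \<partial>lborel) = (\<integral>y. f y \<partial>lborel)"
proof -
  have "(\<integral>y. f y \<partial>lborel) = (\<integral>y. f y \<partial>distr lborel borel (\<lambda>y. x - y))"
    by (subst lborel_eq_reflect[of x]) simp
  also have "\<dots> = (\<integral>y. f (x - y) \<partial>lborel)" by (rule integral_distr) measurable
  finally show ?thesis by simp
qed

lemma integrable_reflect:
  fixes f :: "'a::euclidean_space \<Rightarrow> real"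
  assumes "integrable lborel f"
  shows "integrable lborel (\<lambda>y. f (x - y))"
proof -
  have "integrable (distr lborel borel (\<lambda>y. x - y)) f"
    using assms by (subst lborel_eq_reflect[of x, symmetric])
  then show ?thesis by (rule integrable_distr[rotated]) measurable
qed

context whitney_domain
begin

definition mollify :: "nat \<Rightarrow> ('a \<Rightarrow> real) \<Rightarrow> 'a \<Rightarrow> real" where
  "mollify k u x = (\<integral>y. tent (scale k) (x - y) / mass (scale k) * u y \<partial>lborel)"

lemma tent_shift_integrable: "integrable lborel (\<lambda>y. tent (scale k) (x - y))"
  by (rule integrable_reflect) (simp add: tent_integrable)

lemma tent_shift_integral: "(\<integral>y. tent (scale k) (x - y) / mass (scale k) \<partial>lborel) = 1"
  using integral_reflect[of "tent (scale k)" x] mass_pos[of "scale k"] by (simp add: mass_def)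

lemma bounded_mult_integrable:
  assumes u: "integrable lborel u" and [measurable]: "f \<in> borel_measurable borel"
    and f: "\<And>y. \<bar>f y\<bar> \<le> B"
  shows "integrable lborel (\<lambda>y. f y * u y :: real)"
proof -
  have [measurable]: "u \<in> borel_measurable lborel" using u by simp
  have "integrable lborel (\<lambda>y. B * u y)" using u by simp
  then show ?thesis
  proof (rule Bochner_Integration.integrable_bound)
    show "AE y in lborel. norm (f y * u y) \<le> norm (B * u y)"
      using f by (auto simp: abs_mult intro!: mult_right_mono AE_I2 order_trans[OF f])
  qed measurable
qed

lemma mollify_integrable:
  assumes "integrable lborel u"
  shows "integrable lborel (\<lambda>y. tent (scale k) (x - y) / mass (scale k) * u y)"
  by (rule bounded_mult_integrable[OF assms, of _ "1 / mass (scale k)"])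
     (use tent_bounds[of "scale k"] mass_pos[of "scale k"] in \<open>auto intro!: divide_right_mono\<close>)

text \<open>Integrate in z first. The hat function gives u y minus the coarse average; the exterior
  density gives u y alone, since u vanishes outside. Averaging in y at the finer scale leaves the
  difference of the products of cutoff and average.\<close>

lemma piece_difference_integral:
  assumes u: "integrable lborel u" and u0: "\<And>x. x \<notin> K \<Longrightarrow> u x = 0"
    and I: "integrable lborel (\<lambda>v. piece k x (fst v) (snd v) * (u (fst v) - u (snd v)))"
  shows "(\<integral>v. piece k x (fst v) (snd v) * (u (fst v) - u (snd v)) \<partial>lborel)
    = cut (Suc k) x * mollify (Suc k) u x - cut k x * mollify k u x"
proof -
  have [measurable]: "u \<in> borel_measurable borel" using u by simp
  define a where "a y = tent (scale (Suc k)) (x - y) / mass (scale (Suc k))" for y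
  define q where "q z = tent (scale k) (x - z) / mass (scale k)" for z
  have qi: "integrable lborel q" unfolding q_def[abs_def] using tent_shift_integrable by simp
  have qui: "integrable lborel (\<lambda>z. q z * u z)" unfolding q_def by (rule mollify_integrable[OF u])
  have q1: "(\<integral>z. q z \<partial>lborel) = 1" unfolding q_def by (rule tent_shift_integral)
  have inner: "(\<integral>z. piece k x y z * (u y - u z) \<partial>lborel) = a y * (cut (Suc k) x * u y) - cut k x * mollify k u x * a y" for y
  proof -
    have main: "(\<integral>z. cut k x * (q z * u y - q z * u z) \<partial>lborel) = cut k x * (u y - mollify k u x)"
      and maini: "integrable lborel (\<lambda>z. cut k x * (q z * u y - q z * u z))"
      using qi qui q1 by (auto simp: mollify_def q_def[symmetric])
    have pc: "piece k x y z = a y * (cut k x * q z + (cut (Suc k) x - cut k x) * ext k y z)" for z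
      by (simp add: piece_def a_def q_def)
    show ?thesis
    proof (cases "a y = 0 \<or> cut (Suc k) x = cut k x")
      case True
      then have "piece k x y z * (u y - u z) = a y * (cut k x * (q z * u y - q z * u z))" for z
        unfolding pc by (auto simp: algebra_simps)
      then have "(\<integral>z. piece k x y z * (u y - u z) \<partial>lborel) = a y * (cut k x * (u y - mollify k u x))"
        using main by simp
      then show ?thesis using True by (auto simp: algebra_simps)
    next
      \<comment> \<open>If the cutoff grows at x and y is within the finer hat function, then y lies
        in \<open>K\<close> at distance below 2.5 scales from the complement, which is inside the
        range where \<open>ext\<close> is normalised.\<close>
      case False
      then have xy: "norm (x - y) < scale (Suc k)" by (intro tent_support) (auto simp: a_def)
      have "cut (Suc k) x \<noteq> 0" using False cut_mono[of k x] cut_bounds(1)[of k x] by auto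
      then have d: "scale (Suc k) < infdist x (- K)" by (rule cut_nonzero)
      have yK: "y \<in> K" using in_K_near[of x y] xy d by linarith
      have "cut k x \<noteq> 1" using False cut_mono[of k x] cut_bounds(2)[of "Suc k" x] by auto
      then have "infdist x (- K) < 2 * scale k" by (rule cut_not_1)
      then have "infdist y (- K) < 3 * scale k"
        using infdist_lip[of x y] xy scale_pos[of k] unfolding scale_Suc by linarith
      note e = ext_integral[OF yK this]
      have eu: "ext k y z * u z = 0" for z using u0[of z] by (auto simp: ext_def)
      have "piece k x y z * (u y - u z) = a y * (cut k x * (q z * u y - q z * u z) + (cut (Suc k) x - cut k x) * u y * ext k y z)" for z
      proof -
        have "piece k x y z * (u y - u z) = a y * (cut k x * (q z * u y - q z * u z) + (cut (Suc k) x - cut k x) * u y * ext k y z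
           - (cut (Suc k) x - cut k x) * (ext k y z * u z))"
          unfolding pc by (simp add: algebra_simps)
        then show ?thesis by (simp add: eu)
      qed
      then have "(\<integral>z. piece k x y z * (u y - u z) \<partial>lborel)
         = a y * (cut k x * (u y - mollify k u x) + (cut (Suc k) x - cut k x) * u y)"
        using main maini e by simp
      then show ?thesis by (simp add: algebra_simps)
    qed
  qed
  have ai: "integrable lborel a" unfolding a_def[abs_def] using tent_shift_integrable by simp
  have aui: "integrable lborel (\<lambda>y. a y * u y)" unfolding a_def by (rule mollify_integrable[OF u])
  have a1: "(\<integral>y. a y \<partial>lborel) = 1" unfolding a_def by (rule tent_shift_integral)
  have "(\<integral>v. piece k x (fst v) (snd v) * (u (fst v) - u (snd v)) \<partial>lborel)
    = (\<integral>y. (\<integral>z. piece k x y z * (u y - u z) \<partial>lborel) \<partial>lborel)"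
    using lborel_pair.integral_fst'[of "\<lambda>v. piece k x (fst v) (snd v) * (u (fst v) - u (snd v))"] I
    by (simp add: lborel_prod)
  also have "\<dots> = (\<integral>y. cut (Suc k) x * (a y * u y) - cut k x * mollify k u x * a y \<partial>lborel)"
    unfolding inner by (intro Bochner_Integration.integral_cong) (auto simp: mult_ac)
  also have "\<dots> = cut (Suc k) x * (\<integral>y. a y * u y \<partial>lborel) - cut k x * mollify k u x"
    using ai aui a1 by simp
  finally show ?thesis by (simp add: mollify_def a_def)
qed

text \<open>No differentiation theorem is used. Finiteness of the section integral gives |u y - u x|
  \<le> t^(d+s-\<tau>) h y with h integrable; dividing by the mass of order t^d leaves the rate
  t^(s-\<tau>).\<close>

lemma mollify_tendsto:
  assumes u: "integrable lborel u" and x: "x \<in> K"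
    and H: "(\<integral>\<^sup>+y. ennreal (pair_density (x, y) * \<bar>quot u (x, y)\<bar>) \<partial>lborel) < \<infinity>"
  shows "(\<lambda>k. mollify k u x) \<longlonglongrightarrow> u x"
proof -
  have [measurable]: "u \<in> borel_measurable borel" using u by simp
  define h where "h y = pair_density (x, y) * \<bar>quot u (x, y)\<bar>" for y
  have [measurable]: "h \<in> borel_measurable borel" unfolding h_def[abs_def] by measurable
  have h0: "0 \<le> h y" for y by (simp add: h_def)
  have hi: "integrable lborel h" using H h0 by (intro integrableI_bounded) (auto simp: h_def)
  define m where "m = unit_ball_vol (real DIM('a)) / 2 / 2 ^ DIM('a)"
  have m: "m > 0" by (simp add: m_def)
  have key: "\<bar>u y - u x\<bar> \<le> t powr (real DIM('a) + s - \<tau>) * h y" if "norm (x - y) < t" "t \<le> T" for y t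
  proof (cases "x = y")
    case True
    then show ?thesis using h0 by simp
  next
    case False
    then have w: "x - y \<noteq> 0" "norm (x - y) < 6 * T" using that T_pos by auto
    have g: "gap (x - y) > 0" using gap_pos[OF w(1)] .
    have dp: "dens (x - y) > 0" using dens_pos[OF w(1)] .
    have "\<bar>u y - u x\<bar> = gap (x - y) / dens (x - y) * h y"
      using x g dp by (simp add: h_def pair_density_def quot_def abs_minus_commute)
    also have "gap (x - y) / dens (x - y) = norm (x - y) powr (real DIM('a) + s - \<tau>)"
    proof -
      have e: "real DIM('a) + s - \<tau> = - (\<tau> - s - real DIM('a))" by simp
      show ?thesis using gap_div_dens[OF w] w g dp unfolding e powr_minus by (simp add: field_simps)
    qed
    also have "\<dots> * h y \<le> t powr (real DIM('a) + s - \<tau>) * h y"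
      using that h0 \<tau>_less by (intro mult_right_mono powr_mono2) auto
    finally show ?thesis .
  qed
  have le: "\<bar>mollify k u x - u x\<bar> \<le> (\<integral>y. h y \<partial>lborel) / m * scale k powr (s - \<tau>)" for k
  proof -
    define q where "q y = tent (scale k) (x - y) / mass (scale k)" for y
    have qi: "integrable lborel q" unfolding q_def[abs_def] using tent_shift_integrable by simp
    have qui: "integrable lborel (\<lambda>z. q z * u z)" unfolding q_def by (rule mollify_integrable[OF u])
    have q1: "(\<integral>z. q z \<partial>lborel) = 1" unfolding q_def by (rule tent_shift_integral)
    have "mollify k u x - u x = (\<integral>y. q y * u y - q y * u x \<partial>lborel)"
      using qi qui q1 by (simp add: mollify_def q_def[symmetric])
    also have "\<bar>\<dots>\<bar> \<le> (\<integral>y. \<bar>q y * u y - q y * u x\<bar> \<partial>lborel)" by (rule integral_abs_bound)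
    also have "\<dots> \<le> (\<integral>y. 1 / (m * scale k ^ DIM('a)) * scale k powr (real DIM('a) + s - \<tau>) * h y \<partial>lborel)"
    proof (rule integral_mono)
      show "integrable lborel (\<lambda>y. \<bar>q y * u y - q y * u x\<bar>)" using qi qui by simp
      show "integrable lborel (\<lambda>y. 1 / (m * scale k ^ DIM('a)) * scale k powr (real DIM('a) + s - \<tau>) * h y)" using hi by simp
      fix y
      show "\<bar>q y * u y - q y * u x\<bar> \<le> 1 / (m * scale k ^ DIM('a)) * scale k powr (real DIM('a) + s - \<tau>) * h y"
      proof (cases "q y = 0")
        case True
        then show ?thesis using h0[of y] m by (simp add: less_imp_le)
      next
        case False
        then have xy: "norm (x - y) < scale k" by (intro tent_support) (auto simp: q_def)
        have p: "0 < m * scale k ^ DIM('a)" using m by simp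
        have "q y \<le> 1 / mass (scale k)"
          unfolding q_def using tent_bounds[of "scale k"] mass_pos[of "scale k"] by (intro divide_right_mono) auto
        also have "\<dots> \<le> 1 / (m * scale k ^ DIM('a))"
        proof (rule divide_left_mono)
          show "m * scale k ^ DIM('a) \<le> mass (scale k)" using mass_ge[of "scale k"] by (simp add: m_def)
          show "0 < mass (scale k) * (m * scale k ^ DIM('a))" by (intro mult_pos_pos p mass_pos) simp
        qed simp
        finally have qb: "q y \<le> 1 / (m * scale k ^ DIM('a))" .
        have qn: "0 \<le> q y" unfolding q_def using tent_bounds(1) mass_pos[of "scale k"] by simp
        have "\<bar>q y * u y - q y * u x\<bar> = q y * \<bar>u y - u x\<bar>"
          using qn by (simp add: abs_mult flip: right_diff_distrib)
        also have "\<dots> \<le> 1 / (m * scale k ^ DIM('a)) * (scale k powr (real DIM('a) + s - \<tau>) * h y)"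
          using p by (intro mult_mono qb key[OF xy scale_le]) auto
        finally show ?thesis by simp
      qed
    qed
    also have "\<dots> = 1 / (m * scale k ^ DIM('a)) * scale k powr (real DIM('a) + s - \<tau>) * (\<integral>y. h y \<partial>lborel)"
      by simp
    also have "1 / (m * scale k ^ DIM('a)) * scale k powr (real DIM('a) + s - \<tau>) = 1 / m * scale k powr (s - \<tau>)"
    proof -
      have e: "real DIM('a) + s - \<tau> = real DIM('a) + (s - \<tau>)" by simp
      show ?thesis unfolding e powr_add powr_realpow[OF scale_pos] using m by simp
    qed
    finally show ?thesis by (simp add: mult_ac)
  qed
  have "(\<lambda>k. (\<integral>y. h y \<partial>lborel) / m * scale k powr (s - \<tau>)) \<longlonglongrightarrow> (\<integral>y. h y \<partial>lborel) / m * 0 powr (s - \<tau>)"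
    using \<tau>_less by (intro tendsto_intros tendsto_powr2 scale_tendsto always_eventually) (auto simp: less_imp_le)
  then have l0: "(\<lambda>k. (\<integral>y. h y \<partial>lborel) / m * scale k powr (s - \<tau>)) \<longlonglongrightarrow> 0" by simp
  have "(\<lambda>k. mollify k u x - u x) \<longlonglongrightarrow> 0"
    by (rule Lim_null_comparison[OF _ l0]) (use le in auto)
  then show ?thesis by (simp add: Lim_null[symmetric])
qed

lemma quot_integrable_imp:
  assumes [measurable]: "u \<in> borel_measurable borel" and u0: "\<And>x. x \<notin> K \<Longrightarrow> u x = 0"
    and I: "integrable pair_measure (quot u)"
  shows "integrable lborel u"
    and "AE x in lborel. (\<integral>\<^sup>+y. ennreal (pair_density (x, y) * \<bar>quot u (x, y)\<bar>) \<partial>lborel) < \<infinity>"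
proof -
  have fin: "(\<integral>\<^sup>+w. ennreal \<bar>quot u w\<bar> \<partial>pair_measure) < \<infinity>" using I by (simp add: integrable_iff_bounded)
  obtain C where C: "\<forall>u\<in>borel_measurable borel. (\<forall>x. x \<notin> K \<longrightarrow> u x = 0) \<longrightarrow>
    (\<integral>\<^sup>+x. ennreal (\<bar>u x\<bar> powr 1) \<partial>lborel) \<le> ennreal C * (\<integral>\<^sup>+w. ennreal (\<bar>quot u w\<bar> powr 1) \<partial>pair_measure)"
    using Poincare[of 1] by auto
  have "(\<integral>\<^sup>+x. ennreal (\<bar>u x\<bar> powr 1) \<partial>lborel) \<le> ennreal C * (\<integral>\<^sup>+w. ennreal (\<bar>quot u w\<bar> powr 1) \<partial>pair_measure)"
    by (rule C[rule_format]) (use u0 in auto)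
  also have "\<dots> < \<infinity>" using fin by (simp add: ennreal_mult_less_top)
  finally show "integrable lborel u" by (intro integrableI_bounded) auto
  have "(\<integral>\<^sup>+x. \<integral>\<^sup>+y. ennreal (pair_density (x, y) * \<bar>quot u (x, y)\<bar>) \<partial>lborel \<partial>lborel) = (\<integral>\<^sup>+w. ennreal (pair_density w) * ennreal \<bar>quot u w\<bar> \<partial>lborel)"
    by (subst nn_integral_lborel_pair) (auto simp: ennreal_mult)
  also have "\<dots> = (\<integral>\<^sup>+w. ennreal \<bar>quot u w\<bar> \<partial>pair_measure)"
    by (rule nn_integral_pair_measure[symmetric]) measurable
  finally have "AE x in lborel. (\<integral>\<^sup>+y. ennreal (pair_density (x, y) * \<bar>quot u (x, y)\<bar>) \<partial>lborel) \<noteq> \<infinity>"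
    using fin by (intro nn_integral_PInf_AE) auto
  then show "AE x in lborel. (\<integral>\<^sup>+y. ennreal (pair_density (x, y) * \<bar>quot u (x, y)\<bar>) \<partial>lborel) < \<infinity>"
    by (simp add: less_top)
qed

text \<open>The partial sums telescope to the cutoff times the average at scale n, which tends to u
  x off the boundary. The pieces are nonnegative, so the full kernel dominates the partial sums and
  the limit passes under the integral.\<close>

lemma reconstruct_quot:
  assumes um [measurable]: "u \<in> borel_measurable borel" and u0: "\<And>x. x \<notin> K \<Longrightarrow> u x = 0"
    and I: "integrable pair_measure (quot u)"
  shows "AE x in lborel. reconstruct (quot u) x = u x"
proof -
  have u: "integrable lborel u" by (rule quot_integrable_imp(1)[OF um u0 I])
  have H: "AE x in lborel. (\<integral>\<^sup>+y. ennreal (pair_density (x, y) * \<bar>quot u (x, y)\<bar>) \<partial>lborel) < \<infinity>"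
    by (rule quot_integrable_imp(2)[OF um u0 I])
  show ?thesis
    using reconstruct_integrable_AE[OF I] H boundary_null
proof eventually_elim
  case (elim x)
  show ?case
  proof (cases "x \<in> K")
    case False
    then show ?thesis using reconstruct_outside u0 by simp
  next
    case True
    define D where "D v = u (fst v) - u (snd v)" for v :: "'a \<times> 'a"
    have [measurable]: "D \<in> borel_measurable borel" unfolding D_def[abs_def] by measurable
    have Dq: "quot u v * gap (fst v - snd v) = D v" for v
      using gap_pos[of "fst v - snd v"] by (cases "fst v = snd v") (auto simp: quot_def D_def)
    have ED: "integrable lborel (\<lambda>v. avg_kernel x (fst v) (snd v) * D v)"
      using elim(1) by (simp add: Dq)
    have partial: "(\<Sum>k<n. piece k x (fst v) (snd v)) * \<bar>D v\<bar> \<le> avg_kernel x (fst v) (snd v) * \<bar>D v\<bar>" for n v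
    proof (cases "fst v = snd v")
      case True then show ?thesis by (simp add: D_def)
    next
      case False
      then show ?thesis unfolding avg_kernel_def
        by (intro mult_right_mono sum_le_suminf piece_summable piece_nonneg) auto
    qed
    have bound: "norm ((\<Sum>k<n. piece k x (fst v) (snd v)) * D v) \<le> \<bar>avg_kernel x (fst v) (snd v) * D v\<bar>" for n v
    proof -
      have "norm ((\<Sum>k<n. piece k x (fst v) (snd v)) * D v) = (\<Sum>k<n. piece k x (fst v) (snd v)) * \<bar>D v\<bar>"
        by (simp add: abs_mult abs_of_nonneg sum_nonneg piece_nonneg)
      also have "\<dots> \<le> avg_kernel x (fst v) (snd v) * \<bar>D v\<bar>" by (rule partial)
      also have "\<dots> \<le> \<bar>avg_kernel x (fst v) (snd v) * D v\<bar>" by (simp add: abs_mult mult_right_mono)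
      finally show ?thesis .
    qed
    have PI: "integrable lborel (\<lambda>v. piece k x (fst v) (snd v) * D v)" for k
    proof (rule Bochner_Integration.integrable_bound[OF ED])
      have "norm (piece k x (fst v) (snd v) * D v) \<le> norm (avg_kernel x (fst v) (snd v) * D v)" for v
      proof -
        have "piece k x (fst v) (snd v) \<le> (\<Sum>j<Suc k. piece j x (fst v) (snd v))"
          by (simp add: sum_nonneg piece_nonneg)
        then have "piece k x (fst v) (snd v) * \<bar>D v\<bar> \<le> (\<Sum>j<Suc k. piece j x (fst v) (snd v)) * \<bar>D v\<bar>"
          by (rule mult_right_mono) simp
        also have "\<dots> \<le> avg_kernel x (fst v) (snd v) * \<bar>D v\<bar>" by (rule partial)
        also have "\<dots> \<le> \<bar>avg_kernel x (fst v) (snd v) * D v\<bar>" by (simp add: abs_mult mult_right_mono)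
        finally show ?thesis by (simp add: abs_mult piece_nonneg)
      qed
      then show "AE v in lborel. norm (piece k x (fst v) (snd v) * D v) \<le> norm (avg_kernel x (fst v) (snd v) * D v)" by auto
    qed measurable
    have part: "(\<integral>v. (\<Sum>k<n. piece k x (fst v) (snd v)) * D v \<partial>lborel) = cut n x * mollify n u x" for n
    proof -
      have "(\<integral>v. (\<Sum>k<n. piece k x (fst v) (snd v)) * D v \<partial>lborel) = (\<Sum>k<n. \<integral>v. piece k x (fst v) (snd v) * D v \<partial>lborel)"
        unfolding sum_distrib_right by (rule Bochner_Integration.integral_sum) (rule PI)
      also have "\<dots> = (\<Sum>k<n. cut (Suc k) x * mollify (Suc k) u x - cut k x * mollify k u x)"
        unfolding D_def by (intro sum.cong refl piece_difference_integral[OF u u0] PI[unfolded D_def])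
      also have "\<dots> = cut n x * mollify n u x - cut 0 x * mollify 0 u x"
        by (rule sum_lessThan_telescope)
      finally show ?thesis by (simp add: cut_0)
    qed
    have "(\<lambda>n. \<integral>v. (\<Sum>k<n. piece k x (fst v) (snd v)) * D v \<partial>lborel) \<longlonglongrightarrow> (\<integral>v. avg_kernel x (fst v) (snd v) * D v \<partial>lborel)"
    proof (rule integral_dominated_convergence[where w="\<lambda>v. \<bar>avg_kernel x (fst v) (snd v) * D v\<bar>"])
      show "AE v in lborel. (\<lambda>n. (\<Sum>k<n. piece k x (fst v) (snd v)) * D v) \<longlonglongrightarrow> avg_kernel x (fst v) (snd v) * D v"
      proof (rule AE_I2)
        fix v :: "'a \<times> 'a"
        show "(\<lambda>n. (\<Sum>k<n. piece k x (fst v) (snd v)) * D v) \<longlonglongrightarrow> avg_kernel x (fst v) (snd v) * D v"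
        proof (cases "fst v = snd v")
          case True then show ?thesis by (simp add: D_def)
        next
          case False
          show ?thesis unfolding avg_kernel_def
            by (intro tendsto_intros summable_LIMSEQ piece_summable False)
        qed
      qed
      show "AE v in lborel. norm ((\<Sum>k<n. piece k x (fst v) (snd v)) * D v) \<le> \<bar>avg_kernel x (fst v) (snd v) * D v\<bar>" for n
        using bound by auto
    qed (use ED in auto)
    then have 1: "(\<lambda>n. cut n x * mollify n u x) \<longlonglongrightarrow> reconstruct (quot u) x"
      by (simp add: part reconstruct_def Dq)
    have "(\<lambda>n. cut n x) \<longlonglongrightarrow> 1"
      using cut_tendsto[of x] elim(3) True by (intro tendsto_eventually) auto
    from tendsto_mult[OF this mollify_tendsto[OF u True elim(2)]]
    have 2: "(\<lambda>n. cut n x * mollify n u x) \<longlonglongrightarrow> u x" by simp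
    show ?thesis by (rule LIMSEQ_unique[OF 1 2])
  qed
qed
qed

lemma AE_pair_measure_pair: "AE x in lborel. P x \<Longrightarrow> AE w in pair_measure. P (fst w) \<and> P (snd w)"
  unfolding pair_measure_def by (subst AE_density) (use AE_lborel_pair[of P] in \<open>auto elim: eventually_mono\<close>)

lemma R_quot:
  assumes um [measurable]: "u \<in> borel_measurable borel" and u0: "\<And>x. x \<notin> K \<Longrightarrow> u x = 0"
    and I: "integrable pair_measure (quot u)"
  shows "AE w in pair_measure. R (quot u) w = quot u w"
proof -
  have "AE x in lborel. reconstruct (quot u) x = u x" by (rule reconstruct_quot[OF um u0 I])
  from R_eq_quot_reconstruct[OF I] AE_pair_measure_pair[OF this] show ?thesis
    by eventually_elim (simp add: quot_def)
qed

text \<open>R f is almost everywhere the quotient of the reconstructed function, which vanishes off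
  \<open>K\<close>; \<open>R\<close> fixes the integrable quotients of such functions.\<close>

sublocale schur_projection pair_measure grad_kernel schur_const
proof unfold_locales
  fix f :: "'a \<times> 'a \<Rightarrow> real" assume f: "integrable pair_measure f"
  have [measurable]: "f \<in> borel_measurable borel"
    using borel_measurable_integrable[OF f] by (simp add: measurable_cong_sets[OF sets_pair_measure refl])
  have Em: "reconstruct f \<in> borel_measurable borel" by measurable
  have ae: "AE w in pair_measure. R f w = quot (reconstruct f) w" by (rule R_eq_quot_reconstruct[OF f])
  have m1: "R f \<in> borel_measurable pair_measure" using R_measurable by measurable
  have m2: "quot (reconstruct f) \<in> borel_measurable pair_measure" by (simp add: measurable_cong_sets[OF sets_pair_measure refl])
  have i: "integrable pair_measure (quot (reconstruct f))"
    using R_integrable[OF f] integrable_cong_AE[OF m1 m2 ae] by simp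
  have RR: "R (R f) w = R (quot (reconstruct f)) w" for w
    by (rule R_cong_AE[OF m1 m2 ae]) simp
  have ae_RE: "AE w in pair_measure. R (quot (reconstruct f)) w = quot (reconstruct f) w"
    by (rule R_quot[OF Em reconstruct_outside i])
  show "AE w in pair_measure. R (R f) w = R f w"
    using ae_RE ae by eventually_elim (simp add: RR)
qed

end

section \<open>Lipschitz domains\<close>

text \<open>The graph is the image of a hyperplane under a Lipschitz map of the whole space's
  dimension, and such maps preserve null sets.\<close>

lemma Lipschitz_graph_negligible:
  fixes e :: "'a::euclidean_space"
  assumes e: "norm e = 1" and g: "L-lipschitz_on {y. y \<bullet> e = 0} g"
  shows "negligible {x. x \<bullet> e = g (x - (x \<bullet> e) *\<^sub>R e)}"
proof -
  have ee: "e \<bullet> e = 1" using e by (simp add: dot_square_norm)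
  define H where "H = {y :: 'a. y \<bullet> e = 0}"
  define f where "f y = y + g y *\<^sub>R e" for y
  have "negligible H"
  proof -
    have "e \<noteq> 0" using e by auto
    then show ?thesis unfolding H_def using negligible_hyperplane[of e 0] by (simp add: inner_commute)
  qed
  then have "negligible (f ` H)"
  proof (rule negligible_locally_Lipschitz_image[OF order_refl])
    fix x assume x: "x \<in> H"
    have "norm (f y - f x) \<le> (1 + L) * norm (y - x)" if y: "y \<in> H" for y
    proof -
      have "norm (f y - f x) = norm ((y - x) + (g y - g x) *\<^sub>R e)"
        by (simp add: f_def algebra_simps)
      also have "\<dots> \<le> norm (y - x) + \<bar>g y - g x\<bar>"
        using norm_triangle_ineq[of "y - x" "(g y - g x) *\<^sub>R e"] e by simp
      also have "\<bar>g y - g x\<bar> \<le> L * norm (y - x)"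
        using lipschitz_onD[OF g, of y x] x y by (simp add: H_def dist_norm)
      finally show ?thesis by (simp add: distrib_right)
    qed
    then show "\<exists>U B. open U \<and> x \<in> U \<and> (\<forall>y\<in>H \<inter> U. norm (f y - f x) \<le> B * norm (y - x))"
      by (intro exI[of _ UNIV] exI[of _ "1 + L"]) auto
  qed
  moreover have "{x. x \<bullet> e = g (x - (x \<bullet> e) *\<^sub>R e)} \<subseteq> f ` H"
  proof
    fix x assume "x \<in> {x. x \<bullet> e = g (x - (x \<bullet> e) *\<^sub>R e)}"
    then have x: "x \<bullet> e = g (x - (x \<bullet> e) *\<^sub>R e)" by simp
    show "x \<in> f ` H"
    proof (rule image_eqI)
      show "x - (x \<bullet> e) *\<^sub>R e \<in> H" by (simp add: H_def inner_diff_left ee)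
      show "x = f (x - (x \<bullet> e) *\<^sub>R e)" unfolding f_def x[symmetric] by simp
    qed
  qed
  ultimately show ?thesis by (rule negligible_subset)
qed

text \<open>The function h measures how far a point lies below the graph, so in the chart the domain
  is {h < 0} and its frontier lies in {h = 0}. Moving from z by t/2 against e raises h to t/2, and h
  is Lipschitz, so a ball of proportional radius stays outside. The radius of the chart is halved so
  that all balls remain in it.\<close>

lemma Lipschitz_chart:
  fixes \<Omega> :: "'a::euclidean_space set"
  assumes \<Omega>: "open \<Omega>" "lipschitz_boundary \<Omega>" and z0: "z0 \<in> frontier \<Omega>"
  shows "\<exists>r>0. negligible (frontier \<Omega> \<inter> ball z0 r) \<and>
    (\<exists>c>0. \<forall>z\<in>frontier \<Omega> \<inter> ball z0 r. \<forall>t. 0 < t \<longrightarrow> t \<le> r \<longrightarrow> (\<exists>w. ball w (c * t) \<subseteq> ball z t - closure \<Omega>))"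
proof -
  obtain r e L and g :: "'a \<Rightarrow> real" where r: "r > 0" and e: "norm e = 1" and g: "L-lipschitz_on {y. y \<bullet> e = 0} g"
    and ch: "\<Omega> \<inter> ball z0 r = {x \<in> ball z0 r. g (x - (x \<bullet> e) *\<^sub>R e) < x \<bullet> e}"
    using \<Omega>(2) z0 unfolding lipschitz_boundary_def by blast
  have ee: "e \<bullet> e = 1" using e by (simp add: dot_square_norm)
  have L: "0 \<le> L" using lipschitz_on_nonneg[OF g] .
  define h where "h x = g (x - (x \<bullet> e) *\<^sub>R e) - x \<bullet> e" for x
  have h_iff: "x \<in> \<Omega> \<longleftrightarrow> h x < 0" if "x \<in> ball z0 r" for x
  proof -
    have "x \<in> \<Omega> \<inter> ball z0 r \<longleftrightarrow> x \<in> {x \<in> ball z0 r. g (x - (x \<bullet> e) *\<^sub>R e) < x \<bullet> e}" by (simp only: ch)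
    then show ?thesis using that by (simp add: h_def)
  qed
  have gl: "\<bar>g (x - (x \<bullet> e) *\<^sub>R e) - g (y - (y \<bullet> e) *\<^sub>R e)\<bar> \<le> 2 * L * norm (x - y)" for x y
  proof -
    have "\<bar>g (x - (x \<bullet> e) *\<^sub>R e) - g (y - (y \<bullet> e) *\<^sub>R e)\<bar> \<le> L * norm ((x - (x \<bullet> e) *\<^sub>R e) - (y - (y \<bullet> e) *\<^sub>R e))"
      using lipschitz_onD[OF g, of "x - (x \<bullet> e) *\<^sub>R e" "y - (y \<bullet> e) *\<^sub>R e"]
      by (simp add: inner_diff_left ee dist_norm)
    also have "(x - (x \<bullet> e) *\<^sub>R e) - (y - (y \<bullet> e) *\<^sub>R e) = (x - y) - ((x - y) \<bullet> e) *\<^sub>R e"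
      by (simp add: inner_diff_left algebra_simps)
    also have "norm \<dots> \<le> norm (x - y) + \<bar>(x - y) \<bullet> e\<bar>"
      using norm_triangle_ineq4[of "x - y" "((x - y) \<bullet> e) *\<^sub>R e"] e by simp
    also have "\<bar>(x - y) \<bullet> e\<bar> \<le> norm (x - y)"
      using Cauchy_Schwarz_ineq2[of "x - y" e] e by simp
    finally show ?thesis using L by (simp add: mult_left_mono)
  qed
  have ie: "\<bar>x \<bullet> e - y \<bullet> e\<bar> \<le> norm (x - y)" for x y
    using Cauchy_Schwarz_ineq2[of "x - y" e] e by (simp add: inner_diff_left)
  have hl: "\<bar>h x - h y\<bar> \<le> (1 + 2 * L) * norm (x - y)" for x y
    using gl[of x y] ie[of x y] unfolding h_def distrib_right by linarith
  have fr: "frontier \<Omega> = closure \<Omega> - \<Omega>" using \<Omega>(1) by (simp add: frontier_def interior_open)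
  have h0: "h x = 0" if x: "x \<in> frontier \<Omega>" "x \<in> ball z0 r" for x
  proof (rule antisym)
    show "0 \<le> h x" using h_iff[OF x(2)] x(1) fr by auto
    show "h x \<le> 0"
    proof (rule ccontr)
      assume "\<not> h x \<le> 0"
      then have hx: "h x > 0" by simp
      define \<epsilon> where "\<epsilon> = min (h x / (1 + 2 * L)) (r - dist z0 x)"
      have "\<epsilon> > 0" using hx L x(2) by (simp add: \<epsilon>_def)
      then obtain y where y: "y \<in> \<Omega>" "dist y x < \<epsilon>"
        using x(1) fr closure_approachable[of x \<Omega>] by blast
      have "dist z0 y < r" using y(2) dist_triangle[of z0 y x] by (simp add: \<epsilon>_def dist_commute)
      then have "h y < 0" using h_iff[of y] y by simp
      moreover have "(1 + 2 * L) * norm (x - y) < h x"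
        using y(2) L by (simp add: \<epsilon>_def dist_norm norm_minus_commute field_simps)
      ultimately show False using hl[of x y] by linarith
    qed
  qed
  have "negligible (frontier \<Omega> \<inter> ball z0 (r / 2))"
    by (rule negligible_subset[OF Lipschitz_graph_negligible[OF e g]])
       (use h0 r in \<open>auto simp: h_def\<close>)
  moreover have "\<exists>w. ball w (1 / (4 * (1 + L)) * t) \<subseteq> ball z t - closure \<Omega>"
    if z: "z \<in> frontier \<Omega>" "z \<in> ball z0 (r / 2)" and t: "0 < t" "t \<le> r / 2" for z t
  proof -
    \<comment> \<open>Chosen so that h, with Lipschitz constant at most 1 + 2 L, changes by at most
      t/2 over distance c t; the bound c \<le> 1/4 keeps the small ball inside
      \<open>ball z t\<close>.\<close>
    define c where "c = 1 / (4 * (1 + L))"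
    have c: "0 < c" "c \<le> 1 / 4" "(1 + 2 * L) * c \<le> 1 / 2" using L by (auto simp: c_def field_simps)
    define w where "w = z - (t / 2) *\<^sub>R e"
    have in_ball: "x \<in> ball z t" and out: "x \<notin> \<Omega>" if x: "x \<in> ball w (c * t)" for x
    proof -
      have xw: "norm (x - w) < c * t" using x by (simp add: dist_norm norm_minus_commute)
      have wz: "norm (w - z) = t / 2" using e t by (simp add: w_def)
      have "c * t \<le> t / 4" using c t mult_right_mono[of c "1/4" t] by simp
      moreover have "norm (x - z) \<le> norm (x - w) + norm (w - z)" using norm_triangle_ineq[of "x - w" "w - z"] by simp
      ultimately have xz: "norm (x - z) < t" using xw wz t by linarith
      then show "x \<in> ball z t" by (simp add: dist_norm norm_minus_commute)
      have "dist z0 x < r" using dist_triangle[of z0 x z] z(2) xz t by (simp add: dist_norm norm_minus_commute)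
      moreover have "h x \<ge> 0"
      proof -
        have hz: "h z = 0" using h0[OF z(1)] z(2) r by simp
        have "w - (w \<bullet> e) *\<^sub>R e = z - (z \<bullet> e) *\<^sub>R e" by (simp add: w_def inner_diff_left ee algebra_simps)
        moreover have "w \<bullet> e = z \<bullet> e - t / 2" by (simp add: w_def inner_diff_left ee)
        ultimately have "h w = t / 2" using hz by (simp add: h_def)
        moreover have "(1 + 2 * L) * norm (x - w) \<le> t / 2"
        proof -
          have "(1 + 2 * L) * norm (x - w) \<le> (1 + 2 * L) * (c * t)" using xw L by (intro mult_left_mono) auto
          also have "\<dots> = ((1 + 2 * L) * c) * t" by simp
          also have "\<dots> \<le> 1 / 2 * t" using c t by (intro mult_right_mono) auto
          finally show ?thesis by simp
        qed
        ultimately show ?thesis using hl[of x w] by linarith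
      qed
      ultimately show "x \<notin> \<Omega>" using h_iff[of x] by auto
    qed
    \<comment> \<open>An open set that misses the domain also misses its closure.\<close>
    have "ball w (c * t) \<inter> closure \<Omega> = {}"
      using out by (subst open_Int_closure_eq_empty) auto
    then show ?thesis using in_ball unfolding c_def by blast
  qed
  ultimately show ?thesis using r L by (intro exI[of _ "r / 2"] conjI exI[of _ "1 / (4 * (1 + L))"]) auto
qed

text \<open>Finitely many charts cover the compact frontier. The exterior balls exist in them only
  for small t; larger t up to T are shrunk by a fixed factor first.\<close>

lemma frontier_Lipschitz_negligible:
  fixes \<Omega> :: "'a::euclidean_space set"
  assumes "bounded_lipschitz_domain \<Omega>"
  shows "negligible (frontier \<Omega>)"
    and "0 < T \<Longrightarrow> \<exists>c>0. \<forall>z\<in>frontier \<Omega>. \<forall>t. 0 < t \<longrightarrow> t \<le> T \<longrightarrow> (\<exists>w. ball w (c * t) \<subseteq> ball z t - closure \<Omega>)"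
proof -
  have \<Omega>: "open \<Omega>" "lipschitz_boundary \<Omega>" "bounded \<Omega>" using assms by (auto simp: bounded_lipschitz_domain_def)
  have "\<forall>z0\<in>frontier \<Omega>. \<exists>r c. r > 0 \<and> c > 0 \<and> negligible (frontier \<Omega> \<inter> ball z0 r) \<and>
     (\<forall>z\<in>frontier \<Omega> \<inter> ball z0 r. \<forall>t. 0 < t \<longrightarrow> t \<le> r \<longrightarrow> (\<exists>w. ball w (c * t) \<subseteq> ball z t - closure \<Omega>))"
    using Lipschitz_chart[OF \<Omega>(1,2)] by meson
  then obtain r c where rc: "\<And>z0. z0 \<in> frontier \<Omega> \<Longrightarrow> r z0 > 0" "\<And>z0. z0 \<in> frontier \<Omega> \<Longrightarrow> c z0 > 0"
    "\<And>z0. z0 \<in> frontier \<Omega> \<Longrightarrow> negligible (frontier \<Omega> \<inter> ball z0 (r z0))"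
    "\<And>z0 z t. z0 \<in> frontier \<Omega> \<Longrightarrow> z \<in> frontier \<Omega> \<inter> ball z0 (r z0) \<Longrightarrow> 0 < t \<Longrightarrow> t \<le> r z0 \<Longrightarrow> \<exists>w. ball w (c z0 * t) \<subseteq> ball z t - closure \<Omega>"
    by metis
  have "compact (frontier \<Omega>)" using \<Omega>(3) by (simp add: compact_frontier_bounded)
  then obtain Z where Z: "Z \<subseteq> frontier \<Omega>" "finite Z" "frontier \<Omega> \<subseteq> (\<Union>z\<in>Z. ball z (r z))"
    using rc(1) by (elim compactE_image[of _ "frontier \<Omega>" "\<lambda>z. ball z (r z)"]) auto
  have "negligible (\<Union>z\<in>Z. frontier \<Omega> \<inter> ball z (r z))"
    using Z rc(3) by (intro negligible_Union) auto
  then show "negligible (frontier \<Omega>)" by (rule negligible_subset) (use Z(3) in auto)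
  assume T: "0 < T"
  show "\<exists>c>0. \<forall>z\<in>frontier \<Omega>. \<forall>t. 0 < t \<longrightarrow> t \<le> T \<longrightarrow> (\<exists>w. ball w (c * t) \<subseteq> ball z t - closure \<Omega>)"
  proof (cases "Z = {}")
    case True
    then show ?thesis using Z(3) by (intro exI[of _ 1]) auto
  next
    case False
    define r0 where "r0 = Min (r ` Z)"
    define c0 where "c0 = Min (c ` Z)"
    have r0: "r0 > 0" "\<And>z. z \<in> Z \<Longrightarrow> r0 \<le> r z" using Z False rc(1) by (auto simp: r0_def)
    have c0: "c0 > 0" "\<And>z. z \<in> Z \<Longrightarrow> c0 \<le> c z" using Z False rc(2) by (auto simp: c0_def)
    \<comment> \<open>Shrinking factor: t \<le> T implies that m t is at most the smallest chart
      radius.\<close>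
    define m where "m = min 1 (r0 / T)"
    have m: "0 < m" "m \<le> 1" "m * T \<le> r0" using r0 T by (auto simp: m_def min_def field_simps)
    show ?thesis
    proof (intro exI[of _ "c0 * m"] conjI ballI allI impI)
      show "0 < c0 * m" using c0 m by simp
      fix z t assume z: "z \<in> frontier \<Omega>" and t: "0 < t" "t \<le> T"
      obtain z0 where z0: "z0 \<in> Z" "z \<in> ball z0 (r z0)" using Z(3) z by blast
      have z0f: "z0 \<in> frontier \<Omega>" using z0 Z by auto
      have mt: "0 < m * t" "m * t \<le> r z0"
      proof -
        show "0 < m * t" using m t by simp
        have "m * t \<le> m * T" using m t by (intro mult_left_mono) auto
        then show "m * t \<le> r z0" using m(3) r0(2)[OF z0(1)] by linarith
      qed
      obtain w where w: "ball w (c z0 * (m * t)) \<subseteq> ball z (m * t) - closure \<Omega>"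
        using rc(4)[OF z0f _ mt] z z0 by blast
      have "c0 * m * t \<le> c z0 * (m * t)"
        using mult_right_mono[OF c0(2)[OF z0(1)], of "m * t"] mt by (simp add: mult.assoc)
      moreover have "m * t \<le> t" using m t by (simp add: mult_left_le_one_le)
      ultimately have "ball w (c0 * m * t) \<subseteq> ball w (c z0 * (m * t))" "ball z (m * t) \<subseteq> ball z t"
        by (auto intro: subset_ball)
      then show "\<exists>w. ball w (c0 * m * t) \<subseteq> ball z t - closure \<Omega>" using w by blast
    qed
  qed
qed

text \<open>A segment from y to an exterior point at distance below 3 t meets the frontier at some
  z. The exterior ball inside \<open>ball z t\<close> then lies in
  \<open>ball y (4 * t)\<close>.\<close>

lemma Lipschitz_domain_exterior_measure:
  fixes \<Omega> :: "'a::euclidean_space set"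
  assumes \<Omega>: "bounded_lipschitz_domain \<Omega>" and T: "0 < T"
  shows "\<exists>c>0. \<forall>y\<in>closure \<Omega>. \<forall>t. 0 < t \<longrightarrow> t \<le> T \<longrightarrow> infdist y (- closure \<Omega>) < 3 * t \<longrightarrow>
     c * t ^ DIM('a) \<le> measure lborel (ball y (4 * t) - closure \<Omega>)"
proof -
  obtain c where c: "c > 0" "\<And>z t. z \<in> frontier \<Omega> \<Longrightarrow> 0 < t \<Longrightarrow> t \<le> T \<Longrightarrow> \<exists>w. ball w (c * t) \<subseteq> ball z t - closure \<Omega>"
    using frontier_Lipschitz_negligible(2)[OF \<Omega> T] by metis
  have "bounded (closure \<Omega>)" using \<Omega> by (auto simp: bounded_lipschitz_domain_def intro: bounded_closure)
  then have ne: "- closure \<Omega> \<noteq> {}" using not_bounded_UNIV by (metis Compl_empty_eq double_complement)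
  have V: "unit_ball_vol (real DIM('a)) > 0" by (rule unit_ball_vol_pos) simp
  show ?thesis
  proof (intro exI[of _ "unit_ball_vol (real DIM('a)) * c ^ DIM('a)"] conjI ballI allI impI)
    show "0 < unit_ball_vol (real DIM('a)) * c ^ DIM('a)" using V c(1) by simp
    fix y t assume y: "y \<in> closure \<Omega>" and t: "0 < t" "t \<le> T" "infdist y (- closure \<Omega>) < 3 * t"
    have "(INF b\<in>- closure \<Omega>. dist y b) < 3 * t" using t(3) ne by (simp add: infdist_notempty)
    then obtain b where b: "b \<notin> closure \<Omega>" "dist y b < 3 * t"
      using cINF_less_iff[OF ne, of "dist y" "3 * t"] by (auto intro: bdd_belowI[of _ 0])
    have "closed_segment y b \<inter> frontier (closure \<Omega>) \<noteq> {}"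
      using y b by (intro connected_Int_frontier) auto
    then obtain z where z: "z \<in> closed_segment y b" "z \<in> frontier (closure \<Omega>)" by blast
    \<comment> \<open>The segment argument gives the frontier of the closure, which is part of the
      frontier of the domain; the exterior balls are available for the latter.\<close>
    have zf: "z \<in> frontier \<Omega>" using z(2) interior_mono[OF closure_subset, of \<Omega>] by (auto simp: frontier_def)
    have yz: "dist y z < 3 * t" using segment_bound1[OF z(1)] b(2) by (simp add: dist_norm norm_minus_commute)
    obtain w where w: "ball w (c * t) \<subseteq> ball z t - closure \<Omega>" using c(2)[OF zf t(1,2)] by blast
    have "ball z t \<subseteq> ball y (4 * t)"
    proof
      fix x assume "x \<in> ball z t"
      then show "x \<in> ball y (4 * t)" using yz dist_triangle[of y x z] by simp
    qed
    with w have sub: "ball w (c * t) \<subseteq> ball y (4 * t) - closure \<Omega>" by blast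
    have fin: "emeasure lborel (ball y (4 * t) - closure \<Omega>) < \<infinity>"
      by (rule le_less_trans[OF emeasure_mono emeasure_lborel_ball_finite[of y "4 * t"]]) auto
    have "unit_ball_vol (real DIM('a)) * c ^ DIM('a) * t ^ DIM('a) = measure lborel (ball w (c * t))"
      using c(1) t(1) by (simp add: content_ball power_mult_distrib)
    also have "\<dots> \<le> measure lborel (ball y (4 * t) - closure \<Omega>)"
      using sub fin by (intro measure_mono_fmeasurable) (auto simp: fmeasurable_def)
    finally show "unit_ball_vol (real DIM('a)) * c ^ DIM('a) * t ^ DIM('a) \<le> measure lborel (ball y (4 * t) - closure \<Omega>)" .
  qed
qed

lemma Lipschitz_domain_boundary_null:
  fixes \<Omega> :: "'a::euclidean_space set"
  assumes \<Omega>: "bounded_lipschitz_domain \<Omega>"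
  shows "AE x in lborel. x \<in> closure \<Omega> \<longrightarrow> 0 < infdist x (- closure \<Omega>)"
proof -
  have "bounded (closure \<Omega>)" using \<Omega> by (auto simp: bounded_lipschitz_domain_def intro: bounded_closure)
  then have ne: "- closure \<Omega> \<noteq> {}" using not_bounded_UNIV by (metis Compl_empty_eq double_complement)
  have o: "open \<Omega>" using \<Omega> by (simp add: bounded_lipschitz_domain_def)
  have "frontier \<Omega> \<in> null_sets lebesgue"
    using frontier_Lipschitz_negligible(1)[OF \<Omega>] by (simp add: negligible_iff_null_sets)
  then have "AE x in lebesgue. x \<notin> frontier \<Omega>" by (rule AE_not_in)
  then have "AE x in lborel. x \<notin> frontier \<Omega>" by (simp add: AE_completion_iff)
  then show ?thesis
  proof eventually_elim
    case (elim x)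
    show ?case
    proof
      assume "x \<in> closure \<Omega>"
      then have "x \<in> interior (closure \<Omega>)"
        using elim o interior_mono[OF closure_subset, of \<Omega>] by (auto simp: frontier_def interior_open)
      then have "x \<notin> closure (- closure \<Omega>)" by (simp add: closure_complement)
      then show "0 < infdist x (- closure \<Omega>)"
        using in_closure_iff_infdist_zero[OF ne, of x] infdist_nonneg[of x "- closure \<Omega>"] by linarith
    qed
  qed
qed

section \<open>Comparison of Gagliardo norms with L^p norms of difference quotients\<close>

context whitney_domain
begin

text \<open>Far from the diagonal the difference is estimated by the two values separately, and the
  kernel is integrable in the other variable. Hence the order of differentiability affects only the
  near part of a seminorm.\<close>

lemma tail_bound:
  fixes a p :: real
  assumes a: "0 < a" and p: "0 < p"
  shows "\<exists>C\<ge>0. \<forall>u\<in>borel_measurable borel.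
    (\<integral>\<^sup>+w. ennreal (\<bar>u (fst w) - u (snd w)\<bar> powr p * (if 6 * T \<le> norm (fst w - snd w) then norm (fst w - snd w) powr (- a - real DIM('a)) else 0)) \<partial>lborel)
      \<le> ennreal C * (\<integral>\<^sup>+x. ennreal (\<bar>u x\<bar> powr p) \<partial>(lborel :: 'a measure))"
proof -
  define h where "h w = (if 6 * T \<le> norm w then norm w powr (- a - real DIM('a)) else 0)" for w :: 'a
  have [measurable]: "h \<in> borel_measurable borel" unfolding h_def[abs_def] by measurable
  have h0: "0 \<le> h w" for w by (simp add: h_def)
  obtain C0 where C0: "C0 \<ge> 0" "\<And>t. t > 0 \<Longrightarrow> (\<integral>\<^sup>+w. ennreal (if t \<le> norm w then norm w powr (- a - real DIM('a)) else 0) \<partial>(lborel :: 'a measure)) \<le> ennreal (C0 * t powr (- a))"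
    using nn_integral_norm_powr_outside[OF a] by metis
  define D where "D = C0 * (6 * T) powr (- a)"
  have D: "D \<ge> 0" using C0 by (simp add: D_def)
  have hI: "(\<integral>\<^sup>+w. ennreal (h w) \<partial>lborel) \<le> ennreal D"
    using C0(2)[of "6 * T"] T_pos unfolding h_def D_def by simp
  show ?thesis
  proof (intro exI[of _ "2 powr p * (2 * D)"] conjI ballI)
    show "0 \<le> 2 powr p * (2 * D)" using D by simp
    fix u :: "'a \<Rightarrow> real" assume [measurable]: "u \<in> borel_measurable borel"
    define N where "N = (\<integral>\<^sup>+x. ennreal (\<bar>u x\<bar> powr p) \<partial>(lborel :: 'a measure))"
    have A1: "(\<integral>\<^sup>+w. ennreal (\<bar>u (fst w)\<bar> powr p) * ennreal (h (fst w - snd w)) \<partial>lborel) = N * (\<integral>\<^sup>+w. ennreal (h w) \<partial>lborel)"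
    proof -
      have "(\<integral>\<^sup>+w. ennreal (\<bar>u (fst w)\<bar> powr p) * ennreal (h (fst w - snd w)) \<partial>lborel)
        = (\<integral>\<^sup>+x. \<integral>\<^sup>+y. ennreal (\<bar>u x\<bar> powr p) * ennreal (h (x - y)) \<partial>lborel \<partial>lborel)"
        by (subst nn_integral_lborel_pair) (simp_all, measurable)
      also have "\<dots> = (\<integral>\<^sup>+x. ennreal (\<bar>u x\<bar> powr p) * (\<integral>\<^sup>+w. ennreal (h w) \<partial>lborel) \<partial>lborel)"
        by (intro nn_integral_cong) (simp add: nn_integral_cmult nn_integral_reflect[of "\<lambda>w. ennreal (h w)"])
      also have "\<dots> = N * (\<integral>\<^sup>+w. ennreal (h w) \<partial>lborel)" unfolding N_def by (rule nn_integral_multc) measurable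
      finally show ?thesis .
    qed
    have A2: "(\<integral>\<^sup>+w. ennreal (\<bar>u (snd w)\<bar> powr p) * ennreal (h (fst w - snd w)) \<partial>lborel) = N * (\<integral>\<^sup>+w. ennreal (h w) \<partial>lborel)"
    proof -
      have "(\<integral>\<^sup>+w. ennreal (\<bar>u (snd w)\<bar> powr p) * ennreal (h (fst w - snd w)) \<partial>lborel)
        = (\<integral>\<^sup>+x. \<integral>\<^sup>+y. ennreal (\<bar>u y\<bar> powr p) * ennreal (h (x - y)) \<partial>lborel \<partial>lborel)"
        by (subst nn_integral_lborel_pair) (simp_all, measurable)
      also have "\<dots> = (\<integral>\<^sup>+y. \<integral>\<^sup>+x. ennreal (\<bar>u y\<bar> powr p) * ennreal (h (x - y)) \<partial>lborel \<partial>lborel)"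
        by (subst lborel_pair.Fubini') auto
      also have "\<dots> = (\<integral>\<^sup>+y. ennreal (\<bar>u y\<bar> powr p) * (\<integral>\<^sup>+w. ennreal (h w) \<partial>lborel) \<partial>lborel)"
        by (intro nn_integral_cong) (simp add: nn_integral_cmult nn_integral_shift[of "\<lambda>w. ennreal (h w)"])
      also have "\<dots> = N * (\<integral>\<^sup>+w. ennreal (h w) \<partial>lborel)" unfolding N_def by (rule nn_integral_multc) measurable
      finally show ?thesis .
    qed
    have "(\<integral>\<^sup>+w. ennreal (\<bar>u (fst w) - u (snd w)\<bar> powr p * h (fst w - snd w)) \<partial>lborel)
      \<le> (\<integral>\<^sup>+w. ennreal (2 powr p) * (ennreal (\<bar>u (fst w)\<bar> powr p) * ennreal (h (fst w - snd w)) + ennreal (\<bar>u (snd w)\<bar> powr p) * ennreal (h (fst w - snd w))) \<partial>lborel)"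
    proof (rule nn_integral_mono)
      fix w :: "'a \<times> 'a"
      have "\<bar>u (fst w) - u (snd w)\<bar> powr p * h (fst w - snd w) \<le> 2 powr p * (\<bar>u (fst w)\<bar> powr p + \<bar>u (snd w)\<bar> powr p) * h (fst w - snd w)"
        using powr_add_bound[of p "u (fst w)" "- u (snd w)"] p h0 by (intro mult_right_mono) auto
      then have "ennreal (\<bar>u (fst w) - u (snd w)\<bar> powr p * h (fst w - snd w)) \<le> ennreal (2 powr p * (\<bar>u (fst w)\<bar> powr p * h (fst w - snd w) + \<bar>u (snd w)\<bar> powr p * h (fst w - snd w)))"
        by (intro ennreal_leI) (simp add: algebra_simps)
      also have "\<dots> = ennreal (2 powr p) * (ennreal (\<bar>u (fst w)\<bar> powr p) * ennreal (h (fst w - snd w)) + ennreal (\<bar>u (snd w)\<bar> powr p) * ennreal (h (fst w - snd w)))"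
        using h0 by (simp add: ennreal_mult ennreal_plus)
      finally show "ennreal (\<bar>u (fst w) - u (snd w)\<bar> powr p * h (fst w - snd w)) \<le> \<dots>" .
    qed
    also have "\<dots> = ennreal (2 powr p) * (N * (\<integral>\<^sup>+w. ennreal (h w) \<partial>lborel) + N * (\<integral>\<^sup>+w. ennreal (h w) \<partial>lborel))"
      by (subst nn_integral_cmult, measurable, subst nn_integral_add, measurable, simp only: A1 A2)
    also have "\<dots> \<le> ennreal (2 powr p) * (N * ennreal D + N * ennreal D)"
      by (intro mult_left_mono add_mono hI) auto
    also have "\<dots> = ennreal (2 powr p * (2 * D)) * N"
    proof -
      have "N * ennreal D + N * ennreal D = ennreal (2 * D) * N"
        using D by (simp only: mult_2 ennreal_plus distrib_right mult.commute[of N])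
      then show ?thesis using D by (simp only: ennreal_mult powr_ge_zero mult.assoc mult_nonneg_nonneg zero_le_numeral)
    qed
    finally show "(\<integral>\<^sup>+w. ennreal (\<bar>u (fst w) - u (snd w)\<bar> powr p * (if 6 * T \<le> norm (fst w - snd w) then norm (fst w - snd w) powr (- a - real DIM('a)) else 0)) \<partial>lborel)
      \<le> ennreal (2 powr p * (2 * D)) * (\<integral>\<^sup>+x. ennreal (\<bar>u x\<bar> powr p) \<partial>(lborel :: 'a measure))"
      by (simp only: h_def N_def)
  qed
qed

text \<open>The solution of 2 \<tau> - d - (s + \<tau>) p = -(d + ord p * p), where the left side is
  the exponent of |x - y| in the integrand of |D u|^p dM near the diagonal.\<close>

definition ord :: "real \<Rightarrow> real" where
  "ord p = s + \<tau> * (1 - 2 / p)"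

lemma ord_pos: "1 < p \<Longrightarrow> 0 < ord p"
proof -
  assume p: "1 < p"
  have "\<tau> * (1 - 2 / p) \<ge> \<tau> * (- 1)" using p \<tau>_pos by (intro mult_left_mono) (auto simp: field_simps)
  then show ?thesis unfolding ord_def using \<tau>_less by linarith
qed

lemma gagliardo_measurable [measurable]:
  assumes [measurable]: "u \<in> borel_measurable borel"
  shows "gagliardo_integrand \<alpha> p (u :: 'a \<Rightarrow> real) \<in> borel_measurable borel"
  unfolding gagliardo_integrand_def case_prod_unfold by measurable

lemma gagliardo_eq_quot:
  assumes p: "1 < p" and w: "norm (fst w - snd w) \<le> 6 * T" and u0: "\<And>x. x \<notin> K \<Longrightarrow> u x = 0"
  shows "gagliardo_integrand (ord p) p u w = pair_density w * \<bar>quot u w\<bar> powr p"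
proof (cases "fst w = snd w \<or> fst w \<notin> K \<and> snd w \<notin> K")
  case True
  then show ?thesis using u0 by (auto simp: gagliardo_integrand_def case_prod_unfold quot_def)
next
  case False
  define v where "v = fst w - snd w"
  have v: "v \<noteq> 0" "norm v \<le> 6 * T" using False w by (auto simp: v_def)
  have e: "2 * \<tau> - real DIM('a) - (s + \<tau>) * p = - (real DIM('a) + ord p * p)"
    using p by (simp add: ord_def field_simps)
  have "pair_density w * \<bar>quot u w\<bar> powr p = dens v * (\<bar>u (fst w) - u (snd w)\<bar> powr p / gap v powr p)"
    using False by (simp add: pair_density_def quot_def v_def powr_divide)
  also have "\<dots> = \<bar>u (fst w) - u (snd w)\<bar> powr p * (norm v powr (2 * \<tau> - real DIM('a)) / norm v powr ((s + \<tau>) * p))"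
    using v by (simp add: dens_small gap_small powr_powr)
  also have "norm v powr (2 * \<tau> - real DIM('a)) / norm v powr ((s + \<tau>) * p) = norm v powr (- (real DIM('a) + ord p * p))"
    unfolding e[symmetric] by (rule powr_diff[symmetric])
  also have "\<bar>u (fst w) - u (snd w)\<bar> powr p * norm v powr (- (real DIM('a) + ord p * p)) = gagliardo_integrand (ord p) p u w"
    unfolding powr_minus by (simp add: gagliardo_integrand_def case_prod_unfold v_def divide_inverse)
  finally show ?thesis by simp
qed

text \<open>Up to distance 6 T the two integrands coincide. Their parts beyond 6 T are both
  controlled by the L^p norm of u, which the Poincare inequality bounds by the quotient.\<close>

lemma norm_equivalence:
  assumes p: "1 < p"
  shows "\<exists>C>0. \<forall>u\<in>borel_measurable borel. (\<forall>x. x \<notin> K \<longrightarrow> u x = 0) \<longrightarrow>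
     (\<integral>\<^sup>+w. ennreal (\<bar>quot u w\<bar> powr p) \<partial>pair_measure) \<le> ennreal C * ((\<integral>\<^sup>+x. ennreal (\<bar>u x\<bar> powr p) \<partial>lborel) + (\<integral>\<^sup>+w. ennreal (gagliardo_integrand (ord p) p u w) \<partial>lborel)) \<and>
     (\<integral>\<^sup>+x. ennreal (\<bar>u x\<bar> powr p) \<partial>lborel) + (\<integral>\<^sup>+w. ennreal (gagliardo_integrand (ord p) p u w) \<partial>lborel) \<le> ennreal C * (\<integral>\<^sup>+w. ennreal (\<bar>quot u w\<bar> powr p) \<partial>pair_measure)"
proof -
  have p0: "0 < p" using p by simp
  have op: "0 < ord p * p" using ord_pos[OF p] p by simp
  define tl where "tl a u w = ennreal (\<bar>u (fst w) - u (snd w)\<bar> powr p * (if 6 * T \<le> norm (fst w - snd w) then norm (fst w - snd w) powr (- a - real DIM('a)) else 0))"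
    for a and u :: "'a \<Rightarrow> real" and w :: "'a \<times> 'a"
  obtain C1 where C1: "C1 \<ge> 0" "\<And>u. u \<in> borel_measurable borel \<Longrightarrow> (\<integral>\<^sup>+w. tl (2 * s) u w \<partial>lborel) \<le> ennreal C1 * (\<integral>\<^sup>+x. ennreal (\<bar>u x\<bar> powr p) \<partial>lborel)"
    using tail_bound[of "2 * s" p] p0 order_bounds unfolding tl_def by fastforce
  obtain C2 where C2: "C2 \<ge> 0" "\<And>u. u \<in> borel_measurable borel \<Longrightarrow> (\<integral>\<^sup>+w. tl (ord p * p) u w \<partial>lborel) \<le> ennreal C2 * (\<integral>\<^sup>+x. ennreal (\<bar>u x\<bar> powr p) \<partial>lborel)"
    using tail_bound[OF op p0] unfolding tl_def by blast
  obtain C3 where C3: "C3 > 0" "\<And>u. u \<in> borel_measurable borel \<Longrightarrow> (\<And>x. x \<notin> K \<Longrightarrow> u x = 0) \<Longrightarrow>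
     (\<integral>\<^sup>+x. ennreal (\<bar>u x\<bar> powr p) \<partial>lborel) \<le> ennreal C3 * (\<integral>\<^sup>+w. ennreal (\<bar>quot u w\<bar> powr p) \<partial>pair_measure)"
    using Poincare[OF p0] by blast
  \<comment> \<open>Beyond distance 6 T, \<open>dens\<close> divided by gap^p is exactly b
    |w|^(-2s-d), as \<open>gap\<close> is constant there.\<close>
  define b where "b = (6 * T) powr (2 * (s + \<tau>)) / ((6 * T) powr (s + \<tau>)) powr p"
  have b: "b \<ge> 0" by (simp add: b_def)
  define C where "C = max (1 + b * C1) (C3 + (1 + C2 * C3))"
  have C: "C > 0" using C3(1) C2(1) by (auto simp: C_def less_max_iff_disj add_pos_nonneg)
  show ?thesis
  proof (intro exI[of _ C] conjI ballI impI C)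
    fix u :: "'a \<Rightarrow> real" assume um [measurable]: "u \<in> borel_measurable borel" and "\<forall>x. x \<notin> K \<longrightarrow> u x = 0"
    then have u0: "\<And>x. x \<notin> K \<Longrightarrow> u x = 0" by blast
    define N where "N = (\<integral>\<^sup>+x. ennreal (\<bar>u x\<bar> powr p) \<partial>lborel)"
    define Gg where "Gg = (\<integral>\<^sup>+w. ennreal (gagliardo_integrand (ord p) p u w) \<partial>lborel)"
    define Q where "Q = (\<integral>\<^sup>+w. ennreal (\<bar>quot u w\<bar> powr p) \<partial>pair_measure)"
    have tlm [measurable]: "tl a u \<in> borel_measurable borel" for a unfolding tl_def[abs_def] by measurable
    have Qe: "Q = (\<integral>\<^sup>+w. ennreal (pair_density w * \<bar>quot u w\<bar> powr p) \<partial>lborel)"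
      unfolding Q_def by (subst nn_integral_pair_measure) (auto simp: ennreal_mult)
    have g0: "0 \<le> gagliardo_integrand (ord p) p u w" for w by (auto simp: gagliardo_integrand_def case_prod_unfold)
    have pw1: "ennreal (pair_density w * \<bar>quot u w\<bar> powr p) \<le> ennreal (gagliardo_integrand (ord p) p u w) + ennreal b * tl (2 * s) u w" for w
    proof (cases "norm (fst w - snd w) \<le> 6 * T")
      case True
      then show ?thesis using gagliardo_eq_quot[OF p True u0] by (simp add: add_increasing2)
    next
      case False
      then have big: "6 * T \<le> norm (fst w - snd w)" by simp
      have g: "gap (fst w - snd w) = (6 * T) powr (s + \<tau>)" using big by (simp add: gap_def min_def)
      have "pair_density w * \<bar>quot u w\<bar> powr p \<le> dens (fst w - snd w) * \<bar>quot u w\<bar> powr p"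
        by (intro mult_right_mono pair_density_le) simp
      also have "\<dots> = b * (\<bar>u (fst w) - u (snd w)\<bar> powr p * norm (fst w - snd w) powr (- (2 * s) - real DIM('a)))"
        using dens_large[OF big] T_pos by (simp add: quot_def g powr_divide b_def)
      finally have "ennreal (pair_density w * \<bar>quot u w\<bar> powr p) \<le> ennreal b * tl (2 * s) u w"
        using b big unfolding tl_def by (subst ennreal_mult[symmetric]) (auto intro: ennreal_leI)
      then show ?thesis by (simp add: add_increasing)
    qed
    have pw2: "ennreal (gagliardo_integrand (ord p) p u w) \<le> ennreal (pair_density w * \<bar>quot u w\<bar> powr p) + tl (ord p * p) u w" for w
    proof (cases "norm (fst w - snd w) \<le> 6 * T")
      case True
      then show ?thesis using gagliardo_eq_quot[OF p True u0] by (simp add: add_increasing2)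
    next
      case False
      have e: "- (ord p * p) - real DIM('a) = - (real DIM('a) + ord p * p)" by simp
      have "ennreal (gagliardo_integrand (ord p) p u w) = tl (ord p * p) u w"
        using False unfolding tl_def e powr_minus by (simp add: gagliardo_integrand_def case_prod_unfold divide_inverse)
      then show ?thesis by (simp add: add_increasing)
    qed
    have "Q \<le> (\<integral>\<^sup>+w. ennreal (gagliardo_integrand (ord p) p u w) + ennreal b * tl (2 * s) u w \<partial>lborel)"
      unfolding Qe by (rule nn_integral_mono) (rule pw1)
    also have "\<dots> = Gg + ennreal b * (\<integral>\<^sup>+w. tl (2 * s) u w \<partial>lborel)"
      unfolding Gg_def by (subst nn_integral_add) (auto simp: nn_integral_cmult)
    also have "\<dots> \<le> Gg + ennreal b * (ennreal C1 * N)"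
      unfolding N_def by (intro add_mono mult_left_mono C1 um) auto
    also have "\<dots> \<le> ennreal (1 + b * C1) * (N + Gg)"
    proof -
      have "ennreal (1 + b * C1) * (N + Gg) = (N + Gg) + ennreal (b * C1) * (N + Gg)"
        using b C1(1) by (simp add: ennreal_plus distrib_right)
      moreover have "ennreal (b * C1) * N \<le> ennreal (b * C1) * (N + Gg)" by (intro mult_left_mono) auto
      ultimately show ?thesis using b C1(1) by (simp add: ennreal_mult mult.assoc add_mono add_increasing)
    qed
    also have "\<dots> \<le> ennreal C * (N + Gg)"
      by (intro mult_right_mono ennreal_leI) (auto simp: C_def)
    finally show "(\<integral>\<^sup>+w. ennreal (\<bar>quot u w\<bar> powr p) \<partial>pair_measure) \<le> ennreal C * ((\<integral>\<^sup>+x. ennreal (\<bar>u x\<bar> powr p) \<partial>lborel) + (\<integral>\<^sup>+w. ennreal (gagliardo_integrand (ord p) p u w) \<partial>lborel))"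
      unfolding Q_def N_def Gg_def .
    have NQ: "N \<le> ennreal C3 * Q" unfolding N_def Q_def by (rule C3(2)[OF um u0])
    have "Gg \<le> (\<integral>\<^sup>+w. ennreal (pair_density w * \<bar>quot u w\<bar> powr p) + tl (ord p * p) u w \<partial>lborel)"
      unfolding Gg_def by (rule nn_integral_mono) (rule pw2)
    also have "\<dots> = Q + (\<integral>\<^sup>+w. tl (ord p * p) u w \<partial>lborel)"
      unfolding Qe by (rule nn_integral_add) measurable
    also have "\<dots> \<le> Q + ennreal C2 * N" unfolding N_def by (intro add_mono C2 um) auto
    also have "\<dots> \<le> Q + ennreal C2 * (ennreal C3 * Q)" by (intro add_mono mult_left_mono NQ) auto
    finally have "N + Gg \<le> ennreal C3 * Q + (Q + ennreal C2 * (ennreal C3 * Q))" by (intro add_mono NQ)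
    also have "\<dots> = ennreal (C3 + (1 + C2 * C3)) * Q"
      using C2(1) C3(1) by (simp add: ennreal_plus ennreal_mult distrib_right mult.assoc)
    also have "\<dots> \<le> ennreal C * Q" by (intro mult_right_mono ennreal_leI) (auto simp: C_def)
    finally show "(\<integral>\<^sup>+x. ennreal (\<bar>u x\<bar> powr p) \<partial>lborel) + (\<integral>\<^sup>+w. ennreal (gagliardo_integrand (ord p) p u w) \<partial>lborel) \<le> ennreal C * (\<integral>\<^sup>+w. ennreal (\<bar>quot u w\<bar> powr p) \<partial>pair_measure)"
      unfolding Q_def N_def Gg_def .
  qed
qed

end

section \<open>Sobolev spaces and the weak problem\<close>

lemma AE_lebesgue_pair:
  assumes "AE x in (lborel :: 'a::euclidean_space measure). P x"
  shows "AE w in (lebesgue :: ('a \<times> 'a) measure). P (fst w) \<and> P (snd w)"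
  using AE_lborel_pair[OF assms] by (simp add: AE_completion_iff)

text \<open>The complement of the support is a union of possibly uncountably many open sets on which
  u vanishes almost everywhere; by Lindelof countably many suffice. Conversely, the complement of C
  is itself one of these open sets.\<close>

lemma ess_support_subset_iff:
  fixes u :: "'a::euclidean_space \<Rightarrow> real"
  assumes "closed C"
  shows "ess_support u \<subseteq> C \<longleftrightarrow> (AE x in lborel. x \<notin> C \<longrightarrow> u x = 0)"
proof
  define \<U> where "\<U> = {U. open U \<and> (AE x in lebesgue. x \<in> U \<longrightarrow> u x = 0)}"
  assume "ess_support u \<subseteq> C"
  then have sub: "- C \<subseteq> \<Union>\<U>" by (auto simp: ess_support_def \<U>_def)
  obtain \<V> where V: "\<V> \<subseteq> \<U>" "countable \<V>" "\<Union>\<V> = \<Union>\<U>"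
    using Lindelof[of \<U>] by (auto simp: \<U>_def)
  have "AE x in lborel. \<forall>U\<in>\<V>. x \<in> U \<longrightarrow> u x = 0"
    by (rule AE_ball_countable[THEN iffD2, OF V(2)]) (use V(1) in \<open>auto simp: \<U>_def AE_completion_iff\<close>)
  then show "AE x in lborel. x \<notin> C \<longrightarrow> u x = 0"
    by eventually_elim (use sub V(3) in blast)
next
  assume "AE x in lborel. x \<notin> C \<longrightarrow> u x = 0"
  then have "AE x in lebesgue. x \<in> - C \<longrightarrow> u x = 0" by (simp add: AE_completion_iff)
  then show "ess_support u \<subseteq> C" using assms by (auto simp: ess_support_def)
qed

lemma gagliardo_cmult:
  "gagliardo_integrand \<alpha> p (\<lambda>x. c * u x) w = \<bar>c\<bar> powr p * gagliardo_integrand \<alpha> p u w"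
  by (simp add: gagliardo_integrand_def case_prod_unfold abs_mult powr_mult flip: right_diff_distrib)

lemma sobolev_tilde_cmult:
  assumes "u \<in> sobolev_tilde \<alpha> p \<Omega>"
  shows "(\<lambda>x. c * u x) \<in> sobolev_tilde \<alpha> p \<Omega>"
proof -
  have "AE x in lborel. x \<notin> closure \<Omega> \<longrightarrow> u x = 0"
    using assms by (simp add: sobolev_tilde_def ess_support_subset_iff)
  then have "AE x in lborel. x \<notin> closure \<Omega> \<longrightarrow> c * u x = 0" by eventually_elim simp
  then show ?thesis
    using assms by (auto simp: sobolev_tilde_def frac_sobolev_def Lp_space_def ess_support_subset_iff
        gagliardo_cmult[abs_def] abs_mult powr_mult)
qed

lemma frac_sobolev_norm_cmult:
  assumes "0 < p"
  shows "frac_sobolev_norm \<alpha> p (\<lambda>x. c * u x) = \<bar>c\<bar> * frac_sobolev_norm \<alpha> p u"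
proof -
  have "frac_sobolev_norm \<alpha> p (\<lambda>x. c * u x) = (\<bar>c\<bar> powr p * ((LINT x|lebesgue. \<bar>u x\<bar> powr p) + (LINT z|lebesgue. gagliardo_integrand \<alpha> p u z))) powr (1 / p)"
    by (simp add: frac_sobolev_norm_def gagliardo_cmult[abs_def] abs_mult powr_mult distrib_left)
  also have "\<dots> = \<bar>c\<bar> * frac_sobolev_norm \<alpha> p u"
  proof -
    have "0 \<le> (LINT x|lebesgue. \<bar>u x\<bar> powr p) + (LINT z|lebesgue. gagliardo_integrand \<alpha> p u z)"
      by (intro add_nonneg_nonneg integral_nonneg_AE) (auto simp: gagliardo_integrand_def case_prod_unfold)
    then show ?thesis using assms by (simp add: powr_mult powr_powr frac_sobolev_norm_def)
  qed
  finally show ?thesis .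
qed

lemma frac_sobolev_norm_nonneg: "0 \<le> frac_sobolev_norm \<alpha> p u"
  by (simp add: frac_sobolev_norm_def)

lemma frac_sobolev_norm_AE_zero:
  fixes u :: "'a::euclidean_space \<Rightarrow> real"
  assumes "AE x in lborel. u x = 0"
  shows "frac_sobolev_norm \<alpha> p u = 0"
proof -
  have "AE x in lebesgue. \<bar>u x\<bar> powr p = 0"
    using assms by (auto simp: AE_completion_iff)
  then have 1: "(LINT x|lebesgue. \<bar>u x\<bar> powr p) = 0" by (rule integral_eq_zero_AE)
  have "AE w in lebesgue. gagliardo_integrand \<alpha> p u w = 0"
    using AE_lebesgue_pair[OF assms] by eventually_elim (simp add: gagliardo_integrand_def case_prod_unfold)
  then have 2: "(LINT w|lebesgue. gagliardo_integrand \<alpha> p u w) = 0" by (rule integral_eq_zero_AE)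
  show ?thesis by (simp add: frac_sobolev_norm_def 1 2)
qed

lemma zero_in_sobolev_tilde: "(\<lambda>x. 0) \<in> sobolev_tilde \<alpha> p \<Omega>"
  by (auto simp: sobolev_tilde_def frac_sobolev_def Lp_space_def ess_support_subset_iff gagliardo_integrand_def case_prod_unfold)

lemma sobolev_negD:
  assumes "F \<in> sobolev_neg \<alpha> p \<Omega>"
  shows "\<phi> \<in> sobolev_tilde \<alpha> (conj_exp p) \<Omega> \<Longrightarrow> \<psi> \<in> sobolev_tilde \<alpha> (conj_exp p) \<Omega> \<Longrightarrow> F (\<lambda>x. \<phi> x + \<psi> x) = F \<phi> + F \<psi>"
    and "\<phi> \<in> sobolev_tilde \<alpha> (conj_exp p) \<Omega> \<Longrightarrow> F (\<lambda>x. c * \<phi> x) = c * F \<phi>"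
    and "\<exists>B. \<forall>\<phi>\<in>sobolev_tilde \<alpha> (conj_exp p) \<Omega>. \<bar>F \<phi>\<bar> \<le> B * frac_sobolev_norm \<alpha> (conj_exp p) \<phi>"
  using assms unfolding sobolev_neg_def by blast+

lemma sobolev_neg_norm_bound:
  assumes F: "F \<in> sobolev_neg \<alpha> p \<Omega>" and q: "0 < conj_exp p"
    and \<phi>: "\<phi> \<in> sobolev_tilde \<alpha> (conj_exp p) \<Omega>"
  shows "\<bar>F \<phi>\<bar> \<le> sobolev_neg_norm \<alpha> p \<Omega> F * frac_sobolev_norm \<alpha> (conj_exp p) \<phi>"
    and "0 \<le> sobolev_neg_norm \<alpha> p \<Omega> F"
proof -
  obtain B where B: "\<And>\<phi>. \<phi> \<in> sobolev_tilde \<alpha> (conj_exp p) \<Omega> \<Longrightarrow> \<bar>F \<phi>\<bar> \<le> B * frac_sobolev_norm \<alpha> (conj_exp p) \<phi>"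
    using sobolev_negD(3)[OF F] by blast
  define S where "S = {\<phi> \<in> sobolev_tilde \<alpha> (conj_exp p) \<Omega>. frac_sobolev_norm \<alpha> (conj_exp p) \<phi> \<le> 1}"
  have bdd: "bdd_above ((\<lambda>\<phi>. \<bar>F \<phi>\<bar>) ` S)"
  proof (rule bdd_aboveI2)
    fix \<psi> assume "\<psi> \<in> S"
    then have \<psi>: "\<psi> \<in> sobolev_tilde \<alpha> (conj_exp p) \<Omega>" "frac_sobolev_norm \<alpha> (conj_exp p) \<psi> \<le> 1" by (auto simp: S_def)
    have "\<bar>F \<psi>\<bar> \<le> B * frac_sobolev_norm \<alpha> (conj_exp p) \<psi>" by (rule B[OF \<psi>(1)])
    also have "\<dots> \<le> \<bar>B\<bar> * 1" using \<psi>(2) frac_sobolev_norm_nonneg[of \<alpha> "conj_exp p" \<psi>] by (intro mult_mono) auto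
    finally show "\<bar>F \<psi>\<bar> \<le> \<bar>B\<bar>" by simp
  qed
  have up: "\<bar>F \<psi>\<bar> \<le> sobolev_neg_norm \<alpha> p \<Omega> F" if "\<psi> \<in> S" for \<psi>
    unfolding sobolev_neg_norm_def S_def[symmetric] by (rule cSUP_upper[OF that bdd])
  have "(\<lambda>x. 0) \<in> S" by (simp add: S_def zero_in_sobolev_tilde frac_sobolev_norm_AE_zero)
  from up[OF this] show "0 \<le> sobolev_neg_norm \<alpha> p \<Omega> F" by linarith
  define n where "n = frac_sobolev_norm \<alpha> (conj_exp p) \<phi>"
  show "\<bar>F \<phi>\<bar> \<le> sobolev_neg_norm \<alpha> p \<Omega> F * frac_sobolev_norm \<alpha> (conj_exp p) \<phi>"
  proof (cases "n = 0")
    \<comment> \<open>Normalisation is impossible here; boundedness with any constant forces the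
      value 0.\<close>
    case True
    then show ?thesis using B[OF \<phi>] by (simp add: n_def)
  next
    case False
    then have n: "n > 0" using frac_sobolev_norm_nonneg[of \<alpha> "conj_exp p" \<phi>] by (simp add: n_def)
    have "(\<lambda>x. 1 / n * \<phi> x) \<in> S"
      unfolding S_def using sobolev_tilde_cmult[OF \<phi>, of "1 / n"] frac_sobolev_norm_cmult[OF q, of \<alpha> "1 / n" \<phi>] n
      by (simp add: n_def)
    from up[OF this] have "\<bar>1 / n * F \<phi>\<bar> \<le> sobolev_neg_norm \<alpha> p \<Omega> F"
      using sobolev_negD(2)[OF F \<phi>, of "1 / n"] by simp
    then show ?thesis using n by (simp add: abs_mult n_def[symmetric] field_simps)
  qed
qed

lemma sobolev_neg_AE:
  assumes F: "F \<in> sobolev_neg \<alpha> p \<Omega>"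
    and \<phi>: "\<phi> \<in> sobolev_tilde \<alpha> (conj_exp p) \<Omega>" "\<psi> \<in> sobolev_tilde \<alpha> (conj_exp p) \<Omega>"
    and ae: "AE x in lborel. \<phi> x = \<psi> x" and sum: "(\<lambda>x. \<phi> x + (-1) * \<psi> x) \<in> sobolev_tilde \<alpha> (conj_exp p) \<Omega>"
  shows "F \<phi> = F \<psi>"
proof -
  obtain B where B: "\<And>\<phi>. \<phi> \<in> sobolev_tilde \<alpha> (conj_exp p) \<Omega> \<Longrightarrow> \<bar>F \<phi>\<bar> \<le> B * frac_sobolev_norm \<alpha> (conj_exp p) \<phi>"
    using sobolev_negD(3)[OF F] by blast
  have "frac_sobolev_norm \<alpha> (conj_exp p) (\<lambda>x. \<phi> x + (-1) * \<psi> x) = 0"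
    by (rule frac_sobolev_norm_AE_zero) (use ae in auto)
  then have "F (\<lambda>x. \<phi> x + (-1) * \<psi> x) = 0" using B[OF sum] by simp
  moreover have "F (\<lambda>x. \<phi> x + (-1) * \<psi> x) = F \<phi> + (-1) * F \<psi>"
    using sobolev_negD(1)[OF F \<phi>(1) sobolev_tilde_cmult[OF \<phi>(2), of "-1"]] sobolev_negD(2)[OF F \<phi>(2), of "-1"] by simp
  ultimately show ?thesis by simp
qed

lemma sobolev_tilde_AE:
  fixes u v :: "'a::euclidean_space \<Rightarrow> real"
  assumes v: "v \<in> sobolev_tilde \<alpha> p \<Omega>" and um: "u \<in> borel_measurable lebesgue" and ae: "AE x in lborel. v x = u x"
    and gm: "gagliardo_integrand \<alpha> p u \<in> borel_measurable lebesgue"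
  shows "u \<in> sobolev_tilde \<alpha> p \<Omega>" and "frac_sobolev_norm \<alpha> p v = frac_sobolev_norm \<alpha> p u"
proof -
  note [measurable] = um gm
  have vm [measurable]: "v \<in> borel_measurable lebesgue" and vi: "integrable lebesgue (\<lambda>x. \<bar>v x\<bar> powr p)"
    and vg: "integrable lebesgue (gagliardo_integrand \<alpha> p v)" and vs: "ess_support v \<subseteq> closure \<Omega>"
    using v by (auto simp: sobolev_tilde_def frac_sobolev_def Lp_space_def)
  have [measurable]: "gagliardo_integrand \<alpha> p v \<in> borel_measurable lebesgue" using vg by auto
  have ae1: "AE x in lebesgue. \<bar>v x\<bar> powr p = \<bar>u x\<bar> powr p" using ae by (auto simp: AE_completion_iff)
  have ae2: "AE w in lebesgue. gagliardo_integrand \<alpha> p v w = gagliardo_integrand \<alpha> p u w"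
    using AE_lebesgue_pair[OF ae] by eventually_elim (simp add: gagliardo_integrand_def case_prod_unfold)
  have "integrable lebesgue (\<lambda>x. \<bar>u x\<bar> powr p)"
    using vi integrable_cong_AE[OF _ _ ae1] by simp
  moreover have "integrable lebesgue (gagliardo_integrand \<alpha> p u)"
    using vg integrable_cong_AE[OF _ _ ae2] by simp
  moreover have "ess_support u \<subseteq> closure \<Omega>"
  proof -
    have "AE x in lborel. x \<notin> closure \<Omega> \<longrightarrow> v x = 0" using vs by (simp add: ess_support_subset_iff)
    then have "AE x in lborel. x \<notin> closure \<Omega> \<longrightarrow> u x = 0" using ae by eventually_elim simp
    then show ?thesis by (simp add: ess_support_subset_iff)
  qed
  ultimately show "u \<in> sobolev_tilde \<alpha> p \<Omega>" using um by (auto simp: sobolev_tilde_def frac_sobolev_def Lp_space_def)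
  have "(LINT x|lebesgue. \<bar>v x\<bar> powr p) = (LINT x|lebesgue. \<bar>u x\<bar> powr p)"
    by (rule integral_cong_AE) (use ae1 in auto)
  moreover have "(LINT w|lebesgue. gagliardo_integrand \<alpha> p v w) = (LINT w|lebesgue. gagliardo_integrand \<alpha> p u w)"
    by (rule integral_cong_AE) (use ae2 in auto)
  ultimately show "frac_sobolev_norm \<alpha> p v = frac_sobolev_norm \<alpha> p u" by (simp add: frac_sobolev_norm_def)
qed

section \<open>Translation between Sobolev functions and their difference quotients\<close>

locale whitney_approximation = whitney_domain +
  fixes \<Omega> :: "'a set" assumes closure_\<Omega>: "closure \<Omega> = K"
begin

lemma K_closed: "closed K"
  using K_compact by (rule compact_imp_closed)

text \<open>The representatives for which the kernel arguments are set up: Borel measurable and zero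
  at every point off \<open>K\<close>, not just almost every one. Each Sobolev function on the
  domain has such a representative.\<close>

definition supported :: "('a \<Rightarrow> real) \<Rightarrow> bool" where
  "supported u \<longleftrightarrow> u \<in> borel_measurable borel \<and> (\<forall>x. x \<notin> K \<longrightarrow> u x = 0)"

lemma supported_lebesgue: "supported u \<Longrightarrow> u \<in> borel_measurable lebesgue"
  by (simp add: supported_def measurable_completion)

lemma gagliardo_lebesgue: "supported u \<Longrightarrow> gagliardo_integrand \<alpha> p u \<in> borel_measurable lebesgue"
  by (simp add: supported_def measurable_completion gagliardo_measurable)

lemma supported_integrals:
  assumes u: "supported u"
  shows "integrable lebesgue (\<lambda>x. \<bar>u x\<bar> powr p) \<longleftrightarrow> (\<integral>\<^sup>+x. ennreal (\<bar>u x\<bar> powr p) \<partial>lborel) < \<infinity>"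
    and "integrable lebesgue (gagliardo_integrand \<alpha> p u) \<longleftrightarrow> (\<integral>\<^sup>+w. ennreal (gagliardo_integrand \<alpha> p u w) \<partial>lborel) < \<infinity>"
    and "quot u \<in> Lp pair_measure p \<longleftrightarrow> (\<integral>\<^sup>+w. ennreal (\<bar>quot u w\<bar> powr p) \<partial>pair_measure) < \<infinity>"
proof -
  have [measurable]: "u \<in> borel_measurable borel" using u by (simp add: supported_def)
  have [measurable]: "u \<in> borel_measurable lebesgue" by (rule supported_lebesgue[OF u])
  have [measurable]: "gagliardo_integrand \<alpha> p u \<in> borel_measurable lebesgue" by (rule gagliardo_lebesgue[OF u])
  show "integrable lebesgue (\<lambda>x. \<bar>u x\<bar> powr p) \<longleftrightarrow> (\<integral>\<^sup>+x. ennreal (\<bar>u x\<bar> powr p) \<partial>lborel) < \<infinity>"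
    by (simp add: integrable_iff_bounded nn_integral_completion)
  have g0: "0 \<le> gagliardo_integrand \<alpha> p u w" for w by (auto simp: gagliardo_integrand_def case_prod_unfold)
  show "integrable lebesgue (gagliardo_integrand \<alpha> p u) \<longleftrightarrow> (\<integral>\<^sup>+w. ennreal (gagliardo_integrand \<alpha> p u w) \<partial>lborel) < \<infinity>"
    by (simp add: integrable_iff_bounded nn_integral_completion g0)
  show "quot u \<in> Lp pair_measure p \<longleftrightarrow> (\<integral>\<^sup>+w. ennreal (\<bar>quot u w\<bar> powr p) \<partial>pair_measure) < \<infinity>"
    by (simp add: Lp_def integrable_iff_bounded)
qed

lemma sobolev_tilde_iff:
  assumes p: "1 < p" and u: "supported u"
  shows "u \<in> sobolev_tilde (ord p) p \<Omega> \<longleftrightarrow> quot u \<in> Lp pair_measure p"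
proof -
  obtain C where C: "C > 0"
     "(\<integral>\<^sup>+w. ennreal (\<bar>quot u w\<bar> powr p) \<partial>pair_measure) \<le> ennreal C * ((\<integral>\<^sup>+x. ennreal (\<bar>u x\<bar> powr p) \<partial>lborel) + (\<integral>\<^sup>+w. ennreal (gagliardo_integrand (ord p) p u w) \<partial>lborel))"
     "(\<integral>\<^sup>+x. ennreal (\<bar>u x\<bar> powr p) \<partial>lborel) + (\<integral>\<^sup>+w. ennreal (gagliardo_integrand (ord p) p u w) \<partial>lborel) \<le> ennreal C * (\<integral>\<^sup>+w. ennreal (\<bar>quot u w\<bar> powr p) \<partial>pair_measure)"
    using norm_equivalence[OF p] u unfolding supported_def by blast
  have "ess_support u \<subseteq> closure \<Omega>"
    using u by (subst ess_support_subset_iff) (auto simp: closure_\<Omega> supported_def K_closed)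
  then have "u \<in> sobolev_tilde (ord p) p \<Omega> \<longleftrightarrow> (\<integral>\<^sup>+x. ennreal (\<bar>u x\<bar> powr p) \<partial>lborel) < \<infinity> \<and> (\<integral>\<^sup>+w. ennreal (gagliardo_integrand (ord p) p u w) \<partial>lborel) < \<infinity>"
    using supported_integrals(1,2)[OF u] supported_lebesgue[OF u] by (auto simp: sobolev_tilde_def frac_sobolev_def Lp_space_def)
  also have "\<dots> \<longleftrightarrow> (\<integral>\<^sup>+x. ennreal (\<bar>u x\<bar> powr p) \<partial>lborel) + (\<integral>\<^sup>+w. ennreal (gagliardo_integrand (ord p) p u w) \<partial>lborel) < \<infinity>"
    by simp
  also have "\<dots> \<longleftrightarrow> (\<integral>\<^sup>+w. ennreal (\<bar>quot u w\<bar> powr p) \<partial>pair_measure) < \<infinity>"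
  proof
    assume "(\<integral>\<^sup>+x. ennreal (\<bar>u x\<bar> powr p) \<partial>lborel) + (\<integral>\<^sup>+w. ennreal (gagliardo_integrand (ord p) p u w) \<partial>lborel) < \<infinity>"
    then have "ennreal C * ((\<integral>\<^sup>+x. ennreal (\<bar>u x\<bar> powr p) \<partial>lborel) + (\<integral>\<^sup>+w. ennreal (gagliardo_integrand (ord p) p u w) \<partial>lborel)) < \<infinity>"
      by (simp add: ennreal_mult_less_top)
    with C(2) show "(\<integral>\<^sup>+w. ennreal (\<bar>quot u w\<bar> powr p) \<partial>pair_measure) < \<infinity>" by (rule le_less_trans)
  next
    assume "(\<integral>\<^sup>+w. ennreal (\<bar>quot u w\<bar> powr p) \<partial>pair_measure) < \<infinity>"
    then have "ennreal C * (\<integral>\<^sup>+w. ennreal (\<bar>quot u w\<bar> powr p) \<partial>pair_measure) < \<infinity>" by (simp add: ennreal_mult_less_top)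
    with C(3) show "(\<integral>\<^sup>+x. ennreal (\<bar>u x\<bar> powr p) \<partial>lborel) + (\<integral>\<^sup>+w. ennreal (gagliardo_integrand (ord p) p u w) \<partial>lborel) < \<infinity>" by (rule le_less_trans)
  qed
  finally show ?thesis using supported_integrals(3)[OF u] by simp
qed

lemma sobolev_norm_equivalence:
  assumes p: "1 < p"
  shows "\<exists>C>0. \<forall>u. supported u \<longrightarrow> quot u \<in> Lp pair_measure p \<longrightarrow>
    pint pair_measure p (quot u) powr (1/p) \<le> C * frac_sobolev_norm (ord p) p u \<and>
    frac_sobolev_norm (ord p) p u \<le> C * pint pair_measure p (quot u) powr (1/p)"
proof -
  obtain C where C: "C > 0" "\<And>u. supported u \<Longrightarrow>
     (\<integral>\<^sup>+w. ennreal (\<bar>quot u w\<bar> powr p) \<partial>pair_measure) \<le> ennreal C * ((\<integral>\<^sup>+x. ennreal (\<bar>u x\<bar> powr p) \<partial>lborel) + (\<integral>\<^sup>+w. ennreal (gagliardo_integrand (ord p) p u w) \<partial>lborel))"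
     "\<And>u. supported u \<Longrightarrow> (\<integral>\<^sup>+x. ennreal (\<bar>u x\<bar> powr p) \<partial>lborel) + (\<integral>\<^sup>+w. ennreal (gagliardo_integrand (ord p) p u w) \<partial>lborel) \<le> ennreal C * (\<integral>\<^sup>+w. ennreal (\<bar>quot u w\<bar> powr p) \<partial>pair_measure)"
    using norm_equivalence[OF p] unfolding supported_def by blast
  show ?thesis
  proof (intro exI[of _ "C powr (1/p)"] conjI allI impI)
    show "0 < C powr (1/p)" using C(1) by simp
    fix u assume u: "supported u" and q: "quot u \<in> Lp pair_measure p"
    have st: "u \<in> sobolev_tilde (ord p) p \<Omega>" using sobolev_tilde_iff[OF p u] q by simp
    define N where "N = (LINT x|lebesgue. \<bar>u x\<bar> powr p) + (LINT z|lebesgue. gagliardo_integrand (ord p) p u z)"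
    have i: "integrable lebesgue (\<lambda>x. \<bar>u x\<bar> powr p)" "integrable lebesgue (gagliardo_integrand (ord p) p u)"
      using st by (auto simp: sobolev_tilde_def frac_sobolev_def Lp_space_def)
    have g0: "0 \<le> gagliardo_integrand (ord p) p u w" for w by (auto simp: gagliardo_integrand_def case_prod_unfold)
    have N0: "0 \<le> N" unfolding N_def by (intro add_nonneg_nonneg integral_nonneg_AE) (auto simp: g0)
    have N1: "(\<integral>\<^sup>+x. ennreal (\<bar>u x\<bar> powr p) \<partial>lborel) = ennreal (LINT x|lebesgue. \<bar>u x\<bar> powr p)"
      using nn_integral_eq_integral[OF i(1)] by (simp add: nn_integral_completion)
    have N2: "(\<integral>\<^sup>+w. ennreal (gagliardo_integrand (ord p) p u w) \<partial>lborel) = ennreal (LINT z|lebesgue. gagliardo_integrand (ord p) p u z)"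
      using nn_integral_eq_integral[OF i(2)] by (simp add: nn_integral_completion g0)
    have N: "(\<integral>\<^sup>+x. ennreal (\<bar>u x\<bar> powr p) \<partial>lborel) + (\<integral>\<^sup>+w. ennreal (gagliardo_integrand (ord p) p u w) \<partial>lborel) = ennreal N"
      unfolding N1 N2 N_def by (intro ennreal_plus[symmetric] integral_nonneg_AE) (auto simp: g0)
    have Q: "(\<integral>\<^sup>+w. ennreal (\<bar>quot u w\<bar> powr p) \<partial>pair_measure) = ennreal (pint pair_measure p (quot u))"
      unfolding pint_def by (rule nn_integral_eq_integral[OF LpD(2)[OF q]]) simp
    have a: "pint pair_measure p (quot u) \<le> C * N" "N \<le> C * pint pair_measure p (quot u)"
      using C(2)[OF u] C(3)[OF u] C(1) N0 unfolding N Q by (simp_all add: ennreal_mult[symmetric])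
    have fn: "frac_sobolev_norm (ord p) p u = N powr (1/p)" by (simp add: frac_sobolev_norm_def N_def)
    show "pint pair_measure p (quot u) powr (1/p) \<le> C powr (1/p) * frac_sobolev_norm (ord p) p u"
      unfolding fn using a(1) p C(1) N0 by (subst powr_mult[symmetric]) (auto intro: powr_mono2)
    show "frac_sobolev_norm (ord p) p u \<le> C powr (1/p) * pint pair_measure p (quot u) powr (1/p)"
      unfolding fn using a(2) p C(1) N0 by (subst powr_mult[symmetric]) (auto intro: powr_mono2)
  qed
qed

lemma supported_representative:
  assumes p: "1 < p" and v: "v \<in> sobolev_tilde (ord p) p \<Omega>"
  shows "\<exists>u. supported u \<and> (AE x in lborel. v x = u x) \<and> u \<in> sobolev_tilde (ord p) p \<Omega> \<and> quot u \<in> G p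
     \<and> frac_sobolev_norm (ord p) p v = frac_sobolev_norm (ord p) p u"
proof -
  have "v \<in> borel_measurable lebesgue" using v by (simp add: sobolev_tilde_def frac_sobolev_def Lp_space_def)
  then obtain u0 where u0: "u0 \<in> borel_measurable lborel" "AE x in lborel. v x = u0 x"
    using completion_ex_borel_measurable_real by blast
  have [measurable]: "u0 \<in> borel_measurable borel" using u0(1) by simp
  define u where "u x = (if x \<in> K then u0 x else 0)" for x
  have um: "u \<in> borel_measurable borel" unfolding u_def[abs_def] by measurable
  have u: "supported u" using um by (simp add: supported_def u_def)
  have "AE x in lborel. x \<notin> K \<longrightarrow> v x = 0"
    using v by (simp add: sobolev_tilde_def ess_support_subset_iff closure_\<Omega> K_closed)
  with u0(2) have ae: "AE x in lborel. v x = u x" by eventually_elim (auto simp: u_def)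
  note st = sobolev_tilde_AE[OF v supported_lebesgue[OF u] ae gagliardo_lebesgue[OF u]]
  have q: "quot u \<in> Lp pair_measure p" using sobolev_tilde_iff[OF p u] st(1) by simp
  have "integrable pair_measure (quot u)" using Lp_integrable[OF q] p by simp
  then have "AE w in pair_measure. R (quot u) w = quot u w"
    using u by (intro R_quot) (auto simp: supported_def)
  then have "quot u \<in> G p" using q by (simp add: G_def)
  then show ?thesis using u ae st by blast
qed

text \<open>The converse to taking difference quotients: every element of the abstract range
  \<open>G p\<close> is, almost everywhere, the quotient of a Sobolev function of order
  \<open>ord p\<close>, with the same L^p norm.\<close>

lemma reconstruct_supported:
  assumes p: "1 < p" and \<Phi>: "\<Phi> \<in> G p"
  shows "supported (reconstruct \<Phi>)" "AE w in pair_measure. quot (reconstruct \<Phi>) w = \<Phi> w" "quot (reconstruct \<Phi>) \<in> Lp pair_measure p"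
    "pint pair_measure p (quot (reconstruct \<Phi>)) = pint pair_measure p \<Phi>" "reconstruct \<Phi> \<in> sobolev_tilde (ord p) p \<Omega>"
proof -
  have [measurable]: "\<Phi> \<in> borel_measurable borel"
    using LpD(1)[OF G_D(1)[OF \<Phi>]] by (simp add: measurable_cong_sets[OF sets_pair_measure refl])
  have i: "integrable pair_measure \<Phi>" using Lp_integrable[OF G_D(1)[OF \<Phi>]] p by simp
  have em: "reconstruct \<Phi> \<in> borel_measurable borel" by measurable
  show s: "supported (reconstruct \<Phi>)" using em reconstruct_outside by (simp add: supported_def)
  show ae: "AE w in pair_measure. quot (reconstruct \<Phi>) w = \<Phi> w"
    using R_eq_quot_reconstruct[OF i] G_D(2)[OF \<Phi>] by eventually_elim simp
  have m: "quot (reconstruct \<Phi>) \<in> borel_measurable pair_measure" by (simp add: measurable_cong_sets[OF sets_pair_measure refl])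
  have ae': "AE w in pair_measure. \<Phi> w = quot (reconstruct \<Phi>) w" using ae by eventually_elim simp
  show q: "quot (reconstruct \<Phi>) \<in> Lp pair_measure p" "pint pair_measure p (quot (reconstruct \<Phi>)) = pint pair_measure p \<Phi>"
    using Lp_cong_AE[OF G_D(1)[OF \<Phi>] m ae'] by auto
  show "reconstruct \<Phi> \<in> sobolev_tilde (ord p) p \<Omega>" using sobolev_tilde_iff[OF p s] q by simp
qed

text \<open>Functionals act on functions, not classes. The difference of the two arguments is almost
  everywhere 0, hence belongs to the space with norm 0, and boundedness makes its value
  vanish.\<close>

lemma sobolev_neg_supported_AE:
  assumes F: "F \<in> sobolev_neg (ord q) p \<Omega>" and q: "q = conj_exp p" "1 < q"
    and \<phi>: "\<phi> \<in> sobolev_tilde (ord q) q \<Omega>" and \<psi>: "supported \<psi>" "\<psi> \<in> sobolev_tilde (ord q) q \<Omega>"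
    and ae: "AE x in lborel. \<phi> x = \<psi> x"
  shows "F \<phi> = F \<psi>"
proof (rule sobolev_neg_AE[OF F])
  have z: "(\<lambda>x. 0) \<in> sobolev_tilde (ord q) q \<Omega>" by (rule zero_in_sobolev_tilde)
  obtain u where u: "supported u" "AE x in lborel. \<phi> x = u x" "u \<in> sobolev_tilde (ord q) q \<Omega>"
    using supported_representative[OF q(2) \<phi>] by blast
  have vm: "\<phi> \<in> borel_measurable lebesgue" "\<psi> \<in> borel_measurable lebesgue"
    using \<phi> \<psi>(2) by (auto simp: sobolev_tilde_def frac_sobolev_def Lp_space_def)
  have dm: "(\<lambda>x. \<phi> x + (-1) * \<psi> x) \<in> borel_measurable lebesgue" using vm by measurable
  have d0: "AE x in lborel. 0 = \<phi> x + (-1) * \<psi> x" using ae by eventually_elim simp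
  have "AE w in lebesgue. gagliardo_integrand (ord q) q (\<lambda>x. 0) w = gagliardo_integrand (ord q) q (\<lambda>x. \<phi> x + (-1) * \<psi> x) w"
    using AE_lebesgue_pair[OF d0] by eventually_elim (simp add: gagliardo_integrand_def case_prod_unfold)
  then have gm: "gagliardo_integrand (ord q) q (\<lambda>x. \<phi> x + (-1) * \<psi> x) \<in> borel_measurable lebesgue"
    by (rule borel_measurable_AE[rotated]) (simp add: gagliardo_integrand_def case_prod_unfold)
  show "(\<lambda>x. \<phi> x + (-1) * \<psi> x) \<in> sobolev_tilde (ord q) (conj_exp p) \<Omega>"
    using sobolev_tilde_AE(1)[OF z dm d0 gm] by (simp add: q(1))
qed (use \<phi> \<psi> ae in \<open>simp_all add: q(1)\<close>)

text \<open>Composition with the reconstruction moves the datum to the range of the projection. Norm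
  equivalence contributes the constant C to the bound.\<close>

lemma functional_of_sobolev_neg:
  assumes F: "F \<in> sobolev_neg (ord q) p \<Omega>" and q: "q = conj_exp p" "1 < q"
    and C: "C > 0" "\<And>u. supported u \<Longrightarrow> quot u \<in> Lp pair_measure q \<Longrightarrow> frac_sobolev_norm (ord q) q u \<le> C * pint pair_measure q (quot u) powr (1/q)"
  shows "functional_on q (\<lambda>\<Phi>. F (reconstruct \<Phi>)) (C * sobolev_neg_norm (ord q) p \<Omega> F)"
  unfolding functional_on_def
proof (intro conjI ballI allI)
  have q0: "0 < conj_exp p" using q by simp
  have z: "(\<lambda>x. 0) \<in> sobolev_tilde (ord q) (conj_exp p) \<Omega>" by (rule zero_in_sobolev_tilde)
  have n0: "0 \<le> sobolev_neg_norm (ord q) p \<Omega> F" by (rule sobolev_neg_norm_bound(2)[OF F q0 z])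
  then show "0 \<le> C * sobolev_neg_norm (ord q) p \<Omega> F" using C(1) by simp
  fix \<Phi> assume \<Phi>: "\<Phi> \<in> G q"
  note E\<Phi> = reconstruct_supported[OF q(2) \<Phi>]
  have i\<Phi>: "integrable pair_measure \<Phi>" using Lp_integrable[OF G_D(1)[OF \<Phi>]] q by simp
  have "\<bar>F (reconstruct \<Phi>)\<bar> \<le> sobolev_neg_norm (ord q) p \<Omega> F * frac_sobolev_norm (ord q) q (reconstruct \<Phi>)"
    using sobolev_neg_norm_bound(1)[OF F q0] E\<Phi>(5) by (simp add: q(1))
  also have "\<dots> \<le> sobolev_neg_norm (ord q) p \<Omega> F * (C * pint pair_measure q \<Phi> powr (1/q))"
    using C(2)[OF E\<Phi>(1,3)] n0 unfolding E\<Phi>(4) by (intro mult_left_mono)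
  finally show "\<bar>F (reconstruct \<Phi>)\<bar> \<le> C * sobolev_neg_norm (ord q) p \<Omega> F * pint pair_measure q \<Phi> powr (1/q)" by (simp add: mult_ac)
  have "reconstruct (\<lambda>v. c * \<Phi> v) = (\<lambda>x. c * reconstruct \<Phi> x)" for c
    by (rule ext) (simp add: reconstruct_def mult.left_commute mult.assoc flip: integral_mult_right_zero)
  then show "F (reconstruct (\<lambda>v. c * \<Phi> v)) = c * F (reconstruct \<Phi>)" for c
    using sobolev_negD(2)[OF F, of "reconstruct \<Phi>" c] E\<Phi>(5) by (simp add: q(1))
  fix \<Psi> assume \<Psi>: "\<Psi> \<in> G q"
  note E\<Psi> = reconstruct_supported[OF q(2) \<Psi>]
  have i\<Psi>: "integrable pair_measure \<Psi>" using Lp_integrable[OF G_D(1)[OF \<Psi>]] q by simp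
  have sm: "(\<lambda>v. \<Phi> v + \<Psi> v) \<in> G q" using G_add[OF \<Phi> \<Psi>] q by simp
  note ES = reconstruct_supported[OF q(2) sm]
  \<comment> \<open>Reconstruction is additive only almost everywhere, because its integral has the
    default value 0 at exceptional points; additivity of F therefore needs its invariance under null
    sets.\<close>
  have ae: "AE x in lborel. reconstruct (\<lambda>v. \<Phi> v + \<Psi> v) x = reconstruct \<Phi> x + reconstruct \<Psi> x"
    using reconstruct_integrable_AE[OF i\<Phi>] reconstruct_integrable_AE[OF i\<Psi>]
    by eventually_elim (simp add: reconstruct_def distrib_left distrib_right)
  have s: "supported (\<lambda>x. reconstruct \<Phi> x + reconstruct \<Psi> x)" using E\<Phi>(1) E\<Psi>(1) by (auto simp: supported_def)
  have st: "(\<lambda>x. reconstruct \<Phi> x + reconstruct \<Psi> x) \<in> sobolev_tilde (ord q) q \<Omega>"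
    by (rule sobolev_tilde_AE(1)[OF ES(5) supported_lebesgue[OF s] ae gagliardo_lebesgue[OF s]])
  have "F (reconstruct (\<lambda>v. \<Phi> v + \<Psi> v)) = F (\<lambda>x. reconstruct \<Phi> x + reconstruct \<Psi> x)"
    by (rule sobolev_neg_supported_AE[OF F q ES(5) s st ae])
  also have "\<dots> = F (reconstruct \<Phi>) + F (reconstruct \<Psi>)"
    using sobolev_negD(1)[OF F] E\<Phi>(5) E\<Psi>(5) by (simp add: q(1))
  finally show "F (reconstruct (\<lambda>v. \<Phi> v + \<Psi> v)) = F (reconstruct \<Phi>) + F (reconstruct \<Psi>)" .
qed

text \<open>The density contains gap^2, which cancels the denominators of the two quotients and
  leaves the kernel of order s. Pairs that miss \<open>K\<close> contribute 0 because u vanishes at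
  both points.\<close>

lemma nonlocal_op_eq:
  assumes A: "AE w in lborel. A w = A' w" and [measurable]: "A' \<in> borel_measurable borel"
    and u: "supported u" "AE x in lborel. v x = u x" and g: "supported g" "AE x in lborel. \<phi> x = g x"
  shows "nonlocal_op s A v \<phi> = (\<integral>w. A' w * quot u w * quot g w \<partial>pair_measure)"
proof -
  have [measurable]: "u \<in> borel_measurable borel" "g \<in> borel_measurable borel" using u g by (auto simp: supported_def)
  define H where "H w = A' w * ((u (fst w) - u (snd w)) * (g (fst w) - g (snd w)) / norm (fst w - snd w) powr (real DIM('a) + 2 * s))" for w :: "'a \<times> 'a"
  have Hm [measurable]: "H \<in> borel_measurable borel" unfolding H_def[abs_def] by measurable
  define J where "J w = A w * ((v (fst w) - v (snd w)) * (\<phi> (fst w) - \<phi> (snd w)) / norm (fst w - snd w) powr (real DIM('a) + 2 * s))" for w :: "'a \<times> 'a"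
  have "AE w in lebesgue. A w = A' w" using A by (simp add: AE_completion_iff)
  then have ae: "AE w in lebesgue. H w = J w"
    using AE_lebesgue_pair[OF u(2)] AE_lebesgue_pair[OF g(2)]
    by eventually_elim (simp add: H_def J_def)
  have Hl: "H \<in> borel_measurable lebesgue" by (simp add: measurable_completion)
  have Jl: "J \<in> borel_measurable lebesgue" by (rule borel_measurable_AE[OF Hl ae])
  have "nonlocal_op s A v \<phi> = (LINT w|lebesgue. J w)"
    by (simp add: nonlocal_op_def J_def case_prod_unfold)
  also have "\<dots> = (LINT w|lebesgue. H w)"
    by (rule integral_cong_AE[OF Jl Hl]) (use ae in auto)
  also have "\<dots> = (LINT w|lborel. H w)" by (rule integral_completion) simp
  also have "\<dots> = (LINT w|lborel. pair_density w *\<^sub>R (A' w * quot u w * quot g w))"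
  proof (rule Bochner_Integration.integral_cong[OF refl])
    fix w :: "'a \<times> 'a"
    show "H w = pair_density w *\<^sub>R (A' w * quot u w * quot g w)"
    proof (cases "fst w = snd w \<or> fst w \<notin> K \<and> snd w \<notin> K")
      case True
      then show ?thesis using u(1) by (auto simp: H_def quot_def supported_def)
    next
      case False
      then have gp: "gap (fst w - snd w) > 0" using gap_pos[of "fst w - snd w"] by auto
      have "pair_density w *\<^sub>R (A' w * quot u w * quot g w)
        = (gap (fst w - snd w))\<^sup>2 * norm (fst w - snd w) powr (- (real DIM('a) + 2 * s)) * (A' w * ((u (fst w) - u (snd w)) / gap (fst w - snd w)) * ((g (fst w) - g (snd w)) / gap (fst w - snd w)))"
        using False by (simp add: pair_density_def dens_def quot_def)
      also have "\<dots> = H w"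
        using gp unfolding H_def powr_minus_divide by (simp add: power2_eq_square)
      finally show ?thesis by simp
    qed
  qed
  also have "\<dots> = (\<integral>w. A' w * quot u w * quot g w \<partial>pair_measure)"
    unfolding pair_measure_def by (rule integral_density[symmetric]) auto
  finally show ?thesis .
qed

end

text \<open>A Borel version is clamped to [lam, Lam]. Almost everywhere this changes nothing, and
  the bounds become valid at every point.\<close>

lemma coefficient_representative:
  fixes A :: "'b::euclidean_space \<Rightarrow> real"
  assumes A: "A \<in> Linf_space" and lam: "ess_inf A = ereal lam" and Lam: "Linf_norm A = Lam"
  shows "lam \<le> Lam" and "\<exists>A'\<in>borel_measurable borel. (\<forall>w. lam \<le> A' w \<and> A' w \<le> Lam) \<and> (AE w in lborel. A w = A' w)"
proof -
  define S where "S = esssup lebesgue (\<lambda>z. ereal \<bar>A z\<bar>)"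
  \<comment> \<open>Lebesgue measure is not zero, so an inequality between constants that holds
    almost everywhere holds.\<close>
  have nb: "ae_filter (lebesgue :: 'b measure) \<noteq> bot" by (simp add: ae_filter_eq_bot_iff)
  have SA: "AE z in lebesgue. ereal \<bar>A z\<bar> \<le> S" unfolding S_def by (rule esssup_AE)
  then have "AE z in (lebesgue :: 'b measure). 0 \<le> S"
    by eventually_elim (meson abs_ge_zero ereal_less_eq(5) order_trans)
  then have S0: "0 \<le> S" using eventually_const[OF nb] by simp
  have "S < \<infinity>" using A by (simp add: Linf_space_def S_def)
  then have S: "S = ereal Lam" using S0 Lam by (cases S) (auto simp: Linf_norm_def S_def[symmetric])
  have up: "AE z in lebesgue. A z \<le> Lam" using SA unfolding S by eventually_elim simp
  have L: "esssup lebesgue (\<lambda>z. - ereal (A z)) = - ereal lam"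
    using lam unfolding ess_inf_def by (metis ereal_uminus_uminus)
  have lo: "AE z in lebesgue. lam \<le> A z"
    using esssup_AE[where f="\<lambda>z. - ereal (A z)" and M=lebesgue] unfolding L by eventually_elim simp
  have "AE z in (lebesgue :: 'b measure). lam \<le> Lam" using up lo by eventually_elim simp
  then show ll: "lam \<le> Lam" using eventually_const[OF nb] by simp
  have "A \<in> borel_measurable lebesgue" using A by (simp add: Linf_space_def)
  then obtain A0 where A0: "A0 \<in> borel_measurable lborel" "AE x in lborel. A x = A0 x"
    using completion_ex_borel_measurable_real by blast
  have [measurable]: "A0 \<in> borel_measurable borel" using A0(1) by simp
  define A' where "A' w = max lam (min Lam (A0 w))" for w
  have "A' \<in> borel_measurable borel" unfolding A'_def[abs_def] by measurable
  moreover have "\<forall>w. lam \<le> A' w \<and> A' w \<le> Lam" using ll by (auto simp: A'_def)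
  moreover have "AE w in lborel. A w = A' w"
    using A0(2) up[unfolded AE_completion_iff] lo[unfolded AE_completion_iff]
    by eventually_elim (auto simp: A'_def)
  ultimately show "\<exists>A'\<in>borel_measurable borel. (\<forall>w. lam \<le> A' w \<and> A' w \<le> Lam) \<and> (AE w in lborel. A w = A' w)"
    by blast
qed

context whitney_approximation
begin

text \<open>The conjugate exponent reverses the sign of 1 - 2/p, so the test functions of order 2 s
  - ord p belong to the same scale, at the exponent q, and the weak problem becomes the abstract one
  on \<open>G p\<close> against \<open>G q\<close>.\<close>

lemma weak_solvability:
  fixes A :: "'a \<times> 'a \<Rightarrow> real"
  assumes A: "A \<in> Linf_space" "ess_inf A = ereal lam" "0 < lam" "Linf_norm A = Lam"
    and p: "1 < p" "\<bar>p - 2\<bar> \<le> 1/2" and small: "8 * Lam * schur_const * \<bar>p - 2\<bar> \<le> lam"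
  defines "\<rho> \<equiv> 2 * s - ord p"
  shows "\<forall>F\<in>sobolev_neg \<rho> p \<Omega>. \<exists>u. weak_solution s A \<Omega> (ord p) p F u \<and>
      (\<forall>v. weak_solution s A \<Omega> (ord p) p F v \<longrightarrow> (AE x in lebesgue. v x = u x))"
    and "\<exists>C>0. \<forall>F\<in>sobolev_neg \<rho> p \<Omega>. \<forall>u. weak_solution s A \<Omega> (ord p) p F u \<longrightarrow>
      frac_sobolev_norm (ord p) p u \<le> C * sobolev_neg_norm \<rho> p \<Omega> F"
proof -
  define q where "q = conj_exp p"
  have qe: "q = p / (p - 1)" by (simp add: q_def conj_exp_def)
  have q: "1 < q" "1/p + 1/q = 1" using p by (auto simp: qe field_simps)
  have \<rho>: "\<rho> = ord q"
  proof -
    have "1 / q = 1 - 1/p" using q(2) by linarith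
    moreover have "2 / q = 2 * (1 / q)" "2 / p = 2 * (1 / p)" by simp_all
    ultimately have e: "1 - 2 / q = - (1 - 2 / p)" by linarith
    show ?thesis unfolding \<rho>_def ord_def e mult_minus_right by argo
  qed
  obtain A' where A'm [measurable]: "A' \<in> borel_measurable borel" and A'b: "\<And>w. lam \<le> A' w" "\<And>w. A' w \<le> Lam"
    and AA': "AE w in lborel. A w = A' w"
    using coefficient_representative(2)[OF A(1,2,4)] by blast
  have ll: "lam \<le> Lam" by (rule coefficient_representative(1)[OF A(1,2,4)])
  interpret schur_elliptic pair_measure grad_kernel schur_const A' lam Lam
    by unfold_locales (use A'm A'b A(3) ll in auto)
  obtain Cp where Cp: "Cp > 0" "\<And>u. supported u \<Longrightarrow> quot u \<in> Lp pair_measure p \<Longrightarrow> frac_sobolev_norm (ord p) p u \<le> Cp * pint pair_measure p (quot u) powr (1/p)"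
    using sobolev_norm_equivalence[OF p(1)] by blast
  obtain Cq where Cq: "Cq > 0" "\<And>u. supported u \<Longrightarrow> quot u \<in> Lp pair_measure q \<Longrightarrow> frac_sobolev_norm (ord q) q u \<le> Cq * pint pair_measure q (quot u) powr (1/q)"
    using sobolev_norm_equivalence[OF q(1)] by blast
  obtain C0 where C0: "C0 > 0" "\<And>u. u \<in> borel_measurable borel \<Longrightarrow> (\<And>x. x \<notin> K \<Longrightarrow> u x = 0) \<Longrightarrow>
     (\<integral>\<^sup>+x. ennreal (\<bar>u x\<bar> powr p) \<partial>lborel) \<le> ennreal C0 * (\<integral>\<^sup>+w. ennreal (\<bar>quot u w\<bar> powr p) \<partial>pair_measure)"
    using Poincare[of p] p by auto
  have fn: "functional_on q (\<lambda>\<Phi>. F (reconstruct \<Phi>)) (Cq * sobolev_neg_norm (ord q) p \<Omega> F)"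
    if F: "F \<in> sobolev_neg (ord q) p \<Omega>" for F
    by (rule functional_of_sobolev_neg[OF F q_def q(1) Cq])
  have form_cong: "(\<integral>w. A' w * U w * \<Phi> w \<partial>pair_measure) = (\<integral>w. A' w * U' w * \<Phi>' w \<partial>pair_measure)"
    if "U \<in> Lp pair_measure p" "U' \<in> Lp pair_measure p" "\<Phi> \<in> Lp pair_measure q" "\<Phi>' \<in> Lp pair_measure q" "AE w in pair_measure. U w = U' w" "AE w in pair_measure. \<Phi> w = \<Phi>' w"
    for U U' \<Phi> \<Phi>'
  proof (rule integral_cong_AE)
    show "AE w in pair_measure. A' w * U w * \<Phi> w = A' w * U' w * \<Phi>' w" using that(5,6) by eventually_elim simp
  qed (use A_form_integrable[OF that(1,3) p(1) q] A_form_integrable[OF that(2,4) p(1) q] in auto)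
  have weak_imp: "\<exists>u. supported u \<and> (AE x in lborel. v x = u x) \<and> quot u \<in> G p
      \<and> frac_sobolev_norm (ord p) p v = frac_sobolev_norm (ord p) p u
      \<and> (\<forall>\<Phi>\<in>G q. (\<integral>w. A' w * quot u w * \<Phi> w \<partial>pair_measure) = F (reconstruct \<Phi>))"
    if v: "weak_solution s A \<Omega> (ord p) p F v" for F v
  proof -
    have vs: "v \<in> sobolev_tilde (ord p) p \<Omega>" and veq: "\<And>\<phi>. \<phi> \<in> sobolev_tilde (ord q) q \<Omega> \<Longrightarrow> nonlocal_op s A v \<phi> = F \<phi>"
      using v unfolding weak_solution_def \<rho>_def[symmetric] \<rho> q_def[symmetric] by auto
    from supported_representative[OF p(1) vs] obtain u where u: "supported u" "AE x in lborel. v x = u x" "quot u \<in> G p"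
      "frac_sobolev_norm (ord p) p v = frac_sobolev_norm (ord p) p u" by blast
    have "(\<integral>w. A' w * quot u w * \<Phi> w \<partial>pair_measure) = F (reconstruct \<Phi>)" if \<Phi>: "\<Phi> \<in> G q" for \<Phi>
    proof -
      note E = reconstruct_supported[OF q(1) \<Phi>]
      have "F (reconstruct \<Phi>) = nonlocal_op s A v (reconstruct \<Phi>)" using veq[OF E(5)] by simp
      also have "\<dots> = (\<integral>w. A' w * quot u w * quot (reconstruct \<Phi>) w \<partial>pair_measure)"
        by (rule nonlocal_op_eq[OF AA' A'm u(1,2) E(1)]) simp
      also have "\<dots> = (\<integral>w. A' w * quot u w * \<Phi> w \<partial>pair_measure)"
        by (rule form_cong[OF G_D(1)[OF u(3)] G_D(1)[OF u(3)] E(3) G_D(1)[OF \<Phi>] _ E(2)]) simp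
      finally show ?thesis by simp
    qed
    then show ?thesis using u by blast
  qed
  show "\<forall>F\<in>sobolev_neg \<rho> p \<Omega>. \<exists>u. weak_solution s A \<Omega> (ord p) p F u \<and>
      (\<forall>v. weak_solution s A \<Omega> (ord p) p F v \<longrightarrow> (AE x in lebesgue. v x = u x))"
    unfolding \<rho>
  proof
    fix F assume F: "F \<in> sobolev_neg (ord q) p \<Omega>"
    have "\<exists>U\<in>G p. \<forall>\<Phi>\<in>G q. (\<integral>w. A' w * U w * \<Phi> w \<partial>pair_measure) = F (reconstruct \<Phi>)"
    proof (cases "2 \<le> p")
      case True
      then have "8 * Lam * schur_const * (p - 2) \<le> lam" using small by simp
      from existence_ge_2[OF True this qe fn[OF F]] show ?thesis .
    next
      case False
      then have "p < 2" by simp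
      from existence_lt_2[OF p(1) this p(2) small qe fn[OF F]] show ?thesis .
    qed
    then obtain U where U: "U \<in> G p" and sol: "\<And>\<Phi>. \<Phi> \<in> G q \<Longrightarrow> (\<integral>w. A' w * U w * \<Phi> w \<partial>pair_measure) = F (reconstruct \<Phi>)" by blast
    define u where "u = reconstruct U"
    note E = reconstruct_supported[OF p(1) U, folded u_def]
    have weak: "weak_solution s A \<Omega> (ord p) p F u"
      unfolding weak_solution_def \<rho>_def[symmetric] \<rho> q_def[symmetric]
    proof (intro conjI ballI E(5))
      fix \<phi> assume \<phi>: "\<phi> \<in> sobolev_tilde (ord q) q \<Omega>"
      \<comment> \<open>The abstract equation speaks of arguments \<open>reconstruct \<Phi>\<close>
        only; a general test function agrees almost everywhere with the reconstruction from the
        quotient of its representative.\<close>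
      from supported_representative[OF q(1) \<phi>] obtain g where g: "supported g" "AE x in lborel. \<phi> x = g x" "quot g \<in> G q" by blast
      note Eg = reconstruct_supported[OF q(1) g(3)]
      have "integrable pair_measure (quot g)" using Lp_integrable[OF G_D(1)[OF g(3)]] q by simp
      then have "AE x in lborel. reconstruct (quot g) x = g x"
        using g(1) by (intro reconstruct_quot) (auto simp: supported_def)
      with g(2) have ae: "AE x in lborel. \<phi> x = reconstruct (quot g) x" by eventually_elim simp
      have "nonlocal_op s A u \<phi> = (\<integral>w. A' w * quot u w * quot g w \<partial>pair_measure)"
        by (rule nonlocal_op_eq[OF AA' A'm E(1) _ g(1,2)]) simp
      also have "\<dots> = (\<integral>w. A' w * U w * quot g w \<partial>pair_measure)"
        by (rule form_cong[OF E(3) G_D(1)[OF U] G_D(1)[OF g(3)] G_D(1)[OF g(3)] E(2)]) simp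
      also have "\<dots> = F (reconstruct (quot g))" by (rule sol[OF g(3)])
      also have "\<dots> = F \<phi>" by (rule sobolev_neg_supported_AE[OF F q_def q(1) \<phi> Eg(1,5) ae, symmetric])
      finally show "nonlocal_op s A u \<phi> = F \<phi>" .
    qed
    have "AE x in lebesgue. v x = u x" if v: "weak_solution s A \<Omega> (ord p) p F v" for v
    proof -
      from weak_imp[OF v] obtain v' where v': "supported v'" "AE x in lborel. v x = v' x" "quot v' \<in> G p"
        "\<And>\<Phi>. \<Phi> \<in> G q \<Longrightarrow> (\<integral>w. A' w * quot v' w * \<Phi> w \<partial>pair_measure) = F (reconstruct \<Phi>)" by blast
      define D where "D w = quot v' w - U w" for w
      have D: "D \<in> G p" unfolding D_def[abs_def] using G_diff[OF v'(3) U] p by simp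
      \<comment> \<open>Uniqueness is the a priori bound with B = 0 for the difference of two
        solutions.\<close>
      have "pint pair_measure p D powr (1/p) \<le> 2 * schur_const / lam * 0"
      proof (rule a_priori_bound[OF D p small qe order_refl])
        fix \<Phi> assume \<Phi>: "\<Phi> \<in> G q"
        have "(\<integral>w. A' w * D w * \<Phi> w \<partial>pair_measure) = (\<integral>w. A' w * quot v' w * \<Phi> w \<partial>pair_measure) - (\<integral>w. A' w * U w * \<Phi> w \<partial>pair_measure)"
          using A_form_integrable[OF G_D(1)[OF v'(3)] G_D(1)[OF \<Phi>] p(1) q] A_form_integrable[OF G_D(1)[OF U] G_D(1)[OF \<Phi>] p(1) q]
          by (simp add: D_def left_diff_distrib right_diff_distrib)
        then show "\<bar>\<integral>w. A' w * D w * \<Phi> w \<partial>pair_measure\<bar> \<le> 0 * pint pair_measure q \<Phi> powr (1/q)"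
          using v'(4)[OF \<Phi>] sol[OF \<Phi>] by simp
      qed
      then have "pint pair_measure p D = 0" by (simp add: powr_le_iff[symmetric] not_less)
      then have "AE w in pair_measure. D w = 0" using pint_eq_0_iff[OF G_D(1)[OF D]] by simp
      \<comment> \<open>So far only the quotients agree; as \<open>quot\<close> is linear, the
        Poincare inequality turns this into equality of the functions.\<close>
      with E(2) have z: "AE w in pair_measure. ennreal (\<bar>quot (\<lambda>x. v' x - u x) w\<bar> powr p) = 0"
        by eventually_elim (simp add: D_def quot_def diff_divide_distrib)
      have dm: "(\<lambda>x. v' x - u x) \<in> borel_measurable borel" using v'(1) E(1) by (auto simp: supported_def)
      have "(\<integral>\<^sup>+x. ennreal (\<bar>v' x - u x\<bar> powr p) \<partial>lborel) \<le> ennreal C0 * (\<integral>\<^sup>+w. ennreal (\<bar>quot (\<lambda>x. v' x - u x) w\<bar> powr p) \<partial>pair_measure)"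
        by (rule C0(2)[OF dm]) (use v'(1) E(1) in \<open>auto simp: supported_def\<close>)
      also have "(\<integral>\<^sup>+w. ennreal (\<bar>quot (\<lambda>x. v' x - u x) w\<bar> powr p) \<partial>pair_measure) = 0"
        using nn_integral_cong_AE[OF z] by simp
      finally have "(\<integral>\<^sup>+x. ennreal (\<bar>v' x - u x\<bar> powr p) \<partial>lborel) = 0" by simp
      then have "AE x in lborel. ennreal (\<bar>v' x - u x\<bar> powr p) = 0"
        using dm by (subst (asm) nn_integral_0_iff_AE) auto
      then have "AE x in lborel. v' x = u x" by eventually_elim simp
      with v'(2) have "AE x in lborel. v x = u x" by eventually_elim simp
      then show ?thesis by (simp add: AE_completion_iff)
    qed
    then show "\<exists>u. weak_solution s A \<Omega> (ord p) p F u \<and>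
      (\<forall>v. weak_solution s A \<Omega> (ord p) p F v \<longrightarrow> (AE x in lebesgue. v x = u x))" using weak by blast
  qed
  show "\<exists>C>0. \<forall>F\<in>sobolev_neg \<rho> p \<Omega>. \<forall>u. weak_solution s A \<Omega> (ord p) p F u \<longrightarrow>
      frac_sobolev_norm (ord p) p u \<le> C * sobolev_neg_norm \<rho> p \<Omega> F"
    unfolding \<rho>
  proof (intro exI[of _ "Cp * (2 * schur_const / lam * Cq)"] conjI ballI allI impI)
    show "0 < Cp * (2 * schur_const / lam * Cq)" using Cp Cq C_pos A(3) by simp
    fix F v assume F: "F \<in> sobolev_neg (ord q) p \<Omega>" and v: "weak_solution s A \<Omega> (ord p) p F v"
    note fnF = functional_onD[OF fn[OF F]]
    from weak_imp[OF v] obtain u where u: "supported u" "quot u \<in> G p"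
      "frac_sobolev_norm (ord p) p v = frac_sobolev_norm (ord p) p u"
      "\<And>\<Phi>. \<Phi> \<in> G q \<Longrightarrow> (\<integral>w. A' w * quot u w * \<Phi> w \<partial>pair_measure) = F (reconstruct \<Phi>)" by blast
    have "pint pair_measure p (quot u) powr (1/p) \<le> 2 * schur_const / lam * (Cq * sobolev_neg_norm (ord q) p \<Omega> F)"
      by (rule a_priori_bound[OF u(2) p small qe fnF(1)]) (use u(4) fnF(4) in simp)
    then have "Cp * pint pair_measure p (quot u) powr (1/p) \<le> Cp * (2 * schur_const / lam * (Cq * sobolev_neg_norm (ord q) p \<Omega> F))"
      by (rule mult_left_mono) (use Cp(1) in simp)
    with Cp(2)[OF u(1) G_D(1)[OF u(2)]]
    show "frac_sobolev_norm (ord p) p v \<le> Cp * (2 * schur_const / lam * Cq) * sobolev_neg_norm (ord q) p \<Omega> F"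
      unfolding u(3) by (simp add: mult.assoc)
  qed
qed

end

theorem theorem4:
  fixes \<Omega> :: "'a::euclidean_space set" and s \<kappa> :: real
  assumes "bounded_lipschitz_domain \<Omega>" and "0 < s" and "s < 1"
  shows "\<exists>P \<epsilon>\<^sub>0 :: real. P > 2 \<and> \<epsilon>\<^sub>0 > 0 \<and> {s - \<epsilon>\<^sub>0..s + \<epsilon>\<^sub>0} \<subseteq> {0<..<1} \<and>
    (\<forall>(A :: 'a \<times> 'a \<Rightarrow> real) lam Lam.
       A \<in> Linf_space \<longrightarrow> (AE (x, y) in lebesgue. A (x, y) = A (y, x)) \<longrightarrow>
       ess_inf A = ereal lam \<longrightarrow> lam > 0 \<longrightarrow> Linf_norm A = Lam \<longrightarrow> Lam / lam = \<kappa> \<longrightarrow>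
       (\<forall>p\<in>{conj_exp P..P}. \<exists>\<sigma>\<in>{s - \<epsilon>\<^sub>0..s + \<epsilon>\<^sub>0}.
          (\<forall>F\<in>sobolev_neg (2 * s - \<sigma>) p \<Omega>.
             \<exists>u. weak_solution s A \<Omega> \<sigma> p F u \<and>
                 (\<forall>v. weak_solution s A \<Omega> \<sigma> p F v \<longrightarrow> (AE x in lebesgue. v x = u x))) \<and>
          (\<exists>C>0. \<forall>F\<in>sobolev_neg (2 * s - \<sigma>) p \<Omega>. \<forall>u. weak_solution s A \<Omega> \<sigma> p F u \<longrightarrow>
             frac_sobolev_norm \<sigma> p u \<le> C * sobolev_neg_norm (2 * s - \<sigma>) p \<Omega> F) \<and>
          (p > 2 \<longrightarrow> \<sigma> > s)))"
proof -
  have bd: "bounded (closure \<Omega>)" using assms(1) by (auto simp: bounded_lipschitz_domain_def intro: bounded_closure)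
  then have Kc: "compact (closure \<Omega>)" by (simp add: compact_eq_bounded_closed)
  have "- closure \<Omega> \<noteq> {}" using bd not_bounded_UNIV by (metis Compl_empty_eq double_complement)
  then obtain b where b: "b \<notin> closure \<Omega>" by auto
  obtain r where r: "r > 0" "\<And>x. x \<in> closure \<Omega> \<Longrightarrow> norm x \<le> r"
    using bd unfolding bounded_pos by blast
  \<comment> \<open>Any bound for the distance of points of the closure to one exterior point b
    bounds their distance to the exterior.\<close>
  define T where "T = r + norm b"
  have T: "0 < T" using r(1) by (simp add: T_def add_pos_nonneg)
  have depth: "infdist x (- closure \<Omega>) \<le> T" for x
  proof (cases "x \<in> closure \<Omega>")
    case True
    have "infdist x (- closure \<Omega>) \<le> dist x b" using b by (intro infdist_le) simp
    also have "\<dots> \<le> norm x + norm b" by (simp add: dist_norm norm_triangle_ineq4)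
    finally show ?thesis using r(2)[OF True] by (simp add: T_def)
  next
    case False
    then show ?thesis using T by (simp add: infdist_zero)
  qed
  obtain c where c: "c > 0" "\<And>y t. y \<in> closure \<Omega> \<Longrightarrow> 0 < t \<Longrightarrow> t \<le> T \<Longrightarrow> infdist y (- closure \<Omega>) < 3 * t \<Longrightarrow>
     c * t ^ DIM('a) \<le> measure lborel (ball y (4 * t) - closure \<Omega>)"
    using Lipschitz_domain_exterior_measure[OF assms(1) T] by blast
  \<comment> \<open>Half the distance from s to the ends of the unit interval, which gives both
    \<tau> < s and s + \<tau> < 1; it also serves as \<epsilon>_0.\<close>
  define \<tau> where "\<tau> = min s (1 - s) / 2"
  have \<tau>: "0 < \<tau>" "\<tau> < s" "s + \<tau> < 1" using assms(2,3) by (auto simp: \<tau>_def min_def field_simps)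
  interpret W: whitney_approximation "closure \<Omega>" s \<tau> T c \<Omega>
    by unfold_locales (use Kc \<tau> T c depth Lipschitz_domain_boundary_null[OF assms(1)] in auto)
  \<comment> \<open>1/2 is the range of the weight inequality for negative exponents; the other term
    is 8 Lam C |p - 2| \<le> lam divided by lam. The maximum with 1 keeps \<delta> positive for
    every real \<kappa>.\<close>
  define \<delta> where "\<delta> = min (1/2) (1 / (8 * max \<kappa> 1 * W.schur_const))"
  have Cs: "W.schur_const > 0" by (rule W.C_pos)
  have \<delta>: "0 < \<delta>" "\<delta> \<le> 1/2" using Cs by (auto simp: \<delta>_def)
  have \<delta>C: "8 * max \<kappa> 1 * W.schur_const * \<delta> \<le> 1"
  proof -
    have "8 * max \<kappa> 1 * W.schur_const * \<delta> \<le> 8 * max \<kappa> 1 * W.schur_const * (1 / (8 * max \<kappa> 1 * W.schur_const))"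
      using Cs by (intro mult_left_mono) (auto simp: \<delta>_def)
    then show ?thesis using Cs by (simp split: if_splits)
  qed
  show ?thesis
  proof (rule exI[of _ "2 + \<delta>"], rule exI[of _ \<tau>], intro conjI allI impI ballI)
    show "2 < 2 + \<delta>" "0 < \<tau>" using \<delta> \<tau> by auto
    show "{s - \<tau>..s + \<tau>} \<subseteq> {0<..<1}" using \<tau> by auto
    fix A :: "'a \<times> 'a \<Rightarrow> real" and lam Lam p
    assume A: "A \<in> Linf_space" "ess_inf A = ereal lam" "0 < lam" "Linf_norm A = Lam" and \<kappa>: "Lam / lam = \<kappa>"
      and p: "p \<in> {conj_exp (2 + \<delta>)..2 + \<delta>}"
    \<comment> \<open>The conjugate exponent of 2 + \<delta> exceeds 2 - \<delta> by a second-order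
      term, so the whole interval of p lies within \<delta> of 2.\<close>
    have "conj_exp (2 + \<delta>) = 2 - \<delta> + \<delta>\<^sup>2 / (1 + \<delta>)"
      using \<delta> by (simp add: conj_exp_def field_simps power2_eq_square)
    then have "2 - \<delta> \<le> conj_exp (2 + \<delta>)" using \<delta> by simp
    then have p2: "\<bar>p - 2\<bar> \<le> \<delta>" using p by auto
    have p1: "1 < p" "\<bar>p - 2\<bar> \<le> 1/2" using p2 \<delta> by auto
    have "8 * Lam * W.schur_const * \<bar>p - 2\<bar> \<le> lam"
    proof -
      have "Lam \<le> max \<kappa> 1 * lam" using \<kappa> A(3) by (auto simp: field_simps max_def)
      moreover have "lam \<le> Lam" by (rule coefficient_representative(1)[OF A(1,2,4)])
      ultimately have "8 * Lam * W.schur_const * \<bar>p - 2\<bar> \<le> 8 * (max \<kappa> 1 * lam) * W.schur_const * \<delta>"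
        using p2 Cs A(3) by (intro mult_mono) (auto intro!: mult_nonneg_nonneg)
      also have "\<dots> = lam * (8 * max \<kappa> 1 * W.schur_const * \<delta>)" by simp
      also have "\<dots> \<le> lam * 1" using \<delta>C A(3) by (intro mult_left_mono) auto
      finally show ?thesis by simp
    qed
    note sol = W.weak_solvability[OF A p1 this]
    show "\<exists>\<sigma>\<in>{s - \<tau>..s + \<tau>}.
          (\<forall>F\<in>sobolev_neg (2 * s - \<sigma>) p \<Omega>.
             \<exists>u. weak_solution s A \<Omega> \<sigma> p F u \<and>
                 (\<forall>v. weak_solution s A \<Omega> \<sigma> p F v \<longrightarrow> (AE x in lebesgue. v x = u x))) \<and>
          (\<exists>C>0. \<forall>F\<in>sobolev_neg (2 * s - \<sigma>) p \<Omega>. \<forall>u. weak_solution s A \<Omega> \<sigma> p F u \<longrightarrow>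
             frac_sobolev_norm \<sigma> p u \<le> C * sobolev_neg_norm (2 * s - \<sigma>) p \<Omega> F) \<and>
          (p > 2 \<longrightarrow> \<sigma> > s)"
    proof (intro bexI[of _ "W.ord p"] conjI sol impI)
      \<comment> \<open>For p > 1 the factor of \<tau> in \<open>W.ord p\<close> has absolute value
        at most 1, so the order never leaves the interval of radius \<tau> around s.\<close>
      have "\<bar>1 - 2 / p\<bar> \<le> 1" using p1 by (auto simp: abs_le_iff field_simps)
      then have "\<bar>\<tau> * (1 - 2 / p)\<bar> \<le> \<tau>" using \<tau>(1) by (simp add: abs_mult mult_left_le)
      then show "W.ord p \<in> {s - \<tau>..s + \<tau>}" by (auto simp: W.ord_def)
      assume "p > 2"
      then have "0 < \<tau> * (1 - 2 / p)" using \<tau>(1) by (intro mult_pos_pos) auto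
      then show "W.ord p > s" by (simp add: W.ord_def)
    qed
  qed
qed

end
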